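(* Let $\Omega\subset\mathbb{R}^n$ be a convex body containing the origin in its interior, with radial function $\rho$, and let $\widetilde V_q(z)=\widetilde V_q(\Omega,z)$, $z\in\partial\Omega$. Let $k$ be a positive integer. (i) Assume $q>1$, $q\neq n$. If $\rho\in C^{k,\alpha}(\mathbb{S}^{n-1})$ for some $\alpha\in[0,1]$, then $\widetilde V_q\in C^{k,\alpha}(\partial\Omega)$, and $\|\widetilde V_q\|_{k,\alpha;\partial\Omega}\le\hat C$ for a positive constant $\hat C$ depending only on $n,q,\alpha,k,\|\rho\|_{k,\alpha}$ and $1/\rho_{\min}$. (ii) Assume $0<q\le1$. If $\rho\in C^{k,\alpha}(\mathbb{S}^{n-1})$ for some $\alpha\in(1-q,1]$, then $\widetilde V_q\in C^{k,\alpha'}(\partial\Omega)$ for any $\alpha'\in(0,\alpha+q-1)$, and $\|\widetilde V_q\|_{k,\alpha';\partial\Omega}\le\bar C$ for a positive constant $\bar C$ depending only on $n,q,\alpha,\alpha',k,\|\rho\|_{k,\alpha}$ and $1/\rho_{\min}$. (iii) Assume $-1<q<0$. If $\rho\in C^{k,\alpha}(\mathbb{S}^{n-1})$ for some $\alpha\in(-q,1)$, then $\widetilde V_q\in C^{k-1,\alpha^*}(\partial\Omega)$ for any $\alpha^*\in(0,\alpha+q)$, and $\|\widetilde V_q\|_{k-1,\alpha^*;\partial\Omega}\le C^*$ for a positive constant $C^*$ depending only on $n,q,\alpha,\alpha^*,k,\|\rho\|_{k,\alpha}$ and $1/\rho_{\min}$.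
   Context: A convex body is a compact convex subset of $\mathbb{R}^n$ with non-empty interior. The radial function of $\Omega$ is $\rho(u)=\max\{\lambda\ge 0:\lambda u\in\Omega\}$, $u\in\mathbb{S}^{n-1}$, so that $\partial\Omega=\{\rho(u)u:u\in\mathbb{S}^{n-1}\}$; $\rho_{\min}=\min_{\mathbb{S}^{n-1}}\rho$. The (generalized) dual quermassintegral is, for $z\in\partial\Omega$, $$\widetilde V_q(\Omega,z)=\frac1n\int_{S_z^+}\rho_{\Omega,z}(u)^q\,du,\quad \rho_{\Omega,z}(u)=\max\{\lambda\in\mathbb{R}:\lambda u\in\Omega-z\},\quad S_z^+=\{u\in\mathbb{S}^{n-1}:\rho_{\Omega,z}(u)>0\}.$$ Equivalently, for $z\in\partial\Omega$, $$\widetilde V_q(\Omega,z)=\frac qn\int_\Omega\frac{dy}{|y-z|^{n-q}}\ (q>0),\qquad \widetilde V_q(\Omega,z)=\frac{-q}{2n}\Big(\int_{\Omega^c}\frac{dy}{|y-z|^{n-q}}-\int_\Omega\frac{dy}{|y-z|^{n-q}}\Big)\ (-1<q<0),$$ where $\Omega^c$ is the complement of $\Omega$ and the last difference is understood in the principal value sense. $C^{k,\alpha}$ is the usual Hölder space with norm $\|\cdot\|_{k,\alpha}$ ($C^{k,0}=C^k$; $\alpha=1$ means Lipschitz $k$-th derivatives); functions on $\partial\Omega$ are regarded as functions on $\mathbb{S}^{n-1}$ via the parametrization $u\mapsto\rho(u)u$. *)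

theory Defs
  imports "HOL-Analysis.Analysis"
begin

section \<open>Convex bodies and radial functions\<close>

definition convex_body :: "'a::euclidean_space set \<Rightarrow> bool" where
  "convex_body \<Omega> \<longleftrightarrow> compact \<Omega> \<and> convex \<Omega> \<and> interior \<Omega> \<noteq> {}"

(* For a convex body the suprema in the next two definitions are maxima as soon as u is nonzero
   and the set is nonempty (0 in \<Omega>, respectively z in \<Omega>). *)
definition radial :: "'a::euclidean_space set \<Rightarrow> 'a \<Rightarrow> real" where
  "radial \<Omega> u = Sup {l. 0 \<le> l \<and> l *\<^sub>R u \<in> \<Omega>}"

definition radial_at :: "'a::euclidean_space set \<Rightarrow> 'a \<Rightarrow> 'a \<Rightarrow> real" where
  "radial_at \<Omega> z u = Sup {l. l *\<^sub>R u \<in> (\<lambda>y. y - z) ` \<Omega>}"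

definition radial_min :: "'a::euclidean_space set \<Rightarrow> real" where
  "radial_min \<Omega> = (INF u\<in>sphere 0 1. radial \<Omega> u)"


section \<open>Dual quermassintegrals\<close>

(* The surface measure du of the unit sphere, as a Borel measure on the ambient space: a Borel set
   A of unit vectors has n times the Lebesgue measure of the cone {t u | u in A, 0 < t < 1}. *)
definition sphere_measure :: "'a::euclidean_space measure" where
  "sphere_measure =
     scale_measure (of_nat DIM('a)) (distr (restrict_space lborel (ball 0 1 - {0})) borel sgn)"

lemma emeasure_sphere_measure:
  assumes A: "A \<in> sets (borel :: 'a::euclidean_space measure)" and sub: "A \<subseteq> sphere 0 1"
  shows "emeasure sphere_measure A =
           of_nat DIM('a) * emeasure lborel {t *\<^sub>R u |t u. u \<in> A \<and> 0 < t \<and> t < 1}"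
proof -
  let ?B = "ball (0::'a) 1 - {0}"
  have B: "?B \<in> sets lborel" by simp
  have "(\<lambda>x::'a. x /\<^sub>R norm x) \<in> borel_measurable borel" by measurable
  then have "(sgn :: 'a \<Rightarrow> 'a) \<in> borel_measurable borel" by (simp add: sgn_div_norm[abs_def])
  then have m: "sgn \<in> measurable (restrict_space lborel ?B) (borel :: 'a measure)"
    by (intro measurable_restrict_space1) simp
  have cone: "sgn -` A \<inter> ?B = {t *\<^sub>R u |t u. u \<in> A \<and> 0 < t \<and> t < 1}" (is "?L = ?R")
  proof
    show "?L \<subseteq> ?R"
    proof
      fix x assume x: "x \<in> ?L"
      then have "x = norm x *\<^sub>R sgn x" by (simp add: sgn_div_norm)
      with x show "x \<in> ?R" by (intro CollectI exI[of _ "norm x"] exI[of _ "sgn x"]) auto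
    qed
    show "?R \<subseteq> ?L"
    proof
      fix x assume "x \<in> ?R"
      then obtain t u where tu: "x = t *\<^sub>R u" "u \<in> A" "0 < t" "t < 1" by auto
      with sub have u: "norm u = 1" by auto
      then have "sgn x = u" using tu by (simp add: sgn_div_norm)
      then show "x \<in> ?L" using tu u by auto
    qed
  qed
  show ?thesis
    unfolding sphere_measure_def emeasure_scale_measure emeasure_distr[OF m A]
    by (subst emeasure_restrict_space) (use B cone in \<open>auto simp: space_restrict_space\<close>)
qed

definition visible :: "'a::euclidean_space set \<Rightarrow> 'a \<Rightarrow> 'a set" where
  "visible \<Omega> z = {u \<in> sphere 0 1. 0 < radial_at \<Omega> z u}"

(* The Bochner integral is 0 for a non-integrable integrand, so finiteness of the dual
   quermassintegral has to be expressed separately. *)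
definition dual_quermass_finite :: "real \<Rightarrow> 'a::euclidean_space set \<Rightarrow> 'a \<Rightarrow> bool" where
  "dual_quermass_finite q \<Omega> z \<longleftrightarrow>
     set_integrable sphere_measure (visible \<Omega> z) (\<lambda>u. radial_at \<Omega> z u powr q)"

definition dual_quermass :: "real \<Rightarrow> 'a::euclidean_space set \<Rightarrow> 'a \<Rightarrow> real" where
  "dual_quermass q \<Omega> z =
     1 / real DIM('a) * (LINT u:visible \<Omega> z|sphere_measure. radial_at \<Omega> z u powr q)"


section \<open>Hoelder spaces on the unit sphere\<close>

(* Derivatives of a function f on the sphere are those of its 0-homogeneous extension
   x \<mapsto> f (x / |x|) to the complement of the origin.  A list vs of basis vectors plays the
   role of a multi-index of order length vs. *)
definition hom_ext :: "('a::euclidean_space \<Rightarrow> real) \<Rightarrow> 'a \<Rightarrow> real" where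
  "hom_ext f x = f (x /\<^sub>R norm x)"

primrec iter_deriv :: "'a::euclidean_space list \<Rightarrow> ('a \<Rightarrow> real) \<Rightarrow> 'a \<Rightarrow> real" where
  "iter_deriv [] f = f"
| "iter_deriv (v # vs) f = (\<lambda>x. frechet_derivative (iter_deriv vs f) (at x) v)"

definition multi_indices :: "nat \<Rightarrow> 'a::euclidean_space list set" where
  "multi_indices j = {vs. set vs \<subseteq> Basis \<and> length vs = j}"

definition Ck_on :: "nat \<Rightarrow> 'a::euclidean_space set \<Rightarrow> ('a \<Rightarrow> real) \<Rightarrow> bool" where
  "Ck_on k U f \<longleftrightarrow>
     (\<forall>j<k. \<forall>vs\<in>multi_indices j. \<forall>x\<in>U. iter_deriv vs f differentiable (at x)) \<and>
     (\<forall>j\<le>k. \<forall>vs\<in>multi_indices j. continuous_on U (iter_deriv vs f))"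

definition Holder_sphere :: "nat \<Rightarrow> real \<Rightarrow> ('a::euclidean_space \<Rightarrow> real) \<Rightarrow> bool" where
  "Holder_sphere k \<alpha> f \<longleftrightarrow>
     Ck_on k (- {0}) (hom_ext f) \<and>
     (\<alpha> \<noteq> 0 \<longrightarrow>
       (\<exists>L. \<forall>vs\<in>multi_indices k. \<forall>x\<in>sphere 0 1. \<forall>y\<in>sphere 0 1.
          \<bar>iter_deriv vs (hom_ext f) x - iter_deriv vs (hom_ext f) y\<bar> \<le> L * dist x y powr \<alpha>))"

definition Ck_norm_sphere :: "nat \<Rightarrow> ('a::euclidean_space \<Rightarrow> real) \<Rightarrow> real" where
  "Ck_norm_sphere k f =
     (\<Sum>j\<le>k. SUP (vs, x) \<in> multi_indices j \<times> sphere 0 1. \<bar>iter_deriv vs (hom_ext f) x\<bar>)"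

definition Holder_seminorm_sphere :: "nat \<Rightarrow> real \<Rightarrow> ('a::euclidean_space \<Rightarrow> real) \<Rightarrow> real" where
  "Holder_seminorm_sphere k \<alpha> f =
     (SUP (vs, x, y) \<in> {(vs, x, y). vs \<in> multi_indices k \<and> x \<in> sphere 0 1 \<and> y \<in> sphere 0 1 \<and> x \<noteq> y}.
        \<bar>iter_deriv vs (hom_ext f) x - iter_deriv vs (hom_ext f) y\<bar> / dist x y powr \<alpha>)"

(* By convention the space and the norm for \<alpha> = 0 are those of C^k. *)
definition Holder_norm_sphere :: "nat \<Rightarrow> real \<Rightarrow> ('a::euclidean_space \<Rightarrow> real) \<Rightarrow> real" where
  "Holder_norm_sphere k \<alpha> f =
     Ck_norm_sphere k f + (if \<alpha> = 0 then 0 else Holder_seminorm_sphere k \<alpha> f)"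

(* Functions on the boundary of \<Omega>, read as functions on the sphere through u \<mapsto> \<rho>(u) u. *)
definition on_sphere :: "'a::euclidean_space set \<Rightarrow> ('a \<Rightarrow> real) \<Rightarrow> 'a \<Rightarrow> real" where
  "on_sphere \<Omega> V u = V (radial \<Omega> u *\<^sub>R u)"

definition Holder_boundary :: "nat \<Rightarrow> real \<Rightarrow> 'a::euclidean_space set \<Rightarrow> ('a \<Rightarrow> real) \<Rightarrow> bool" where
  "Holder_boundary k \<alpha> \<Omega> V \<longleftrightarrow> Holder_sphere k \<alpha> (on_sphere \<Omega> V)"

definition Holder_norm_boundary :: "nat \<Rightarrow> real \<Rightarrow> 'a::euclidean_space set \<Rightarrow> ('a \<Rightarrow> real) \<Rightarrow> real" where
  "Holder_norm_boundary k \<alpha> \<Omega> V = Holder_norm_sphere k \<alpha> (on_sphere \<Omega> V)"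

end

(* The dual quermassintegral at z = g(x) x / |x|, where g is the 0-homogeneous extension of the
   radial function, is written as an integral over the unit ball.  For q > 0 the integrand is
   |g(w) w - z|^(q - n) g(w)^n, up to a factor q / n.  For q < 0 the projection from z onto the
   boundary, parametrised by y |-> y - gauge(y) z, gives
   |g(w) w / |w| - z|^(q - n) (1 - grad gauge(w) . z) g(w)^n, where the middle factor, the height
   of z below the tangent hyperplane at g(w) w / |w|, vanishes to order 1 + alpha at z and takes
   the place of the principal value.

   The singularity at z moves with x.  The reflection exchanging a fixed unit vector e with
   x / |x| brings it to the fixed point e and preserves Lebesgue measure, so that x only enters
   through smooth reflections and through g; here x stays near - e, where the reflection is a
   smooth function of x.  Every x-derivative of |g(Rw) w - g(Re) e|^s of order at most k is of
   size |w - e|^s, a derivative of order k + 1 costs |w - e|^(alpha - 1), and its Hoelder quotient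
   of exponent beta a further |w - e|^(- beta).  All these powers are integrable under
   the stated conditions on the exponents, so one may differentiate under the integral. *)
theory Submission
  imports Defs
begin

section \<open>Weighted Hoelder classes of families of functions\<close>

text \<open>The top derivative costs a power because g(Rw) - g(Re) and its lower derivatives gain a
  full factor |w - e| from Lipschitz bounds, while the top derivative of g is only \<alpha>-Hoelder
  and gains |w - e|^\<alpha>. Hence the two parameters of \<open>Holder_class\<close>: weight
  exponent \<gamma> below the top order and \<gamma> - \<tau> at the top, applied with \<tau> = 1 -
  \<alpha>. A calculus of such classes has to prevent two losses from meeting in one product; this
  works as soon as one derivative is available, since undifferentiated factors then carry no loss.
  The constants depend only on the listed data because the body is itself part of the index: one
  existential constant serves all bodies with equal norm and equal 1/\<rho>_min. For q < 0 the
  kernel |y - z|^(q - n) is not integrable at z. Its replacement depends on the direction of w only,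
  so it is singular along the whole ray through e, and the integrability threshold for its exponent
  is 1 - n instead of - n. The gradient of the gauge uses up one derivative of g; this is the
  derivative missing from the conclusion.\<close>

abbreviation partial :: "'a::euclidean_space \<Rightarrow> ('a \<Rightarrow> real) \<Rightarrow> 'a \<Rightarrow> real" where
  "partial v f \<equiv> \<lambda>x. frechet_derivative f (at x) v"

text \<open>In the application an index consists of a body, a base point and the integration variable, and
  \<open>d i\<close> is the distance of the latter to the singularity of the integrand.\<close>

primrec Holder_class ::
    "'i set \<Rightarrow> ('i \<Rightarrow> 'a::euclidean_space set) \<Rightarrow> ('i \<Rightarrow> real) \<Rightarrow> real \<Rightarrow> nat \<Rightarrow> real \<Rightarrow> real \<Rightarrow> ('i \<Rightarrow> 'a \<Rightarrow> real) \<Rightarrow> bool"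
where
  "Holder_class I U d \<beta> 0 \<gamma> \<tau> f \<longleftrightarrow>
     (\<exists>C\<ge>0. \<forall>i\<in>I. continuous_on (U i) (f i) \<and>
        (\<forall>x\<in>U i. \<bar>f i x\<bar> \<le> C * d i powr (\<gamma> - \<tau>)) \<and>
        (\<forall>x\<in>U i. \<forall>y\<in>U i. \<bar>f i x - f i y\<bar> \<le> C * d i powr (\<gamma> - \<tau> - \<beta>) * dist x y powr \<beta>))"
| "Holder_class I U d \<beta> (Suc k) \<gamma> \<tau> f \<longleftrightarrow>
     (\<exists>C\<ge>0. \<forall>i\<in>I. \<forall>x\<in>U i. f i differentiable (at x) \<and> \<bar>f i x\<bar> \<le> C * d i powr \<gamma>) \<and>
     (\<forall>v\<in>Basis. Holder_class I U d \<beta> k \<gamma> \<tau> (\<lambda>i. partial v (f i)))"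

section \<open>Calculus of partial derivatives\<close>

lemma partial_eqI:
  assumes "(f has_derivative f') (at x)"
  shows "partial v f x = f' v"
  using frechet_derivative_at[OF assms] by simp

lemma frechet_derivative_expand:
  fixes f :: "'a::euclidean_space \<Rightarrow> real"
  assumes "f differentiable (at x)"
  shows "frechet_derivative f (at x) h = (\<Sum>v\<in>Basis. (h \<bullet> v) * partial v f x)"
proof -
  have "bounded_linear (frechet_derivative f (at x))"
    using assms frechet_derivative_works has_derivative_bounded_linear by blast
  then have lin: "linear (frechet_derivative f (at x))"
    by (rule bounded_linear.linear)
  have "frechet_derivative f (at x) (\<Sum>v\<in>Basis. (h \<bullet> v) *\<^sub>R v) = (\<Sum>v\<in>Basis. (h \<bullet> v) * partial v f x)"
    by (simp add: linear_sum[OF lin] linear_scale[OF lin])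
  then show ?thesis by (simp add: euclidean_representation)
qed

lemma partial_cong:
  assumes "open U" "x \<in> U" "\<And>y. y \<in> U \<Longrightarrow> f y = g y"
  shows "partial v f x = partial v g x"
proof (cases "f differentiable (at x)")
  case True
  then show ?thesis using frechet_derivative_transform_within_open[OF _ assms] by simp
next
  case False
  \<comment> \<open>\<open>frechet_derivative\<close> is a choice among all derivatives, so two
    functions with the same derivatives, possibly none, receive the same value.\<close>
  have "(f has_derivative f') (at x) \<longleftrightarrow> (g has_derivative f') (at x)" for f'
    using has_derivative_transform_within_open[of f f' x UNIV U g]
      has_derivative_transform_within_open[of g f' x UNIV U f] assms by auto
  then show ?thesis unfolding frechet_derivative_def by simp
qed

lemma differentiable_cong_open:
  assumes "open U" "x \<in> U" "\<And>y. y \<in> U \<Longrightarrow> f y = g y" "f differentiable (at x)"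
  shows "g differentiable (at x)"
  using assms(4) has_derivative_transform_within_open[of f _ x UNIV U g] assms(1-3)
  unfolding differentiable_def by blast

lemma lipschitz_from_partials:
  fixes f :: "'a::euclidean_space \<Rightarrow> real"
  assumes "convex U" "\<And>z. z \<in> U \<Longrightarrow> f differentiable (at z)"
    and B: "\<And>z v. z \<in> U \<Longrightarrow> v \<in> Basis \<Longrightarrow> \<bar>partial v f z\<bar> \<le> B"
    and "x \<in> U" "y \<in> U"
  shows "\<bar>f x - f y\<bar> \<le> (real DIM('a) * B) * dist x y"
proof -
  have "norm (f x - f y) \<le> (real DIM('a) * B) * norm (x - y)"
  proof (rule differentiable_bound[of U f "\<lambda>z. frechet_derivative f (at z)", OF \<open>convex U\<close> _ _ \<open>x \<in> U\<close> \<open>y \<in> U\<close>])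
    fix z assume z: "z \<in> U"
    then have d: "(f has_derivative frechet_derivative f (at z)) (at z)"
      using assms(2) frechet_derivative_works by blast
    then show "(f has_derivative frechet_derivative f (at z)) (at z within U)"
      by (rule has_derivative_at_withinI)
    have "onorm (frechet_derivative f (at z)) \<le> (\<Sum>v\<in>Basis. norm (partial v f z))"
      using d by (intro onorm_componentwise has_derivative_bounded_linear)
    also have "\<dots> \<le> (\<Sum>v\<in>(Basis::'a set). B)" using B[OF z] by (intro sum_mono) simp
    finally show "onorm (frechet_derivative f (at z)) \<le> real DIM('a) * B" by simp
  qed
  then show ?thesis by (simp add: dist_norm)
qed

text \<open>The derivative \<open>s * t powr (s - 1)\<close> is monotone in t, increasing or
  decreasing according to the sign of s - 1. Adding its values at both ends of the interval avoids
  the case distinction.\<close>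

lemma powr_lipschitz:
  fixes s :: real
  assumes "0 < m" "a \<in> {m..M}" "b \<in> {m..M}"
  shows "\<bar>a powr s - b powr s\<bar> \<le> \<bar>s\<bar> * (m powr (s - 1) + M powr (s - 1)) * \<bar>a - b\<bar>"
proof -
  have "norm (a powr s - b powr s) \<le> \<bar>s\<bar> * (m powr (s - 1) + M powr (s - 1)) * norm (a - b)"
  proof (rule field_differentiable_bound[of "{m..M}" "\<lambda>t. t powr s" "\<lambda>t. s * t powr (s - 1)"])
    fix t assume t: "t \<in> {m..M}"
    then have "((\<lambda>t. t powr s) has_real_derivative s * t powr (s - 1)) (at t)"
      using assms(1) by (intro has_real_derivative_powr) auto
    then show "((\<lambda>t. t powr s) has_real_derivative s * t powr (s - 1)) (at t within {m..M})"
      by (rule has_field_derivative_at_within)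
    have "t powr (s - 1) \<le> m powr (s - 1) + M powr (s - 1)"
    proof (cases "s \<ge> 1")
      case True
      then have "t powr (s - 1) \<le> M powr (s - 1)" using t assms(1) by (intro powr_mono2) auto
      then show ?thesis by (simp add: add_increasing)
    next
      case False
      then have "t powr (s - 1) \<le> m powr (s - 1)" using t assms(1) by (intro powr_mono2') auto
      then show ?thesis by (simp add: add_increasing2)
    qed
    then show "norm (s * t powr (s - 1)) \<le> \<bar>s\<bar> * (m powr (s - 1) + M powr (s - 1))"
      by (simp add: abs_mult mult_left_mono)
  qed (use assms in auto)
  then show ?thesis by simp
qed

section \<open>The algebra of the weighted classes\<close>

locale weighted_family =
  fixes I :: "'i set" and U :: "'i \<Rightarrow> 'a::euclidean_space set" and d :: "'i \<Rightarrow> real" and D \<beta> :: real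
  assumes open_U: "i \<in> I \<Longrightarrow> open (U i)" and convex_U: "i \<in> I \<Longrightarrow> convex (U i)"
    and d_pos: "i \<in> I \<Longrightarrow> 0 < d i" and d_le: "i \<in> I \<Longrightarrow> d i \<le> D" and D_pos: "0 < D"
    and \<beta>_nonneg: "0 \<le> \<beta>" and \<beta>_le: "\<beta> \<le> 1"
begin

abbreviation "W \<equiv> Holder_class I U d \<beta>"

lemma weight_mono:
  assumes "i \<in> I" "\<gamma>' \<le> \<gamma>"
  shows "d i powr \<gamma> \<le> D powr (\<gamma> - \<gamma>') * d i powr \<gamma>'"
proof -
  have "d i powr \<gamma> = d i powr (\<gamma> - \<gamma>') * d i powr \<gamma>'" by (simp flip: powr_add)
  also have "\<dots> \<le> D powr (\<gamma> - \<gamma>') * d i powr \<gamma>'"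
    using assms d_pos d_le by (intro mult_right_mono powr_mono2) (auto intro: less_imp_le)
  finally show ?thesis .
qed

text \<open>Only two exponents matter, \<gamma> below the top order and \<gamma> - \<tau> at the
  top, and each may be lowered because the weights are bounded by D.\<close>

lemma W_mono:
  "W k \<gamma> \<tau> f \<Longrightarrow> \<gamma>' \<le> \<gamma> \<Longrightarrow> \<gamma>' - \<tau>' \<le> \<gamma> - \<tau> \<Longrightarrow> W k \<gamma>' \<tau>' f"
proof (induction k arbitrary: f)
  case 0
  then obtain C where C: "C \<ge> 0"
    "\<And>i. i \<in> I \<Longrightarrow> continuous_on (U i) (f i)"
    "\<And>i x. i \<in> I \<Longrightarrow> x \<in> U i \<Longrightarrow> \<bar>f i x\<bar> \<le> C * d i powr (\<gamma> - \<tau>)"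
    "\<And>i x y. i \<in> I \<Longrightarrow> x \<in> U i \<Longrightarrow> y \<in> U i \<Longrightarrow> \<bar>f i x - f i y\<bar> \<le> C * d i powr (\<gamma> - \<tau> - \<beta>) * dist x y powr \<beta>"
    by auto
  let ?K = "C * D powr ((\<gamma> - \<tau>) - (\<gamma>' - \<tau>'))"
  have "\<bar>f i x\<bar> \<le> ?K * d i powr (\<gamma>' - \<tau>')" if "i \<in> I" "x \<in> U i" for i x
    using C(3)[OF that] mult_left_mono[OF weight_mono[OF that(1) 0(3)] C(1)] by simp
  moreover have "\<bar>f i x - f i y\<bar> \<le> ?K * d i powr (\<gamma>' - \<tau>' - \<beta>) * dist x y powr \<beta>"
    if "i \<in> I" "x \<in> U i" "y \<in> U i" for i x y
  proof -
    have "d i powr (\<gamma> - \<tau> - \<beta>) \<le> D powr ((\<gamma> - \<tau>) - (\<gamma>' - \<tau>')) * d i powr (\<gamma>' - \<tau>' - \<beta>)"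
      using weight_mono[OF that(1), of "\<gamma>' - \<tau>' - \<beta>" "\<gamma> - \<tau> - \<beta>"] 0(3) by (simp add: algebra_simps)
    then have "C * d i powr (\<gamma> - \<tau> - \<beta>) \<le> ?K * d i powr (\<gamma>' - \<tau>' - \<beta>)"
      using mult_left_mono[OF _ C(1)] by (simp add: mult.assoc)
    then show ?thesis using C(4)[OF that] mult_right_mono[of _ _ "dist x y powr \<beta>"] by fastforce
  qed
  ultimately show ?case using C(1,2) D_pos by (auto intro!: exI[of _ ?K])
next
  case (Suc k)
  then obtain C where C: "C \<ge> 0"
    "\<And>i x. i \<in> I \<Longrightarrow> x \<in> U i \<Longrightarrow> f i differentiable (at x) \<and> \<bar>f i x\<bar> \<le> C * d i powr \<gamma>" by auto
  let ?K = "C * D powr (\<gamma> - \<gamma>')"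
  have "\<bar>f i x\<bar> \<le> ?K * d i powr \<gamma>'" if "i \<in> I" "x \<in> U i" for i x
    using C(2)[OF that] mult_left_mono[OF weight_mono[OF that(1) Suc(3)] C(1)] by simp
  then show ?case using C Suc D_pos by (auto intro!: exI[of _ ?K])
qed

lemma W_cong:
  assumes "\<And>i x. i \<in> I \<Longrightarrow> x \<in> U i \<Longrightarrow> f i x = g i x" "W k \<gamma> \<tau> f"
  shows "W k \<gamma> \<tau> g"
  using assms
proof (induction k arbitrary: f g)
  case 0
  then obtain C where C: "C \<ge> 0"
    "\<And>i. i \<in> I \<Longrightarrow> continuous_on (U i) (f i)"
    "\<And>i x. i \<in> I \<Longrightarrow> x \<in> U i \<Longrightarrow> \<bar>f i x\<bar> \<le> C * d i powr (\<gamma> - \<tau>)"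
    "\<And>i x y. i \<in> I \<Longrightarrow> x \<in> U i \<Longrightarrow> y \<in> U i \<Longrightarrow> \<bar>f i x - f i y\<bar> \<le> C * d i powr (\<gamma> - \<tau> - \<beta>) * dist x y powr \<beta>"
    by auto
  have "continuous_on (U i) (g i)" if "i \<in> I" for i
    using C(2)[OF that] 0(1)[OF that] by (rule continuous_on_eq)
  moreover have "\<bar>g i x\<bar> \<le> C * d i powr (\<gamma> - \<tau>)" if "i \<in> I" "x \<in> U i" for i x
    using C(3)[OF that] 0(1)[OF that] by simp
  moreover have "\<bar>g i x - g i y\<bar> \<le> C * d i powr (\<gamma> - \<tau> - \<beta>) * dist x y powr \<beta>"
    if "i \<in> I" "x \<in> U i" "y \<in> U i" for i x y
    using C(4)[OF that] 0(1)[OF that(1,2)] 0(1)[OF that(1,3)] by simp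
  ultimately show ?case using C(1) unfolding Holder_class.simps by blast
next
  case (Suc k)
  have "W k \<gamma> \<tau> (\<lambda>i. partial v (g i))" if "v \<in> Basis" for v
  proof (rule Suc.IH[of "\<lambda>i. partial v (f i)"])
    show "partial v (f i) x = partial v (g i) x" if "i \<in> I" "x \<in> U i" for i x
      using that open_U Suc(2) by (intro partial_cong[of "U i"]) auto
  qed (use Suc that in auto)
  moreover have "\<exists>C\<ge>0. \<forall>i\<in>I. \<forall>x\<in>U i. g i differentiable (at x) \<and> \<bar>g i x\<bar> \<le> C * d i powr \<gamma>"
  proof -
    obtain C where C: "C \<ge> 0"
      "\<And>i x. i \<in> I \<Longrightarrow> x \<in> U i \<Longrightarrow> f i differentiable (at x) \<and> \<bar>f i x\<bar> \<le> C * d i powr \<gamma>"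
      using Suc(3) by auto
    have "g i differentiable (at x) \<and> \<bar>g i x\<bar> \<le> C * d i powr \<gamma>" if "i \<in> I" "x \<in> U i" for i x
      using C(2)[OF that] that open_U Suc(2) differentiable_cong_open[of "U i" x "f i" "g i"] by auto
    then show ?thesis using C(1) by blast
  qed
  ultimately show ?case by simp
qed

text \<open>One constant for all coordinate directions. If k = 0, the first derivatives already are
  the top ones, so their weight carries the loss \<tau>.\<close>

lemma partials_bound:
  assumes "W (Suc k) \<gamma> \<tau> f"
  obtains B where "B \<ge> 0" "\<And>i x v. i \<in> I \<Longrightarrow> x \<in> U i \<Longrightarrow> v \<in> Basis \<Longrightarrow>
    \<bar>partial v (f i) x\<bar> \<le> B * d i powr (case k of 0 \<Rightarrow> \<gamma> - \<tau> | Suc _ \<Rightarrow> \<gamma>)"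
proof -
  let ?e = "case k of 0 \<Rightarrow> \<gamma> - \<tau> | Suc _ \<Rightarrow> \<gamma>"
  have "\<exists>C\<ge>0. \<forall>i\<in>I. \<forall>x\<in>U i. \<bar>partial v (f i) x\<bar> \<le> C * d i powr ?e" if "v \<in> Basis" for v
  proof -
    have "W k \<gamma> \<tau> (\<lambda>i. partial v (f i))" using assms that by auto
    then show ?thesis by (cases k) auto
  qed
  then obtain C where C: "\<And>v. v \<in> Basis \<Longrightarrow> C v \<ge> 0"
    "\<And>v i x. v \<in> Basis \<Longrightarrow> i \<in> I \<Longrightarrow> x \<in> U i \<Longrightarrow> \<bar>partial v (f i) x\<bar> \<le> C v * d i powr ?e" by metis
  show ?thesis
  proof
    show "0 \<le> (\<Sum>v\<in>Basis. C v)" using C by (simp add: sum_nonneg)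
    fix i x v assume a: "i \<in> I" "x \<in> U i" "v \<in> (Basis :: 'a set)"
    have "C v \<le> (\<Sum>v\<in>Basis. C v)" using a C by (intro member_le_sum) auto
    then have "C v * d i powr ?e \<le> (\<Sum>v\<in>Basis. C v) * d i powr ?e"
      by (intro mult_right_mono) auto
    with C(2)[OF a(3,1,2)] show "\<bar>partial v (f i) x\<bar> \<le> (\<Sum>v\<in>Basis. C v) * d i powr ?e" by linarith
  qed
qed

text \<open>For the Hoelder bound of order zero: use the gradient bound at distances below the weight,
  and the bound of the values beyond.\<close>

lemma W_Suc_imp_W:
  assumes "0 \<le> \<tau>" "\<tau> \<le> 1" "W (Suc k) \<gamma> \<tau> f"
  shows "W k \<gamma> 0 f"
  using assms(3)
proof (induction k arbitrary: f)
  case 0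
  obtain B where B: "B \<ge> 0"
    "\<And>i x v. i \<in> I \<Longrightarrow> x \<in> U i \<Longrightarrow> v \<in> Basis \<Longrightarrow> \<bar>partial v (f i) x\<bar> \<le> B * d i powr (\<gamma> - \<tau>)"
    using partials_bound[OF 0] by auto
  obtain C where C: "C \<ge> 0"
    "\<And>i x. i \<in> I \<Longrightarrow> x \<in> U i \<Longrightarrow> f i differentiable (at x) \<and> \<bar>f i x\<bar> \<le> C * d i powr \<gamma>"
    using 0 by auto
  let ?L = "real DIM('a) * B * D powr (1 - \<tau>)"
  let ?K = "2 * C + ?L"
  have K: "?K \<ge> 0" using B C D_pos by simp
  have hol: "\<bar>f i x - f i y\<bar> \<le> ?K * d i powr (\<gamma> - \<beta>) * dist x y powr \<beta>"
    if i: "i \<in> I" and xy: "x \<in> U i" "y \<in> U i" for i x y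
  proof (cases "x = y")
    case True
    then show ?thesis using K by simp
  next
    case False
    then have pos: "dist x y > 0" by simp
    have dp: "d i > 0" using d_pos[OF i] .
    show ?thesis
    proof (cases "dist x y \<le> d i")
      case True
      have "\<bar>f i x - f i y\<bar> \<le> (real DIM('a) * (B * d i powr (\<gamma> - \<tau>))) * dist x y"
        using lipschitz_from_partials[OF convex_U[OF i], of "f i" "B * d i powr (\<gamma> - \<tau>)"] B C i xy by blast
      also have "dist x y = dist x y powr \<beta> * dist x y powr (1 - \<beta>)"
        using pos by (simp flip: powr_add)
      also have "(real DIM('a) * (B * d i powr (\<gamma> - \<tau>))) * (dist x y powr \<beta> * dist x y powr (1 - \<beta>))
        \<le> (real DIM('a) * (B * d i powr (\<gamma> - \<tau>))) * (dist x y powr \<beta> * d i powr (1 - \<beta>))"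
        using True pos \<beta>_le B by (intro mult_left_mono powr_mono2) auto
      also have "\<dots> = real DIM('a) * B * dist x y powr \<beta> * d i powr (\<gamma> - \<tau> + (1 - \<beta>))"
        by (simp add: powr_add mult_ac)
      \<comment> \<open>Here \<tau> \<le> 1 enters: the loss \<tau> of the gradient is compensated
        by the full power of the distance, which is at most \<open>d i\<close>.\<close>
      also have "\<dots> \<le> real DIM('a) * B * dist x y powr \<beta> * (D powr (1 - \<tau>) * d i powr (\<gamma> - \<beta>))"
        using weight_mono[OF i, of "\<gamma> - \<beta>" "\<gamma> - \<tau> + (1 - \<beta>)"] B assms
        by (intro mult_left_mono) (auto simp: algebra_simps)
      also have "\<dots> = ?L * d i powr (\<gamma> - \<beta>) * dist x y powr \<beta>" by (simp add: mult_ac)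
      also have "\<dots> \<le> ?K * d i powr (\<gamma> - \<beta>) * dist x y powr \<beta>"
        using C by (intro mult_right_mono) auto
      finally show ?thesis .
    next
      case False
      have "\<bar>f i x - f i y\<bar> \<le> 2 * C * d i powr \<gamma>"
        using C(2)[OF i xy(1)] C(2)[OF i xy(2)] by linarith
      also have "d i powr \<gamma> = d i powr (\<gamma> - \<beta>) * d i powr \<beta>" by (simp flip: powr_add)
      also have "2 * C * (d i powr (\<gamma> - \<beta>) * d i powr \<beta>) \<le> 2 * C * (d i powr (\<gamma> - \<beta>) * dist x y powr \<beta>)"
        using False dp C \<beta>_nonneg by (intro mult_left_mono powr_mono2) auto
      also have "\<dots> = 2 * C * d i powr (\<gamma> - \<beta>) * dist x y powr \<beta>" by simp
      also have "\<dots> \<le> ?K * d i powr (\<gamma> - \<beta>) * dist x y powr \<beta>"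
        using B D_pos by (intro mult_right_mono) auto
      finally show ?thesis .
    qed
  qed
  have "continuous_on (U i) (f i)" if "i \<in> I" for i
    using C(2)[OF that] by (meson differentiable_imp_continuous_on differentiable_at_imp_differentiable_on)
  moreover have "\<bar>f i x\<bar> \<le> ?K * d i powr \<gamma>" if "i \<in> I" "x \<in> U i" for i x
  proof -
    have "C * d i powr \<gamma> \<le> ?K * d i powr \<gamma>" using B C D_pos by (intro mult_right_mono) auto
    then show ?thesis using C(2)[OF that] by linarith
  qed
  ultimately show ?case using hol K by (auto intro!: exI[of _ ?K])
next
  case (Suc k)
  have "W (Suc k) \<gamma> \<tau> (\<lambda>i. partial v (f i))" if "v \<in> Basis" for v
    using Suc.prems that by simp
  then have "W k \<gamma> 0 (\<lambda>i. partial v (f i))" if "v \<in> Basis" for v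
    using Suc.IH that by blast
  then show ?case using Suc.prems by auto
qed

lemma W_add:
  assumes "W k \<gamma> \<tau> f" "W k \<gamma> \<tau> g"
  shows "W k \<gamma> \<tau> (\<lambda>i x. f i x + g i x)"
  using assms
proof (induction k arbitrary: f g)
  case 0
  then obtain C1 C2 where C: "C1 \<ge> 0" "C2 \<ge> 0"
    "\<And>i. i \<in> I \<Longrightarrow> continuous_on (U i) (f i)" "\<And>i. i \<in> I \<Longrightarrow> continuous_on (U i) (g i)"
    "\<And>i x. i \<in> I \<Longrightarrow> x \<in> U i \<Longrightarrow> \<bar>f i x\<bar> \<le> C1 * d i powr (\<gamma> - \<tau>)"
    "\<And>i x. i \<in> I \<Longrightarrow> x \<in> U i \<Longrightarrow> \<bar>g i x\<bar> \<le> C2 * d i powr (\<gamma> - \<tau>)"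
    "\<And>i x y. i \<in> I \<Longrightarrow> x \<in> U i \<Longrightarrow> y \<in> U i \<Longrightarrow> \<bar>f i x - f i y\<bar> \<le> C1 * d i powr (\<gamma> - \<tau> - \<beta>) * dist x y powr \<beta>"
    "\<And>i x y. i \<in> I \<Longrightarrow> x \<in> U i \<Longrightarrow> y \<in> U i \<Longrightarrow> \<bar>g i x - g i y\<bar> \<le> C2 * d i powr (\<gamma> - \<tau> - \<beta>) * dist x y powr \<beta>"
    by auto
  have "\<bar>f i x + g i x\<bar> \<le> (C1 + C2) * d i powr (\<gamma> - \<tau>)" if "i \<in> I" "x \<in> U i" for i x
    using C(5,6)[OF that] unfolding distrib_right by linarith
  moreover have "\<bar>f i x + g i x - (f i y + g i y)\<bar> \<le> (C1 + C2) * d i powr (\<gamma> - \<tau> - \<beta>) * dist x y powr \<beta>"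
    if "i \<in> I" "x \<in> U i" "y \<in> U i" for i x y
    using C(7,8)[OF that] unfolding distrib_right by linarith
  ultimately show ?case using C(1-4)
    by (auto intro!: exI[of _ "C1 + C2"] continuous_on_add)
next
  case (Suc k)
  then obtain C1 C2 where C: "C1 \<ge> 0" "C2 \<ge> 0"
    "\<And>i x. i \<in> I \<Longrightarrow> x \<in> U i \<Longrightarrow> f i differentiable (at x) \<and> \<bar>f i x\<bar> \<le> C1 * d i powr \<gamma>"
    "\<And>i x. i \<in> I \<Longrightarrow> x \<in> U i \<Longrightarrow> g i differentiable (at x) \<and> \<bar>g i x\<bar> \<le> C2 * d i powr \<gamma>"
    by auto
  have "\<bar>f i x + g i x\<bar> \<le> (C1 + C2) * d i powr \<gamma>" if "i \<in> I" "x \<in> U i" for i x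
    using C(3,4)[OF that] unfolding distrib_right by linarith
  moreover have "W k \<gamma> \<tau> (\<lambda>i. partial v (\<lambda>x. f i x + g i x))" if v: "v \<in> Basis" for v
  proof (rule W_cong)
    show "W k \<gamma> \<tau> (\<lambda>i x. partial v (f i) x + partial v (g i) x)"
      using Suc v by auto
    show "partial v (f i) x + partial v (g i) x = partial v (\<lambda>x. f i x + g i x) x" if "i \<in> I" "x \<in> U i" for i x
      using C(3,4)[OF that] unfolding frechet_derivative_works
      by (intro partial_eqI[symmetric] has_derivative_add) auto
  qed
  ultimately show ?case using C by (auto intro!: exI[of _ "C1 + C2"])
qed

lemma W_const:
  assumes "C \<ge> 0" "\<And>i. i \<in> I \<Longrightarrow> \<bar>c i\<bar> \<le> C * d i powr \<gamma>"
  shows "W k \<gamma> 0 (\<lambda>i x. c i)"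
  using assms
proof (induction k arbitrary: c C)
  case 0
  then show ?case by (auto intro!: exI[of _ C])
next
  case (Suc k)
  have "partial v (\<lambda>x. c i) = (\<lambda>x. 0)" for i v by (simp add: frechet_derivative_const)
  moreover have "W k \<gamma> 0 (\<lambda>i x. 0)" by (rule Suc.IH[of 0]) auto
  ultimately show ?case using Suc.prems by auto
qed

text \<open>The exponent \<open>max \<gamma> (\<gamma> - \<tau>)\<close> lies above both exponents
  that \<open>W_mono\<close> has to reach.\<close>

lemma W_zero: "W k \<gamma> \<tau> (\<lambda>i x. 0)"
  by (rule W_mono[OF W_const[of 0 _ "max \<gamma> (\<gamma> - \<tau>)"]]) auto

lemma W_sum:
  assumes "finite T" "\<And>j. j \<in> T \<Longrightarrow> W k \<gamma> \<tau> (f j)"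
  shows "W k \<gamma> \<tau> (\<lambda>i x. \<Sum>j\<in>T. f j i x)"
  using assms by (induction T rule: finite_induct) (auto intro: W_add W_zero)

text \<open>Only one factor may carry the loss: at order zero a product of two lossy factors would
  lose 2 \<tau>. The induction preserves this asymmetry. In the term with the derivative on f, the
  factor g has one derivative in reserve, so \<open>W_Suc_imp_W\<close> applies to it.\<close>

lemma W_mult:
  assumes \<tau>: "0 \<le> \<tau>" "\<tau> \<le> 1" and fg: "W k \<gamma> 0 f" "W k \<gamma>' \<tau> g"
  shows "W k (\<gamma> + \<gamma>') \<tau> (\<lambda>i x. f i x * g i x)"
  using fg
proof (induction k arbitrary: f g \<gamma> \<gamma>')
  case 0
  then obtain C1 C2 where C: "C1 \<ge> 0" "C2 \<ge> 0"
    "\<And>i. i \<in> I \<Longrightarrow> continuous_on (U i) (f i)" "\<And>i. i \<in> I \<Longrightarrow> continuous_on (U i) (g i)"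
    "\<And>i x. i \<in> I \<Longrightarrow> x \<in> U i \<Longrightarrow> \<bar>f i x\<bar> \<le> C1 * d i powr \<gamma>"
    "\<And>i x. i \<in> I \<Longrightarrow> x \<in> U i \<Longrightarrow> \<bar>g i x\<bar> \<le> C2 * d i powr (\<gamma>' - \<tau>)"
    "\<And>i x y. i \<in> I \<Longrightarrow> x \<in> U i \<Longrightarrow> y \<in> U i \<Longrightarrow> \<bar>f i x - f i y\<bar> \<le> C1 * d i powr (\<gamma> - \<beta>) * dist x y powr \<beta>"
    "\<And>i x y. i \<in> I \<Longrightarrow> x \<in> U i \<Longrightarrow> y \<in> U i \<Longrightarrow> \<bar>g i x - g i y\<bar> \<le> C2 * d i powr (\<gamma>' - \<tau> - \<beta>) * dist x y powr \<beta>"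
    by auto
  have "\<bar>f i x * g i x\<bar> \<le> (2 * C1 * C2) * d i powr (\<gamma> + \<gamma>' - \<tau>)" if "i \<in> I" "x \<in> U i" for i x
  proof -
    have "\<bar>f i x * g i x\<bar> \<le> (C1 * d i powr \<gamma>) * (C2 * d i powr (\<gamma>' - \<tau>))"
      unfolding abs_mult using C(1,2) C(5,6)[OF that] by (intro mult_mono) auto
    also have "\<dots> = (C1 * C2) * d i powr (\<gamma> + \<gamma>' - \<tau>)"
      by (simp flip: powr_add add: mult_ac add_diff_eq)
    also have "\<dots> \<le> (2 * C1 * C2) * d i powr (\<gamma> + \<gamma>' - \<tau>)"
      using C(1,2) by (intro mult_right_mono) auto
    finally show ?thesis .
  qed
  moreover have "\<bar>f i x * g i x - f i y * g i y\<bar> \<le> (2 * C1 * C2) * d i powr (\<gamma> + \<gamma>' - \<tau> - \<beta>) * dist x y powr \<beta>"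
    if "i \<in> I" "x \<in> U i" "y \<in> U i" for i x y
  proof -
    have "f i x * g i x - f i y * g i y = f i x * (g i x - g i y) + (f i x - f i y) * g i y"
      by (simp add: algebra_simps)
    then have "\<bar>f i x * g i x - f i y * g i y\<bar> \<le> \<bar>f i x\<bar> * \<bar>g i x - g i y\<bar> + \<bar>f i x - f i y\<bar> * \<bar>g i y\<bar>"
      by (metis abs_mult abs_triangle_ineq)
    also have "\<dots> \<le> (C1 * d i powr \<gamma>) * (C2 * d i powr (\<gamma>' - \<tau> - \<beta>) * dist x y powr \<beta>)
       + (C1 * d i powr (\<gamma> - \<beta>) * dist x y powr \<beta>) * (C2 * d i powr (\<gamma>' - \<tau>))"
      using that C(1,2) by (intro add_mono mult_mono C(5-8)) auto
    also have "\<dots> = (2 * C1 * C2) * d i powr (\<gamma> + \<gamma>' - \<tau> - \<beta>) * dist x y powr \<beta>"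
    proof -
      have "d i powr \<gamma> * d i powr (\<gamma>' - \<tau> - \<beta>) = d i powr (\<gamma> + \<gamma>' - \<tau> - \<beta>)"
        "d i powr (\<gamma> - \<beta>) * d i powr (\<gamma>' - \<tau>) = d i powr (\<gamma> + \<gamma>' - \<tau> - \<beta>)"
        by (simp_all flip: powr_add add: algebra_simps)
      then show ?thesis by (simp add: algebra_simps)
    qed
    finally show ?thesis .
  qed
  ultimately show ?case using C(1-4)
    by (auto intro!: exI[of _ "2 * C1 * C2"] continuous_on_mult)
next
  case (Suc k)
  then obtain C1 C2 where C: "C1 \<ge> 0" "C2 \<ge> 0"
    "\<And>i x. i \<in> I \<Longrightarrow> x \<in> U i \<Longrightarrow> f i differentiable (at x) \<and> \<bar>f i x\<bar> \<le> C1 * d i powr \<gamma>"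
    "\<And>i x. i \<in> I \<Longrightarrow> x \<in> U i \<Longrightarrow> g i differentiable (at x) \<and> \<bar>g i x\<bar> \<le> C2 * d i powr \<gamma>'"
    by auto
  have "\<bar>f i x * g i x\<bar> \<le> (C1 * C2) * d i powr (\<gamma> + \<gamma>')" if "i \<in> I" "x \<in> U i" for i x
  proof -
    have "\<bar>f i x * g i x\<bar> \<le> (C1 * d i powr \<gamma>) * (C2 * d i powr \<gamma>')"
      unfolding abs_mult using C(1,2) C(3,4)[OF that] by (intro mult_mono) auto
    then show ?thesis by (simp add: powr_add mult_ac)
  qed
  moreover have "W k (\<gamma> + \<gamma>') \<tau> (\<lambda>i. partial v (\<lambda>x. f i x * g i x))" if v: "v \<in> Basis" for v
  proof (rule W_cong)
    have f: "W k \<gamma> 0 f" using Suc.prems(1) by (rule W_Suc_imp_W[rotated 2]) auto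
    have df: "W k \<gamma> 0 (\<lambda>i. partial v (f i))" and dg: "W k \<gamma>' \<tau> (\<lambda>i. partial v (g i))"
      using Suc.prems v by auto
    have g: "W k \<gamma>' \<tau> g"
      by (rule W_mono[OF W_Suc_imp_W[OF \<tau> Suc.prems(2)]]) (use \<tau> in auto)
    have "W k (\<gamma> + \<gamma>') \<tau> (\<lambda>i x. partial v (f i) x * g i x)"
      by (rule Suc.IH[OF df g])
    then show "W k (\<gamma> + \<gamma>') \<tau> (\<lambda>i x. f i x * partial v (g i) x + partial v (f i) x * g i x)"
      using Suc.IH[OF f dg] by (intro W_add)
    show "f i x * partial v (g i) x + partial v (f i) x * g i x = partial v (\<lambda>x. f i x * g i x) x"
      if "i \<in> I" "x \<in> U i" for i x
      using C(3,4)[OF that] unfolding frechet_derivative_works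
      by (intro partial_eqI[symmetric] has_derivative_mult) auto
  qed
  ultimately show ?case using C by (auto intro!: exI[of _ "C1 * C2"])
qed

text \<open>Introduction rule for an arbitrary derivative in place of \<open>partial\<close>, so
  that the product, power and chain rules can be used in closed form.\<close>

lemma W_SucI:
  assumes "C \<ge> 0" "\<And>i x. i \<in> I \<Longrightarrow> x \<in> U i \<Longrightarrow> \<bar>f i x\<bar> \<le> C * d i powr \<gamma>"
    and der: "\<And>i x. i \<in> I \<Longrightarrow> x \<in> U i \<Longrightarrow> (f i has_derivative f' i x) (at x)"
    and W: "\<And>v. v \<in> Basis \<Longrightarrow> W k \<gamma> \<tau> (\<lambda>i x. f' i x v)"
  shows "W (Suc k) \<gamma> \<tau> f"
proof -
  have "W k \<gamma> \<tau> (\<lambda>i. partial v (f i))" if "v \<in> Basis" for v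
    using W_cong[OF _ W[OF that], of "\<lambda>i. partial v (f i)"] partial_eqI[OF der] by simp
  moreover have "f i differentiable (at x)" if "i \<in> I" "x \<in> U i" for i x
    using der[OF that] differentiable_def by blast
  ultimately show ?thesis using assms(1,2) by auto
qed

lemma W_SucD:
  assumes "W (Suc k) \<gamma> \<tau> f"
  obtains C where "C \<ge> 0" "\<And>i x. i \<in> I \<Longrightarrow> x \<in> U i \<Longrightarrow> \<bar>f i x\<bar> \<le> C * d i powr \<gamma>"
    "\<And>i x. i \<in> I \<Longrightarrow> x \<in> U i \<Longrightarrow> (f i has_derivative frechet_derivative (f i) (at x)) (at x)"
    "\<And>v. v \<in> Basis \<Longrightarrow> W k \<gamma> \<tau> (\<lambda>i. partial v (f i))"
  using assms unfolding Holder_class.simps frechet_derivative_works by blast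

text \<open>With at least one derivative both factors may carry the loss: in each Leibniz term the
  undifferentiated factor is lossless at order k by \<open>W_Suc_imp_W\<close>, so that
  \<open>W_mult\<close> applies. The top derivative never falls on both factors at once.\<close>

lemma W_mult_Suc:
  assumes \<tau>: "0 \<le> \<tau>" "\<tau> \<le> 1" and f: "W (Suc k) \<gamma> \<tau> f" and g: "W (Suc k) \<gamma>' \<tau> g"
  shows "W (Suc k) (\<gamma> + \<gamma>') \<tau> (\<lambda>i x. f i x * g i x)"
proof -
  obtain C1 where C1: "C1 \<ge> 0" "\<And>i x. i \<in> I \<Longrightarrow> x \<in> U i \<Longrightarrow> \<bar>f i x\<bar> \<le> C1 * d i powr \<gamma>"
    "\<And>i x. i \<in> I \<Longrightarrow> x \<in> U i \<Longrightarrow> (f i has_derivative frechet_derivative (f i) (at x)) (at x)"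
    "\<And>v. v \<in> Basis \<Longrightarrow> W k \<gamma> \<tau> (\<lambda>i. partial v (f i))" using W_SucD[OF f] by blast
  obtain C2 where C2: "C2 \<ge> 0" "\<And>i x. i \<in> I \<Longrightarrow> x \<in> U i \<Longrightarrow> \<bar>g i x\<bar> \<le> C2 * d i powr \<gamma>'"
    "\<And>i x. i \<in> I \<Longrightarrow> x \<in> U i \<Longrightarrow> (g i has_derivative frechet_derivative (g i) (at x)) (at x)"
    "\<And>v. v \<in> Basis \<Longrightarrow> W k \<gamma>' \<tau> (\<lambda>i. partial v (g i))" using W_SucD[OF g] by blast
  show ?thesis
  proof (rule W_SucI)
    show "0 \<le> C1 * C2" using C1 C2 by simp
    show "\<bar>f i x * g i x\<bar> \<le> (C1 * C2) * d i powr (\<gamma> + \<gamma>')" if "i \<in> I" "x \<in> U i" for i x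
    proof -
      have "\<bar>f i x * g i x\<bar> \<le> (C1 * d i powr \<gamma>) * (C2 * d i powr \<gamma>')"
        unfolding abs_mult using C1(1) C2(1) C1(2)[OF that] C2(2)[OF that] by (intro mult_mono) auto
      then show ?thesis by (simp add: powr_add mult_ac)
    qed
    show "((\<lambda>x. f i x * g i x) has_derivative (\<lambda>h. f i x * frechet_derivative (g i) (at x) h
      + frechet_derivative (f i) (at x) h * g i x)) (at x)" if "i \<in> I" "x \<in> U i" for i x
      using C1(3)[OF that] C2(3)[OF that] by (rule has_derivative_mult)
    fix v :: 'a assume v: "v \<in> Basis"
    have "W k (\<gamma>' + \<gamma>) \<tau> (\<lambda>i x. g i x * partial v (f i) x)"
      by (rule W_mult[OF \<tau> W_Suc_imp_W[OF \<tau> g] C1(4)[OF v]])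
    then have "W k (\<gamma> + \<gamma>') \<tau> (\<lambda>i x. partial v (f i) x * g i x)"
      by (simp add: mult.commute add.commute)
    then show "W k (\<gamma> + \<gamma>') \<tau> (\<lambda>i x. f i x * partial v (g i) x + partial v (f i) x * g i x)"
      using W_mult[OF \<tau> W_Suc_imp_W[OF \<tau> f] C2(4)[OF v]] by (intro W_add)
  qed
qed

text \<open>Both bounds on t are required since s may have either sign; the sum of the two constants
  covers both cases.\<close>

lemma powr_bounds:
  assumes "0 < c" "i \<in> I" "c * d i powr \<gamma> \<le> t" "t \<le> C * d i powr \<gamma>" "c \<le> C"
  shows "t powr s \<le> (c powr s + C powr s) * d i powr (s * \<gamma>)"
proof -
  have t: "0 < t" using assms d_pos[of i] by (smt (verit) mult_pos_pos powr_gt_zero)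
  have eq: "(c powr s + C powr s) * d i powr (s * \<gamma>) = (c * d i powr \<gamma>) powr s + (C * d i powr \<gamma>) powr s"
    using assms d_pos[of i] by (simp add: powr_mult powr_powr algebra_simps)
  show ?thesis
  proof (cases "s \<ge> 0")
    case True
    then have "t powr s \<le> (C * d i powr \<gamma>) powr s" using t assms(4) by (intro powr_mono2) auto
    then show ?thesis unfolding eq by (simp add: add_increasing)
  next
    case False
    then have "t powr s \<le> (c * d i powr \<gamma>) powr s"
      using t assms d_pos[of i] by (intro powr_mono2') auto
    then show ?thesis unfolding eq by (simp add: add_increasing2)
  qed
qed

text \<open>The lower bound makes f comparable to the weight \<open>d i powr \<gamma>\<close>, hence
  its power comparable to \<open>d i powr (s * \<gamma>)\<close> even for s < 0. The derivative
  contains the power s - 1, so the induction is over all s simultaneously.\<close>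

lemma W_powr:
  assumes "0 < c" "\<And>i x. i \<in> I \<Longrightarrow> x \<in> U i \<Longrightarrow> c * d i powr \<gamma> \<le> f i x" "W k \<gamma> 0 f"
  shows "W k (s * \<gamma>) 0 (\<lambda>i x. f i x powr s)"
  using assms(3)
proof (induction k arbitrary: s)
  case 0
  then obtain C0 where C0: "C0 \<ge> 0"
    "\<And>i. i \<in> I \<Longrightarrow> continuous_on (U i) (f i)"
    "\<And>i x. i \<in> I \<Longrightarrow> x \<in> U i \<Longrightarrow> \<bar>f i x\<bar> \<le> C0 * d i powr \<gamma>"
    "\<And>i x y. i \<in> I \<Longrightarrow> x \<in> U i \<Longrightarrow> y \<in> U i \<Longrightarrow> \<bar>f i x - f i y\<bar> \<le> C0 * d i powr (\<gamma> - \<beta>) * dist x y powr \<beta>"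
    by auto
  \<comment> \<open>The maximum guarantees c \<le> C, so that the values of f lie in a genuine
    interval between \<open>c * d i powr \<gamma>\<close> and
    \<open>C * d i powr \<gamma>\<close>.\<close>
  define C where "C = max C0 c"
  have C: "C \<ge> c" "C \<ge> C0" "C > 0" using assms(1) by (auto simp: C_def)
  have fC: "f i x \<le> C * d i powr \<gamma>" if "i \<in> I" "x \<in> U i" for i x
    using C0(3)[OF that] mult_right_mono[OF C(2), of "d i powr \<gamma>"] by simp
  have pos: "0 < f i x" if "i \<in> I" "x \<in> U i" for i x
    using assms(2)[OF that] assms(1) d_pos[OF that(1)] by (smt (verit) mult_pos_pos powr_gt_zero)
  let ?K = "c powr s + C powr s" and ?L = "\<bar>s\<bar> * (c powr (s - 1) + C powr (s - 1)) * C0"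
  have "\<bar>f i x powr s\<bar> \<le> (?K + ?L) * d i powr (s * \<gamma>)" if "i \<in> I" "x \<in> U i" for i x
  proof -
    have "f i x powr s \<le> ?K * d i powr (s * \<gamma>)"
      using powr_bounds[OF assms(1) that(1) assms(2)[OF that] fC[OF that] C(1)] .
    also have "\<dots> \<le> (?K + ?L) * d i powr (s * \<gamma>)" using C0(1) by (intro mult_right_mono) auto
    finally show ?thesis by simp
  qed
  moreover have "\<bar>f i x powr s - f i y powr s\<bar> \<le> (?K + ?L) * d i powr (s * \<gamma> - \<beta>) * dist x y powr \<beta>"
    if i: "i \<in> I" and xy: "x \<in> U i" "y \<in> U i" for i x y
  proof -
    have d0: "d i > 0" using d_pos[OF i] .
    have "\<bar>f i x powr s - f i y powr s\<bar>
      \<le> \<bar>s\<bar> * ((c * d i powr \<gamma>) powr (s - 1) + (C * d i powr \<gamma>) powr (s - 1)) * \<bar>f i x - f i y\<bar>"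
      using assms(1,2) i xy fC d0 by (intro powr_lipschitz) auto
    also have "\<dots> \<le> \<bar>s\<bar> * ((c * d i powr \<gamma>) powr (s - 1) + (C * d i powr \<gamma>) powr (s - 1))
        * (C0 * d i powr (\<gamma> - \<beta>) * dist x y powr \<beta>)"
      using C0(4)[OF i xy] by (intro mult_left_mono) auto
    also have "\<dots> = ?L * (d i powr (\<gamma> * (s - 1)) * d i powr (\<gamma> - \<beta>)) * dist x y powr \<beta>"
      using assms(1) C(3) d0 by (simp add: powr_mult powr_powr algebra_simps)
    also have "d i powr (\<gamma> * (s - 1)) * d i powr (\<gamma> - \<beta>) = d i powr (s * \<gamma> - \<beta>)"
      by (simp flip: powr_add add: algebra_simps)
    also have "?L * d i powr (s * \<gamma> - \<beta>) * dist x y powr \<beta>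
        \<le> (?K + ?L) * d i powr (s * \<gamma> - \<beta>) * dist x y powr \<beta>"
      by (intro mult_right_mono) auto
    finally show ?thesis .
  qed
  moreover have "continuous_on (U i) (\<lambda>x. f i x powr s)" if "i \<in> I" for i
    using C0(2)[OF that] pos[OF that] by (intro continuous_on_powr continuous_on_const) force+
  moreover have "?K + ?L \<ge> 0" using C0(1) by simp
  ultimately show ?case by (auto intro!: exI[of _ "?K + ?L"])
next
  case (Suc k)
  obtain C0 where C0: "C0 \<ge> 0" "\<And>i x. i \<in> I \<Longrightarrow> x \<in> U i \<Longrightarrow> \<bar>f i x\<bar> \<le> C0 * d i powr \<gamma>"
    "\<And>i x. i \<in> I \<Longrightarrow> x \<in> U i \<Longrightarrow> (f i has_derivative frechet_derivative (f i) (at x)) (at x)"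
    "\<And>v. v \<in> Basis \<Longrightarrow> W k \<gamma> 0 (\<lambda>i. partial v (f i))" using W_SucD[OF Suc.prems] by blast
  define C where "C = max C0 c"
  have C: "C \<ge> c" "C \<ge> C0" "C > 0" using assms(1) by (auto simp: C_def)
  have fC: "f i x \<le> C * d i powr \<gamma>" if "i \<in> I" "x \<in> U i" for i x
    using C0(2)[OF that] mult_right_mono[OF C(2), of "d i powr \<gamma>"] by simp
  have pos: "0 < f i x" if "i \<in> I" "x \<in> U i" for i x
    using assms(2)[OF that] assms(1) d_pos[OF that(1)] by (smt (verit) mult_pos_pos powr_gt_zero)
  have W0: "W k \<gamma> 0 f" by (rule W_Suc_imp_W[OF _ _ Suc.prems]) auto
  show ?case
  proof (rule W_SucI)
    show "0 \<le> c powr s + C powr s" by simp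
    show "\<bar>f i x powr s\<bar> \<le> (c powr s + C powr s) * d i powr (s * \<gamma>)" if "i \<in> I" "x \<in> U i" for i x
      using powr_bounds[OF assms(1) that(1) assms(2)[OF that] fC[OF that] C(1)] by simp
    show "((\<lambda>x. f i x powr s) has_derivative
        (\<lambda>h. s * (f i x powr (s - 1) * frechet_derivative (f i) (at x) h))) (at x)"
      if "i \<in> I" "x \<in> U i" for i x
    proof -
      have "((\<lambda>x. f i x powr s) has_derivative (\<lambda>h. (f i x powr s) *
          (0 * ln (f i x) + frechet_derivative (f i) (at x) h * s / f i x))) (at x)"
        using C0(3)[OF that] pos[OF that] by (intro has_derivative_powr) auto
      then show ?thesis
        by (rule has_derivative_eq_rhs) (use pos[OF that] in \<open>auto simp: powr_diff\<close>)
    qed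
    fix v :: 'a assume "v \<in> Basis"
    then have "W k ((s - 1) * \<gamma> + \<gamma>) 0 (\<lambda>i x. f i x powr (s - 1) * partial v (f i) x)"
      by (intro W_mult Suc.IH C0(4) W0) auto
    moreover have "W k 0 0 (\<lambda>i x. s)" by (rule W_const[of "\<bar>s\<bar>"]) (use d_pos in force)+
    ultimately have "W k (0 + ((s - 1) * \<gamma> + \<gamma>)) 0 (\<lambda>i x. s * (f i x powr (s - 1) * partial v (f i) x))"
      by (intro W_mult[where \<gamma> = 0]) auto
    then show "W k (s * \<gamma>) 0 (\<lambda>i x. s * (f i x powr (s - 1) * partial v (f i) x))"
      by (simp add: algebra_simps)
  qed
qed

text \<open>The loss sits in the partial derivative of f alone: the factor
  \<open>f i x powr (s - 1)\<close> is lossless at order k by \<open>W_powr\<close>, and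
  \<open>W_mult\<close> finishes.\<close>

lemma W_powr_Suc:
  assumes \<tau>: "0 \<le> \<tau>" "\<tau> \<le> 1"
    and c: "0 < c" "\<And>i x. i \<in> I \<Longrightarrow> x \<in> U i \<Longrightarrow> c * d i powr \<gamma> \<le> f i x" and f: "W (Suc k) \<gamma> \<tau> f"
  shows "W (Suc k) (s * \<gamma>) \<tau> (\<lambda>i x. f i x powr s)"
proof -
  obtain C0 where C0: "C0 \<ge> 0" "\<And>i x. i \<in> I \<Longrightarrow> x \<in> U i \<Longrightarrow> \<bar>f i x\<bar> \<le> C0 * d i powr \<gamma>"
    "\<And>i x. i \<in> I \<Longrightarrow> x \<in> U i \<Longrightarrow> (f i has_derivative frechet_derivative (f i) (at x)) (at x)"
    "\<And>v. v \<in> Basis \<Longrightarrow> W k \<gamma> \<tau> (\<lambda>i. partial v (f i))" using W_SucD[OF f] by blast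
  define C where "C = max C0 c"
  have C: "C \<ge> c" "C \<ge> C0" "C > 0" using c by (auto simp: C_def)
  have fC: "f i x \<le> C * d i powr \<gamma>" if "i \<in> I" "x \<in> U i" for i x
    using C0(2)[OF that] mult_right_mono[OF C(2), of "d i powr \<gamma>"] by simp
  have pos: "0 < f i x" if "i \<in> I" "x \<in> U i" for i x
    using c(2)[OF that] c(1) d_pos[OF that(1)] by (smt (verit) mult_pos_pos powr_gt_zero)
  have W0: "W k \<gamma> 0 f" by (rule W_Suc_imp_W[OF \<tau> f])
  show ?thesis
  proof (rule W_SucI)
    show "0 \<le> c powr s + C powr s" by simp
    show "\<bar>f i x powr s\<bar> \<le> (c powr s + C powr s) * d i powr (s * \<gamma>)" if "i \<in> I" "x \<in> U i" for i x
      using powr_bounds[OF c(1) that(1) c(2)[OF that] fC[OF that] C(1)] by simp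
    show "((\<lambda>x. f i x powr s) has_derivative
        (\<lambda>h. s * (f i x powr (s - 1) * frechet_derivative (f i) (at x) h))) (at x)"
      if "i \<in> I" "x \<in> U i" for i x
    proof -
      have "((\<lambda>x. f i x powr s) has_derivative (\<lambda>h. (f i x powr s) *
          (0 * ln (f i x) + frechet_derivative (f i) (at x) h * s / f i x))) (at x)"
        using C0(3)[OF that] pos[OF that] by (intro has_derivative_powr) auto
      then show ?thesis
        by (rule has_derivative_eq_rhs) (use pos[OF that] in \<open>auto simp: powr_diff\<close>)
    qed
    fix v :: 'a assume "v \<in> Basis"
    then have "W k ((s - 1) * \<gamma> + \<gamma>) \<tau> (\<lambda>i x. f i x powr (s - 1) * partial v (f i) x)"
      by (intro W_mult W_powr[OF c W0] C0(4) \<tau>)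
    moreover have "W k 0 0 (\<lambda>i x. s)" by (rule W_const[of "\<bar>s\<bar>"]) (use d_pos in force)+
    ultimately have "W k (0 + ((s - 1) * \<gamma> + \<gamma>)) \<tau> (\<lambda>i x. s * (f i x powr (s - 1) * partial v (f i) x))"
      by (intro W_mult[where \<gamma> = 0] \<tau>)
    then show "W k (s * \<gamma>) \<tau> (\<lambda>i x. s * (f i x powr (s - 1) * partial v (f i) x))"
      by (simp add: algebra_simps)
  qed
qed

text \<open>Proved one order higher, where the derivatives are constants; stepping down with
  \<open>W_Suc_imp_W\<close> supplies the Hoelder quotient.\<close>

lemma W_coord:
  assumes "\<And>i x. i \<in> I \<Longrightarrow> x \<in> U i \<Longrightarrow> norm x \<le> B"
  shows "W k 0 0 (\<lambda>i x. x \<bullet> b)"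
proof (rule W_Suc_imp_W[of 0])
  have bd: "\<bar>x \<bullet> b\<bar> \<le> (\<bar>B\<bar> * norm b) * d i powr 0" if "i \<in> I" "x \<in> U i" for i x
  proof -
    have "\<bar>x \<bullet> b\<bar> \<le> norm x * norm b" by (rule Cauchy_Schwarz_ineq2)
    also have "\<dots> \<le> \<bar>B\<bar> * norm b" using assms[OF that] by (intro mult_right_mono) auto
    finally show ?thesis using d_pos[OF that(1)] by simp
  qed
  show "W (Suc k) 0 0 (\<lambda>i x. x \<bullet> b)"
  proof (rule W_SucI[OF _ bd])
    show "((\<lambda>x. x \<bullet> b) has_derivative (\<lambda>h. h \<bullet> b)) (at x)" for x :: 'a
      by (auto intro!: derivative_eq_intros)
    show "W k 0 0 (\<lambda>i x. v \<bullet> b)" for v by (rule W_const[of "\<bar>v \<bullet> b\<bar>"]) (use d_pos in force)+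
  qed auto
qed auto

text \<open>\<open>Holder_class\<close> consumes the innermost derivative first, whereas
  \<open>iter_deriv\<close> is defined by adding the outermost one; hence induction from the end of
  the list.\<close>

lemma W_iter_deriv:
  assumes "W k \<gamma> \<tau> f" "vs \<in> multi_indices j" "j \<le> k"
  shows "W (k - j) \<gamma> \<tau> (\<lambda>i. iter_deriv vs (f i))"
  using assms
proof (induction vs arbitrary: f j k rule: rev_induct)
  case (snoc v vs)
  have iter: "iter_deriv (vs @ [v]) g = iter_deriv vs (partial v g)" for g :: "'a \<Rightarrow> real"
    by (induction vs) auto
  obtain j' k' where jk: "j = Suc j'" "k = Suc k'" "j' \<le> k'"
    using snoc.prems unfolding multi_indices_def by (cases j; cases k) auto
  have "W k' \<gamma> \<tau> (\<lambda>i. partial v (f i))" using snoc.prems(1,2) unfolding jk multi_indices_def by auto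
  moreover have "vs \<in> multi_indices j'" using snoc.prems(2) unfolding jk multi_indices_def by auto
  ultimately show ?case using snoc.IH[of k' "\<lambda>i. partial v (f i)" j'] jk by (simp add: iter)
qed (auto simp: multi_indices_def)

end

text \<open>Permits treating indices close to the singularity and far from it by different
  arguments; the two constants are added.\<close>

lemma Holder_class_Un:
  assumes "Holder_class I U d \<beta> k \<gamma> \<tau> f" "Holder_class J U d \<beta> k \<gamma> \<tau> f"
  shows "Holder_class (I \<union> J) U d \<beta> k \<gamma> \<tau> f"
  using assms
proof (induction k arbitrary: f)
  case 0
  then obtain C1 C2 where C: "C1 \<ge> 0" "\<forall>i\<in>I. continuous_on (U i) (f i) \<and>
        (\<forall>x\<in>U i. \<bar>f i x\<bar> \<le> C1 * d i powr (\<gamma> - \<tau>)) \<and>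
        (\<forall>x\<in>U i. \<forall>y\<in>U i. \<bar>f i x - f i y\<bar> \<le> C1 * d i powr (\<gamma> - \<tau> - \<beta>) * dist x y powr \<beta>)"
     "C2 \<ge> 0" "\<forall>i\<in>J. continuous_on (U i) (f i) \<and>
        (\<forall>x\<in>U i. \<bar>f i x\<bar> \<le> C2 * d i powr (\<gamma> - \<tau>)) \<and>
        (\<forall>x\<in>U i. \<forall>y\<in>U i. \<bar>f i x - f i y\<bar> \<le> C2 * d i powr (\<gamma> - \<tau> - \<beta>) * dist x y powr \<beta>)"
    unfolding Holder_class.simps by blast
  have le: "t \<le> (C1 + C2) * a" if "a \<ge> 0" "t \<le> C1 * a \<or> t \<le> C2 * a" for a t
    using that C(1,3) mult_nonneg_nonneg[OF C(1), of a] mult_nonneg_nonneg[OF C(3), of a]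
    unfolding distrib_right by linarith
  have "continuous_on (U i) (f i) \<and>
        (\<forall>x\<in>U i. \<bar>f i x\<bar> \<le> (C1 + C2) * d i powr (\<gamma> - \<tau>)) \<and>
        (\<forall>x\<in>U i. \<forall>y\<in>U i. \<bar>f i x - f i y\<bar> \<le> (C1 + C2) * d i powr (\<gamma> - \<tau> - \<beta>) * dist x y powr \<beta>)"
    if i: "i \<in> I \<union> J" for i
  proof (intro conjI ballI)
    show "continuous_on (U i) (f i)" using i C by auto
    show "\<bar>f i x\<bar> \<le> (C1 + C2) * d i powr (\<gamma> - \<tau>)" if "x \<in> U i" for x
      using i that C by (intro le) auto
    show "\<bar>f i x - f i y\<bar> \<le> (C1 + C2) * d i powr (\<gamma> - \<tau> - \<beta>) * dist x y powr \<beta>"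
      if "x \<in> U i" "y \<in> U i" for x y
      unfolding mult.assoc using i that C by (intro le) (auto simp: mult.assoc)
  qed
  then show ?case using C(1,3) unfolding Holder_class.simps by (intro exI[of _ "C1 + C2"]) auto
next
  case (Suc k)
  then obtain C1 C2 where C: "C1 \<ge> 0" "\<forall>i\<in>I. \<forall>x\<in>U i. f i differentiable (at x) \<and> \<bar>f i x\<bar> \<le> C1 * d i powr \<gamma>"
     "C2 \<ge> 0" "\<forall>i\<in>J. \<forall>x\<in>U i. f i differentiable (at x) \<and> \<bar>f i x\<bar> \<le> C2 * d i powr \<gamma>"
    unfolding Holder_class.simps by blast
  have le: "t \<le> (C1 + C2) * a" if "a \<ge> 0" "t \<le> C1 * a \<or> t \<le> C2 * a" for a t
    using that C(1,3) mult_nonneg_nonneg[OF C(1), of a] mult_nonneg_nonneg[OF C(3), of a]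
    unfolding distrib_right by linarith
  have "f i differentiable (at x) \<and> \<bar>f i x\<bar> \<le> (C1 + C2) * d i powr \<gamma>" if "i \<in> I \<union> J" "x \<in> U i" for i x
    using that C by (intro conjI le) auto
  moreover have "Holder_class (I \<union> J) U d \<beta> k \<gamma> \<tau> (\<lambda>i. partial v (f i))" if "v \<in> Basis" for v
    using Suc.IH[of "\<lambda>i. partial v (f i)"] Suc.prems that by auto
  ultimately show ?case using C(1,3) unfolding Holder_class.simps by (meson add_nonneg_nonneg)
qed

section \<open>Differentiation under the integral sign\<close>

lemma has_derivative_integral_dominated:
  fixes f :: "'s \<Rightarrow> 'a::euclidean_space \<Rightarrow> real"
  assumes U: "open U" "convex U" "x \<in> U"
    and diff: "\<And>s y. s \<in> space M \<Longrightarrow> y \<in> U \<Longrightarrow> f s differentiable (at y)"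
    and bound: "\<And>s y v. s \<in> space M \<Longrightarrow> y \<in> U \<Longrightarrow> v \<in> Basis \<Longrightarrow> \<bar>partial v (f s) y\<bar> \<le> g s"
    and g: "integrable M g" and f: "\<And>y. y \<in> U \<Longrightarrow> integrable M (\<lambda>s. f s y)"
  shows borel_measurable_partial: "\<And>v. (\<lambda>s. partial v (f s) x) \<in> borel_measurable M"
    and "((\<lambda>y. \<integral>s. f s y \<partial>M) has_derivative (\<lambda>h. \<Sum>v\<in>Basis. (h \<bullet> v) * (\<integral>s. partial v (f s) x \<partial>M))) (at x)"
proof -
  obtain e where e: "e > 0" "ball x e \<subseteq> U" using U open_contains_ball by blast
  have der: "(f s has_derivative frechet_derivative (f s) (at x)) (at x)" if "s \<in> space M" for s
    using diff[OF that U(3)] frechet_derivative_works by blast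
  show meas: "(\<lambda>s. partial v (f s) x) \<in> borel_measurable M" for v
  proof -
    \<comment> \<open>Measurability of the partial derivative: it is a limit of difference quotients
      along steps \<open>h n\<close>. The 1 in c avoids a division by zero, and the 2 in
      \<open>real n + 2\<close> keeps \<open>x + h n v\<close> strictly inside the ball of radius e
      around x.\<close>
    define c where "c = 1 + norm v"
    have c: "c > 0" using norm_ge_zero[of v] unfolding c_def by linarith
    define h where "h = (\<lambda>n::nat. e / c / (real n + 2))"
    have h0: "h n > 0" for n
      using e(1) c by (simp add: h_def)
    have hlim: "h \<longlonglongrightarrow> 0"
      using tendsto_mult_right_zero[OF LIMSEQ_Suc[OF LIMSEQ_inverse_real_of_nat], of "e / c"]
      unfolding h_def by (simp add: divide_inverse add.commute)
    have inU: "x + h n *\<^sub>R v \<in> U" for n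
    proof -
      have "h n * norm v \<le> h n * c" using h0[of n] by (intro mult_left_mono) (auto simp: c_def)
      also have "\<dots> = e / (real n + 2)"
        using c by (simp add: h_def)
      also have "\<dots> < e" using e(1) by (simp add: field_simps add_pos_nonneg)
      finally have "x + h n *\<^sub>R v \<in> ball x e" using h0[of n] by (simp add: dist_norm)
      then show ?thesis using e(2) by blast
    qed
    show ?thesis
    proof (rule borel_measurable_LIMSEQ_real)
      fix s assume s: "s \<in> space M"
      have "((\<lambda>t. f s (x + t *\<^sub>R v)) has_derivative (\<lambda>t. frechet_derivative (f s) (at x) (t *\<^sub>R v))) (at 0)"
        by (rule has_derivative_compose[of "\<lambda>t. x + t *\<^sub>R v", simplified])
           (use der[OF s] in \<open>auto intro!: derivative_eq_intros\<close>)
      moreover have "(\<lambda>t. frechet_derivative (f s) (at x) (t *\<^sub>R v)) = (*) (partial v (f s) x)"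
        using linear_scale[OF has_derivative_linear[OF der[OF s]]] by (simp add: fun_eq_iff mult.commute)
      ultimately have "((\<lambda>t. f s (x + t *\<^sub>R v)) has_real_derivative partial v (f s) x) (at 0)"
        unfolding has_field_derivative_def by metis
      then have "((\<lambda>t. (f s (x + t *\<^sub>R v) - f s x) / t) \<longlongrightarrow> partial v (f s) x) (at 0)"
        by (simp add: DERIV_def)
      moreover have "filterlim h (at 0) sequentially"
        unfolding filterlim_at using hlim h0 by (auto intro!: always_eventually simp: less_imp_neq[symmetric])
      ultimately show "(\<lambda>n. (f s (x + h n *\<^sub>R v) - f s x) / h n) \<longlonglongrightarrow> partial v (f s) x"
        by (rule filterlim_compose)
    next
      show "(\<lambda>s. (f s (x + h n *\<^sub>R v) - f s x) / h n) \<in> borel_measurable M" for n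
        using f[OF inU] f[OF U(3)] by (intro borel_measurable_divide borel_measurable_diff) auto
    qed
  qed
  have gpos: "g s \<ge> 0" if "s \<in> space M" for s
    using bound[OF that U(3)] nonempty_Basis by (meson abs_ge_zero all_not_in_conv order_trans)
  have pint: "integrable M (\<lambda>s. partial v (f s) x)" if "v \<in> Basis" for v
    by (rule Bochner_Integration.integrable_bound[OF g meas])
       (use bound U(3) that gpos in \<open>auto intro!: AE_I2\<close>)
  let ?D = "\<lambda>h. \<Sum>v\<in>Basis. (h \<bullet> v) * (\<integral>s. partial v (f s) x \<partial>M)"
  have D: "?D h = (\<integral>s. frechet_derivative (f s) (at x) h \<partial>M)"
    and Dint: "integrable M (\<lambda>s. frechet_derivative (f s) (at x) h)" for h
  proof -
    have eq: "frechet_derivative (f s) (at x) h = (\<Sum>v\<in>Basis. (h \<bullet> v) * partial v (f s) x)"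
      if "s \<in> space M" for s using frechet_derivative_expand[OF diff[OF that U(3)]] .
    have "integrable M (\<lambda>s. \<Sum>v\<in>Basis. (h \<bullet> v) * partial v (f s) x)"
      using pint by auto
    then show "integrable M (\<lambda>s. frechet_derivative (f s) (at x) h)"
      using eq by (subst Bochner_Integration.integrable_cong[OF refl eq]) auto
    have "(\<integral>s. frechet_derivative (f s) (at x) h \<partial>M) = (\<integral>s. (\<Sum>v\<in>Basis. (h \<bullet> v) * partial v (f s) x) \<partial>M)"
      using eq by (intro Bochner_Integration.integral_cong) auto
    also have "\<dots> = ?D h" using pint by simp
    finally show "?D h = (\<integral>s. frechet_derivative (f s) (at x) h \<partial>M)" by simp
  qed
  show "((\<lambda>y. \<integral>s. f s y \<partial>M) has_derivative ?D) (at x)"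
    unfolding has_derivative_iff_norm
  proof
    show "bounded_linear ?D"
      by (intro bounded_linear_sum bounded_linear_mult_left bounded_linear_compose[OF bounded_linear_mult_left bounded_linear_inner_left])
    let ?Q = "\<lambda>s y. norm (f s y - f s x - frechet_derivative (f s) (at x) (y - x)) / norm (y - x)"
    show "((\<lambda>y. norm ((\<integral>s. f s y \<partial>M) - (\<integral>s. f s x \<partial>M) - ?D (y - x)) / norm (y - x)) \<longlongrightarrow> 0) (at x)"
      unfolding tendsto_at_iff_sequentially
    proof (intro allI impI)
      fix X :: "nat \<Rightarrow> 'a" assume X: "\<forall>i. X i \<in> UNIV - {x}" "X \<longlonglongrightarrow> x"
      then have "\<forall>\<^sub>F n in sequentially. X n \<in> U" using U X(2) by (simp add: topological_tendstoD)
      then obtain N where N: "\<And>n. n \<ge> N \<Longrightarrow> X n \<in> U" by (auto simp: eventually_sequentially)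
      let ?Y = "\<lambda>n. X (n + N)"
      have YU: "?Y n \<in> U" and Yx: "?Y n \<noteq> x" for n using N X by auto
      have Ylim: "?Y \<longlonglongrightarrow> x" using X(2) by (rule LIMSEQ_ignore_initial_segment)
      have Qint: "integrable M (\<lambda>s. f s (?Y n) - f s x - frechet_derivative (f s) (at x) (?Y n - x))" for n
        by (intro Bochner_Integration.integrable_diff f YU U(3) Dint)
      have "(\<lambda>n. \<integral>s. ?Q s (?Y n) \<partial>M) \<longlonglongrightarrow> (\<integral>s. 0 \<partial>M)"
      proof (rule integral_dominated_convergence[where w="\<lambda>s. 2 * real DIM('a) * g s"])
        show "(\<lambda>s. ?Q s (?Y n)) \<in> borel_measurable M" for n
          using Qint[of n] by (intro borel_measurable_divide borel_measurable_norm) auto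
        show "AE s in M. (\<lambda>n. ?Q s (?Y n)) \<longlonglongrightarrow> 0"
        proof (rule AE_I2)
          fix s assume "s \<in> space M"
          then have "((\<lambda>y. ?Q s y) \<longlongrightarrow> 0) (at x)" using der unfolding has_derivative_iff_norm by blast
          then show "(\<lambda>n. ?Q s (?Y n)) \<longlonglongrightarrow> 0"
            using Ylim Yx unfolding tendsto_at_iff_sequentially by (auto simp: o_def)
        qed
        \<comment> \<open>The factor 2 counts the increment of f and its linear part, each bounded
          by \<open>real DIM('a) * g s\<close> times the distance.\<close>
        show "AE s in M. norm (?Q s (?Y n)) \<le> 2 * real DIM('a) * g s" for n
        proof (rule AE_I2)
          fix s assume s: "s \<in> space M"
          have "\<bar>f s (?Y n) - f s x\<bar> \<le> (real DIM('a) * g s) * dist (?Y n) x"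
            using diff[OF s] bound[OF s] by (intro lipschitz_from_partials[OF U(2)] YU U(3)) auto
          moreover have "\<bar>frechet_derivative (f s) (at x) (?Y n - x)\<bar> \<le> (real DIM('a) * g s) * dist (?Y n) x"
          proof -
            have "\<bar>frechet_derivative (f s) (at x) (?Y n - x)\<bar> \<le> (\<Sum>v\<in>Basis. \<bar>((?Y n - x) \<bullet> v) * partial v (f s) x\<bar>)"
              using sum_abs by (subst frechet_derivative_expand[OF diff[OF s U(3)], of "?Y n - x"])
            also have "\<dots> \<le> (\<Sum>v\<in>(Basis::'a set). dist (?Y n) x * g s)"
              using bound[OF s U(3)] gpos[OF s]
              by (intro sum_mono) (auto simp: abs_mult dist_norm intro!: mult_mono Basis_le_norm)
            finally show ?thesis by (simp add: mult_ac)
          qed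
          ultimately have "norm (f s (?Y n) - f s x - frechet_derivative (f s) (at x) (?Y n - x))
            \<le> (2 * real DIM('a) * g s) * norm (?Y n - x)"
            unfolding dist_norm real_norm_def by linarith
          then show "norm (?Q s (?Y n)) \<le> 2 * real DIM('a) * g s"
            using Yx[of n] by (simp add: divide_le_eq)
        qed
      qed (use g in auto)
      then have lim0: "(\<lambda>n. \<integral>s. ?Q s (?Y n) \<partial>M) \<longlonglongrightarrow> 0" by simp
      have le: "norm (norm ((\<integral>s. f s (?Y n) \<partial>M) - (\<integral>s. f s x \<partial>M) - ?D (?Y n - x)) / norm (?Y n - x))
         \<le> (\<integral>s. ?Q s (?Y n) \<partial>M)" for n
      proof -
        have "(\<integral>s. f s (?Y n) \<partial>M) - (\<integral>s. f s x \<partial>M) - ?D (?Y n - x)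
           = (\<integral>s. f s (?Y n) - f s x - frechet_derivative (f s) (at x) (?Y n - x) \<partial>M)"
          unfolding D using f[OF YU] f[OF U(3)] Dint by (simp add: Bochner_Integration.integral_diff)
        then have "norm ((\<integral>s. f s (?Y n) \<partial>M) - (\<integral>s. f s x \<partial>M) - ?D (?Y n - x))
           \<le> (\<integral>s. norm (f s (?Y n) - f s x - frechet_derivative (f s) (at x) (?Y n - x)) \<partial>M)"
          by simp
        then show ?thesis by (simp add: divide_right_mono)
      qed
      have "(\<lambda>n. norm ((\<integral>s. f s (?Y n) \<partial>M) - (\<integral>s. f s x \<partial>M) - ?D (?Y n - x)) / norm (?Y n - x)) \<longlonglongrightarrow> 0"
        using le by (intro Lim_null_comparison[OF _ lim0] always_eventually) blast
      then show "((\<lambda>y. norm ((\<integral>s. f s y \<partial>M) - (\<integral>s. f s x \<partial>M) - ?D (y - x)) / norm (y - x)) \<circ> X) \<longlonglongrightarrow> 0"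
        unfolding o_def by (rule LIMSEQ_offset)
    qed
  qed
qed

text \<open>Differentiation under the integral carries the class over: a derivative below the top
  order, a top derivative and a Hoelder quotient are dominated by the weight with exponents
  \<gamma>, \<gamma> - \<tau> and \<gamma> - \<tau> - \<beta>, so bounds for these three integrals
  suffice. The weight \<open>d'\<close> of the result is free: it is 1 when the singularity is
  integrated out, and it stays the old weight when only an auxiliary parameter is
  integrated.\<close>

theorem Holder_class_integral:
  fixes I :: "'i set" and U :: "'i \<Rightarrow> 'a::euclidean_space set" and M :: "'i \<Rightarrow> 's measure"
    and f :: "'i \<times> 's \<Rightarrow> 'a \<Rightarrow> real"
  defines "J \<equiv> Sigma I (\<lambda>i. space (M i))"
  assumes wf: "weighted_family J (\<lambda>(i, s). U i) d D \<beta>"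
    and wfi: "weighted_family I U d' D' \<beta>"
    and f: "Holder_class J (\<lambda>(i, s). U i) d \<beta> k \<gamma> \<tau> f"
    and meas: "\<And>i x. i \<in> I \<Longrightarrow> x \<in> U i \<Longrightarrow> (\<lambda>s. f (i, s) x) \<in> borel_measurable (M i)"
    and K: "0 \<le> K" "\<And>i p. i \<in> I \<Longrightarrow> p \<in> {\<gamma>, \<gamma> - \<tau>, \<gamma> - \<tau> - \<beta>} \<Longrightarrow>
        integrable (M i) (\<lambda>s. d (i, s) powr p) \<and> (\<integral>s. d (i, s) powr p \<partial>M i) \<le> K * d' i powr p"
  shows "Holder_class I U d' \<beta> k \<gamma> \<tau> (\<lambda>i x. \<integral>s. f (i, s) x \<partial>M i)"
    and "\<And>i x. i \<in> I \<Longrightarrow> x \<in> U i \<Longrightarrow> integrable (M i) (\<lambda>s. f (i, s) x)"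
proof -
  interpret J: weighted_family J "\<lambda>(i, s). U i" d D \<beta> by fact
  interpret I: weighted_family I U d' D' \<beta> by fact
  have inJ: "(i, s) \<in> J" if "i \<in> I" "s \<in> space (M i)" for i s using that by (auto simp: J_def)
  have int: "integrable (M i) (\<lambda>s. h s)"
    and bd: "\<bar>\<integral>s. h s \<partial>M i\<bar> \<le> (C * K) * d' i powr p"
    if "i \<in> I" "C \<ge> 0" "p \<in> {\<gamma>, \<gamma> - \<tau>, \<gamma> - \<tau> - \<beta>}" "h \<in> borel_measurable (M i)"
      "\<And>s. s \<in> space (M i) \<Longrightarrow> \<bar>h s\<bar> \<le> C * d (i, s) powr p" for i C p and h :: "'s \<Rightarrow> real"
  proof -
    show int: "integrable (M i) (\<lambda>s. h s)"
      by (rule Bochner_Integration.integrable_bound[of _ "\<lambda>s. C * d (i, s) powr p"])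
         (use that K in \<open>auto intro!: AE_I2 simp: abs_mult\<close>)
    have "\<bar>\<integral>s. h s \<partial>M i\<bar> \<le> (\<integral>s. \<bar>h s\<bar> \<partial>M i)" using integral_norm_bound[of "M i" h] by simp
    also have "\<dots> \<le> (\<integral>s. C * d (i, s) powr p \<partial>M i)"
      using int that K(2)[OF that(1,3)] by (intro integral_mono) auto
    also have "\<dots> = C * (\<integral>s. d (i, s) powr p \<partial>M i)" by simp
    also have "\<dots> \<le> C * (K * d' i powr p)" using K(2)[OF that(1,3)] that(2) by (intro mult_left_mono) auto
    finally show "\<bar>\<integral>s. h s \<partial>M i\<bar> \<le> (C * K) * d' i powr p" by (simp add: mult_ac)
  qed
  have "(\<forall>i\<in>I. \<forall>x\<in>U i. integrable (M i) (\<lambda>s. f (i, s) x)) \<and>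
     Holder_class I U d' \<beta> k \<gamma> \<tau> (\<lambda>i x. \<integral>s. f (i, s) x \<partial>M i)"
    using f meas
  proof (induction k arbitrary: f)
    case 0
    then obtain C where "C \<ge> 0" and C': "\<forall>j\<in>J. continuous_on (case j of (i, s) \<Rightarrow> U i) (f j) \<and>
        (\<forall>x\<in>(case j of (i, s) \<Rightarrow> U i). \<bar>f j x\<bar> \<le> C * d j powr (\<gamma> - \<tau>)) \<and>
        (\<forall>x\<in>(case j of (i, s) \<Rightarrow> U i). \<forall>y\<in>(case j of (i, s) \<Rightarrow> U i).
           \<bar>f j x - f j y\<bar> \<le> C * d j powr (\<gamma> - \<tau> - \<beta>) * dist x y powr \<beta>)"
      unfolding Holder_class.simps by blast
    have C: "C \<ge> 0"
      "\<And>i s. i \<in> I \<Longrightarrow> s \<in> space (M i) \<Longrightarrow> continuous_on (U i) (f (i, s))"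
      "\<And>i s x. i \<in> I \<Longrightarrow> s \<in> space (M i) \<Longrightarrow> x \<in> U i \<Longrightarrow> \<bar>f (i, s) x\<bar> \<le> C * d (i, s) powr (\<gamma> - \<tau>)"
      "\<And>i s x y. i \<in> I \<Longrightarrow> s \<in> space (M i) \<Longrightarrow> x \<in> U i \<Longrightarrow> y \<in> U i \<Longrightarrow>
         \<bar>f (i, s) x - f (i, s) y\<bar> \<le> C * d (i, s) powr (\<gamma> - \<tau> - \<beta>) * dist x y powr \<beta>"
      using \<open>C \<ge> 0\<close> C'[rule_format, OF inJ] by auto
    have fint: "integrable (M i) (\<lambda>s. f (i, s) x)" if "i \<in> I" "x \<in> U i" for i x
      using int[OF that(1) C(1), of "\<gamma> - \<tau>"] 0(2)[OF that] C(3)[OF that(1) _ that(2)] by blast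
    have "\<bar>\<integral>s. f (i, s) x \<partial>M i\<bar> \<le> (C * K) * d' i powr (\<gamma> - \<tau>)" if "i \<in> I" "x \<in> U i" for i x
      using bd[OF that(1) C(1), of "\<gamma> - \<tau>"] 0(2)[OF that] C(3)[OF that(1) _ that(2)] by blast
    moreover have "\<bar>(\<integral>s. f (i, s) x \<partial>M i) - (\<integral>s. f (i, s) y \<partial>M i)\<bar>
        \<le> (C * K) * d' i powr (\<gamma> - \<tau> - \<beta>) * dist x y powr \<beta>" if i: "i \<in> I" and xy: "x \<in> U i" "y \<in> U i" for i x y
    proof -
      have "\<bar>\<integral>s. f (i, s) x - f (i, s) y \<partial>M i\<bar> \<le> ((C * dist x y powr \<beta>) * K) * d' i powr (\<gamma> - \<tau> - \<beta>)"
        using C(4)[OF i _ xy] C(1) 0(2)[OF i] xy by (intro bd[OF i]) (auto simp: mult_ac)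
      then show ?thesis using fint[OF i] xy by (simp add: Bochner_Integration.integral_diff mult_ac)
    qed
    moreover have "continuous_on (U i) (\<lambda>x. \<integral>s. f (i, s) x \<partial>M i)" if i: "i \<in> I" for i
      unfolding continuous_on_sequentially o_def
    proof (intro allI ballI impI)
      fix X x assume x: "x \<in> U i" and X: "(\<forall>n. X n \<in> U i) \<and> X \<longlonglongrightarrow> x"
      show "(\<lambda>n. \<integral>s. f (i, s) (X n) \<partial>M i) \<longlonglongrightarrow> (\<integral>s. f (i, s) x \<partial>M i)"
      proof (rule integral_dominated_convergence[where w="\<lambda>s. C * d (i, s) powr (\<gamma> - \<tau>)"])
        show "AE s in M i. (\<lambda>n. f (i, s) (X n)) \<longlonglongrightarrow> f (i, s) x"
          using C(2)[OF i] X x unfolding continuous_on_sequentially o_def by (auto intro!: AE_I2)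
        show "AE s in M i. norm (f (i, s) (X n)) \<le> C * d (i, s) powr (\<gamma> - \<tau>)" for n
          using C(3)[OF i] X by (auto intro!: AE_I2)
      qed (use 0(2)[OF i] x X K(2)[OF i] in auto)
    qed
    ultimately show ?case using fint C(1) K(1) unfolding Holder_class.simps
      by (intro conjI ballI exI[of _ "C * K"]) auto
  next
    case (Suc k)
    obtain C where C: "C \<ge> 0" "\<And>j x. j \<in> J \<Longrightarrow> x \<in> (case j of (i, s) \<Rightarrow> U i) \<Longrightarrow> \<bar>f j x\<bar> \<le> C * d j powr \<gamma>"
      "\<And>j x. j \<in> J \<Longrightarrow> x \<in> (case j of (i, s) \<Rightarrow> U i) \<Longrightarrow> (f j has_derivative frechet_derivative (f j) (at x)) (at x)"
      "\<And>v. v \<in> Basis \<Longrightarrow> J.W k \<gamma> \<tau> (\<lambda>i. partial v (f i))"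
      using J.W_SucD[OF Suc.prems(1)] by blast
    obtain B where B: "B \<ge> 0" "\<And>j x v. j \<in> J \<Longrightarrow> x \<in> (case j of (i, s) \<Rightarrow> U i) \<Longrightarrow> v \<in> Basis \<Longrightarrow>
      \<bar>partial v (f j) x\<bar> \<le> B * d j powr (case k of 0 \<Rightarrow> \<gamma> - \<tau> | Suc _ \<Rightarrow> \<gamma>)"
      using J.partials_bound[OF Suc.prems(1)] by blast
    \<comment> \<open>The dominating function for the first derivatives: for k = 0 they are top
      derivatives and carry the loss.\<close>
    let ?p = "case k of 0 \<Rightarrow> \<gamma> - \<tau> | Suc _ \<Rightarrow> \<gamma>"
    have p: "?p \<in> {\<gamma>, \<gamma> - \<tau>, \<gamma> - \<tau> - \<beta>}" by (cases k) auto
    have fint: "integrable (M i) (\<lambda>s. f (i, s) x)" if "i \<in> I" "x \<in> U i" for i x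
      by (rule int[OF that(1) C(1), of \<gamma>]) (use Suc.prems(2)[OF that] C(2)[OF inJ[OF that(1)]] that(2) in auto)
    have diff: "f (i, s) differentiable (at x)" if "i \<in> I" "s \<in> space (M i)" "x \<in> U i" for i s x
      using C(3)[OF inJ[OF that(1,2)]] that(3) differentiable_def by blast
    have gint: "integrable (M i) (\<lambda>s. B * d (i, s) powr ?p)" if "i \<in> I" for i
      using K(2)[OF that p] by auto
    note der = has_derivative_integral_dominated[OF I.open_U I.convex_U _ diff _ gint fint]
    have measp: "(\<lambda>s. partial v (f (i, s)) x) \<in> borel_measurable (M i)" if "i \<in> I" "x \<in> U i" for v i x
      by (rule der(1)[of i x]) (use that B(2)[OF inJ] in auto)
    have deri: "((\<lambda>y. \<integral>s. f (i, s) y \<partial>M i) has_derivative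
        (\<lambda>h. \<Sum>v\<in>Basis. (h \<bullet> v) * (\<integral>s. partial v (f (i, s)) x \<partial>M i))) (at x)"
      if "i \<in> I" "x \<in> U i" for i x
      by (rule der(2)[of i x]) (use that B(2)[OF inJ] in auto)
    have "I.W (Suc k) \<gamma> \<tau> (\<lambda>i x. \<integral>s. f (i, s) x \<partial>M i)"
    proof (rule I.W_SucI)
      show "0 \<le> C * K" using C K by simp
      show "\<bar>\<integral>s. f (i, s) x \<partial>M i\<bar> \<le> (C * K) * d' i powr \<gamma>" if "i \<in> I" "x \<in> U i" for i x
        by (rule bd[OF that(1) C(1), of \<gamma>]) (use Suc.prems(2)[OF that] C(2)[OF inJ[OF that(1)]] that(2) in auto)
      fix v :: 'a assume v: "v \<in> Basis"
      have eq: "(\<Sum>w\<in>Basis. (v \<bullet> w) * t w) = t v" for t :: "'a \<Rightarrow> real"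
      proof -
        have "(\<Sum>w\<in>Basis. (v \<bullet> w) * t w) = (\<Sum>w\<in>Basis. if w = v then t w else 0)"
          using v by (intro sum.cong) (auto simp: inner_Basis)
        then show ?thesis using v by simp
      qed
      show "I.W k \<gamma> \<tau> (\<lambda>i x. \<Sum>w\<in>Basis. (v \<bullet> w) * (\<integral>s. partial w (f (i, s)) x \<partial>M i))"
        unfolding eq using Suc.IH[OF C(4)[OF v] measp] by blast
    qed (use deri in auto)
    then show ?case using fint by blast
  qed
  then show "I.W k \<gamma> \<tau> (\<lambda>i x. \<integral>s. f (i, s) x \<partial>M i)"
    and "\<And>i x. i \<in> I \<Longrightarrow> x \<in> U i \<Longrightarrow> integrable (M i) (\<lambda>s. f (i, s) x)" by auto
qed

section \<open>Composition with a smooth family of reflections\<close>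

text \<open>The reflection that exchanges the unit vectors \<open>e\<close> and \<open>x / |x|\<close>.\<close>

definition swap :: "'a::euclidean_space \<Rightarrow> 'a \<Rightarrow> 'a \<Rightarrow> 'a" where
  "swap e x p = p - (2 * (p \<bullet> (sgn x - e)) / ((sgn x - e) \<bullet> (sgn x - e))) *\<^sub>R (sgn x - e)"

lemma swap_add: "swap e x (p + p') = swap e x p + swap e x p'"
proof -
  define m where "m = sgn x - e"
  show ?thesis
    unfolding swap_def m_def[symmetric]
    by (simp add: inner_add_left distrib_left add_divide_distrib scaleR_add_left)
qed

lemma swap_scaleR: "swap e x (c *\<^sub>R p) = c *\<^sub>R swap e x p"
  by (simp add: swap_def scaleR_diff_right mult.left_commute)

lemma swap_diff: "swap e x p - swap e x p' = swap e x (p - p')"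
  using swap_add[of e x "p - p'" p'] by simp

text \<open>For sgn x = e the vector sgn x - e vanishes and division by zero turns
  \<open>swap\<close> into the identity, which is an isometry as well; hence no condition on
  x.\<close>

lemma inner_swap: "swap e x p \<bullet> swap e x p' = p \<bullet> p'"
proof (cases "sgn x = e")
  case False
  define m where "m = sgn x - e"
  have "m \<bullet> m \<noteq> 0" using False by (simp add: m_def)
  then show ?thesis
    unfolding swap_def m_def[symmetric]
    by (simp add: inner_diff_left inner_diff_right inner_commute field_simps)
qed (simp add: swap_def)

lemma norm_swap [simp]: "norm (swap e x p) = norm p"
  by (simp add: norm_eq_sqrt_inner inner_swap)

lemma swap_swap [simp]: "swap e x (swap e x p) = p"
proof (cases "sgn x = e")
  case False
  define m where "m = sgn x - e"
  have m: "m \<bullet> m \<noteq> 0" using False by (simp add: m_def)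
  have "swap e x p \<bullet> m = - (p \<bullet> m)"
    unfolding swap_def m_def[symmetric] using m by (simp add: inner_diff_left field_simps)
  then have "swap e x (swap e x p) = swap e x p + (2 * (p \<bullet> m) / (m \<bullet> m)) *\<^sub>R m"
    unfolding swap_def[of e x "swap e x p"] m_def[symmetric] by simp
  then show ?thesis unfolding swap_def m_def[symmetric] by simp
qed (simp add: swap_def)

text \<open>Equal lengths of sgn x and e give 2 (e . m) = - (m . m) for m = sgn x - e, so the
  reflection adds exactly m to e.\<close>

lemma swap_base:
  assumes "norm e = 1" "x \<noteq> 0" "sgn x \<noteq> e"
  shows "swap e x e = sgn x"
proof -
  define m where "m = sgn x - e"
  have n: "sgn x \<bullet> sgn x = 1" "e \<bullet> e = 1"
    using assms by (simp_all add: dot_square_norm norm_sgn)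
  have m: "m \<bullet> m \<noteq> 0" using assms by (simp add: m_def)
  have "2 * (e \<bullet> m) = - (m \<bullet> m)"
    using n unfolding m_def by (simp add: inner_diff_left inner_diff_right inner_commute)
  then have "swap e x e = e + m"
    unfolding swap_def m_def[symmetric] using m by simp
  then show ?thesis by (simp add: m_def)
qed

lemma sgn_swap: "sgn (swap e x p) = swap e x (sgn p)"
  by (simp add: sgn_div_norm swap_scaleR)

text \<open>Bounds on the shell 1/4 \<le> |x| \<le> 1 with one constant for all indices. The
  arguments used later have norm between 1/2 and 1; the larger shell leaves room for segments
  between nearby points.\<close>

definition smooth_family :: "'i set \<Rightarrow> nat \<Rightarrow> real \<Rightarrow> ('i \<Rightarrow> 'a::euclidean_space \<Rightarrow> real) \<Rightarrow> bool" where
  "smooth_family I k \<alpha> h \<longleftrightarrow> (\<exists>C\<ge>0. \<forall>i\<in>I. Ck_on k (- {0}) (h i) \<and>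
     (\<forall>j\<le>k. \<forall>vs\<in>multi_indices j. \<forall>x\<in>cball 0 1 - ball 0 (1/4). \<bar>iter_deriv vs (h i) x\<bar> \<le> C) \<and>
     (\<forall>vs\<in>multi_indices k. \<forall>x\<in>cball 0 1 - ball 0 (1/4). \<forall>y\<in>cball 0 1 - ball 0 (1/4).
        \<bar>iter_deriv vs (h i) x - iter_deriv vs (h i) y\<bar> \<le> C * dist x y powr \<alpha>))"

lemma iter_deriv_append: "iter_deriv (vs @ [v]) f = iter_deriv vs (partial v f)"
  by (induction vs) auto

lemma snoc_multi_indices: "v \<in> Basis \<Longrightarrow> vs \<in> multi_indices j \<Longrightarrow> vs @ [v] \<in> multi_indices (Suc j)"
  by (auto simp: multi_indices_def)

lemma Nil_multi_indices [simp]: "[] \<in> multi_indices j \<longleftrightarrow> j = 0"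
  by (auto simp: multi_indices_def)

lemma smooth_family_Suc:
  assumes "smooth_family I (Suc k) \<alpha> h"
  shows "v \<in> Basis \<Longrightarrow> smooth_family I k \<alpha> (\<lambda>i. partial v (h i))"
    and "i \<in> I \<Longrightarrow> x \<noteq> 0 \<Longrightarrow> h i differentiable (at x)"
    and "\<exists>C\<ge>0. \<forall>i\<in>I. \<forall>x\<in>cball 0 1 - ball 0 (1/4). \<bar>h i x\<bar> \<le> C \<and> (\<forall>v\<in>Basis. \<bar>partial v (h i) x\<bar> \<le> C)"
proof -
  obtain C where C: "C \<ge> 0" "\<And>i. i \<in> I \<Longrightarrow> Ck_on (Suc k) (- {0}) (h i)"
     "\<And>i j vs x. i \<in> I \<Longrightarrow> j \<le> Suc k \<Longrightarrow> vs \<in> multi_indices j \<Longrightarrow> x \<in> cball 0 1 - ball 0 (1/4) \<Longrightarrow> \<bar>iter_deriv vs (h i) x\<bar> \<le> C"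
     "\<And>i vs x y. i \<in> I \<Longrightarrow> vs \<in> multi_indices (Suc k) \<Longrightarrow> x \<in> cball 0 1 - ball 0 (1/4) \<Longrightarrow> y \<in> cball 0 1 - ball 0 (1/4) \<Longrightarrow>
        \<bar>iter_deriv vs (h i) x - iter_deriv vs (h i) y\<bar> \<le> C * dist x y powr \<alpha>"
    using assms unfolding smooth_family_def by blast
  show "smooth_family I k \<alpha> (\<lambda>i. partial v (h i))" if v: "v \<in> Basis"
    unfolding smooth_family_def
  proof (intro exI[of _ C] conjI ballI allI impI C(1))
    fix i assume i: "i \<in> I"
    show "Ck_on k (- {0}) (partial v (h i))"
      unfolding Ck_on_def
    proof (intro conjI allI impI ballI)
      fix j and vs :: "'b list" and x :: 'b assume "j < k" "vs \<in> multi_indices j" "x \<in> - {0}"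
      then show "iter_deriv vs (partial v (h i)) differentiable at x"
        using C(2)[OF i] snoc_multi_indices[OF v] unfolding Ck_on_def iter_deriv_append[symmetric]
        by (meson Suc_less_eq)
    next
      fix j and vs :: "'b list" assume "j \<le> k" "vs \<in> multi_indices j"
      then show "continuous_on (- {0}) (iter_deriv vs (partial v (h i)))"
        using C(2)[OF i] snoc_multi_indices[OF v] unfolding Ck_on_def iter_deriv_append[symmetric]
        by (meson Suc_le_mono)
    qed
    show "\<bar>iter_deriv vs (partial v (h i)) x\<bar> \<le> C"
      if "j \<le> k" "vs \<in> multi_indices j" "x \<in> cball 0 1 - ball 0 (1/4)" for j vs x
      using C(3)[OF i, of "Suc j" "vs @ [v]" x] snoc_multi_indices[OF v] that
      by (simp add: iter_deriv_append)
    show "\<bar>iter_deriv vs (partial v (h i)) x - iter_deriv vs (partial v (h i)) y\<bar> \<le> C * dist x y powr \<alpha>"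
      if "vs \<in> multi_indices k" "x \<in> cball 0 1 - ball 0 (1/4)" "y \<in> cball 0 1 - ball 0 (1/4)" for vs x y
      using C(4)[OF i, of "vs @ [v]" x y] snoc_multi_indices[OF v] that
      by (simp add: iter_deriv_append)
  qed
  show "h i differentiable (at x)" if "i \<in> I" "x \<noteq> 0"
    using C(2)[OF that(1)] that(2) unfolding Ck_on_def
    by (auto dest!: spec[of _ 0] bspec[of _ _ "[]"])
  show "\<exists>C\<ge>0. \<forall>i\<in>I. \<forall>x\<in>cball 0 1 - ball 0 (1/4). \<bar>h i x\<bar> \<le> C \<and> (\<forall>v\<in>Basis. \<bar>partial v (h i) x\<bar> \<le> C)"
  proof (intro exI[of _ C] conjI ballI C(1))
    show "\<bar>h i x\<bar> \<le> C" if "i \<in> I" "x \<in> cball 0 1 - ball 0 (1/4)" for i x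
      using C(3)[OF that(1), of 0 "[]" x] that by simp
    show "\<bar>partial v (h i) x\<bar> \<le> C" if "i \<in> I" "x \<in> cball 0 1 - ball 0 (1/4)" "v \<in> Basis" for i x v
      using C(3)[OF that(1), of 1 "[v]" x] that by (simp add: multi_indices_def)
  qed
qed

text \<open>A shell is not convex. Points at distance less than 1/4 are joined by a segment inside
  the larger shell; for the others the trivial bound 2 B is at most 8 B times the distance.\<close>

lemma shell_lipschitz:
  fixes f :: "'a::euclidean_space \<Rightarrow> real"
  assumes "\<And>x. x \<noteq> 0 \<Longrightarrow> f differentiable (at x)"
    and B: "B \<ge> 0" "\<And>x. x \<in> cball 0 1 - ball 0 (1/4) \<Longrightarrow> \<bar>f x\<bar> \<le> B \<and> (\<forall>v\<in>Basis. \<bar>partial v f x\<bar> \<le> B)"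
    and p: "p \<in> cball 0 1 - ball 0 (1/2)" "p' \<in> cball 0 1 - ball 0 (1/2)"
  shows "\<bar>f p - f p'\<bar> \<le> (real DIM('a) + 8) * B * dist p p'"
proof (cases "dist p p' < 1/4")
  case True
  have seg: "z \<in> cball 0 1 - ball 0 (1/4)" if z: "z \<in> closed_segment p p'" for z
  proof -
    have "closed_segment p p' \<subseteq> cball 0 1" using p by (intro closed_segment_subset convex_cball) auto
    moreover have "dist z p \<le> dist p p'" using z by (metis dist_commute dist_in_closed_segment(1))
    moreover have "norm p \<le> norm z + dist z p" by (metis dist_norm norm_minus_commute norm_triangle_sub)
    ultimately show ?thesis using z p True by auto
  qed
  have "\<bar>f p - f p'\<bar> \<le> (real DIM('a) * B) * dist p p'"
  proof (rule lipschitz_from_partials[of "closed_segment p p'"])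
    show "f differentiable (at z)" if "z \<in> closed_segment p p'" for z
      using assms(1)[of z] seg[OF that] by (cases "z = 0") auto
  qed (use B seg in auto)
  also have "\<dots> \<le> (real DIM('a) + 8) * B * dist p p'"
    using B by (intro mult_right_mono) auto
  finally show ?thesis .
next
  case False
  have "p \<in> cball 0 1 - ball 0 (1/4)" "p' \<in> cball 0 1 - ball 0 (1/4)" using p by auto
  then have "\<bar>f p - f p'\<bar> \<le> B + B" using B(2)[of p] B(2)[of p'] by linarith
  also have "\<dots> \<le> 8 * B * dist p p'" using False B mult_left_mono[of "1/4" "dist p p'" "8 * B"] by simp
  also have "\<dots> \<le> (real DIM('a) + 8) * B * dist p p'"
    using B by (intro mult_right_mono) auto
  finally show ?thesis .
qed

text \<open>For x in this ball the inner product of sgn x and e is negative, so the denominator |sgn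
  x - e|^2 = 2 - 2 (sgn x . e) of the reflection exceeds 2.\<close>

locale reflected_family = weighted_family I "\<lambda>i. ball (- e i) (1/2)" d D \<beta>
  for I :: "'i set" and e :: "'i \<Rightarrow> 'a::euclidean_space" and d :: "'i \<Rightarrow> real" and D \<beta> :: real +
  assumes norm_e: "i \<in> I \<Longrightarrow> norm (e i) = 1"
begin

lemma dom:
  assumes "i \<in> I" "x \<in> ball (- e i) (1/2)"
  shows "1/2 < norm x" "norm x < 3/2" "x \<noteq> 0" "x \<bullet> e i < 0" "sgn x \<noteq> e i" "sgn x \<bullet> e i < 0"
proof -
  have n: "norm (x + e i) < 1/2" using assms(2) by (simp add: dist_norm norm_minus_commute add.commute)
  have e: "norm (e i) = 1" using norm_e assms by auto
  show l: "1/2 < norm x" using n e norm_triangle_ineq4[of "x + e i" x] by simp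
  show "norm x < 3/2" using n e norm_triangle_ineq4[of "x + e i" "e i"] by simp
  show "x \<noteq> 0" using l by auto
  have "(x + e i) \<bullet> e i \<le> norm (x + e i) * norm (e i)" by (rule norm_cauchy_schwarz)
  then show i: "x \<bullet> e i < 0" using n e by (simp add: inner_add_left dot_square_norm)
  then show s: "sgn x \<bullet> e i < 0" using \<open>x \<noteq> 0\<close> by (simp add: sgn_div_norm mult_less_0_iff)
  show "sgn x \<noteq> e i" using s by (metis inner_ge_zero not_le)
qed

lemma W_real_const: "W k 0 0 (\<lambda>i x. c)"
  by (rule W_const[of "\<bar>c\<bar>"]) (use d_pos in force)+

lemma W_cmult: "W k \<gamma> \<tau> f \<Longrightarrow> 0 \<le> \<tau> \<Longrightarrow> \<tau> \<le> 1 \<Longrightarrow> W k \<gamma> \<tau> (\<lambda>i x. c * f i x)"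
  using W_mult[of \<tau> k 0 "\<lambda>i x. c" \<gamma> f] W_real_const by simp

lemma W_diff: "W k \<gamma> \<tau> f \<Longrightarrow> W k \<gamma> \<tau> g \<Longrightarrow> 0 \<le> \<tau> \<Longrightarrow> \<tau> \<le> 1 \<Longrightarrow> W k \<gamma> \<tau> (\<lambda>i x. f i x - g i x)"
  using W_add[of k \<gamma> \<tau> f "\<lambda>i x. (-1) * g i x"] W_cmult[of k \<gamma> \<tau> g "-1"] by simp

text \<open>The components are (x . b) (x . x)^(-1/2) with x . x \<ge> 1/4 on the ball, so closure
  under products and powers is enough.\<close>

lemma W_sgn: "W k 0 0 (\<lambda>i x. sgn x \<bullet> b)"
proof -
  have co: "W k 0 0 (\<lambda>i x. x \<bullet> b)" for b
    by (rule W_coord[of "3/2"]) (rule less_imp_le[OF dom(2)])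
  have "W k (0 + 0) 0 (\<lambda>i x. (x \<bullet> b) * (x \<bullet> b))" for b by (intro W_mult co) auto
  then have sq: "W k 0 0 (\<lambda>i x. x \<bullet> x)"
    by (subst euclidean_inner) (auto intro!: W_sum)
  have "W k ((-1/2) * 0) 0 (\<lambda>i x. (x \<bullet> x) powr (-1/2))"
  proof (rule W_powr[of "1/4"])
    fix i x assume i: "i \<in> I" and x: "x \<in> ball (- e i) (1/2)"
    have "(1/2)\<^sup>2 \<le> (norm x)\<^sup>2" using dom[OF i x] by (intro power_mono) auto
    then show "1/4 * d i powr 0 \<le> x \<bullet> x" using d_pos[OF i] by (simp add: power2_norm_eq_inner power_divide)
  qed (use sq in auto)
  then have sp: "W k 0 0 (\<lambda>i x. (x \<bullet> x) powr (-1/2))" by simp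
  have "W k (0 + 0) 0 (\<lambda>i x. (x \<bullet> b) * (x \<bullet> x) powr (-1/2))"
    by (rule W_mult[OF _ _ co sp]) auto
  then have "W k 0 0 (\<lambda>i x. (x \<bullet> b) * (x \<bullet> x) powr (-1/2))" by simp
  then show ?thesis
  proof (rule W_cong[rotated])
    fix i x assume "i \<in> I" "x \<in> ball (- e i) (1/2)"
    then have "x \<noteq> 0" by (rule dom)
    have "(x \<bullet> x) powr (-1/2) = inverse (norm x)"
      by (simp add: powr_minus powr_half_sqrt norm_eq_sqrt_inner)
    then show "(x \<bullet> b) * (x \<bullet> x) powr (-1/2) = sgn x \<bullet> b"
      by (simp add: sgn_div_norm)
  qed
qed

text \<open>The reflection is linear in the reflected vector, so every derivative in x inherits the
  size \<open>d i powr \<gamma>\<close> of \<open>p i\<close>. Applied to a difference p - p' of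
  size d, this yields the gain of one power of the weight.\<close>

lemma W_swap:
  assumes "C \<ge> 0" "\<And>i. i \<in> I \<Longrightarrow> norm (p i) \<le> C * d i powr \<gamma>" "b \<in> Basis"
  shows "W k \<gamma> 0 (\<lambda>i x. swap (e i) x (p i) \<bullet> b)"
proof -
  have pc: "W k \<gamma> 0 (\<lambda>i x. p i \<bullet> b)" if "b \<in> Basis" for b
    by (rule W_const[OF assms(1)]) (use assms(2) that order_trans[OF Basis_le_norm] in blast)
  have ec: "W k 0 0 (\<lambda>i x. e i \<bullet> b)" if "b \<in> Basis" for b
  proof (rule W_const)
    show "\<bar>e i \<bullet> b\<bar> \<le> 1 * d i powr 0" if "i \<in> I" for i
      using Basis_le_norm[OF \<open>b \<in> Basis\<close>, of "e i"] norm_e[OF that] d_pos[OF that] by simp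
  qed simp
  have pe: "W k \<gamma> 0 (\<lambda>i x. p i \<bullet> e i)"
  proof (rule W_const[OF assms(1)])
    fix i assume i: "i \<in> I"
    show "\<bar>p i \<bullet> e i\<bar> \<le> C * d i powr \<gamma>"
      using Cauchy_Schwarz_ineq2[of "p i" "e i"] assms(2)[OF i] norm_e[OF i] by simp
  qed
  have ps: "W k \<gamma> 0 (\<lambda>i x. p i \<bullet> sgn x)"
  proof -
    have "W k (0 + \<gamma>) 0 (\<lambda>i x. (sgn x \<bullet> b) * (p i \<bullet> b))" if "b \<in> Basis" for b
      by (rule W_mult[OF _ _ W_sgn pc[OF that]]) auto
    then have "W k \<gamma> 0 (\<lambda>i x. (\<Sum>b\<in>Basis. (sgn x \<bullet> b) * (p i \<bullet> b)))" by (auto intro!: W_sum)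
    then show ?thesis by (subst euclidean_inner) (simp add: mult.commute)
  qed
  have es: "W k 0 0 (\<lambda>i x. sgn x \<bullet> e i)"
  proof -
    have "W k (0 + 0) 0 (\<lambda>i x. (sgn x \<bullet> b) * (e i \<bullet> b))" if "b \<in> Basis" for b
      by (rule W_mult[OF _ _ W_sgn ec[OF that]]) auto
    then have "W k 0 0 (\<lambda>i x. (\<Sum>b\<in>Basis. (sgn x \<bullet> b) * (e i \<bullet> b)))" by (auto intro!: W_sum)
    then show ?thesis by (subst euclidean_inner)
  qed
  have pm: "W k \<gamma> 0 (\<lambda>i x. p i \<bullet> sgn x - p i \<bullet> e i)" by (intro W_diff ps pe) auto
  have mb: "W k 0 0 (\<lambda>i x. sgn x \<bullet> b - e i \<bullet> b)" using assms(3) by (intro W_diff W_sgn ec) auto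
  have "W k ((-1) * 0) 0 (\<lambda>i x. (2 - 2 * (sgn x \<bullet> e i)) powr (-1))"
  proof (rule W_powr[of 2])
    show "2 * d i powr 0 \<le> 2 - 2 * (sgn x \<bullet> e i)" if "i \<in> I" "x \<in> ball (- e i) (1/2)" for i x
      using dom(6)[OF that] d_pos[OF that(1)] by simp
    show "W k 0 0 (\<lambda>i x. 2 - 2 * (sgn x \<bullet> e i))" by (intro W_diff W_cmult es W_real_const) auto
  qed auto
  then have mm: "W k 0 0 (\<lambda>i x. (2 - 2 * (sgn x \<bullet> e i)) powr (-1))" by simp
  have "W k (0 + 0) 0 (\<lambda>i x. (2 - 2 * (sgn x \<bullet> e i)) powr (-1) * (sgn x \<bullet> b - e i \<bullet> b))"
    by (rule W_mult[OF _ _ mm mb]) auto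
  from W_mult[OF _ _ this pm] have "W k ((0 + 0) + \<gamma>) 0 (\<lambda>i x. ((2 - 2 * (sgn x \<bullet> e i)) powr (-1) * (sgn x \<bullet> b - e i \<bullet> b))
      * (p i \<bullet> sgn x - p i \<bullet> e i))" by simp
  then have "W k \<gamma> 0 (\<lambda>i x. p i \<bullet> b - 2 * (((2 - 2 * (sgn x \<bullet> e i)) powr (-1) * (sgn x \<bullet> b - e i \<bullet> b))
      * (p i \<bullet> sgn x - p i \<bullet> e i)))" 
    by (intro W_diff W_cmult pc assms(3)) auto
  then show ?thesis
  proof (rule W_cong[rotated])
    fix i x assume i: "i \<in> I" and x: "x \<in> ball (- e i) (1/2)"
    have "(sgn x - e i) \<bullet> (sgn x - e i) = 2 - 2 * (sgn x \<bullet> e i)"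
    proof -
      have "sgn x \<bullet> sgn x = 1" "e i \<bullet> e i = 1"
        using dom(3)[OF i x] norm_e[OF i] by (simp_all add: dot_square_norm norm_sgn)
      then show ?thesis by (simp add: inner_diff_left inner_diff_right inner_commute)
    qed
    moreover have "0 < 2 - 2 * (sgn x \<bullet> e i)" using dom(6)[OF i x] by simp
    ultimately show "p i \<bullet> b - 2 * (((2 - 2 * (sgn x \<bullet> e i)) powr (-1) * (sgn x \<bullet> b - e i \<bullet> b))
      * (p i \<bullet> sgn x - p i \<bullet> e i)) = swap (e i) x (p i) \<bullet> b"
      by (simp add: swap_def inner_diff_left[of _ _ b] inner_diff_right[of "p i"] powr_minus divide_inverse
        mult_ac del: inner_diff_left inner_diff_right)
  qed
qed

lemma swap_derivative:
  assumes "C \<ge> 0" "\<And>i. i \<in> I \<Longrightarrow> norm (p i) \<le> C" "i \<in> I" "x \<in> ball (- e i) (1/2)"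
  shows "((\<lambda>x. swap (e i) x (p i)) has_derivative
     (\<lambda>v. \<Sum>b\<in>Basis. frechet_derivative (\<lambda>x. swap (e i) x (p i) \<bullet> b) (at x) v *\<^sub>R b)) (at x)"
proof -
  have "(\<lambda>x. swap (e i) x (p i) \<bullet> b) differentiable (at x)" if "b \<in> Basis" for b
    using W_swap[OF assms(1) _ that, of p 0 "Suc 0"] assms d_pos by (fastforce)
  then have "((\<lambda>x. \<Sum>b\<in>Basis. (swap (e i) x (p i) \<bullet> b) *\<^sub>R b) has_derivative
     (\<lambda>v. \<Sum>b\<in>Basis. frechet_derivative (\<lambda>x. swap (e i) x (p i) \<bullet> b) (at x) v *\<^sub>R b)) (at x)"
    unfolding frechet_derivative_works
    by (intro has_derivative_sum has_derivative_scaleR_left) auto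
  then show ?thesis by (simp add: euclidean_representation)
qed

text \<open>Bounded vectors give weight exponent 0 in \<open>W_swap\<close>, so the gradient bound
  and with it the Lipschitz constant are independent of the index.\<close>

lemma swap_lipschitz:
  assumes "C \<ge> 0" "\<And>i. i \<in> I \<Longrightarrow> norm (p i) \<le> C"
  shows "\<exists>L\<ge>0. \<forall>i\<in>I. \<forall>x\<in>ball (- e i) (1/2). \<forall>y\<in>ball (- e i) (1/2).
    dist (swap (e i) x (p i)) (swap (e i) y (p i)) \<le> L * dist x y"
proof -
  have W1: "W (Suc 0) 0 0 (\<lambda>i x. swap (e i) x (p i) \<bullet> b)" if "b \<in> Basis" for b
    using that assms d_pos by (intro W_swap) fastforce+
  have "\<exists>L\<ge>0. \<forall>i\<in>I. \<forall>x\<in>ball (- e i) (1/2). \<forall>y\<in>ball (- e i) (1/2).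
      \<bar>swap (e i) x (p i) \<bullet> b - swap (e i) y (p i) \<bullet> b\<bar> \<le> L * dist x y" if b: "b \<in> Basis" for b
  proof -
    obtain B where B: "B \<ge> 0" "\<And>i x v. i \<in> I \<Longrightarrow> x \<in> ball (- e i) (1/2) \<Longrightarrow> v \<in> Basis \<Longrightarrow>
      \<bar>partial v (\<lambda>x. swap (e i) x (p i) \<bullet> b) x\<bar> \<le> B * d i powr (case 0 of 0 \<Rightarrow> 0 - 0 | Suc _ \<Rightarrow> 0)"
      using partials_bound[OF W1[OF b]] by blast
    have "\<bar>swap (e i) x (p i) \<bullet> b - swap (e i) y (p i) \<bullet> b\<bar> \<le> (real DIM('a) * B) * dist x y"
      if "i \<in> I" "x \<in> ball (- e i) (1/2)" "y \<in> ball (- e i) (1/2)" for i x y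
      using W1[OF b] B(2)[OF that(1)] d_pos[OF that(1)] that
      by (intro lipschitz_from_partials[OF convex_U[OF that(1)]]) auto
    then show ?thesis using B(1) by (intro exI[of _ "real DIM('a) * B"]) auto
  qed
  then obtain L where L: "\<And>b. b \<in> Basis \<Longrightarrow> L b \<ge> 0"
    "\<And>b i x y. b \<in> Basis \<Longrightarrow> i \<in> I \<Longrightarrow> x \<in> ball (- e i) (1/2) \<Longrightarrow> y \<in> ball (- e i) (1/2) \<Longrightarrow>
      \<bar>swap (e i) x (p i) \<bullet> b - swap (e i) y (p i) \<bullet> b\<bar> \<le> L b * dist x y" by metis
  show ?thesis
  proof (intro exI conjI ballI)
    show "0 \<le> (\<Sum>b\<in>Basis. L b)" using L(1) by (simp add: sum_nonneg)
    fix i x y assume i: "i \<in> I" "x \<in> ball (- e i) (1/2)" "y \<in> ball (- e i) (1/2)"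
    have "dist (swap (e i) x (p i)) (swap (e i) y (p i))
       \<le> (\<Sum>b\<in>Basis. \<bar>(swap (e i) x (p i) - swap (e i) y (p i)) \<bullet> b\<bar>)"
      unfolding dist_norm by (rule norm_le_l1)
    also have "\<dots> \<le> (\<Sum>b\<in>Basis. L b * dist x y)"
      using L(2)[OF _ i] by (intro sum_mono) (simp add: inner_diff_left)
    finally show "dist (swap (e i) x (p i)) (swap (e i) y (p i)) \<le> (\<Sum>b\<in>Basis. L b) * dist x y"
      by (simp add: sum_distrib_right)
  qed
qed

text \<open>The second claim contains the gain. Reflecting is isometric, so the two arguments are at
  distance at most C d. As long as a derivative of h has another derivative, the difference of its
  values is of size d by \<open>shell_lipschitz\<close>; the top one is only \<alpha>-Hoelder and
  leaves d^\<alpha>, which is \<gamma> = 1 with loss \<tau> = 1 - \<alpha>.\<close>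

lemma W_comp_swap:
  assumes h: "smooth_family I k \<alpha> h" and \<alpha>: "\<beta> \<le> \<alpha>" "\<alpha> \<le> 1"
    and p: "\<And>i. i \<in> I \<Longrightarrow> p i \<in> cball 0 1 - ball 0 (1/2)"
  shows "W k 0 0 (\<lambda>i x. h i (swap (e i) x (p i)))"
    and "\<lbrakk>\<And>i. i \<in> I \<Longrightarrow> p' i \<in> cball 0 1 - ball 0 (1/2); 0 \<le> C; \<And>i. i \<in> I \<Longrightarrow> dist (p i) (p' i) \<le> C * d i\<rbrakk>
      \<Longrightarrow> W k 1 (1 - \<alpha>) (\<lambda>i x. h i (swap (e i) x (p i)) - h i (swap (e i) x (p' i)))"
proof -
  have \<alpha>0: "0 \<le> \<alpha>" using \<alpha> \<beta>_nonneg by simp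
  have shell: "swap (e i) x q \<in> cball 0 1 - ball 0 (1/4)" if "q \<in> cball 0 1 - ball 0 (1/2)" for i x q
    using that by simp
  have nz: "swap (e i) x q \<noteq> 0" if "q \<in> cball 0 1 - ball 0 (1/2)" for i x q
  proof -
    have "0 < norm (swap (e i) x q)" unfolding norm_swap using that by auto
    then show ?thesis by (metis norm_zero less_irrefl)
  qed
  have np: "norm (q i) \<le> 1 * d i powr 0" if "i \<in> I" "\<And>i. i \<in> I \<Longrightarrow> q i \<in> cball 0 1 - ball 0 (1/2)" for i and q :: "'i \<Rightarrow> 'a"
    using that(2)[OF that(1)] d_pos[OF that(1)] by simp
  have W_swap1: "W k 0 0 (\<lambda>i x. swap (e i) x (q i) \<bullet> b)"
    if "\<And>i. i \<in> I \<Longrightarrow> q i \<in> cball 0 1 - ball 0 (1/2)" "b \<in> Basis" for q b k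
    by (rule W_swap[OF zero_le_one _ that(2)]) (use that(1) np in blast)
  have W_swap_deriv: "W k 0 0 (\<lambda>i. partial v (\<lambda>x. swap (e i) x (q i) \<bullet> b))"
    if "\<And>i. i \<in> I \<Longrightarrow> q i \<in> cball 0 1 - ball 0 (1/2)" "b \<in> Basis" "v \<in> Basis" for q b v k
  proof -
    have "W (Suc k) 0 0 (\<lambda>i x. swap (e i) x (q i) \<bullet> b)" by (rule W_swap1[OF _ that(2)]) (rule that(1))
    then show ?thesis using that(3) by simp
  qed
  have der: "((\<lambda>x. h i (swap (e i) x (q i))) has_derivative
      (\<lambda>v. \<Sum>b\<in>Basis. partial b (h i) (swap (e i) x (q i)) * frechet_derivative (\<lambda>x. swap (e i) x (q i) \<bullet> b) (at x) v)) (at x)"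
    if "smooth_family I (Suc k) \<alpha> h" and i: "i \<in> I" and x: "x \<in> ball (- e i) (1/2)"
      and q: "\<And>i. i \<in> I \<Longrightarrow> q i \<in> cball 0 1 - ball 0 (1/2)" for i x k and q :: "'i \<Rightarrow> 'a" and h
  proof -
    have hd: "h i differentiable (at (swap (e i) x (q i)))"
      by (rule smooth_family_Suc(2)[OF that(1) i nz[OF q[OF i]]])
    have sd: "((\<lambda>x. swap (e i) x (q i)) has_derivative
       (\<lambda>v. \<Sum>b\<in>Basis. frechet_derivative (\<lambda>x. swap (e i) x (q i) \<bullet> b) (at x) v *\<^sub>R b)) (at x)"
      by (rule swap_derivative[OF zero_le_one _ i x]) (use q in simp)
    have c: "((\<lambda>x. h i (swap (e i) x (q i))) has_derivative (\<lambda>v. frechet_derivative (h i) (at (swap (e i) x (q i)))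
        (\<Sum>b\<in>Basis. frechet_derivative (\<lambda>x. swap (e i) x (q i) \<bullet> b) (at x) v *\<^sub>R b))) (at x)"
      using hd unfolding frechet_derivative_works by (rule has_derivative_compose[OF sd])
    show ?thesis
    proof (rule has_derivative_eq_rhs[OF c], rule ext)
      fix v
      show "frechet_derivative (h i) (at (swap (e i) x (q i)))
          (\<Sum>b\<in>Basis. frechet_derivative (\<lambda>x. swap (e i) x (q i) \<bullet> b) (at x) v *\<^sub>R b)
        = (\<Sum>b\<in>Basis. partial b (h i) (swap (e i) x (q i)) * frechet_derivative (\<lambda>x. swap (e i) x (q i) \<bullet> b) (at x) v)"
        by (subst frechet_derivative_expand[OF hd]) (auto intro!: sum.cong simp: mult.commute)
    qed
  qed
  have W0: "W k 0 0 (\<lambda>i x. h i (swap (e i) x (p i)))"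
    if "smooth_family I k \<alpha> h" "\<And>i. i \<in> I \<Longrightarrow> p i \<in> cball 0 1 - ball 0 (1/2)" for k h p
    using that
  proof (induction k arbitrary: h p)
    case 0
    obtain C0 where C0: "C0 \<ge> 0" "\<And>i. i \<in> I \<Longrightarrow> continuous_on (- {0}) (h i)"
      "\<And>i x. i \<in> I \<Longrightarrow> x \<in> cball 0 1 - ball 0 (1/4) \<Longrightarrow> \<bar>h i x\<bar> \<le> C0"
      "\<And>i x y. i \<in> I \<Longrightarrow> x \<in> cball 0 1 - ball 0 (1/4) \<Longrightarrow> y \<in> cball 0 1 - ball 0 (1/4) \<Longrightarrow>
        \<bar>h i x - h i y\<bar> \<le> C0 * dist x y powr \<alpha>"
      using 0(1) unfolding smooth_family_def Ck_on_def by (fastforce simp: multi_indices_def)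
    have "\<exists>L\<ge>0. \<forall>i\<in>I. \<forall>x\<in>ball (- e i) (1/2). \<forall>y\<in>ball (- e i) (1/2).
        dist (swap (e i) x (p i)) (swap (e i) y (p i)) \<le> L * dist x y"
      by (rule swap_lipschitz[OF zero_le_one]) (use 0(2) in simp)
    then obtain L where L: "L \<ge> 0" "\<And>i x y. i \<in> I \<Longrightarrow> x \<in> ball (- e i) (1/2) \<Longrightarrow> y \<in> ball (- e i) (1/2) \<Longrightarrow>
        dist (swap (e i) x (p i)) (swap (e i) y (p i)) \<le> L * dist x y"
      by blast
    let ?K = "C0 + C0 * L powr \<alpha> * D powr \<beta>"
    have K: "?K \<ge> 0" using C0 by simp
    have "\<bar>h i (swap (e i) x (p i)) - h i (swap (e i) y (p i))\<bar> \<le> ?K * d i powr (0 - 0 - \<beta>) * dist x y powr \<beta>"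
      if i: "i \<in> I" and x: "x \<in> ball (- e i) (1/2)" and y: "y \<in> ball (- e i) (1/2)" for i x y
    proof -
      have d1: "dist x y \<le> 1"
        using x y dist_triangle2[of x y "- e i"] by (simp add: dist_commute)
      have "\<bar>h i (swap (e i) x (p i)) - h i (swap (e i) y (p i))\<bar> \<le> C0 * dist (swap (e i) x (p i)) (swap (e i) y (p i)) powr \<alpha>"
        using 0(2)[OF i] by (intro C0(4)[OF i] shell)
      also have "\<dots> \<le> C0 * (L * dist x y) powr \<alpha>"
        using L(2)[OF i x y] C0(1) \<alpha>0 by (intro mult_left_mono powr_mono2) auto
      also have "\<dots> = C0 * L powr \<alpha> * dist x y powr \<alpha>"
        using L(1) by (simp add: powr_mult)
      also have "\<dots> \<le> C0 * L powr \<alpha> * dist x y powr \<beta>"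
        using C0(1) d1 \<alpha>(1) by (intro mult_left_mono powr_mono') auto
      \<comment> \<open>The bound obtained so far is independent of the weight; since d \<le> D, it
        may be weakened to the weighted form required by the class.\<close>
      also have "1 \<le> D powr \<beta> * d i powr (- \<beta>)"
        using weight_mono[OF i, of "- \<beta>" 0] d_pos[OF i] \<beta>_nonneg by simp
      then have "C0 * L powr \<alpha> * dist x y powr \<beta> \<le> C0 * L powr \<alpha> * dist x y powr \<beta> * (D powr \<beta> * d i powr (- \<beta>))"
        using C0(1) mult_left_mono[of 1 "D powr \<beta> * d i powr (- \<beta>)" "C0 * L powr \<alpha> * dist x y powr \<beta>"] by simp
      also have "\<dots> = (C0 * L powr \<alpha> * D powr \<beta>) * d i powr (0 - 0 - \<beta>) * dist x y powr \<beta>"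
        by (simp add: mult_ac)
      also have "\<dots> \<le> ?K * d i powr (0 - 0 - \<beta>) * dist x y powr \<beta>"
        using C0(1) by (intro mult_right_mono) auto
      finally show ?thesis .
    qed
    moreover have "\<bar>h i (swap (e i) x (p i))\<bar> \<le> ?K * d i powr (0 - 0)" if "i \<in> I" for i x
    proof -
      have "\<bar>h i (swap (e i) x (p i))\<bar> \<le> C0" by (rule C0(3)[OF that shell[OF 0(2)[OF that]]])
      then show ?thesis using C0(1) d_pos[OF that] by (simp add: add_increasing2)
    qed
    moreover have "continuous_on (ball (- e i) (1/2)) (\<lambda>x. h i (swap (e i) x (p i)))" if i: "i \<in> I" for i
    proof (rule continuous_on_compose2[OF C0(2)[OF i]])
      have sd: "((\<lambda>x. swap (e i) x (p i)) has_derivative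
         (\<lambda>v. \<Sum>b\<in>Basis. frechet_derivative (\<lambda>x. swap (e i) x (p i) \<bullet> b) (at x) v *\<^sub>R b)) (at x)"
        if "x \<in> ball (- e i) (1/2)" for x
        by (rule swap_derivative[OF zero_le_one _ i that]) (use 0(2) in simp)
      show "continuous_on (ball (- e i) (1/2)) (\<lambda>x. swap (e i) x (p i))"
        using has_derivative_continuous[OF sd] by (auto intro!: continuous_at_imp_continuous_on)
      show "(\<lambda>x. swap (e i) x (p i)) ` ball (- e i) (1/2) \<subseteq> - {0}"
        using nz[OF 0(2)[OF i]] by auto
    qed
    ultimately show ?case using K unfolding Holder_class.simps by blast
  next
    case (Suc k)
    obtain C0 where C0: "C0 \<ge> 0" "\<forall>i\<in>I. \<forall>x\<in>cball 0 1 - ball 0 (1/4). \<bar>h i x\<bar> \<le> C0 \<and> (\<forall>v\<in>Basis. \<bar>partial v (h i) x\<bar> \<le> C0)"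
      using smooth_family_Suc(3)[OF Suc.prems(1)] by blast
    show ?case
    proof (rule W_SucI[OF C0(1)])
      show "\<bar>h i (swap (e i) x (p i))\<bar> \<le> C0 * d i powr 0" if "i \<in> I" for i x
        using C0(2) shell[OF Suc.prems(2)[OF that]] d_pos[OF that] that by simp
      show "((\<lambda>x. h i (swap (e i) x (p i))) has_derivative (\<lambda>v. \<Sum>b\<in>Basis. partial b (h i) (swap (e i) x (p i)) *
          frechet_derivative (\<lambda>x. swap (e i) x (p i) \<bullet> b) (at x) v)) (at x)"
        if "i \<in> I" "x \<in> ball (- e i) (1/2)" for i x
        by (rule der[OF Suc.prems(1) that]) (rule Suc.prems(2))
      fix v :: 'a assume v: "v \<in> Basis"
      have "W k (0 + 0) 0 (\<lambda>i x. partial b (h i) (swap (e i) x (p i)) * frechet_derivative (\<lambda>x. swap (e i) x (p i) \<bullet> b) (at x) v)"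
        if b: "b \<in> Basis" for b
      proof (rule W_mult)
        show "W k 0 0 (\<lambda>i x. partial b (h i) (swap (e i) x (p i)))"
          by (rule Suc.IH[OF smooth_family_Suc(1)[OF Suc.prems(1) b] Suc.prems(2)])
        show "W k 0 0 (\<lambda>i. partial v (\<lambda>x. swap (e i) x (p i) \<bullet> b))"
          by (rule W_swap_deriv[OF _ b v]) (rule Suc.prems(2))
      qed auto
      then show "W k 0 0 (\<lambda>i x. \<Sum>b\<in>Basis. partial b (h i) (swap (e i) x (p i)) * frechet_derivative (\<lambda>x. swap (e i) x (p i) \<bullet> b) (at x) v)"
        by (auto intro!: W_sum)
    qed
  qed
  show "W k 0 0 (\<lambda>i x. h i (swap (e i) x (p i)))" by (rule W0[OF h p])
  assume p': "\<And>i. i \<in> I \<Longrightarrow> p' i \<in> cball 0 1 - ball 0 (1/2)" and C: "0 \<le> C"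
    and pp': "\<And>i. i \<in> I \<Longrightarrow> dist (p i) (p' i) \<le> C * d i"
  have ds: "dist (swap (e i) x (p i)) (swap (e i) x (p' i)) \<le> C * d i" if "i \<in> I" for i x
    using pp'[OF that] by (simp add: dist_norm swap_diff)
  show "W k 1 (1 - \<alpha>) (\<lambda>i x. h i (swap (e i) x (p i)) - h i (swap (e i) x (p' i)))" using h
  proof (induction k arbitrary: h)
    case 0
    obtain C0 where C0: "C0 \<ge> 0" "\<And>i. i \<in> I \<Longrightarrow> continuous_on (- {0}) (h i)"
      "\<And>i x. i \<in> I \<Longrightarrow> x \<in> cball 0 1 - ball 0 (1/4) \<Longrightarrow> \<bar>h i x\<bar> \<le> C0"
      "\<And>i x y. i \<in> I \<Longrightarrow> x \<in> cball 0 1 - ball 0 (1/4) \<Longrightarrow> y \<in> cball 0 1 - ball 0 (1/4) \<Longrightarrow>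
        \<bar>h i x - h i y\<bar> \<le> C0 * dist x y powr \<alpha>"
      using 0(1) unfolding smooth_family_def Ck_on_def by (fastforce simp: multi_indices_def)
    have "\<exists>L\<ge>0. \<forall>i\<in>I. \<forall>x\<in>ball (- e i) (1/2). \<forall>y\<in>ball (- e i) (1/2).
        dist (swap (e i) x (p i)) (swap (e i) y (p i)) \<le> L * dist x y"
      by (rule swap_lipschitz[OF zero_le_one]) (use p in simp)
    then obtain L where L: "L \<ge> 0" "\<And>i x y. i \<in> I \<Longrightarrow> x \<in> ball (- e i) (1/2) \<Longrightarrow> y \<in> ball (- e i) (1/2) \<Longrightarrow>
        dist (swap (e i) x (p i)) (swap (e i) y (p i)) \<le> L * dist x y"
      by blast
    have "\<exists>L\<ge>0. \<forall>i\<in>I. \<forall>x\<in>ball (- e i) (1/2). \<forall>y\<in>ball (- e i) (1/2).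
        dist (swap (e i) x (p' i)) (swap (e i) y (p' i)) \<le> L * dist x y"
      by (rule swap_lipschitz[OF zero_le_one]) (use p' in simp)
    then obtain L' where L': "L' \<ge> 0" "\<And>i x y. i \<in> I \<Longrightarrow> x \<in> ball (- e i) (1/2) \<Longrightarrow> y \<in> ball (- e i) (1/2) \<Longrightarrow>
        dist (swap (e i) x (p' i)) (swap (e i) y (p' i)) \<le> L' * dist x y"
      by blast
    let ?g = "\<lambda>i x. h i (swap (e i) x (p i)) - h i (swap (e i) x (p' i))"
    let ?A = "C0 * C powr \<alpha>" and ?B = "C0 * (L powr \<alpha> + L' powr \<alpha>)"
    let ?K = "2 * ?A + ?B"
    have K: "?K \<ge> 0" using C0 by simp
    have bd: "\<bar>?g i x\<bar> \<le> ?A * d i powr \<alpha>" if i: "i \<in> I" for i x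
    proof -
      have "\<bar>?g i x\<bar> \<le> C0 * dist (swap (e i) x (p i)) (swap (e i) x (p' i)) powr \<alpha>"
        by (intro C0(4)[OF i] shell p p' i)
      also have "\<dots> \<le> C0 * (C * d i) powr \<alpha>"
        using ds[OF i] C0(1) \<alpha>0 by (intro mult_left_mono powr_mono2) auto
      finally show ?thesis using C d_pos[OF i] by (simp add: powr_mult)
    qed
    have hol: "\<bar>?g i x - ?g i y\<bar> \<le> ?K * d i powr (1 - (1 - \<alpha>) - \<beta>) * dist x y powr \<beta>"
      if i: "i \<in> I" and x: "x \<in> ball (- e i) (1/2)" and y: "y \<in> ball (- e i) (1/2)" for i x y
    \<comment> \<open>Interpolation between two bounds: for close x and y the Hoelder continuity of
      h in each term, for distant ones the size d^\<alpha> of the difference itself.\<close>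
    proof (cases "dist x y \<le> d i")
      case True
      have 1: "\<bar>h i (swap (e i) x q) - h i (swap (e i) y q)\<bar> \<le> C0 * l powr \<alpha> * dist x y powr \<alpha>"
        if q: "q \<in> cball 0 1 - ball 0 (1/2)" and l: "l \<ge> 0" "dist (swap (e i) x q) (swap (e i) y q) \<le> l * dist x y" for q l
      proof -
        have "\<bar>h i (swap (e i) x q) - h i (swap (e i) y q)\<bar> \<le> C0 * dist (swap (e i) x q) (swap (e i) y q) powr \<alpha>"
          by (intro C0(4)[OF i] shell q)
        also have "\<dots> \<le> C0 * (l * dist x y) powr \<alpha>"
          using l C0(1) \<alpha>0 by (intro mult_left_mono powr_mono2) auto
        finally show ?thesis using l by (simp add: powr_mult)
      qed
      have "\<bar>?g i x - ?g i y\<bar> \<le> C0 * L powr \<alpha> * dist x y powr \<alpha> + C0 * L' powr \<alpha> * dist x y powr \<alpha>"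
        using 1[OF p[OF i] L(1) L(2)[OF i x y]] 1[OF p'[OF i] L'(1) L'(2)[OF i x y]] by linarith
      also have "\<dots> = ?B * dist x y powr \<alpha>" by (simp add: algebra_simps)
      also have "dist x y powr \<alpha> = dist x y powr (\<alpha> - \<beta>) * dist x y powr \<beta>" by (simp flip: powr_add)
      also have "?B * (dist x y powr (\<alpha> - \<beta>) * dist x y powr \<beta>) \<le> ?B * (d i powr (\<alpha> - \<beta>) * dist x y powr \<beta>)"
        using True C0(1) \<alpha>(1) by (intro mult_left_mono mult_right_mono powr_mono2) auto
      also have "\<dots> = ?B * d i powr (1 - (1 - \<alpha>) - \<beta>) * dist x y powr \<beta>" by simp
      also have "\<dots> \<le> ?K * d i powr (1 - (1 - \<alpha>) - \<beta>) * dist x y powr \<beta>"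
        using C0(1) by (intro mult_right_mono) auto
      finally show ?thesis .
    next
      case False
      have "\<bar>?g i x - ?g i y\<bar> \<le> 2 * ?A * d i powr \<alpha>" using bd[OF i, of x] bd[OF i, of y] by linarith
      also have "d i powr \<alpha> = d i powr (\<alpha> - \<beta>) * d i powr \<beta>" by (simp flip: powr_add)
      also have "2 * ?A * (d i powr (\<alpha> - \<beta>) * d i powr \<beta>) \<le> 2 * ?A * (d i powr (\<alpha> - \<beta>) * dist x y powr \<beta>)"
        using False C0(1) \<beta>_nonneg d_pos[OF i] by (intro mult_left_mono powr_mono2) auto
      also have "\<dots> = 2 * ?A * d i powr (1 - (1 - \<alpha>) - \<beta>) * dist x y powr \<beta>" by simp
      also have "\<dots> \<le> ?K * d i powr (1 - (1 - \<alpha>) - \<beta>) * dist x y powr \<beta>"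
        using C0(1) by (intro mult_right_mono) auto
      finally show ?thesis .
    qed
    have "\<bar>?g i x\<bar> \<le> ?K * d i powr (1 - (1 - \<alpha>))" if i: "i \<in> I" for i x
    proof -
      have "?A * d i powr \<alpha> \<le> ?K * d i powr \<alpha>" using C0(1) by (intro mult_right_mono) auto
      then show ?thesis using bd[OF i, of x] by simp
    qed
    moreover have "continuous_on (ball (- e i) (1/2)) (?g i)" if i: "i \<in> I" for i
    proof -
      have "W 0 0 0 (\<lambda>i x. h i (swap (e i) x (p i)))" by (rule W0[OF 0]) (rule p)
      moreover have "W 0 0 0 (\<lambda>i x. h i (swap (e i) x (p' i)))" by (rule W0[OF 0]) (rule p')
      ultimately show ?thesis using i unfolding Holder_class.simps by (intro continuous_on_diff) blast+
    qed
    ultimately show ?case using K hol unfolding Holder_class.simps by blast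
  next
    case (Suc k)
    obtain C0 where C0: "C0 \<ge> 0" "\<forall>i\<in>I. \<forall>x\<in>cball 0 1 - ball 0 (1/4). \<bar>h i x\<bar> \<le> C0 \<and> (\<forall>v\<in>Basis. \<bar>partial v (h i) x\<bar> \<le> C0)"
      using smooth_family_Suc(3)[OF Suc.prems(1)] by blast
    let ?D = "\<lambda>q i x b v. frechet_derivative (\<lambda>x. swap (e i) x (q i) \<bullet> b) (at x) v"
    show ?case
    proof (rule W_SucI)
      show "0 \<le> (real DIM('a) + 8) * C0 * C" using C0 C by simp
      show "\<bar>h i (swap (e i) x (p i)) - h i (swap (e i) x (p' i))\<bar> \<le> ((real DIM('a) + 8) * C0 * C) * d i powr 1"
        if i: "i \<in> I" for i x
      proof -
        have "\<bar>h i (swap (e i) x (p i)) - h i (swap (e i) x (p' i))\<bar>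
          \<le> (real DIM('a) + 8) * C0 * dist (swap (e i) x (p i)) (swap (e i) x (p' i))"
          by (rule shell_lipschitz[OF smooth_family_Suc(2)[OF Suc.prems i] C0(1)])
             (use C0(2) i p[OF i] p'[OF i] in auto)
        also have "\<dots> \<le> (real DIM('a) + 8) * C0 * (C * d i)"
          using ds[OF i] C0(1) by (intro mult_left_mono) auto
        finally show ?thesis using d_pos[OF i] by (simp add: mult_ac)
      qed
      show "((\<lambda>x. h i (swap (e i) x (p i)) - h i (swap (e i) x (p' i))) has_derivative
        (\<lambda>v. (\<Sum>b\<in>Basis. partial b (h i) (swap (e i) x (p i)) * ?D p i x b v)
          - (\<Sum>b\<in>Basis. partial b (h i) (swap (e i) x (p' i)) * ?D p' i x b v))) (at x)"
        if "i \<in> I" "x \<in> ball (- e i) (1/2)" for i x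
        by (intro has_derivative_diff der[OF Suc.prems that] p p')
      fix v :: 'a assume v: "v \<in> Basis"
      \<comment> \<open>Discrete product rule for the chain rule terms. Either h is differentiated
        at both points and the induction hypothesis applies to its partial derivative, or the
        reflection is differentiated, where linearity produces the reflected difference p - p' of
        size d.\<close>
      have "W k 1 (1 - \<alpha>) (\<lambda>i x. ?D p i x b v * (partial b (h i) (swap (e i) x (p i)) - partial b (h i) (swap (e i) x (p' i)))
          + partial b (h i) (swap (e i) x (p' i)) * (?D (\<lambda>i. p i - p' i) i x b v))" if b: "b \<in> Basis" for b
      proof (rule W_add)
        have "W k 0 0 (\<lambda>i x. ?D p i x b v)"
          by (rule W_swap_deriv[OF _ b v]) (rule p)
        from W_mult[OF _ _ this Suc.IH[OF smooth_family_Suc(1)[OF Suc.prems(1) b]]]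
        show "W k 1 (1 - \<alpha>) (\<lambda>i x. ?D p i x b v * (partial b (h i) (swap (e i) x (p i)) - partial b (h i) (swap (e i) x (p' i))))"
          using \<alpha>(2) \<alpha>0 by simp
        have "W (Suc k) 1 0 (\<lambda>i x. swap (e i) x (p i - p' i) \<bullet> b)"
        proof (rule W_swap[OF C _ b])
          show "norm (p i - p' i) \<le> C * d i powr 1" if "i \<in> I" for i
            using pp'[OF that] d_pos[OF that] by (simp add: dist_norm)
        qed
        then have D: "W k 1 0 (\<lambda>i x. ?D (\<lambda>i. p i - p' i) i x b v)" using v by simp
        have "W k 0 0 (\<lambda>i x. partial b (h i) (swap (e i) x (p' i)))"
          by (rule W0[OF smooth_family_Suc(1)[OF Suc.prems(1) b]]) (rule p')
        from W_mult[OF _ _ this D]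
        have "W k 1 0 (\<lambda>i x. partial b (h i) (swap (e i) x (p' i)) * ?D (\<lambda>i. p i - p' i) i x b v)" by simp
        then show "W k 1 (1 - \<alpha>) (\<lambda>i x. partial b (h i) (swap (e i) x (p' i)) * ?D (\<lambda>i. p i - p' i) i x b v)"
          by (rule W_mono) (use \<alpha> in auto)
      qed
      then have "W k 1 (1 - \<alpha>) (\<lambda>i x. \<Sum>b\<in>Basis. ?D p i x b v * (partial b (h i) (swap (e i) x (p i)) - partial b (h i) (swap (e i) x (p' i)))
          + partial b (h i) (swap (e i) x (p' i)) * (?D (\<lambda>i. p i - p' i) i x b v))"
        by (auto intro!: W_sum)
      then show "W k 1 (1 - \<alpha>) (\<lambda>i x. (\<Sum>b\<in>Basis. partial b (h i) (swap (e i) x (p i)) * ?D p i x b v)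
          - (\<Sum>b\<in>Basis. partial b (h i) (swap (e i) x (p' i)) * ?D p' i x b v))"
      proof (rule W_cong[rotated])
        fix i x assume i: "i \<in> I" and x: "x \<in> ball (- e i) (1/2)"
        have Deq: "?D (\<lambda>i. p i - p' i) i x b v = ?D p i x b v - ?D p' i x b v" if b: "b \<in> Basis" for b
        proof -
          have d: "((\<lambda>x. swap (e i) x (q i) \<bullet> b) has_derivative ?D q i x b) (at x)"
            if "\<And>i. i \<in> I \<Longrightarrow> q i \<in> cball 0 1 - ball 0 (1/2)" for q
          proof -
            have "W (Suc 0) 0 0 (\<lambda>i x. swap (e i) x (q i) \<bullet> b)" by (rule W_swap1[OF _ b]) (rule that)
            then show ?thesis using i x unfolding Holder_class.simps frechet_derivative_works by blast
          qed
          show ?thesis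
            unfolding swap_diff[symmetric] inner_diff_left
            by (intro partial_eqI has_derivative_diff d p p')
        qed
        show "(\<Sum>b\<in>Basis. ?D p i x b v * (partial b (h i) (swap (e i) x (p i)) - partial b (h i) (swap (e i) x (p' i)))
          + partial b (h i) (swap (e i) x (p' i)) * (?D (\<lambda>i. p i - p' i) i x b v))
          = (\<Sum>b\<in>Basis. partial b (h i) (swap (e i) x (p i)) * ?D p i x b v)
          - (\<Sum>b\<in>Basis. partial b (h i) (swap (e i) x (p' i)) * ?D p' i x b v)"
          unfolding sum_subtractf[symmetric] by (intro sum.cong refl) (simp only: Deq, simp add: algebra_simps)
      qed
    qed
  qed
qed

end

section \<open>Polar coordinates\<close>

lemma nn_integral_lborel_scaleR:
  fixes f :: "'a::euclidean_space \<Rightarrow> ennreal"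
  assumes [measurable]: "f \<in> borel_measurable borel" and c: "0 < c"
  shows "(\<integral>\<^sup>+x. f (c *\<^sub>R x) \<partial>lborel) = ennreal (1 / c ^ DIM('a)) * (\<integral>\<^sup>+x. f x \<partial>lborel)"
proof -
  have "(\<integral>\<^sup>+x. f x \<partial>lborel) = (\<integral>\<^sup>+x. f x \<partial>density (distr lborel borel (\<lambda>x::'a. 0 + c *\<^sub>R x)) (\<lambda>_. ennreal (\<bar>c\<bar> ^ DIM('a))))"
    using c by (subst lborel_affine[of c 0]) auto
  also have "\<dots> = ennreal (c ^ DIM('a)) * (\<integral>\<^sup>+x. f (c *\<^sub>R x) \<partial>lborel)"
    using c by (simp add: nn_integral_density nn_integral_distr nn_integral_cmult)
  finally have "ennreal (1 / c ^ DIM('a)) * (\<integral>\<^sup>+x. f x \<partial>lborel)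
      = (ennreal (1 / c ^ DIM('a)) * ennreal (c ^ DIM('a))) * (\<integral>\<^sup>+x. f (c *\<^sub>R x) \<partial>lborel)"
    by (simp add: mult.assoc)
  also have "ennreal (1 / c ^ DIM('a)) * ennreal (c ^ DIM('a)) = 1"
    using c by (simp flip: ennreal_mult)
  finally show ?thesis by simp
qed

lemma nn_integral_powr_tail:
  assumes "0 < a" "0 < n"
  shows "(\<integral>\<^sup>+t\<in>{a<..}. ennreal (real n * t powr (- real n - 1)) \<partial>lborel) = ennreal (1 / a ^ n)"
proof -
  have "(\<integral>\<^sup>+t\<in>{a<..}. ennreal (real n * t powr (- real n - 1)) \<partial>lborel)
    = (\<integral>\<^sup>+t. ennreal (real n * t powr (- real n - 1)) * indicator {a..} t \<partial>lborel)"
    by (rule nn_integral_cong_AE, rule AE_mp[OF AE_lborel_singleton[of a]], rule AE_I2)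
       (auto simp: indicator_def)
  also have "\<dots> = 0 - (- (a powr (- real n)))"
  proof (rule nn_integral_FTC_atLeast)
    show "((\<lambda>t. - (t powr (- real n))) has_real_derivative real n * t powr (- real n - 1)) (at t)" if "a \<le> t" for t
      using that assms by (auto intro!: derivative_eq_intros)
    have "((\<lambda>t::real. t powr (- real n)) \<longlongrightarrow> 0) at_top"
      using assms by (intro tendsto_neg_powr) (auto simp: filterlim_ident)
    then show "((\<lambda>t::real. - (t powr (- real n))) \<longlongrightarrow> 0) at_top"
      by (rule tendsto_eq_intros) simp
  qed auto
  also have "0 - (- (a powr (- real n))) = 1 / a ^ n"
    using assms by (simp add: powr_minus powr_realpow divide_inverse)
  finally show ?thesis .
qed

text \<open>Substituting \<open>t = \<tau> |w|\<close> in the inner integral and then \<open>y = \<tau> w\<close> in the outer one,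
  the right-hand side becomes the integral of \<open>F y |y| ^ n\<close> against
  \<open>n \<tau> ^ (- n - 1)\<close> over \<open>\<tau> > |y|\<close>.\<close>

lemma nn_integral_polar:
  fixes F :: "'a::euclidean_space \<Rightarrow> ennreal"
  assumes F [measurable]: "F \<in> borel_measurable borel"
  shows "(\<integral>\<^sup>+y. F y \<partial>lborel) = (\<integral>\<^sup>+w\<in>ball 0 1. (\<integral>\<^sup>+t\<in>{0<..}.
           ennreal (real DIM('a) * t ^ (DIM('a) - 1)) * F (t *\<^sub>R sgn w) \<partial>lborel) \<partial>lborel)"
proof -
  let ?n = "DIM('a)"
  have n: "?n > 0" by simp
  define A where "A = (\<lambda>\<tau> w. indicator {0<..} \<tau> * indicator (ball 0 1) w *
      (ennreal (real ?n * \<tau> ^ (?n - 1) * norm w ^ ?n) * F (\<tau> *\<^sub>R (w::'a))))"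
  have [measurable]: "ball (0::'a) r \<in> sets borel" for r by simp
  have "(\<lambda>(\<tau>, w). A \<tau> w) \<in> borel_measurable (borel \<Otimes>\<^sub>M borel)"
    unfolding A_def by measurable
  then have [measurable]: "(\<lambda>(\<tau>, w). A \<tau> w) \<in> borel_measurable (lborel \<Otimes>\<^sub>M lborel)"
    by (simp add: measurable_cong_sets[OF sets_pair_measure_cong[OF sets_lborel sets_lborel] refl])
  have [measurable]: "(\<lambda>w::'a. sgn w) \<in> borel_measurable borel"
    unfolding sgn_div_norm[abs_def] by measurable
  have "(\<integral>\<^sup>+w\<in>ball 0 1. (\<integral>\<^sup>+t\<in>{0<..}. ennreal (real ?n * t ^ (?n - 1)) * F (t *\<^sub>R sgn w) \<partial>lborel) \<partial>lborel)
    = (\<integral>\<^sup>+w. (\<integral>\<^sup>+\<tau>. A \<tau> w \<partial>lborel) \<partial>lborel)"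
  proof (rule nn_integral_cong_AE, rule AE_mp[OF AE_lborel_singleton[of 0]], rule AE_I2, rule impI)
    fix w :: 'a assume w: "w \<noteq> 0"
    let ?G = "\<lambda>t. ennreal (real ?n * t ^ (?n - 1)) * F (t *\<^sub>R sgn w) * indicator {0<..} t"
    have "(\<integral>\<^sup>+t. ?G t \<partial>lborel) = ennreal (norm w) * (\<integral>\<^sup>+\<tau>. ?G (norm w * \<tau>) \<partial>lborel)"
      using w by (subst nn_integral_real_affine[of ?G "norm w" 0]) auto
    also have "\<dots> = (\<integral>\<^sup>+\<tau>. ennreal (norm w) * ?G (norm w * \<tau>) \<partial>lborel)"
      by (intro nn_integral_cmult[symmetric]) measurable
    finally have eq: "(\<integral>\<^sup>+t. ?G t \<partial>lborel) = (\<integral>\<^sup>+\<tau>. ennreal (norm w) * ?G (norm w * \<tau>) \<partial>lborel)" .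
    have "(\<integral>\<^sup>+t. ?G t \<partial>lborel) * indicator (ball 0 1) w
        = (\<integral>\<^sup>+\<tau>. ennreal (norm w) * ?G (norm w * \<tau>) * indicator (ball 0 1) w \<partial>lborel)"
      unfolding eq by (intro nn_integral_multc[symmetric]) measurable
    also have "\<dots> = (\<integral>\<^sup>+\<tau>. A \<tau> w \<partial>lborel)"
    proof (rule nn_integral_cong)
      fix \<tau> :: real
      show "ennreal (norm w) * ?G (norm w * \<tau>) * indicator (ball 0 1) w = A \<tau> w"
      proof (cases "\<tau> > 0")
        case True
        have "norm w * (real ?n * (norm w * \<tau>) ^ (?n - 1)) = real ?n * \<tau> ^ (?n - 1) * (norm w * norm w ^ (?n - 1))"
          by (simp add: power_mult_distrib mult_ac)
        also have "norm w * norm w ^ (?n - 1) = norm w ^ ?n" using n by (metis power_eq_if mult.commute less_not_refl)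
        finally have "ennreal (norm w) * ennreal (real ?n * (norm w * \<tau>) ^ (?n - 1)) = ennreal (real ?n * \<tau> ^ (?n - 1) * norm w ^ ?n)"
          by (subst ennreal_mult[symmetric]) (use True in auto)
        then have "ennreal (norm w) * ?G (norm w * \<tau>) = ennreal (real ?n * \<tau> ^ (?n - 1) * norm w ^ ?n) * F ((norm w * \<tau>) *\<^sub>R sgn w)"
          using True w by (simp add: zero_less_mult_iff flip: mult.assoc)
        moreover have "(norm w * \<tau>) *\<^sub>R sgn w = \<tau> *\<^sub>R w" using w by (simp add: sgn_div_norm)
        ultimately show ?thesis using True unfolding A_def by (simp add: mult_ac)
      next
        case False
        then show ?thesis using w by (simp add: A_def zero_less_mult_iff)
      qed
    qed
    finally show "(\<integral>\<^sup>+t. ?G t \<partial>lborel) * indicator (ball 0 1) w = (\<integral>\<^sup>+\<tau>. A \<tau> w \<partial>lborel)" .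
  qed
  also have "\<dots> = (\<integral>\<^sup>+\<tau>. (\<integral>\<^sup>+w. A \<tau> w \<partial>lborel) \<partial>lborel)"
    by (rule lborel_pair.Fubini') measurable
  also have "\<dots> = (\<integral>\<^sup>+\<tau>. (\<integral>\<^sup>+y. indicator {norm y<..} \<tau> *
        (ennreal (real ?n * \<tau> powr (- real ?n - 1)) * (ennreal (norm y ^ ?n) * F y)) \<partial>lborel) \<partial>lborel)"
  proof (rule nn_integral_cong)
    fix \<tau> :: real
    show "(\<integral>\<^sup>+w. A \<tau> w \<partial>lborel) = (\<integral>\<^sup>+y. indicator {norm y<..} \<tau> *
        (ennreal (real ?n * \<tau> powr (- real ?n - 1)) * (ennreal (norm y ^ ?n) * F y)) \<partial>lborel)"
    proof (cases "\<tau> > 0")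
      case True
      let ?H = "\<lambda>y::'a. indicator (ball 0 \<tau>) y * (ennreal (real ?n * \<tau> ^ (?n - 1) * (norm y / \<tau>) ^ ?n) * F y)"
      have "(\<integral>\<^sup>+w. A \<tau> w \<partial>lborel) = (\<integral>\<^sup>+w. ?H (\<tau> *\<^sub>R w) \<partial>lborel)"
        using True by (intro nn_integral_cong) (auto simp: A_def indicator_def abs_of_pos)
      also have "\<dots> = ennreal (1 / \<tau> ^ ?n) * (\<integral>\<^sup>+y. ?H y \<partial>lborel)"
        using True by (intro nn_integral_lborel_scaleR) measurable
      also have "\<dots> = (\<integral>\<^sup>+y. ennreal (1 / \<tau> ^ ?n) * ?H y \<partial>lborel)"
        by (intro nn_integral_cmult[symmetric]) measurable
      also have "\<dots> = (\<integral>\<^sup>+y. indicator {norm y<..} \<tau> *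
        (ennreal (real ?n * \<tau> powr (- real ?n - 1)) * (ennreal (norm y ^ ?n) * F y)) \<partial>lborel)"
      proof (rule nn_integral_cong)
        fix y :: 'a
        have e: "1 / \<tau> ^ ?n * (real ?n * \<tau> ^ (?n - 1) * (norm y / \<tau>) ^ ?n) = real ?n * \<tau> powr (- real ?n - 1) * norm y ^ ?n"
        proof -
          have "\<tau> powr (- real ?n - 1) = 1 / (\<tau> ^ ?n * \<tau>)"
            using True by (simp add: powr_diff powr_minus powr_realpow divide_inverse)
          moreover have "\<tau> ^ ?n = \<tau> * \<tau> ^ (?n - 1)" using n by (metis power_eq_if less_not_refl)
          ultimately show ?thesis using True by (simp add: power_divide)
        qed
        have "ennreal (1 / \<tau> ^ ?n) * ennreal (real ?n * \<tau> ^ (?n - 1) * (norm y / \<tau>) ^ ?n)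
          = ennreal (real ?n * \<tau> powr (- real ?n - 1)) * ennreal (norm y ^ ?n)"
          using True by (subst (1 2) ennreal_mult[symmetric]) (use e in auto)
        then show "ennreal (1 / \<tau> ^ ?n) * ?H y = indicator {norm y<..} \<tau> *
          (ennreal (real ?n * \<tau> powr (- real ?n - 1)) * (ennreal (norm y ^ ?n) * F y))"
          by (auto simp: indicator_def mult.assoc[symmetric])
      qed
      finally show ?thesis .
    next
      case False
      then have "A \<tau> w = 0" for w by (simp add: A_def)
      moreover have "indicator {norm y<..} \<tau> = (0::ennreal)" for y :: 'a
      proof -
        have "\<not> norm y < \<tau>" using False norm_ge_zero[of y] by linarith
        then show ?thesis by simp
      qed
      ultimately show ?thesis by simp
    qed
  qed
  also have "\<dots> = (\<integral>\<^sup>+y. (\<integral>\<^sup>+\<tau>. indicator {norm y<..} \<tau> *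
        (ennreal (real ?n * \<tau> powr (- real ?n - 1)) * (ennreal (norm y ^ ?n) * F y)) \<partial>lborel) \<partial>lborel)"
  proof (rule lborel_pair.Fubini')
    have "(\<lambda>p. (if norm (fst p :: 'a) < snd p then 1 else 0) *
        (ennreal (real ?n * snd p powr (- real ?n - 1)) * (ennreal (norm (fst p) ^ ?n) * F (fst p))))
        \<in> borel_measurable (borel \<Otimes>\<^sub>M borel)" by measurable
    then show "(\<lambda>(y::'a, \<tau>). indicator {norm y<..} \<tau> *
        (ennreal (real ?n * \<tau> powr (- real ?n - 1)) * (ennreal (norm y ^ ?n) * F y))) \<in> borel_measurable (lborel \<Otimes>\<^sub>M lborel)"
      by (simp add: measurable_cong_sets[OF sets_pair_measure_cong[OF sets_lborel sets_lborel] refl]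
          split_beta' indicator_def of_bool_def)
  qed
  also have "\<dots> = (\<integral>\<^sup>+y. F y \<partial>lborel)"
  proof (rule nn_integral_cong_AE, rule AE_mp[OF AE_lborel_singleton[of 0]], rule AE_I2, rule impI)
    fix y :: 'a assume y: "y \<noteq> 0"
    have "(\<integral>\<^sup>+\<tau>. indicator {norm y<..} \<tau> *
        (ennreal (real ?n * \<tau> powr (- real ?n - 1)) * (ennreal (norm y ^ ?n) * F y)) \<partial>lborel)
       = (\<integral>\<^sup>+\<tau>\<in>{norm y<..}. ennreal (real ?n * \<tau> powr (- real ?n - 1)) \<partial>lborel) * (ennreal (norm y ^ ?n) * F y)"
      by (subst nn_integral_multc[symmetric]) (auto intro!: nn_integral_cong simp: mult_ac)
    also have "\<dots> = (ennreal (1 / norm y ^ ?n) * ennreal (norm y ^ ?n)) * F y"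
      using y n by (subst nn_integral_powr_tail) (auto simp: mult.assoc)
    also have "\<dots> = F y" using y by (simp flip: ennreal_mult)
    finally show "(\<integral>\<^sup>+\<tau>. indicator {norm y<..} \<tau> *
        (ennreal (real ?n * \<tau> powr (- real ?n - 1)) * (ennreal (norm y ^ ?n) * F y)) \<partial>lborel) = F y" .
  qed
  finally show ?thesis by simp
qed

section \<open>Change of variables for rank one perturbations of the identity\<close>

text \<open>Row operations with row k remove the multiples of v from the rows in T; for empty T this
  is Cramer's rule for the identity matrix.\<close>

lemma det_row_insert:
  fixes u v :: "real^'n"
  assumes "finite T" "k \<notin> T"
  shows "det (\<chi> i. if i = k then v else if i \<in> T then axis i 1 + u$i *s v else axis i 1 :: real^'n^'n) = v$k"
  using assms
proof (induction T rule: finite_induct)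
  case empty
  have row: "row j (mat 1 :: real^'n^'n) = axis j 1" for j
    by (simp add: row_def mat_def axis_def vec_eq_iff)
  have sum: "(\<Sum>j\<in>UNIV. v$j *s axis j 1) = v" by (rule basis_expansion)
  show ?case
    using cramer_lemma_transpose[of k v "mat 1"] unfolding row sum by (simp cong: if_cong)
next
  case (insert j T)
  let ?A = "(\<chi> i. if i = k then v else if i \<in> T then axis i 1 + u$i *s v else axis i 1) :: real^'n^'n"
  have "(\<chi> i. if i = k then v else if i \<in> insert j T then axis i 1 + u$i *s v else axis i 1)
      = (\<chi> i. if i = j then row j ?A + u$j *s row k ?A else row i ?A)"
    using insert.hyps insert.prems by (auto simp: vec_eq_iff row_def)
  then have "det (\<chi> i. if i = k then v else if i \<in> insert j T then axis i 1 + u$i *s v else axis i 1 :: real^'n^'n)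
      = det (\<chi> i. if i = j then row j ?A + u$j *s row k ?A else row i ?A)" by (rule arg_cong)
  also have "\<dots> = det ?A" using insert.prems by (intro det_row_operation) auto
  also have "\<dots> = v$k" using insert by simp
  finally show ?case .
qed

text \<open>The matrix determinant lemma. The rows are perturbed one at a time; by linearity in the
  new row the determinant grows by u_k times the determinant with row k replaced by v.\<close>

lemma det_rank_one:
  fixes u v :: "real^'n"
  shows "det (\<chi> i. axis i 1 + u$i *s v) = 1 + u \<bullet> v"
proof -
  have "det (\<chi> i. if i \<in> T then axis i 1 + u$i *s v else axis i 1 :: real^'n^'n) = 1 + (\<Sum>i\<in>T. u$i * v$i)"
    if "finite T" for T :: "'n set"
    using that
  proof (induction T rule: finite_induct)
    case empty
    have "(\<chi> i. axis i 1) = (mat 1 :: real^'n^'n)" by (simp add: mat_def axis_def vec_eq_iff)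
    then show ?case by simp
  next
    case (insert k T)
    let ?c = "\<lambda>i. if i \<in> T then axis i 1 + u$i *s v else axis i 1 :: real^'n"
    have "(\<chi> i. if i \<in> insert k T then axis i 1 + u$i *s v else axis i 1 :: real^'n^'n)
       = (\<chi> i. if i = k then axis i 1 + u$i *s v else ?c i)"
      using insert.hyps by (auto simp: vec_eq_iff)
    then have "det (\<chi> i. if i \<in> insert k T then axis i 1 + u$i *s v else axis i 1 :: real^'n^'n)
       = det (\<chi> i. if i = k then axis i 1 else ?c i) + det (\<chi> i. if i = k then u$i *s v else ?c i)"
      by (simp add: det_row_add)
    also have "(\<chi> i. if i = k then axis i 1 else ?c i) = (\<chi> i. ?c i)"
      using insert.hyps by (auto simp: vec_eq_iff)
    also have "(\<chi> i. if i = k then u$i *s v else ?c i) = (\<chi> i. if i = k then u$k *s v else ?c i)"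
      by (auto simp: vec_eq_iff)
    also have "det (\<chi> i. if i = k then u$k *s v else ?c i) = u$k * det (\<chi> i. if i = k then v else ?c i)"
      by (rule det_row_mul)
    finally show ?case using insert det_row_insert[OF insert.hyps, of v u] by simp
  qed
  from this[of UNIV] show ?thesis by (simp add: inner_vec_def)
qed

text \<open>The image under G of Lebesgue measure with the Jacobian as density agrees with Lebesgue
  measure restricted to T: this is checked on measurable subsets of T by the change of variables
  formula for images of sets, and nothing is carried outside T.\<close>

lemma nn_integral_rank_one_wellorder:
  fixes z :: "real^'n::{finite,wellorder}" and \<phi> :: "real^'n::_ \<Rightarrow> real"
  defines "G \<equiv> \<lambda>y. y - \<phi> y *\<^sub>R z"
  assumes S: "open S" and der: "\<And>y. y \<in> S \<Longrightarrow> (\<phi> has_derivative (\<lambda>h. g y \<bullet> h)) (at y)"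
    and g: "continuous_on S g" and inj: "inj_on G S" and T: "G ` S = T" "T \<in> sets borel"
    and f: "f \<in> borel_measurable borel"
  shows "(\<integral>\<^sup>+v\<in>T. f v \<partial>lborel) = (\<integral>\<^sup>+y\<in>S. (f (G y) * ennreal \<bar>1 - g y \<bullet> z\<bar>) \<partial>lborel)"
proof -
  let ?J = "\<lambda>y. \<bar>1 - g y \<bullet> z\<bar>"
  have derG: "(G has_derivative (\<lambda>h. h - (g y \<bullet> h) *\<^sub>R z)) (at y)" if "y \<in> S" for y
    unfolding G_def using der[OF that] by (auto intro!: derivative_eq_intros)
  have det: "\<bar>det (matrix (\<lambda>h. h - (g y \<bullet> h) *\<^sub>R z))\<bar> = ?J y" for y
  proof -
    have m: "matrix (\<lambda>h. h - (g y \<bullet> h) *\<^sub>R z) = (\<chi> i. axis i 1 + (- z)$i *s g y)"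
      by (simp add: matrix_def vec_eq_iff inner_axis) (simp add: axis_def)
    show ?thesis unfolding m det_rank_one by (simp add: inner_commute)
  qed
  have contG: "continuous_on S G"
    using has_derivative_continuous[OF derG] by (auto intro!: continuous_at_imp_continuous_on)
  have Sb [measurable]: "S \<in> sets borel" using S by simp
  \<comment> \<open>G and the Jacobian are only known to be continuous on S; extending them by 0
    makes them Borel functions on the whole space.\<close>
  define G' where "G' = (\<lambda>y. if y \<in> S then G y else 0)"
  have G' [measurable]: "G' \<in> borel_measurable borel"
    unfolding G'_def using contG Sb by (intro borel_measurable_continuous_on_if) auto
  define J' where "J' = (\<lambda>y. if y \<in> S then ?J y else 0)"
  have J' [measurable]: "J' \<in> borel_measurable borel"
    unfolding J'_def using g Sb
    by (intro borel_measurable_continuous_on_if) (auto intro!: continuous_intros)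
  define M where "M = distr (density lborel (\<lambda>y. ennreal (J' y))) borel G'"
  have emM: "emeasure M A = emeasure (density lborel (indicator T)) A" if A: "A \<in> sets borel" "A \<subseteq> T" for A
  proof -
    define P where "P = S \<inter> G' -` A"
    have P [measurable]: "P \<in> sets borel"
      unfolding P_def using A(1) measurable_sets[OF G' A(1)] by (intro sets.Int) auto
    have GP: "G ` P = A" using A(2) T(1) by (auto simp: P_def G'_def)
    have injP: "inj_on G P" using inj by (rule inj_on_subset) (auto simp: P_def)
    have derP: "(G has_derivative (\<lambda>h. h - (g y \<bullet> h) *\<^sub>R z)) (at y within P)" if "y \<in> P" for y
      by (rule has_derivative_at_withinI, rule derG) (use that in \<open>auto simp: P_def\<close>)
    have img: "A \<in> lmeasurable \<and> measure lebesgue A = m \<longleftrightarrow> (?J has_integral m) P" for m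
      using has_measure_differentiable_image[OF _ derP injP, of m] P
      unfolding GP det by simp
    have J'P: "ennreal (J' y) * indicator P y = ennreal (?J y) * indicator P y" for y
      by (auto simp: J'_def P_def indicator_def)
    have "emeasure M A = (\<integral>\<^sup>+y. ennreal (J' y) * indicator (G' -` A) y \<partial>lborel)"
      unfolding M_def using A(1) measurable_sets[OF G' A(1)] by (simp add: emeasure_distr emeasure_density)
    also have "\<dots> = (\<integral>\<^sup>+y. ennreal (?J y) * indicator P y \<partial>lborel)"
      unfolding J'P[symmetric] by (intro nn_integral_cong) (auto simp: J'_def P_def indicator_def)
    also have "\<dots> = emeasure lborel A"
    \<comment> \<open>The formula for images concerns sets of finite measure. In the infinite case a
      finite integral would, by the same equivalence, force the image to have finite
      measure.\<close>
    proof (cases "emeasure lborel A = \<infinity>")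
      case False
      then have "A \<in> lmeasurable" using A(1) by (auto simp: fmeasurable_def less_top)
      then have "(?J has_integral measure lebesgue A) P" using img[of "measure lebesgue A"] by simp
      then have "(\<integral>\<^sup>+y. ennreal (?J y) * indicator P y \<partial>lborel) = ennreal (measure lebesgue A)"
        by (intro nn_integral_has_integral_lebesgue') auto
      also have "\<dots> = emeasure lborel A"
        using False A(1) by (simp add: emeasure_eq_ennreal_measure)
      finally show ?thesis .
    next
      case True
      have "(\<integral>\<^sup>+y. ennreal (?J y) * indicator P y \<partial>lborel) = \<infinity>"
      proof (rule ccontr)
        assume "(\<integral>\<^sup>+y. ennreal (?J y) * indicator P y \<partial>lborel) \<noteq> \<infinity>"
        then obtain r where r: "r \<ge> 0" "(\<integral>\<^sup>+y. ennreal (?J y) * indicator P y \<partial>lborel) = ennreal r"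
          by (cases "(\<integral>\<^sup>+y. ennreal (?J y) * indicator P y \<partial>lborel)") auto
        have eq: "J' y * indicator P y = (if y \<in> P then ?J y else 0)" for y
          by (auto simp: J'_def P_def)
        have "((\<lambda>y. J' y * indicator P y) has_integral r) UNIV"
        proof (rule nn_integral_has_integral)
          show "(\<integral>\<^sup>+y. ennreal (J' y * indicator P y) \<partial>lborel) = ennreal r"
            unfolding r(2)[symmetric] by (intro nn_integral_cong) (auto simp: J'_def P_def indicator_def)
          show "(\<lambda>y. J' y * indicator P y) \<in> borel_measurable borel" by measurable
          show "0 \<le> J' y * indicator P y" for y by (simp add: J'_def)
        qed (use r in simp)
        then have "(?J has_integral r) P" by (simp add: eq has_integral_restrict_UNIV)
        then have "A \<in> lmeasurable" using img[of r] by simp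
        then have "emeasure lborel A < \<infinity>" using A(1) by (simp add: fmeasurable_def)
        then show False using True by simp
      qed
      then show ?thesis using True by simp
    qed
    also have "\<dots> = emeasure (density lborel (indicator T)) A"
    proof -
      have "emeasure (density lborel (indicator T)) A = (\<integral>\<^sup>+x. indicator T x * indicator A x \<partial>lborel)"
        using A(1) T(2) by (simp add: emeasure_density)
      also have "\<dots> = (\<integral>\<^sup>+x. indicator A x \<partial>lborel)"
        using A(2) by (intro nn_integral_cong) (auto simp: indicator_def)
      finally show ?thesis using A(1) by simp
    qed
    finally show ?thesis .
  qed
  have zero: "emeasure M (- T) = 0"
  proof -
    have "emeasure M (- T) = (\<integral>\<^sup>+y. ennreal (J' y) * indicator (G' -` (- T)) y \<partial>lborel)"
      unfolding M_def using T(2) measurable_sets[OF G', of "- T"] by (simp add: emeasure_distr emeasure_density)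
    also have "\<dots> = (\<integral>\<^sup>+(y::real^'n::_). 0 \<partial>lborel)"
      using T(1) by (intro nn_integral_cong) (auto simp: J'_def G'_def indicator_def)
    finally show ?thesis by simp
  qed
  have eqM: "M = density lborel (indicator T)"
  proof (rule measure_eqI)
    show "sets M = sets (density lborel (indicator T))" by (simp add: M_def)
    fix A assume "A \<in> sets M"
    then have A: "A \<in> sets borel" by (simp add: M_def)
    have "emeasure M A = emeasure M (A \<inter> T) + emeasure M (A - T)"
      using A T(2) by (subst plus_emeasure) (auto simp: M_def intro!: arg_cong[where f="emeasure _"])
    also have "emeasure M (A - T) = 0"
      using zero emeasure_mono[of "A - T" "- T" M] T(2) by (auto simp: M_def)
    also have "emeasure M (A \<inter> T) + 0 = emeasure (density lborel (indicator T)) (A \<inter> T)"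
      using A T(2) emM[of "A \<inter> T"] by auto
    also have "\<dots> = emeasure (density lborel (indicator T)) A"
      using A T(2) by (simp add: emeasure_density) (auto intro!: nn_integral_cong simp: indicator_def)
    finally show "emeasure M A = emeasure (density lborel (indicator T)) A" .
  qed
  have "(\<integral>\<^sup>+v\<in>T. f v \<partial>lborel) = (\<integral>\<^sup>+v. f v \<partial>M)"
    unfolding eqM using f T(2) by (simp add: nn_integral_density mult.commute)
  also have "\<dots> = (\<integral>\<^sup>+y. ennreal (J' y) * f (G' y) \<partial>lborel)"
    unfolding M_def using f by (simp add: nn_integral_density nn_integral_distr)
  also have "\<dots> = (\<integral>\<^sup>+y\<in>S. (f (G y) * ennreal (?J y)) \<partial>lborel)"
    by (intro nn_integral_cong) (auto simp: J'_def G'_def indicator_def mult.commute)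
  finally show ?thesis .
qed

text \<open>The change of variables formula of the library requires a well-ordered index type.\<close>

typedef (overloaded) ('n::finite) idx = "{..<CARD('n)}"
  by (rule exI[of _ 0]) simp

instantiation idx :: (finite) "{finite, wellorder}"
begin

definition "(a :: 'a idx) \<le> b \<longleftrightarrow> Rep_idx a \<le> Rep_idx b"
definition "(a :: 'a idx) < b \<longleftrightarrow> Rep_idx a < Rep_idx b"

instance
proof
  have "(UNIV :: 'a idx set) = Abs_idx ` {..<CARD('a)}"
    by (metis type_definition.Abs_image type_definition_idx)
  then show "finite (UNIV :: 'a idx set)" by (metis finite_imageI finite_lessThan)
  fix P :: "'a idx \<Rightarrow> bool" and a assume IH: "\<And>x. (\<And>y. y < x \<Longrightarrow> P y) \<Longrightarrow> P x"
  show "P a"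
    by (induction a rule: measure_induct_rule[of Rep_idx]) (rule IH, simp add: less_idx_def)
qed (auto simp: less_eq_idx_def less_idx_def Rep_idx_inject)

end

lemma ex_bij_idx: "\<exists>\<pi> :: 'n::finite idx \<Rightarrow> 'n. bij \<pi>"
proof -
  have "card (UNIV :: 'n idx set) = CARD('n)"
    using type_definition.card[OF type_definition_idx] by simp
  then show ?thesis
    using finite_same_card_bij[of "UNIV :: 'n idx set" "UNIV :: 'n set"] by auto
qed

lemma prod_Basis_cart: "(\<Prod>b\<in>Basis. f ((x::real^'n) \<bullet> b)) = (\<Prod>i\<in>UNIV. f (x $ i))"
proof -
  have B: "(Basis :: (real^'n) set) = (\<lambda>i. axis i 1) ` UNIV" by (auto simp: Basis_vec_def)
  have inj: "inj (\<lambda>i::'n. axis i (1::real))" by (auto simp: inj_on_def axis_eq_axis)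
  show ?thesis unfolding B prod.reindex[OF inj] by (simp add: inner_axis)
qed

text \<open>Relabelling coordinates maps boxes to boxes with the same side lengths, and boxes
  determine Lebesgue measure.\<close>

lemma lborel_reindex:
  fixes \<pi> :: "'m::finite \<Rightarrow> 'n::finite"
  assumes "bij \<pi>"
  shows "distr lborel borel (\<lambda>x::real^'n. \<chi> i. x $ \<pi> i) = lborel"
proof (rule lborel_eqI[symmetric])
  have m [measurable]: "(\<lambda>x::real^'n. \<chi> i. x $ \<pi> i) \<in> borel \<rightarrow>\<^sub>M borel"
    by (intro borel_measurable_continuous_onI continuous_intros)
  fix l u :: "real^'m" assume le: "\<And>b. b \<in> Basis \<Longrightarrow> l \<bullet> b \<le> u \<bullet> b"
  let ?K = "\<lambda>y::real^'m. \<chi> j. y $ inv \<pi> j"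
  have inv: "inv \<pi> (\<pi> i) = i" "\<pi> (inv \<pi> j) = j" for i j
    using assms by (simp_all add: bij_is_inj bij_is_surj surj_f_inv_f)
  have "(\<lambda>x::real^'n. \<chi> i. x $ \<pi> i) -` box l u = box (?K l) (?K u)"
    unfolding set_eq_iff vimage_eq mem_box_cart by (simp, metis inv)
  then have "emeasure (distr lborel borel (\<lambda>x::real^'n. \<chi> i. x $ \<pi> i)) (box l u) = emeasure lborel (box (?K l) (?K u))"
    by (simp add: emeasure_distr)
  also have "\<dots> = (\<Prod>b\<in>Basis. (?K u - ?K l) \<bullet> b)"
  proof (rule emeasure_lborel_box)
    fix b :: "real^'n" assume "b \<in> Basis"
    then obtain j where "b = axis j 1" by (auto simp: Basis_vec_def)
    then show "?K l \<bullet> b \<le> ?K u \<bullet> b" using le[of "axis (inv \<pi> j) 1"] by (simp add: inner_axis)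
  qed
  also have "(\<Prod>b\<in>Basis. (?K u - ?K l) \<bullet> b) = (\<Prod>j\<in>UNIV. (u - l) $ inv \<pi> j)"
    using prod_Basis_cart[of "\<lambda>t. t" "?K u - ?K l"] by simp
  also have "\<dots> = (\<Prod>i\<in>UNIV. (u - l) $ i)"
    by (rule prod.reindex_bij_betw) (rule bij_imp_bij_inv[OF assms])
  also have "\<dots> = (\<Prod>b\<in>Basis. (u - l) \<bullet> b)" using prod_Basis_cart[of "\<lambda>t. t" "u - l"] by simp
  finally show "emeasure (distr lborel borel (\<lambda>x::real^'n. \<chi> i. x $ \<pi> i)) (box l u) = ennreal (\<Prod>b\<in>Basis. (u - l) \<bullet> b)" .
qed simp

text \<open>Transport along the relabelling \<open>?J\<close>, which preserves Lebesgue measure and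
  whose inverse \<open>?K\<close> is also its adjoint; hence inner products, and with them the
  Jacobian factor, keep their form. Images under \<open>?J\<close> are preimages under
  \<open>?K\<close>, which settles openness and measurability.\<close>

theorem nn_integral_rank_one:
  fixes z :: "real^'n" and \<phi> :: "real^'n \<Rightarrow> real"
  defines "G \<equiv> \<lambda>y. y - \<phi> y *\<^sub>R z"
  assumes S: "open S" and der: "\<And>y. y \<in> S \<Longrightarrow> (\<phi> has_derivative (\<lambda>h. g y \<bullet> h)) (at y)"
    and g: "continuous_on S g" and inj: "inj_on G S" and T: "G ` S = T" "T \<in> sets borel"
    and f: "f \<in> borel_measurable borel"
  shows "(\<integral>\<^sup>+v\<in>T. f v \<partial>lborel) = (\<integral>\<^sup>+y\<in>S. (f (G y) * ennreal \<bar>1 - g y \<bullet> z\<bar>) \<partial>lborel)"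
proof -
  obtain \<pi> :: "'n idx \<Rightarrow> 'n" where \<pi>: "bij \<pi>" using ex_bij_idx by blast
  let ?J = "\<lambda>x::real^'n. \<chi> i. x $ \<pi> i" and ?K = "\<lambda>y::real^('n idx). \<chi> j. y $ inv \<pi> j"
  have inv: "inv \<pi> (\<pi> i) = i" "\<pi> (inv \<pi> j) = j" for i j
    using \<pi> by (simp_all add: bij_is_inj bij_is_surj surj_f_inv_f)
  have KJ: "?K (?J x) = x" and JK: "?J (?K y) = y" for x y
    by (simp_all add: vec_eq_iff inv)
  have contJ: "continuous_on A ?J" and contK: "continuous_on B ?K" for A B
    by (intro continuous_intros)+
  have mJ: "?J \<in> borel \<rightarrow>\<^sub>M borel" and mK: "?K \<in> borel \<rightarrow>\<^sub>M borel"
    by (intro borel_measurable_continuous_onI contJ contK)+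
  have innerJ: "?J a \<bullet> b = a \<bullet> ?K b" for a b
    unfolding inner_vec_def using sum.reindex_bij_betw[OF \<pi>, of "\<lambda>j. a $ j * b $ inv \<pi> j"] by (simp add: inv)
  have linK: "bounded_linear ?K"
    by (intro linear_conv_bounded_linear[THEN iffD1]) (auto simp: linear_iff vec_eq_iff)
  have vim: "?J ` A = ?K -` A" for A
  proof (intro equalityI subsetI)
    show "y \<in> ?K -` A" if "y \<in> ?J ` A" for y using that KJ by auto
    show "y \<in> ?J ` A" if "y \<in> ?K -` A" for y
      using imageI[of "?K y" A ?J] that unfolding JK by simp
  qed
  have change: "(\<integral>\<^sup>+v. h v \<partial>lborel) = (\<integral>\<^sup>+y. h (?K y) \<partial>lborel)" if "h \<in> borel_measurable borel" for h
  proof -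
    have "(\<integral>\<^sup>+y. h (?K y) \<partial>lborel) = (\<integral>\<^sup>+y. h (?K y) \<partial>distr lborel borel ?J)"
      by (simp add: lborel_reindex[OF \<pi>])
    also have "\<dots> = (\<integral>\<^sup>+x. h (?K (?J x)) \<partial>lborel)"
      using mJ measurable_compose[OF mK that] by (intro nn_integral_distr) auto
    finally show ?thesis unfolding KJ by simp
  qed
  have J_scale: "?J (a - c *\<^sub>R b) = ?J a - c *\<^sub>R ?J b" for a b c by (simp add: vec_eq_iff)
  have GJ: "?J (G (?K y)) = y - \<phi> (?K y) *\<^sub>R ?J z" for y
    unfolding G_def J_scale JK ..
  have "(\<integral>\<^sup>+v\<in>?J ` T. f (?K v) \<partial>lborel) = (\<integral>\<^sup>+y\<in>?J ` S. (f (?K (y - \<phi> (?K y) *\<^sub>R ?J z))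
        * ennreal \<bar>1 - ?J (g (?K y)) \<bullet> ?J z\<bar>) \<partial>lborel)"
  proof (rule nn_integral_rank_one_wellorder)
    show "open (?J ` S)" unfolding vim using contK S by (simp add: continuous_on_eq_continuous_within open_vimage)
    show "((\<lambda>y. \<phi> (?K y)) has_derivative (\<lambda>h. ?J (g (?K y)) \<bullet> h)) (at y)" if "y \<in> ?J ` S" for y
    proof -
      have "?K y \<in> S" using that unfolding vim by simp
      from has_derivative_compose[OF bounded_linear_imp_has_derivative[OF linK] der[OF this]]
      show ?thesis unfolding innerJ .
    qed
    have "continuous_on (?J ` S) (\<lambda>y. g (?K y))"
      by (rule continuous_on_compose2[OF g contK]) (auto simp: inv)
    then show "continuous_on (?J ` S) (\<lambda>y. ?J (g (?K y)))"
      by (rule continuous_on_compose2[OF contJ[of UNIV]]) auto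
    show "inj_on (\<lambda>y. y - \<phi> (?K y) *\<^sub>R ?J z) (?J ` S)"
      unfolding GJ[symmetric]
    proof (rule inj_onI)
      fix a b assume ab: "a \<in> ?J ` S" "b \<in> ?J ` S" "?J (G (?K a)) = ?J (G (?K b))"
      then have "G (?K a) = G (?K b)" using KJ by metis
      moreover have "?K a \<in> S" "?K b \<in> S" using ab(1,2) unfolding vim by auto
      ultimately have "?K a = ?K b" by (rule inj_onD[OF inj])
      then show "a = b" using JK by metis
    qed
    show "(\<lambda>y. y - \<phi> (?K y) *\<^sub>R ?J z) ` ?J ` S = ?J ` T"
      unfolding GJ[symmetric] T(1)[symmetric] image_image KJ ..
    show "?J ` T \<in> sets borel" unfolding vim using measurable_sets[OF mK T(2)] by simp
    show "(\<lambda>v. f (?K v)) \<in> borel_measurable borel" by (rule measurable_compose[OF mK f])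
  qed
  also have "\<dots> = (\<integral>\<^sup>+y\<in>S. (f (G y) * ennreal \<bar>1 - g y \<bullet> z\<bar>) \<partial>lborel)"
  proof -
    let ?h = "\<lambda>y. f (G y) * ennreal \<bar>1 - g y \<bullet> z\<bar> * indicator S y"
    have "continuous_on S G"
      unfolding G_def using has_derivative_continuous[OF der]
      by (intro continuous_intros) (auto intro!: continuous_at_imp_continuous_on)
    then have m1: "(\<lambda>y. if y \<in> S then G y else 0) \<in> borel_measurable borel"
      using S by (intro borel_measurable_continuous_on_if) auto
    have m2: "(\<lambda>y. if y \<in> S then \<bar>1 - g y \<bullet> z\<bar> else 0) \<in> borel_measurable borel"
      using S g by (intro borel_measurable_continuous_on_if continuous_intros) auto
    \<comment> \<open>Off S nothing is assumed about G and g, so measurability is shown for the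
      integrand with these values replaced by 0; the indicator hides the change.\<close>
    have "(\<lambda>y. f (if y \<in> S then G y else 0) * ennreal (if y \<in> S then \<bar>1 - g y \<bullet> z\<bar> else 0) * indicator S y) \<in> borel_measurable borel"
      by (intro borel_measurable_times_ennreal measurable_compose[OF m1 f] measurable_compose[OF m2 measurable_ennreal]
          borel_measurable_indicator) (use S in auto)
    moreover have "(\<lambda>y. f (if y \<in> S then G y else 0) * ennreal (if y \<in> S then \<bar>1 - g y \<bullet> z\<bar> else 0) * indicator S y) = ?h"
      by (auto simp: fun_eq_iff indicator_def)
    ultimately have "?h \<in> borel_measurable borel" by simp
    from change[OF this] show ?thesis
      unfolding GJ[symmetric] KJ innerJ vim by (simp add: indicator_def)
  qed
  also have "(\<integral>\<^sup>+v\<in>?J ` T. f (?K v) \<partial>lborel) = (\<integral>\<^sup>+v\<in>T. f v \<partial>lborel)"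
    using change[of "\<lambda>v. f v * indicator T v"] f T(2) unfolding vim by (simp add: indicator_def)
  finally show ?thesis .
qed

text \<open>A reflection subtracts a multiple of m that is linear in w, with determinant 1 - 2 = -1,
  so the rank one formula applies with absolute Jacobian 1.\<close>

lemma nn_integral_swap:
  fixes f :: "real^'n \<Rightarrow> ennreal"
  assumes "f \<in> borel_measurable borel"
  shows "(\<integral>\<^sup>+w. f (swap e x w) \<partial>lborel) = (\<integral>\<^sup>+w. f w \<partial>lborel)"
proof (cases "sgn x = e")
  case False
  define m where "m = sgn x - e"
  have "m \<noteq> 0" using False by (simp add: m_def)
  then have m: "m \<bullet> m \<noteq> 0" by simp
  let ?\<phi> = "\<lambda>w. 2 * (w \<bullet> m) / (m \<bullet> m)"
  have sw: "swap e x w = w - ?\<phi> w *\<^sub>R m" for w by (simp add: swap_def m_def)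
  have "(\<integral>\<^sup>+v\<in>UNIV. f v \<partial>lborel) = (\<integral>\<^sup>+w\<in>UNIV. (f (w - ?\<phi> w *\<^sub>R m) *
      ennreal \<bar>1 - ((2 / (m \<bullet> m)) *\<^sub>R m) \<bullet> m\<bar>) \<partial>lborel)"
  proof (rule nn_integral_rank_one)
    show "(?\<phi> has_derivative (\<lambda>h. (2 / (m \<bullet> m)) *\<^sub>R m \<bullet> h)) (at y)" for y
      using m by (auto intro!: derivative_eq_intros simp: inner_commute)
    show "inj (\<lambda>w. w - ?\<phi> w *\<^sub>R m)"
      unfolding sw[symmetric] by (metis injI swap_swap)
    show "range (\<lambda>w. w - ?\<phi> w *\<^sub>R m) = UNIV"
      unfolding sw[symmetric] by (metis surjI swap_swap)
  qed (use assms in auto)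
  then show ?thesis using m by (simp add: sw)
qed (simp add: swap_def)

section \<open>Radial function and gauge of a convex body\<close>

lemma hom_ext_sgn: "hom_ext f x = f (sgn x)"
  by (simp add: hom_ext_def sgn_div_norm)

lemma hom_ext_scaleR: "0 < c \<Longrightarrow> hom_ext f (c *\<^sub>R x) = hom_ext f x"
  by (simp add: hom_ext_sgn sgn_scaleR)

text \<open>The difference of the directions splits into (y - y') / |y'| and a multiple of sgn y of
  length at most |y - y'| / |y'|. The convention sgn 0 = 0 makes y = 0 harmless.\<close>

lemma dist_sgn_le:
  fixes y y' :: "'a::real_normed_vector"
  assumes "y' \<noteq> 0"
  shows "norm (sgn y - sgn y') \<le> 2 * norm (y - y') / norm y'"
proof (cases "y = 0")
  case True
  then show ?thesis using assms by (simp add: norm_sgn)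
next
  case False
  have "sgn y - sgn y' = (y - y') /\<^sub>R norm y' + ((norm y' - norm y) / norm y') *\<^sub>R sgn y"
  proof -
    have "(norm y / norm y') *\<^sub>R sgn y = y /\<^sub>R norm y'"
      using False by (simp add: sgn_div_norm divide_inverse mult.assoc mult.left_commute)
    moreover have "((norm y' - norm y) / norm y') *\<^sub>R sgn y = sgn y - (norm y / norm y') *\<^sub>R sgn y"
      using assms by (simp add: diff_divide_distrib scaleR_diff_left)
    ultimately show ?thesis using assms by (simp add: scaleR_diff_right sgn_div_norm[of y'])
  qed
  then have "norm (sgn y - sgn y') \<le> norm ((y - y') /\<^sub>R norm y') + norm (((norm y' - norm y) / norm y') *\<^sub>R sgn y)"
    by (metis norm_triangle_ineq)
  also have "\<dots> = norm (y - y') / norm y' + \<bar>norm y' - norm y\<bar> / norm y'"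
    using False by (simp add: norm_sgn) (simp add: divide_inverse mult.commute)
  also have "\<dots> \<le> norm (y - y') / norm y' + norm (y - y') / norm y'"
    using norm_triangle_ineq3[of y' y] by (intro add_left_mono divide_right_mono) (auto simp: norm_minus_commute)
  finally show ?thesis by simp
qed

locale body =
  fixes \<Omega> :: "'a::euclidean_space set"
  assumes body: "convex_body \<Omega>" and zero_interior: "0 \<in> interior \<Omega>"
begin

definition g :: "'a \<Rightarrow> real" where "g = hom_ext (radial \<Omega>)"
text \<open>The Minkowski functional of \<Omega>, expressed through the radial function; at the
  origin the numerator vanishes and the value is 0.\<close>

definition gauge :: "'a \<Rightarrow> real" where "gauge x = norm x / g x"

lemma compact: "compact \<Omega>" and convex: "convex \<Omega>" and closed: "closed \<Omega>" and bounded: "bounded \<Omega>"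
  using body by (auto simp: convex_body_def compact_imp_closed compact_imp_bounded)

lemma zero_mem: "0 \<in> \<Omega>" using zero_interior interior_subset by blast

text \<open>Compactness makes the supremum attained and convexity fills the ray up to it. The base
  point z is arbitrary in \<Omega> because z = 0 serves the radial function and a boundary point
  serves \<open>radial_at\<close>.\<close>

lemma ray_mem_iff:
  assumes z: "z \<in> \<Omega>" and u: "norm u = 1" and "0 \<le> l"
  shows "z + l *\<^sub>R u \<in> \<Omega> \<longleftrightarrow> l \<le> Sup {l. z + l *\<^sub>R u \<in> \<Omega>}" "0 \<le> Sup {l. z + l *\<^sub>R u \<in> \<Omega>}"
    "z + Sup {l. z + l *\<^sub>R u \<in> \<Omega>} *\<^sub>R u \<in> \<Omega>"
proof -
  let ?S = "{l. z + l *\<^sub>R u \<in> \<Omega>}"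
  have 0: "0 \<in> ?S" using z by simp
  obtain B where B: "\<And>x. x \<in> \<Omega> \<Longrightarrow> norm x \<le> B" using bounded by (auto simp: bounded_iff)
  have "\<bar>l\<bar> \<le> B + norm z" if "l \<in> ?S" for l
  proof -
    have "\<bar>l\<bar> = norm (z + l *\<^sub>R u - z)" using u by simp
    also have "\<dots> \<le> norm (z + l *\<^sub>R u) + norm z" by (rule norm_triangle_ineq4)
    finally show ?thesis using B[of "z + l *\<^sub>R u"] that by simp
  qed
  then have bdd: "bdd_above ?S" by (intro bdd_aboveI[of _ "B + norm z"]) (use abs_le_D1 in blast)
  have "closed ((\<lambda>l. z + l *\<^sub>R u) -` \<Omega>)" by (intro closed_vimage closed continuous_intros)
  then have cl: "closed ?S" by (simp add: vimage_def)
  have Sup: "Sup ?S \<in> ?S" using closed_contains_Sup[OF _ bdd cl] 0 by blast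
  then show "z + Sup ?S *\<^sub>R u \<in> \<Omega>" by simp
  show pos: "0 \<le> Sup ?S" using cSup_upper[OF 0 bdd] .
  show "z + l *\<^sub>R u \<in> \<Omega> \<longleftrightarrow> l \<le> Sup ?S"
  proof
    assume "l \<le> Sup ?S"
    show "z + l *\<^sub>R u \<in> \<Omega>"
    proof (cases "Sup ?S = 0")
      case True
      then show ?thesis using \<open>l \<le> Sup ?S\<close> assms by simp
    next
      case False
      let ?t = "l / Sup ?S"
      have t: "0 \<le> ?t" "?t \<le> 1" using \<open>l \<le> Sup ?S\<close> assms pos False by auto
      have "(1 - ?t) *\<^sub>R z + ?t *\<^sub>R (z + Sup ?S *\<^sub>R u) \<in> \<Omega>"
        using t z Sup by (intro convexD[OF convex]) auto
      moreover have "(1 - ?t) *\<^sub>R z + ?t *\<^sub>R (z + Sup ?S *\<^sub>R u) = z + l *\<^sub>R u"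
        using False by (simp add: algebra_simps)
      ultimately show ?thesis by simp
    qed
  qed (use cSup_upper[OF _ bdd] in blast)
qed

text \<open>The supremum over all real l is attained at a nonnegative value, so the restriction to l
  \<ge> 0 in \<open>radial\<close> does not change it.\<close>

lemma radial_mem_iff:
  assumes "norm u = 1" "0 \<le> l"
  shows "l *\<^sub>R u \<in> \<Omega> \<longleftrightarrow> l \<le> radial \<Omega> u"
proof -
  have "Sup {l. 0 \<le> l \<and> l *\<^sub>R u \<in> \<Omega>} = Sup {l. l *\<^sub>R u \<in> \<Omega>}"
  proof (rule antisym)
    have S: "l \<le> Sup {l. l *\<^sub>R u \<in> \<Omega>}" if "0 \<le> l" "l *\<^sub>R u \<in> \<Omega>" for l
      using ray_mem_iff(1)[OF zero_mem assms(1) that(1)] that by simp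
    show "Sup {l. 0 \<le> l \<and> l *\<^sub>R u \<in> \<Omega>} \<le> Sup {l. l *\<^sub>R u \<in> \<Omega>}"
      by (rule cSup_least) (use zero_mem S in auto)
    have "Sup {l. l *\<^sub>R u \<in> \<Omega>} \<in> {l. 0 \<le> l \<and> l *\<^sub>R u \<in> \<Omega>}"
      using ray_mem_iff(2,3)[OF zero_mem assms(1), of 0] by simp
    then show "Sup {l. l *\<^sub>R u \<in> \<Omega>} \<le> Sup {l. 0 \<le> l \<and> l *\<^sub>R u \<in> \<Omega>}"
      by (rule cSup_upper) (use S in \<open>auto intro!: bdd_aboveI\<close>)
  qed
  then show ?thesis
    using ray_mem_iff(1)[OF zero_mem assms] by (simp add: radial_def)
qed

lemma obtain_ball: obtains e where "e > 0" "cball 0 e \<subseteq> \<Omega>"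
  using zero_interior by (meson mem_interior_cball)

lemma g_mem_iff: "x \<noteq> 0 \<Longrightarrow> x \<in> \<Omega> \<longleftrightarrow> norm x \<le> g x"
  using radial_mem_iff[of "sgn x" "norm x"] by (simp add: g_def hom_ext_sgn norm_sgn sgn_div_norm)

lemma g_pos: "x \<noteq> 0 \<Longrightarrow> 0 < g x"
proof -
  assume x: "x \<noteq> 0"
  obtain e where e: "e > 0" "cball 0 e \<subseteq> \<Omega>" by (rule obtain_ball)
  have "norm (e *\<^sub>R sgn x) \<le> e" using e x by (simp add: norm_sgn)
  then have "e *\<^sub>R sgn x \<in> \<Omega>" using e by (auto simp: mem_cball)
  then have "e \<le> g x" using radial_mem_iff[of "sgn x" e] x e by (simp add: g_def hom_ext_sgn norm_sgn)
  then show ?thesis using e by simp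
qed

lemma g_scaleR: "0 < c \<Longrightarrow> g (c *\<^sub>R x) = g x" by (simp add: g_def hom_ext_scaleR)

lemma g_sgn: "g (sgn x) = g x" by (cases "x = 0") (auto simp: sgn_div_norm g_scaleR)

lemma radial_min:
  shows radial_min_pos: "0 < radial_min \<Omega>" and radial_min_le: "x \<noteq> 0 \<Longrightarrow> radial_min \<Omega> \<le> g x"
proof -
  obtain e where e: "e > 0" "cball 0 e \<subseteq> \<Omega>" by (rule obtain_ball)
  have le: "e \<le> radial \<Omega> u" if u: "u \<in> sphere 0 1" for u
  proof -
    have "e *\<^sub>R u \<in> \<Omega>" using e u by auto
    then show ?thesis using radial_mem_iff[of u e] u e by simp
  qed
  have "sphere (0::'a) 1 \<noteq> {}" by simp
  then have "e \<le> radial_min \<Omega>" unfolding radial_min_def by (intro cINF_greatest le)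
  then show "0 < radial_min \<Omega>" using e by simp
  assume "x \<noteq> 0"
  then have "sgn x \<in> sphere 0 1" by (simp add: norm_sgn)
  then show "radial_min \<Omega> \<le> g x"
    unfolding radial_min_def g_def hom_ext_sgn
    by (intro cINF_lower bdd_belowI2[of _ e] le) auto
qed

lemma gauge_nonneg: "0 \<le> gauge x"
  using g_pos[of x] by (cases "x = 0") (auto simp: gauge_def)

lemma gauge_pos: "x \<noteq> 0 \<Longrightarrow> 0 < gauge x"
  using g_pos[of x] by (auto simp: gauge_def)

lemma gauge_0 [simp]: "gauge 0 = 0" by (simp add: gauge_def)

lemma gauge_scaleR: "0 \<le> c \<Longrightarrow> gauge (c *\<^sub>R x) = c * gauge x"
  by (cases "c = 0") (auto simp: gauge_def g_scaleR)

lemma gauge_le_1_iff: "gauge x \<le> 1 \<longleftrightarrow> x \<in> \<Omega>"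
  using g_mem_iff[of x] g_pos[of x] zero_mem by (cases "x = 0") (auto simp: gauge_def)

lemma gauge_normalize: "x \<noteq> 0 \<Longrightarrow> gauge (x /\<^sub>R gauge x) = 1"
  using gauge_pos[of x] by (simp add: gauge_scaleR)

lemma normalize_gauge: "x \<noteq> 0 \<Longrightarrow> x /\<^sub>R gauge x = g x *\<^sub>R sgn x"
  by (simp add: gauge_def sgn_div_norm divide_inverse)

lemma gauge_g_scaleR: "gauge (g x *\<^sub>R x) = norm x"
proof (cases "x = 0")
  case False
  then have "gauge (g x *\<^sub>R x) = g x * gauge x" using g_pos by (simp add: gauge_scaleR less_imp_le)
  then show ?thesis using g_pos[OF False] by (simp add: gauge_def)
qed simp

lemma gauge_triangle: "gauge (x + y) \<le> gauge x + gauge y"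
proof (cases "x = 0 \<or> y = 0")
  case False
  then have xy: "x \<noteq> 0" "y \<noteq> 0" by auto
  note p = gauge_pos[OF xy(1)] gauge_pos[OF xy(2)]
  let ?s = "gauge x + gauge y"
  have "x /\<^sub>R gauge x \<in> \<Omega>" "y /\<^sub>R gauge y \<in> \<Omega>"
    using gauge_normalize[OF xy(1)] gauge_normalize[OF xy(2)] gauge_le_1_iff by (metis order_refl)+
  then have "(gauge x / ?s) *\<^sub>R (x /\<^sub>R gauge x) + (gauge y / ?s) *\<^sub>R (y /\<^sub>R gauge y) \<in> \<Omega>"
    using p by (intro convexD[OF convex]) (auto simp: add_divide_distrib[symmetric])
  also have "(gauge x / ?s) *\<^sub>R (x /\<^sub>R gauge x) + (gauge y / ?s) *\<^sub>R (y /\<^sub>R gauge y) = (1 / ?s) *\<^sub>R (x + y)"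
    using p by (simp add: scaleR_add_right)
  finally have "gauge ((1 / ?s) *\<^sub>R (x + y)) \<le> 1" using gauge_le_1_iff by blast
  then show ?thesis using p by (simp add: gauge_scaleR)
qed (auto simp: gauge_nonneg)

lemma gauge_le_norm: "gauge x \<le> norm x / radial_min \<Omega>"
proof (cases "x = 0")
  case False
  then show ?thesis unfolding gauge_def
    using radial_min_le[OF False] radial_min_pos by (intro divide_left_mono mult_pos_pos g_pos) auto
qed simp

text \<open>Subadditivity reduces this to the bound of the gauge by |x| / \<rho>_min. It is one
  source of the dependence of the constants on 1/\<rho>_min.\<close>

lemma gauge_diff_le: "\<bar>gauge x - gauge y\<bar> \<le> norm (x - y) / radial_min \<Omega>"
proof -
  have "gauge x \<le> gauge y + norm (x - y) / radial_min \<Omega>" for x y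
    using gauge_triangle[of y "x - y"] gauge_le_norm[of "x - y"] by simp
  from this[of x y] this[of y x] show ?thesis by (simp add: norm_minus_commute abs_le_iff)
qed

lemma continuous_gauge: "continuous_on UNIV gauge"
proof (rule lipschitz_on_continuous_on)
  show "(1 / radial_min \<Omega>)-lipschitz_on UNIV gauge"
    using gauge_diff_le radial_min_pos by (intro lipschitz_onI) (auto simp: dist_norm)
qed

lemma continuous_g: "continuous_on (- {0}) g"
proof (rule continuous_on_eq)
  show "continuous_on (- {0}) (\<lambda>x. norm x / gauge x)"
    using gauge_pos by (intro continuous_intros continuous_on_subset[OF continuous_gauge]) (auto simp: less_imp_neq[symmetric])
  show "norm x / gauge x = g x" if "x \<in> - {0}" for x using that by (simp add: gauge_def)
qed

text \<open>The Lipschitz constant of the inverse \<open>y \<mapsto> gauge y *\<^sub>R sgn y\<close> of \<open>w \<mapsto> g w *\<^sub>R w\<close>.\<close>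

lemma bilipschitz:
  assumes "w \<noteq> 0" "w' \<noteq> 0"
  shows "radial_min \<Omega> / 3 * norm (w - w') \<le> norm (g w *\<^sub>R w - g w' *\<^sub>R w')"
proof -
  let ?y = "g w *\<^sub>R w" and ?y' = "g w' *\<^sub>R w'"
  have nz: "?y \<noteq> 0" "?y' \<noteq> 0" using assms g_pos by (auto simp: less_imp_neq[symmetric])
  have inv: "gauge (g v *\<^sub>R v) *\<^sub>R sgn (g v *\<^sub>R v) = v" if "v \<noteq> 0" for v
    using that g_pos[OF that] by (simp add: gauge_g_scaleR sgn_scaleR) (simp add: sgn_div_norm)
  have "w - w' = (gauge ?y - gauge ?y') *\<^sub>R sgn ?y + gauge ?y' *\<^sub>R (sgn ?y - sgn ?y')"
    using inv[OF assms(1)] inv[OF assms(2)] by (simp add: algebra_simps)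
  then have "norm (w - w') \<le> norm ((gauge ?y - gauge ?y') *\<^sub>R sgn ?y) + norm (gauge ?y' *\<^sub>R (sgn ?y - sgn ?y'))"
    by (metis norm_triangle_ineq)
  also have "\<dots> = \<bar>gauge ?y - gauge ?y'\<bar> + gauge ?y' * norm (sgn ?y - sgn ?y')"
    using nz gauge_nonneg[of ?y'] by (simp add: norm_sgn)
  also have "\<dots> \<le> norm (?y - ?y') / radial_min \<Omega> + (norm ?y' / radial_min \<Omega>) * (2 * norm (?y - ?y') / norm ?y')"
    using gauge_diff_le[of ?y ?y'] gauge_le_norm[of ?y'] dist_sgn_le[OF nz(2), of ?y] radial_min_pos
    by (intro add_mono mult_mono) auto
  also have "\<dots> = 3 * norm (?y - ?y') / radial_min \<Omega>" using nz by (simp add: field_simps)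
  finally show ?thesis using radial_min_pos by (simp add: field_simps)
qed

lemma interior_iff: "x \<in> interior \<Omega> \<longleftrightarrow> gauge x < 1"
proof
  assume x: "x \<in> interior \<Omega>"
  show "gauge x < 1"
  proof (cases "x = 0")
    case False
    obtain e where e: "e > 0" "cball x e \<subseteq> \<Omega>" using x by (meson mem_interior_cball)
    have "(1 + e / norm x) *\<^sub>R x \<in> cball x e" using e False by (simp add: dist_norm algebra_simps)
    then have "gauge ((1 + e / norm x) *\<^sub>R x) \<le> 1" using e gauge_le_1_iff by blast
    then have "(1 + e / norm x) * gauge x \<le> 1" using e by (subst (asm) gauge_scaleR) auto
    moreover have "gauge x < (1 + e / norm x) * gauge x" using e False gauge_pos[OF False] by (simp add: distrib_right)
    ultimately show ?thesis by simp
  qed simp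
next
  assume "gauge x < 1"
  then have "x \<in> {x. gauge x < 1}" by simp
  moreover have "open {x. gauge x < 1}"
    using open_Collect_less[OF continuous_gauge continuous_on_const] by simp
  moreover have "{x. gauge x < 1} \<subseteq> \<Omega>" using gauge_le_1_iff less_imp_le by blast
  ultimately show "x \<in> interior \<Omega>" using interiorI by blast
qed

lemma frontier_iff: "x \<in> frontier \<Omega> \<longleftrightarrow> gauge x = 1"
  using interior_iff[of x] gauge_le_1_iff[of x] closed by (auto simp: frontier_def)

lemma frontier_eq: "z \<in> frontier \<Omega> \<Longrightarrow> z = g z *\<^sub>R sgn z"
  using normalize_gauge[of z] by (cases "z = 0") (auto simp: frontier_iff)

lemma boundary_point: "norm u = 1 \<Longrightarrow> g u *\<^sub>R u \<in> frontier \<Omega>"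
  by (simp add: frontier_iff gauge_g_scaleR)

text \<open>Restricted to the line from y to x the gauge is a convex function of one variable, which
  lies above its tangent at 0.\<close>

lemma gauge_above_tangent:
  assumes "(gauge has_derivative f') (at y)"
  shows "gauge y + f' (x - y) \<le> gauge x"
proof -
  let ?\<phi> = "\<lambda>t. gauge (y + t *\<^sub>R (x - y))"
  have "convex_on UNIV ?\<phi>"
  proof (rule convex_onI)
    fix t a b :: real assume t: "0 < t" "t < 1"
    have "y + ((1 - t) *\<^sub>R a + t *\<^sub>R b) *\<^sub>R (x - y) = (1 - t) *\<^sub>R (y + a *\<^sub>R (x - y)) + t *\<^sub>R (y + b *\<^sub>R (x - y))"
      by (simp add: algebra_simps)
    then show "?\<phi> ((1 - t) *\<^sub>R a + t *\<^sub>R b) \<le> (1 - t) * ?\<phi> a + t * ?\<phi> b"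
      using gauge_triangle[of "(1 - t) *\<^sub>R (y + a *\<^sub>R (x - y))" "t *\<^sub>R (y + b *\<^sub>R (x - y))"] t
      by (simp add: gauge_scaleR)
  qed simp
  moreover have "(?\<phi> has_real_derivative f' (x - y)) (at 0)"
  proof -
    have "(?\<phi> has_derivative (\<lambda>t. f' (t *\<^sub>R (x - y)))) (at 0)"
      by (rule has_derivative_compose[of "\<lambda>t. y + t *\<^sub>R (x - y)"]) (use assms in \<open>auto intro!: derivative_eq_intros\<close>)
    moreover have "(\<lambda>t. f' (t *\<^sub>R (x - y))) = (*) (f' (x - y))"
      using linear_scale[OF has_derivative_linear[OF assms]] by (simp add: fun_eq_iff mult.commute)
    ultimately show ?thesis unfolding has_field_derivative_def by metis
  qed
  ultimately have "?\<phi> 1 - ?\<phi> 0 \<ge> f' (x - y) * (1 - 0)"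
    by (intro convex_on_imp_above_tangent[of UNIV]) auto
  then show ?thesis by simp
qed

end

section \<open>Dual quermassintegrals as integrals over the unit ball\<close>

lemma nn_integral_powr_from_0:
  assumes "0 < q" "0 \<le> r"
  shows "(\<integral>\<^sup>+t\<in>{0<..r}. ennreal (t powr (q - 1)) \<partial>lborel) = ennreal (r powr q / q)"
proof -
  have "(\<integral>\<^sup>+t\<in>{0<..r}. ennreal (t powr (q - 1)) \<partial>lborel) = (\<integral>\<^sup>+t\<in>{0..r}. ennreal (t powr (q - 1)) \<partial>lborel)"
    by (intro nn_integral_cong) (auto simp: indicator_def)
  also have "\<dots> = ennreal (r powr (q - 1 + 1) / (q - 1 + 1))"
    using assms by (intro nn_integral_has_integral_lebesgue' has_integral_powr_from_0) auto
  finally show ?thesis by simp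
qed

lemma nn_integral_translate:
  fixes f :: "'a::euclidean_space \<Rightarrow> ennreal"
  assumes "f \<in> borel_measurable borel"
  shows "(\<integral>\<^sup>+v. f (z + v) \<partial>lborel) = (\<integral>\<^sup>+y. f y \<partial>lborel)"
proof -
  have "(\<integral>\<^sup>+y. f y \<partial>lborel) = (\<integral>\<^sup>+y. f y \<partial>distr lborel borel ((+) z))"
    by (simp add: lborel_distr_plus)
  also have "\<dots> = (\<integral>\<^sup>+v. f (z + v) \<partial>lborel)"
    using assms by (intro nn_integral_distr) auto
  finally show ?thesis by simp
qed

context body
begin

lemma borel_\<Omega> [measurable]: "\<Omega> \<in> sets borel" using closed by simp

lemma g_measurable [measurable]: "g \<in> borel_measurable borel"
proof -
  have "(\<lambda>x. if x \<in> - {0} then g x else g 0) \<in> borel_measurable borel"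
    by (intro borel_measurable_continuous_on_if continuous_g) auto
  moreover have "(\<lambda>x. if x \<in> - {0} then g x else g 0) = g" by auto
  ultimately show ?thesis by simp
qed

text \<open>Extension of \<open>radial_at\<close> from directions to vectors, constant on rays. For
  z in \<Omega> its value is nonnegative because l = 0 is admissible in the supremum.\<close>

definition R :: "'a \<Rightarrow> 'a \<Rightarrow> real" where
  "R z v = (if v = 0 then 0 else radial_at \<Omega> z (sgn v))"

lemma radial_at_eq_Sup: "radial_at \<Omega> z u = Sup {l. z + l *\<^sub>R u \<in> \<Omega>}"
proof -
  have "l *\<^sub>R u \<in> (\<lambda>y. y - z) ` \<Omega> \<longleftrightarrow> z + l *\<^sub>R u \<in> \<Omega>" for l
    by (auto simp: image_iff algebra_simps)
  then show ?thesis by (simp add: radial_at_def)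
qed

lemma R_0 [simp]: "R z 0 = 0" by (simp add: R_def)

lemma R_scaleR: "0 < c \<Longrightarrow> R z (c *\<^sub>R v) = R z v"
  by (simp add: R_def sgn_scaleR)

lemma R_sgn: "R z (sgn v) = R z v"
  by (cases "v = 0") (auto simp: sgn_div_norm R_scaleR)

lemma R_nonneg: "z \<in> \<Omega> \<Longrightarrow> 0 \<le> R z v"
  using ray_mem_iff(2)[of z "sgn v" 0] by (simp add: R_def radial_at_eq_Sup norm_sgn)

lemma R_iff:
  assumes "z \<in> \<Omega>" "v \<noteq> 0" "0 \<le> l"
  shows "z + l *\<^sub>R sgn v \<in> \<Omega> \<longleftrightarrow> l \<le> R z v"
  using ray_mem_iff(1)[of z "sgn v" l] assms by (simp add: R_def radial_at_eq_Sup norm_sgn)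

lemma R_measurable:
  assumes z: "z \<in> \<Omega>"
  shows "R z \<in> borel_measurable borel"
  unfolding borel_measurable_iff_ge
proof (intro allI)
  fix a :: real
  show "{w \<in> space borel. a \<le> R z w} \<in> sets borel"
  proof (cases "a \<le> 0")
    case True
    then have "{w \<in> space borel. a \<le> R z w} = UNIV" using R_nonneg[OF z] order_trans by auto
    then show ?thesis by simp
  next
    case False
    \<comment> \<open>For a > 0 the ray from z in direction w reaches length a exactly if its point
      at distance a lies in \<Omega>.\<close>
    then have "{w \<in> space borel. a \<le> R z w} = (\<lambda>w. z + a *\<^sub>R sgn w) -` \<Omega> \<inter> - {0}"
      using R_iff[OF z, of _ a] by (auto simp: R_def)
    moreover have "(\<lambda>w. z + a *\<^sub>R sgn w) \<in> borel_measurable borel" by measurable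
    ultimately show ?thesis
      using measurable_sets[of "\<lambda>w. z + a *\<^sub>R sgn w" borel borel \<Omega>] by auto
  qed
qed

text \<open>The dual quermassintegral with the normalised sphere integral replaced by an integral
  over the solid ball of a function of the direction, kept in \<open>ennreal\<close> until
  finiteness is known. The restriction to visible directions is built in: where R vanishes,
  \<open>0 powr q\<close> is 0 also for q < 0.\<close>

definition Q :: "real \<Rightarrow> 'a \<Rightarrow> ennreal" where
  "Q q z = (\<integral>\<^sup>+w\<in>ball 0 1. ennreal (R z w powr q) \<partial>lborel)"

lemma dual_quermass_Q:
  assumes z: "z \<in> \<Omega>"
  shows "dual_quermass q \<Omega> z = enn2real (Q q z)" "dual_quermass_finite q \<Omega> z \<longleftrightarrow> Q q z < \<infinity>"
proof -
  note [measurable] = R_measurable[OF z]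
  let ?n = "real DIM('a)"
  define f where "f = (\<lambda>u. indicator (visible \<Omega> z) u *\<^sub>R (radial_at \<Omega> z u powr q))"
  have f: "f = (\<lambda>u. if norm u = 1 then R z u powr q else 0)"
  proof
    fix u
    show "f u = (if norm u = 1 then R z u powr q else 0)"
    proof (cases "norm u = 1")
      case True
      then have u: "u \<noteq> 0" "sgn u = u" by (auto simp: sgn_div_norm)
      then have "R z u = radial_at \<Omega> z u" by (simp add: R_def)
      then show ?thesis using True R_nonneg[OF z, of u] by (auto simp: f_def visible_def indicator_def)
    qed (simp add: f_def visible_def)
  qed
  have f_meas [measurable]: "f \<in> borel_measurable borel" unfolding f by measurable
  have f0: "0 \<le> f u" for u by (simp add: f)
  have B: "ball (0::'a) 1 - {0} \<in> sets lborel" by simp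
  have sg: "sgn \<in> measurable (restrict_space lborel (ball (0::'a) 1 - {0})) (borel :: 'a measure)"
    by (intro measurable_restrict_space1) simp
  have "(\<integral>\<^sup>+u. ennreal (f u) \<partial>sphere_measure)
      = of_nat DIM('a) * (\<integral>\<^sup>+w. ennreal (f (sgn w)) \<partial>restrict_space lborel (ball (0::'a) 1 - {0}))"
    unfolding sphere_measure_def using sg
    by (subst nn_integral_scale_measure) (auto simp: nn_integral_distr)
  also have "(\<integral>\<^sup>+w. ennreal (f (sgn w)) \<partial>restrict_space lborel (ball (0::'a) 1 - {0}))
      = (\<integral>\<^sup>+w. ennreal (f (sgn w)) * indicator (ball 0 1 - {0}) w \<partial>lborel)"
    by (subst nn_integral_restrict_space) auto
  also have "\<dots> = Q q z"
    unfolding Q_def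
    by (intro nn_integral_cong) (auto simp: indicator_def f norm_sgn R_sgn)
  finally have nn: "(\<integral>\<^sup>+u. ennreal (f u) \<partial>sphere_measure) = of_nat DIM('a) * Q q z" .
  have fs: "f \<in> borel_measurable sphere_measure"
    using f_meas by (simp add: sphere_measure_def measurable_def space_scale_measure)
  \<comment> \<open>For a nonnegative function the Bochner integral equals \<open>enn2real\<close>
    of the extended one even if the latter is infinite, both being 0; so the value can be identified
    before integrability.\<close>
  have "(LINT u:visible \<Omega> z|sphere_measure. radial_at \<Omega> z u powr q) = enn2real (of_nat DIM('a) * Q q z)"
    unfolding set_lebesgue_integral_def nn[symmetric] f_def[symmetric]
    using fs f0 by (intro integral_eq_nn_integral) (auto simp: f_def)
  then show "dual_quermass q \<Omega> z = enn2real (Q q z)"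
    by (simp add: dual_quermass_def enn2real_mult)
  have "dual_quermass_finite q \<Omega> z \<longleftrightarrow> integrable sphere_measure f"
    by (simp add: dual_quermass_finite_def set_integrable_def f_def)
  also have "\<dots> \<longleftrightarrow> (\<integral>\<^sup>+u. ennreal (f u) \<partial>sphere_measure) < \<infinity>"
    using fs f0 by (simp add: integrable_iff_bounded)
  also have "\<dots> \<longleftrightarrow> Q q z < \<infinity>"
    unfolding nn by (auto simp: ennreal_mult_less_top of_nat_less_top)
  finally show "dual_quermass_finite q \<Omega> z \<longleftrightarrow> Q q z < \<infinity>" .
qed

text \<open>Polar coordinates around z: along each ray the body occupies 0 < t \<le> R, so a kernel
  whose radial integral is \<open>c * R z w powr q\<close> integrates to c times Q. Two kernels are
  put in below.\<close>

lemma polar_body: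
  assumes z: "z \<in> \<Omega>" and h: "h \<in> borel_measurable borel"
    and inner: "\<And>w. w \<noteq> 0 \<Longrightarrow> (\<integral>\<^sup>+t\<in>{0<..R z w}. (ennreal (real DIM('a) * t powr (real DIM('a) - 1)) * ennreal (h (t *\<^sub>R sgn w))) \<partial>lborel)
      = ennreal (c * R z w powr q)"
    and c: "0 \<le> c"
  shows "(\<integral>\<^sup>+v. ennreal (h v) * indicator \<Omega> (z + v) \<partial>lborel) = ennreal c * Q q z"
proof -
  note [measurable] = R_measurable[OF z] h
  have [measurable]: "ball (0::'a) 1 \<in> sets borel" by simp
  let ?n = "DIM('a)"
  have "(\<integral>\<^sup>+v. ennreal (h v) * indicator \<Omega> (z + v) \<partial>lborel) = (\<integral>\<^sup>+w\<in>ball 0 1. (\<integral>\<^sup>+t\<in>{0<..}.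
      ennreal (real ?n * t ^ (?n - 1)) * (ennreal (h (t *\<^sub>R sgn w)) * indicator \<Omega> (z + t *\<^sub>R sgn w)) \<partial>lborel) \<partial>lborel)"
    by (rule nn_integral_polar) measurable
  also have "\<dots> = (\<integral>\<^sup>+w\<in>ball 0 1. ennreal (c * R z w powr q) \<partial>lborel)"
  proof (rule nn_integral_cong_AE, rule AE_mp[OF AE_lborel_singleton[of 0]], rule AE_I2, rule impI)
    fix w :: 'a assume w: "w \<noteq> 0"
    have "(\<integral>\<^sup>+t\<in>{0<..}. ennreal (real ?n * t ^ (?n - 1)) * (ennreal (h (t *\<^sub>R sgn w)) * indicator \<Omega> (z + t *\<^sub>R sgn w)) \<partial>lborel)
      = (\<integral>\<^sup>+t\<in>{0<..R z w}. (ennreal (real ?n * t powr (real ?n - 1)) * ennreal (h (t *\<^sub>R sgn w))) \<partial>lborel)"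
    proof (rule nn_integral_cong)
      fix t :: real
      show "ennreal (real ?n * t ^ (?n - 1)) * (ennreal (h (t *\<^sub>R sgn w)) * indicator \<Omega> (z + t *\<^sub>R sgn w)) * indicator {0<..} t
        = ennreal (real ?n * t powr (real ?n - 1)) * ennreal (h (t *\<^sub>R sgn w)) * indicator {0<..R z w} t"
      proof (cases "t > 0")
        case True
        have "t powr (real ?n - 1) = t ^ (?n - 1)" using True by (simp add: of_nat_diff flip: powr_realpow)
        moreover have "(indicator \<Omega> (z + t *\<^sub>R sgn w) :: ennreal) = indicator {0<..R z w} t"
          using R_iff[OF z w, of t] True by (auto simp: indicator_def)
        ultimately show ?thesis using True by (simp add: mult.assoc)
      qed simp
    qed
    also have "\<dots> = ennreal (c * R z w powr q)" by (rule inner[OF w])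
    finally show "(\<integral>\<^sup>+t\<in>{0<..}. ennreal (real ?n * t ^ (?n - 1)) * (ennreal (h (t *\<^sub>R sgn w)) * indicator \<Omega> (z + t *\<^sub>R sgn w)) \<partial>lborel)
        * indicator (ball 0 1) w = ennreal (c * R z w powr q) * indicator (ball 0 1) w" by simp
  qed
  also have "\<dots> = (\<integral>\<^sup>+w. ennreal c * (ennreal (R z w powr q) * indicator (ball 0 1) w) \<partial>lborel)"
    using c by (simp add: ennreal_mult mult.assoc)
  also have "\<dots> = ennreal c * Q q z"
    unfolding Q_def by (intro nn_integral_cmult) measurable
  finally show ?thesis .
qed

text \<open>The kernel R^(q - n) is constant along rays from z, so its radial integral converges for
  every real q. This replaces |v|^(q - n), whose radial integral diverges at 0 for q < 0.\<close>

lemma Q_radial: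
  assumes z: "z \<in> \<Omega>"
  shows "Q q z = (\<integral>\<^sup>+v. ennreal (R z v powr (q - real DIM('a))) * indicator \<Omega> (z + v) \<partial>lborel)"
proof -
  let ?n = "real DIM('a)"
  have "(\<integral>\<^sup>+v. ennreal (R z v powr (q - ?n)) * indicator \<Omega> (z + v) \<partial>lborel) = ennreal 1 * Q q z"
  proof (rule polar_body[OF z])
    show "(\<lambda>v. R z v powr (q - ?n)) \<in> borel_measurable borel"
      using R_measurable[OF z] by measurable
    fix w :: 'a assume w: "w \<noteq> 0"
    let ?r = "R z w"
    have r: "0 \<le> ?r" by (rule R_nonneg[OF z])
    have "(\<integral>\<^sup>+t\<in>{0<..?r}. (ennreal (?n * t powr (?n - 1)) * ennreal (R z (t *\<^sub>R sgn w) powr (q - ?n))) \<partial>lborel)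
      = (\<integral>\<^sup>+t. ennreal (?n * ?r powr (q - ?n)) * (ennreal (t powr (?n - 1)) * indicator {0<..?r} t) \<partial>lborel)"
      by (intro nn_integral_cong)
         (auto simp: indicator_def R_scaleR R_sgn mult_ac simp flip: ennreal_mult)
    also have "\<dots> = ennreal (?n * ?r powr (q - ?n)) * ennreal (?r powr ?n / ?n)"
      using r by (subst nn_integral_cmult) (auto simp: nn_integral_powr_from_0)
    also have "\<dots> = ennreal (1 * ?r powr q)"
      using r by (simp flip: ennreal_mult powr_add)
    finally show "(\<integral>\<^sup>+t\<in>{0<..?r}. (ennreal (?n * t powr (?n - 1)) * ennreal (R z (t *\<^sub>R sgn w) powr (q - ?n))) \<partial>lborel)
      = ennreal (1 * ?r powr q)" .
  qed simp
  then show ?thesis by simp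
qed

text \<open>For q > 0 the radial integral of n t^(n - 1) t^(q - n) over 0 < t \<le> R is (n / q)
  R^q, which produces the factor q / n.\<close>

lemma Q_solid:
  assumes z: "z \<in> \<Omega>" and q: "0 < q"
  shows "Q q z = ennreal (q / DIM('a)) * (\<integral>\<^sup>+v. ennreal (norm v powr (q - real DIM('a))) * indicator \<Omega> (z + v) \<partial>lborel)"
proof -
  let ?n = "real DIM('a)"
  have "(\<integral>\<^sup>+v. ennreal (norm v powr (q - ?n)) * indicator \<Omega> (z + v) \<partial>lborel) = ennreal (?n / q) * Q q z"
  proof (rule polar_body[OF z])
    fix w :: 'a assume w: "w \<noteq> 0"
    let ?r = "R z w"
    have r: "0 \<le> ?r" by (rule R_nonneg[OF z])
    have "(\<integral>\<^sup>+t\<in>{0<..?r}. (ennreal (?n * t powr (?n - 1)) * ennreal (norm (t *\<^sub>R sgn w) powr (q - ?n))) \<partial>lborel)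
      = (\<integral>\<^sup>+t. ennreal ?n * (ennreal (t powr (q - 1)) * indicator {0<..?r} t) \<partial>lborel)"
    proof (rule nn_integral_cong)
      fix t :: real
      have "?n * t powr (?n - 1) * t powr (q - ?n) = ?n * t powr (q - 1)"
        by (simp add: mult.assoc flip: powr_add)
      then show "ennreal (?n * t powr (?n - 1)) * ennreal (norm (t *\<^sub>R sgn w) powr (q - ?n)) * indicator {0<..?r} t
        = ennreal ?n * (ennreal (t powr (q - 1)) * indicator {0<..?r} t)"
        using w by (auto simp: indicator_def norm_sgn simp flip: ennreal_mult)
    qed
    also have "\<dots> = ennreal ?n * ennreal (?r powr q / q)"
      using r q by (subst nn_integral_cmult) (auto simp: nn_integral_powr_from_0)
    also have "\<dots> = ennreal (?n / q * ?r powr q)"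
      using q by (simp flip: ennreal_mult)
    finally show "(\<integral>\<^sup>+t\<in>{0<..?r}. (ennreal (?n * t powr (?n - 1)) * ennreal (norm (t *\<^sub>R sgn w) powr (q - ?n))) \<partial>lborel)
      = ennreal (?n / q * ?r powr q)" .
  qed (use q in auto)
  then have "ennreal (q / ?n) * (\<integral>\<^sup>+v. ennreal (norm v powr (q - ?n)) * indicator \<Omega> (z + v) \<partial>lborel)
     = (ennreal (q / ?n) * ennreal (?n / q)) * Q q z" by (simp add: mult.assoc)
  also have "ennreal (q / ?n) * ennreal (?n / q) = 1" using q by (simp flip: ennreal_mult)
  finally show ?thesis by simp
qed

text \<open>The map w \<mapsto> g(w) w from the unit ball onto \<Omega> stretches each ray by a
  constant factor. In polar coordinates this is a linear substitution on each ray, so the Jacobian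
  g^n appears without differentiating g.\<close>

lemma nn_integral_body:
  assumes H [measurable]: "H \<in> borel_measurable borel"
  shows "(\<integral>\<^sup>+y\<in>\<Omega>. H y \<partial>lborel) = (\<integral>\<^sup>+w\<in>ball 0 1. (H (g w *\<^sub>R w) * ennreal (g w ^ DIM('a))) \<partial>lborel)"
proof -
  let ?n = "DIM('a)"
  have [measurable]: "ball (0::'a) 1 \<in> sets borel" by simp
  have "(\<integral>\<^sup>+y\<in>\<Omega>. H y \<partial>lborel) = (\<integral>\<^sup>+w\<in>ball 0 1. (\<integral>\<^sup>+t\<in>{0<..}.
      ennreal (real ?n * t ^ (?n - 1)) * (H (t *\<^sub>R sgn w) * indicator \<Omega> (t *\<^sub>R sgn w)) \<partial>lborel) \<partial>lborel)"
    by (rule nn_integral_polar) measurable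
  also have "\<dots> = (\<integral>\<^sup>+w\<in>ball 0 1. (\<integral>\<^sup>+t\<in>{0<..}. ennreal (real ?n * t ^ (?n - 1)) *
      (H (g (t *\<^sub>R sgn w) *\<^sub>R (t *\<^sub>R sgn w)) * ennreal (g (t *\<^sub>R sgn w) ^ ?n) * indicator (ball 0 1) (t *\<^sub>R sgn w)) \<partial>lborel) \<partial>lborel)"
  proof (rule nn_integral_cong_AE, rule AE_mp[OF AE_lborel_singleton[of 0]], rule AE_I2, rule impI)
    fix w :: 'a assume w: "w \<noteq> 0"
    let ?r = "g w" and ?u = "sgn w"
    have r: "0 < ?r" by (rule g_pos[OF w])
    let ?G = "\<lambda>t. ennreal (real ?n * t ^ (?n - 1)) * (H (t *\<^sub>R ?u) * indicator \<Omega> (t *\<^sub>R ?u)) * indicator {0<..} t"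
    have "(\<integral>\<^sup>+t. ?G t \<partial>lborel) = ennreal ?r * (\<integral>\<^sup>+t. ?G (?r * t) \<partial>lborel)"
      using r by (subst nn_integral_real_affine[of ?G ?r 0]) auto
    also have "\<dots> = (\<integral>\<^sup>+t. ennreal ?r * ?G (?r * t) \<partial>lborel)"
      by (intro nn_integral_cmult[symmetric]) measurable
    also have "\<dots> = (\<integral>\<^sup>+t\<in>{0<..}. ennreal (real ?n * t ^ (?n - 1)) *
      (H (g (t *\<^sub>R ?u) *\<^sub>R (t *\<^sub>R ?u)) * ennreal (g (t *\<^sub>R ?u) ^ ?n) * indicator (ball 0 1) (t *\<^sub>R ?u)) \<partial>lborel)"
    \<comment> \<open>The value t = 1 is discarded because \<Omega> contains its boundary while the
      ball is open.\<close>
    proof (rule nn_integral_cong_AE, rule AE_mp[OF AE_lborel_singleton[of 1]], rule AE_I2, rule impI)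
      fix t :: real assume t1: "t \<noteq> 1"
      show "ennreal ?r * ?G (?r * t) = ennreal (real ?n * t ^ (?n - 1)) *
        (H (g (t *\<^sub>R ?u) *\<^sub>R (t *\<^sub>R ?u)) * ennreal (g (t *\<^sub>R ?u) ^ ?n) * indicator (ball 0 1) (t *\<^sub>R ?u)) * indicator {0<..} t"
      proof (cases "t > 0")
        case True
        have gt: "g (t *\<^sub>R ?u) = ?r" using True by (simp add: g_scaleR g_sgn)
        have "(?r * t) *\<^sub>R ?u \<in> \<Omega> \<longleftrightarrow> norm ((?r * t) *\<^sub>R ?u) \<le> g ((?r * t) *\<^sub>R ?u)"
          using True r w by (intro g_mem_iff) (auto simp: sgn_zero_iff)
        also have "\<dots> \<longleftrightarrow> t \<le> 1" using True r w by (simp add: g_scaleR g_sgn norm_sgn)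
        finally have ind: "(indicator \<Omega> ((?r * t) *\<^sub>R ?u) :: ennreal) = indicator (ball 0 1) (t *\<^sub>R ?u)"
          using True t1 w by (auto simp: indicator_def norm_sgn)
        have e: "?r * (real ?n * (?r * t) ^ (?n - 1)) = real ?n * t ^ (?n - 1) * ?r ^ ?n"
        proof -
          have "?r ^ ?n = ?r * ?r ^ (?n - 1)" by (metis DIM_positive power_eq_if less_not_refl)
          then show ?thesis by (simp add: power_mult_distrib)
        qed
        have "ennreal ?r * ennreal (real ?n * (?r * t) ^ (?n - 1)) = ennreal (real ?n * t ^ (?n - 1)) * ennreal (?r ^ ?n)"
          using e r True by (subst (1 2) ennreal_mult[symmetric]) auto
        then have "ennreal ?r * ?G (?r * t) = ennreal (real ?n * t ^ (?n - 1)) * ennreal (?r ^ ?n) * (H ((?r * t) *\<^sub>R ?u) * indicator \<Omega> ((?r * t) *\<^sub>R ?u))"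
          using True r by (simp flip: mult.assoc)
        then show ?thesis unfolding gt ind using True by (simp add: mult_ac)
      next
        case False
        then show ?thesis using r by (simp add: zero_less_mult_iff)
      qed
    qed
    finally show "(\<integral>\<^sup>+t. ?G t \<partial>lborel) * indicator (ball 0 1) w = (\<integral>\<^sup>+t\<in>{0<..}. ennreal (real ?n * t ^ (?n - 1)) *
      (H (g (t *\<^sub>R ?u) *\<^sub>R (t *\<^sub>R ?u)) * ennreal (g (t *\<^sub>R ?u) ^ ?n) * indicator (ball 0 1) (t *\<^sub>R ?u)) \<partial>lborel) * indicator (ball 0 1) w"
      by simp
  qed
  also have "\<dots> = (\<integral>\<^sup>+w. H (g w *\<^sub>R w) * ennreal (g w ^ ?n) * indicator (ball 0 1) w \<partial>lborel)"
    by (rule nn_integral_polar[symmetric]) measurable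
  finally show ?thesis .
qed

lemma Q_ball:
  assumes z: "z \<in> \<Omega>" and q: "0 < q"
  shows "Q q z = ennreal (q / DIM('a)) *
    (\<integral>\<^sup>+w\<in>ball 0 1. (ennreal (norm (g w *\<^sub>R w - z) powr (q - real DIM('a)) * g w ^ DIM('a))) \<partial>lborel)"
proof -
  let ?n = "real DIM('a)"
  have "(\<integral>\<^sup>+v. ennreal (norm v powr (q - ?n)) * indicator \<Omega> (z + v) \<partial>lborel)
      = (\<integral>\<^sup>+v. ennreal (norm ((z + v) - z) powr (q - ?n)) * indicator \<Omega> (z + v) \<partial>lborel)"
    by simp
  also have "\<dots> = (\<integral>\<^sup>+y\<in>\<Omega>. ennreal (norm (y - z) powr (q - ?n)) \<partial>lborel)"
    by (rule nn_integral_translate) measurable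
  also have "\<dots> = (\<integral>\<^sup>+w\<in>ball 0 1. (ennreal (norm (g w *\<^sub>R w - z) powr (q - ?n)) * ennreal (g w ^ DIM('a))) \<partial>lborel)"
    by (rule nn_integral_body) measurable
  also have "\<dots> = (\<integral>\<^sup>+w\<in>ball 0 1. (ennreal (norm (g w *\<^sub>R w - z) powr (q - ?n) * g w ^ DIM('a))) \<partial>lborel)"
  proof (rule nn_integral_cong_AE, rule AE_mp[OF AE_lborel_singleton[of 0]], rule AE_I2, rule impI)
    show "ennreal (norm (g w *\<^sub>R w - z) powr (q - ?n)) * ennreal (g w ^ DIM('a)) * indicator (ball 0 1) w
      = ennreal (norm (g w *\<^sub>R w - z) powr (q - ?n) * g w ^ DIM('a)) * indicator (ball 0 1) w" if "w \<noteq> 0" for w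
      using g_pos[OF that] by (simp add: ennreal_mult)
  qed
  finally show ?thesis unfolding Q_solid[OF z q] by simp
qed

end

lemma nn_integral_interior:
  fixes S :: "'a::euclidean_space set"
  assumes "convex S" "closed S"
  shows "(\<integral>\<^sup>+x\<in>S. f x \<partial>lborel) = (\<integral>\<^sup>+x\<in>interior S. f x \<partial>lborel)"
proof -
  have "frontier S \<in> null_sets lborel"
    using negligible_convex_frontier[OF assms(1)]
    by (simp add: negligible_iff_null_sets null_sets_completion_iff)
  then have "AE x in lborel. x \<notin> frontier S" by (rule AE_not_in)
  then show ?thesis
    using interior_subset[of S] assms(2)
    by (intro nn_integral_cong_AE) (auto elim!: eventually_mono simp: indicator_def frontier_def)
qed

lemma norm_sgn_self: "norm x *\<^sub>R sgn x = (x :: 'a::real_normed_vector)"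
  by (cases "x = 0") (auto simp: sgn_div_norm)

text \<open>The map \<open>y \<mapsto> y - gauge y *\<^sub>R z\<close> moves the segment from \<open>0\<close> to a boundary point
  \<open>\<eta>\<close> to the one from \<open>0\<close> to \<open>\<eta> - z\<close>, so it turns polar coordinates around \<open>0\<close> into polar
  coordinates around \<open>z\<close>; its Jacobian determinant is \<open>1 - gr y \<bullet> z\<close>.\<close>

locale smooth_body = body \<Omega> for \<Omega> :: "(real^'n) set" +
  fixes gr :: "real^'n \<Rightarrow> real^'n"
  assumes gauge_derivative: "\<And>y. y \<noteq> 0 \<Longrightarrow> (gauge has_derivative (\<lambda>h. gr y \<bullet> h)) (at y)"
    and continuous_gr: "continuous_on (- {0}) gr"
begin

lemma gr_measurable: "(\<lambda>y. if y \<in> - {0} then gr y else 0) \<in> borel_measurable borel"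
  by (intro borel_measurable_continuous_on_if continuous_gr) auto

text \<open>Euler's identity for the gauge, which is homogeneous of degree one: the derivative along
  the ray is computed in two ways.\<close>

lemma gr_self:
  assumes "y \<noteq> 0"
  shows "gr y \<bullet> y = gauge y"
proof -
  have "((\<lambda>t. gauge (y + t *\<^sub>R y)) has_derivative (\<lambda>t. gr y \<bullet> (t *\<^sub>R y))) (at 0)"
    by (rule has_derivative_compose[of "\<lambda>t. y + t *\<^sub>R y"])
       (use gauge_derivative[OF assms] in \<open>auto intro!: derivative_eq_intros\<close>)
  moreover have "((\<lambda>t. gauge (y + t *\<^sub>R y)) has_derivative (\<lambda>t. t * gauge y)) (at 0)"
  \<comment> \<open>The gauge is only positively homogeneous, so the two expressions are compared
    for t > -1.\<close>
  proof (rule has_derivative_transform_within_open[of "\<lambda>t. (1 + t) * gauge y" _ _ _ "{-1<..}"])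
    show "((\<lambda>t. (1 + t) * gauge y) has_derivative (\<lambda>t. t * gauge y)) (at 0)"
      by (auto intro!: derivative_eq_intros)
    show "(1 + t) * gauge y = gauge (y + t *\<^sub>R y)" if "t \<in> {-1<..}" for t
      using gauge_scaleR[of "1 + t" y] that by (simp add: scaleR_add_left)
  qed auto
  ultimately have "(\<lambda>t. gr y \<bullet> (t *\<^sub>R y)) = (\<lambda>t. t * gauge y)" by (rule has_derivative_unique)
  from fun_cong[OF this, of 1] show ?thesis by simp
qed

lemma gr_scaleR:
  assumes "y \<noteq> 0" "0 < c"
  shows "gr (c *\<^sub>R y) = gr y"
proof -
  have "((\<lambda>x. gauge (c *\<^sub>R x)) has_derivative (\<lambda>h. gr (c *\<^sub>R y) \<bullet> (c *\<^sub>R h))) (at y)"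
    by (rule has_derivative_compose[of "\<lambda>x. c *\<^sub>R x"])
       (use gauge_derivative[of "c *\<^sub>R y"] assms in \<open>auto intro!: derivative_eq_intros\<close>)
  moreover have "((\<lambda>x. gauge (c *\<^sub>R x)) has_derivative (\<lambda>h. c * (gr y \<bullet> h))) (at y)"
    using assms gauge_derivative[OF assms(1)] by (simp add: gauge_scaleR) (auto intro!: derivative_eq_intros)
  ultimately have "(\<lambda>h. gr (c *\<^sub>R y) \<bullet> (c *\<^sub>R h)) = (\<lambda>h. c * (gr y \<bullet> h))" by (rule has_derivative_unique)
  then have "gr (c *\<^sub>R y) \<bullet> h = gr y \<bullet> h" for h using assms(2) by (simp add: fun_eq_iff)
  then show ?thesis by (metis vector_eq_rdot)
qed

lemma tangent: "y \<noteq> 0 \<Longrightarrow> gauge y + gr y \<bullet> (x - y) \<le> gauge x"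
  using gauge_above_tangent[OF gauge_derivative] .

lemma gr_le: "y \<noteq> 0 \<Longrightarrow> gr y \<bullet> x \<le> gauge x"
  using tangent[of y x] gr_self[of y] by (simp add: inner_diff_right)

text \<open>If z lies strictly below the supporting hyperplane at \<eta>, the ray from z through
  \<eta> crosses it there, and the tangent inequality excludes later points from \<Omega>; so \<eta>
  is the exit point.\<close>

lemma R_boundary:
  assumes z: "z \<in> frontier \<Omega>" and \<eta>: "gauge \<eta> = 1" "gr \<eta> \<bullet> z < 1"
  shows "R z (\<eta> - z) = norm (\<eta> - z)"
proof -
  have \<eta>0: "\<eta> \<noteq> 0" using \<eta>(1) by auto
  have zO: "z \<in> \<Omega>" using z gauge_le_1_iff[of z] frontier_iff[of z] by simp
  have k: "gr \<eta> \<bullet> (\<eta> - z) > 0" using gr_self[OF \<eta>0] \<eta> by (simp add: inner_diff_right)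
  then have v: "\<eta> - z \<noteq> 0" by auto
  have eq: "norm (\<eta> - z) *\<^sub>R sgn (\<eta> - z) = \<eta> - z" using v by (simp add: sgn_div_norm)
  have "z + norm (\<eta> - z) *\<^sub>R sgn (\<eta> - z) \<in> \<Omega>" unfolding eq using \<eta> gauge_le_1_iff[of \<eta>] by simp
  then have 1: "norm (\<eta> - z) \<le> R z (\<eta> - z)" using R_iff[OF zO v] by simp
  let ?r = "R z (\<eta> - z)" and ?c = "R z (\<eta> - z) / norm (\<eta> - z) - 1"
  have "z + ?r *\<^sub>R sgn (\<eta> - z) \<in> \<Omega>" using R_iff[OF zO v, of ?r] R_nonneg[OF zO] by simp
  then have "gauge (z + ?r *\<^sub>R sgn (\<eta> - z)) \<le> 1" using gauge_le_1_iff by blast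
  moreover have "z + ?r *\<^sub>R sgn (\<eta> - z) - \<eta> = ?c *\<^sub>R (\<eta> - z)"
    by (simp add: sgn_div_norm divide_inverse scaleR_diff_left)
  ultimately have "gr \<eta> \<bullet> (?c *\<^sub>R (\<eta> - z)) \<le> 0"
    using tangent[OF \<eta>0, of "z + ?r *\<^sub>R sgn (\<eta> - z)"] \<eta> by simp
  then have "?c \<le> 0" using k by (simp add: mult_le_0_iff)
  then show ?thesis using 1 v by (simp add: divide_le_eq)
qed

text \<open>The gauge increases strictly along the segment as it arrives at \<eta>, so it is below 1
  shortly before; convexity, with value 1 at z, carries the strict inequality to all interior points
  of the segment.\<close>

lemma segment_interior:
  assumes z: "z \<in> frontier \<Omega>" and \<eta>: "gauge \<eta> = 1" "gr \<eta> \<bullet> z < 1" and s: "0 < s" "s < 1"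
  shows "gauge (z + s *\<^sub>R (\<eta> - z)) < 1"
proof -
  let ?\<phi> = "\<lambda>t. gauge (z + t *\<^sub>R (\<eta> - z))"
  have \<eta>0: "\<eta> \<noteq> 0" using \<eta>(1) by auto
  have k: "gr \<eta> \<bullet> (\<eta> - z) > 0" using gr_self[OF \<eta>0] \<eta> by (simp add: inner_diff_right)
  have "(?\<phi> has_derivative (\<lambda>t. gr \<eta> \<bullet> (t *\<^sub>R (\<eta> - z)))) (at 1)"
    by (rule has_derivative_compose[of "\<lambda>t. z + t *\<^sub>R (\<eta> - z)"])
       (use gauge_derivative[OF \<eta>0] in \<open>auto intro!: derivative_eq_intros\<close>)
  moreover have "(\<lambda>t. gr \<eta> \<bullet> (t *\<^sub>R (\<eta> - z))) = (*) (gr \<eta> \<bullet> (\<eta> - z))" by (simp add: fun_eq_iff mult.commute)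
  ultimately have "(?\<phi> has_real_derivative gr \<eta> \<bullet> (\<eta> - z)) (at 1)"
    unfolding has_field_derivative_def by metis
  from DERIV_pos_inc_left[OF this k] obtain e where e: "e > 0" "\<And>h. 0 < h \<Longrightarrow> h < e \<Longrightarrow> ?\<phi> (1 - h) < ?\<phi> 1" by blast
  \<comment> \<open>Small enough for the strict increase at \<eta>, and also small enough for the
    point 1 - h to lie beyond s.\<close>
  define h where "h = min (e / 2) ((1 - s) / 2)"
  have h: "0 < h" "h < e" "s < 1 - h" using e(1) s by (auto simp: h_def min_def field_simps)
  let ?t = "1 - h" and ?l = "s / (1 - h)"
  have l: "0 < ?l" "?l < 1" using h s by auto
  have t: "?\<phi> ?t < 1" using e(2)[OF h(1,2)] \<eta> by simp
  have "z + s *\<^sub>R (\<eta> - z) = (1 - ?l) *\<^sub>R z + ?l *\<^sub>R (z + ?t *\<^sub>R (\<eta> - z))"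
  proof -
    have "(1 - l) *\<^sub>R z + l *\<^sub>R (z + t *\<^sub>R v) = z + (l * t) *\<^sub>R v" for l t and v :: "real^'n"
      by (simp add: algebra_simps)
    moreover have "?l * ?t = s" using h s by simp
    ultimately show ?thesis by metis
  qed
  then have "?\<phi> s \<le> (1 - ?l) * gauge z + ?l * ?\<phi> ?t"
    using gauge_triangle[of "(1 - ?l) *\<^sub>R z" "?l *\<^sub>R (z + ?t *\<^sub>R (\<eta> - z))"] l by (simp add: gauge_scaleR)
  also have "\<dots> < (1 - ?l) * 1 + ?l * 1"
    using t l z by (intro add_le_less_mono mult_strict_left_mono) (auto simp: frontier_iff)
  finally show ?thesis by simp
qed

text \<open>The substitution v = y - gauge(y) z is applied to the integral with kernel R^(q - n).
  Injectivity requires that y lie off the ray of z and that z lie strictly below the tangent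
  hyperplane at y / gauge(y). Where z lies in that hyperplane the Jacobian vanishes, so these y may
  be restored afterwards.\<close>

lemma Q_shadow:
  assumes z: "z \<in> frontier \<Omega>"
  shows "Q q z = (\<integral>\<^sup>+w\<in>ball 0 1 - {w. w = 0 \<or> sgn w = sgn z}.
    (ennreal (norm (g w *\<^sub>R sgn w - z) powr (q - real CARD('n)) * (1 - gr w \<bullet> z) * g w ^ CARD('n))) \<partial>lborel)"
proof -
  let ?n = "real CARD('n)"
  have gz: "gauge z = 1" and zO: "z \<in> \<Omega>" using z frontier_iff[of z] gauge_le_1_iff[of z] by auto
  have z0: "z \<noteq> 0" using gz by auto
  note [measurable] = R_measurable[OF zO]
  define G where "G = (\<lambda>y. y - gauge y *\<^sub>R z)"
  define S where "S = interior \<Omega> \<inter> ((- {0} \<inter> (\<lambda>y. gr y \<bullet> z) -` {..<1}) \<inter> (- {0} \<inter> sgn -` (- {sgn z})))"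
  define T where "T = {v. z + v \<in> interior \<Omega>}"
  have sgn_cont: "continuous_on (- {0}) (sgn :: real^'n \<Rightarrow> real^'n)"
    unfolding sgn_div_norm[abs_def] by (intro continuous_intros) auto
  have S_iff: "y \<in> S \<longleftrightarrow> gauge y < 1 \<and> y \<noteq> 0 \<and> gr y \<bullet> z < 1 \<and> sgn y \<noteq> sgn z" for y
    by (auto simp: S_def interior_iff)
  have "open S" unfolding S_def
    by (intro open_Int open_interior continuous_open_preimage sgn_cont continuous_intros continuous_gr) auto
  have T: "T \<in> sets borel" "v \<in> T \<longleftrightarrow> gauge (z + v) < 1" for v
  proof -
    have "open ((\<lambda>v. z + v) -` interior \<Omega>)" by (intro open_vimage continuous_intros) auto
    then show "T \<in> sets borel" by (simp add: T_def vimage_def)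
    show "v \<in> T \<longleftrightarrow> gauge (z + v) < 1" by (simp add: T_def interior_iff)
  qed
  have bp: "gauge (y /\<^sub>R gauge y) = 1" "gr (y /\<^sub>R gauge y) = gr y" "G y = gauge y *\<^sub>R (y /\<^sub>R gauge y - z)" "0 < gauge y"
    if "y \<noteq> 0" for y
    using that gauge_normalize[OF that] gauge_pos[OF that] by (auto simp: gr_scaleR G_def scaleR_diff_right)
  have GR: "R z (G y) = norm (y /\<^sub>R gauge y - z)" if "y \<in> S" for y
    using that bp[of y] R_boundary[OF z, of "y /\<^sub>R gauge y"] by (simp add: S_iff R_scaleR)
  have Gsgn: "sgn (G y) = sgn (y /\<^sub>R gauge y - z)" if "y \<noteq> 0" for y
    unfolding bp(3)[OF that] using bp(4)[OF that] by (simp add: sgn_scaleR)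
  \<comment> \<open>The direction of G y determines the boundary point y / gauge(y) as the exit
    point of a ray from z, and the length of G y then determines gauge(y).\<close>
  have inj: "inj_on G S"
  proof (rule inj_onI)
    fix y y' assume S: "y \<in> S" "y' \<in> S" and eq: "G y = G y'"
    then have y0: "y \<noteq> 0" "y' \<noteq> 0" by (auto simp: S_iff)
    have "norm (y /\<^sub>R gauge y - z) *\<^sub>R sgn (y /\<^sub>R gauge y - z) = norm (y' /\<^sub>R gauge y' - z) *\<^sub>R sgn (y' /\<^sub>R gauge y' - z)"
      using GR[OF S(1)] GR[OF S(2)] Gsgn[OF y0(1)] Gsgn[OF y0(2)] eq by simp
    then have \<eta>: "y /\<^sub>R gauge y = y' /\<^sub>R gauge y'"
      unfolding norm_sgn_self by simp
    have "y /\<^sub>R gauge y - z \<noteq> 0"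
    proof
      assume "y /\<^sub>R gauge y - z = 0"
      then have "sgn y = sgn z" using bp(4)[OF y0(1)] sgn_scaleR[of "inverse (gauge y)" y] by simp
      then show False using S by (simp add: S_iff)
    qed
    then have "gauge y = gauge y'" using eq unfolding bp(3)[OF y0(1)] bp(3)[OF y0(2)] \<eta> by simp
    then show "y = y'" using \<eta> bp(4)[OF y0(1)] by simp
  qed
  have img: "G ` S = T"
  proof (intro equalityI subsetI)
    fix v assume "v \<in> G ` S"
    then obtain y where y: "y \<in> S" "v = G y" by auto
    then have y0: "y \<noteq> 0" by (simp add: S_iff)
    have "gauge (z + gauge y *\<^sub>R (y /\<^sub>R gauge y - z)) < 1"
      using y(1) bp[OF y0] by (intro segment_interior[OF z]) (auto simp: S_iff)
    then show "v \<in> T" using y(2) bp(3)[OF y0] T(2) by simp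
  next
    fix v assume "v \<in> T"
    then have v: "gauge (z + v) < 1" using T(2) by simp
    then have v0: "v \<noteq> 0" using gz by auto
    define r where "r = R z v"
    have nv: "norm v *\<^sub>R sgn v = v" using v0 by (simp add: sgn_div_norm)
    have "z + norm v *\<^sub>R sgn v \<in> \<Omega>" unfolding nv using v gauge_le_1_iff[of "z + v"] by simp
    then have r: "norm v \<le> r" "0 < r" using R_iff[OF zO v0, of "norm v"] v0 unfolding r_def
      by (auto intro: less_le_trans[of 0 "norm v"])
    \<comment> \<open>The preimage of v: follow the ray from z through z + v to its exit point
      \<eta>, and shrink \<eta> by the ratio s of |v| to the length of the whole chord.\<close>
    define \<eta> where "\<eta> = z + r *\<^sub>R sgn v"
    have "\<eta> \<in> \<Omega>" using R_iff[OF zO v0, of r] r by (simp add: \<eta>_def r_def)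
    then have "gauge \<eta> \<le> 1" using gauge_le_1_iff[of \<eta>] by simp
    moreover have "\<not> gauge \<eta> < 1"
    proof
      assume "gauge \<eta> < 1"
      then obtain e where e: "e > 0" "cball \<eta> e \<subseteq> \<Omega>" using interior_iff by (meson mem_interior_cball)
      have "z + (r + e) *\<^sub>R sgn v \<in> cball \<eta> e" using e v0 by (simp add: \<eta>_def dist_norm scaleR_add_left norm_sgn)
      then have "r + e \<le> r" using e r R_iff[OF zO v0, of "r + e"] by (auto simp: r_def)
      then show False using e by simp
    qed
    ultimately have \<eta>: "gauge \<eta> = 1" by simp
    then have \<eta>0: "\<eta> \<noteq> 0" by auto
    define s where "s = norm v / r"
    have s: "0 < s" "s \<le> 1" using r v0 by (auto simp: s_def)
    have sv: "s *\<^sub>R (\<eta> - z) = v" using r nv by (simp add: \<eta>_def s_def)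
    have s1: "s < 1"
    proof (rule ccontr)
      assume "\<not> s < 1"
      then have "s = 1" using s by simp
      then have "z + v = \<eta>" unfolding sv[symmetric] by simp
      then show False using v \<eta> by simp
    qed
    have zv: "z + v - \<eta> = (s - 1) *\<^sub>R (\<eta> - z)"
      unfolding sv[symmetric] by (simp add: scaleR_diff_left)
    have gy: "gauge (s *\<^sub>R \<eta>) = s" using s \<eta> by (simp add: gauge_scaleR)
    have "G (s *\<^sub>R \<eta>) = v" unfolding G_def gy using sv by (simp add: scaleR_diff_right)
    moreover have "s *\<^sub>R \<eta> \<in> S"
      unfolding S_iff
    proof (intro conjI)
      show "gauge (s *\<^sub>R \<eta>) < 1" using gy s1 by simp
      show "s *\<^sub>R \<eta> \<noteq> 0" using s \<eta>0 by simp
      have gs: "gr (s *\<^sub>R \<eta>) = gr \<eta>" using gr_scaleR[OF \<eta>0 s(1)] .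
      \<comment> \<open>Otherwise the chord lies in the supporting hyperplane at \<eta>, so the
        tangent inequality gives gauge \<ge> 1 at z + v, contradicting that z + v is an interior
        point.\<close>
      have "gr \<eta> \<bullet> z \<noteq> 1"
      proof
        assume "gr \<eta> \<bullet> z = 1"
        then have "gr \<eta> \<bullet> (z + v - \<eta>) = 0" unfolding zv using gr_self[OF \<eta>0] \<eta> by (simp add: inner_diff_right)
        then show False using tangent[OF \<eta>0, of "z + v"] v \<eta> by simp
      qed
      then show "gr (s *\<^sub>R \<eta>) \<bullet> z < 1" unfolding gs using gr_le[OF \<eta>0, of z] gz by simp
      show "sgn (s *\<^sub>R \<eta>) \<noteq> sgn z"
      proof
        assume "sgn (s *\<^sub>R \<eta>) = sgn z"
        then have sg: "sgn \<eta> = sgn z" using s by (simp add: sgn_scaleR)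
        have "g \<eta> = g z" using sg by (metis g_sgn)
        moreover have "\<eta> = g \<eta> *\<^sub>R sgn \<eta>" using frontier_eq[of \<eta>] \<eta> frontier_iff[of \<eta>] by simp
        moreover have "z = g z *\<^sub>R sgn z" using frontier_eq[OF z] .
        ultimately have "\<eta> = z" using sg by simp
        then show False using sv v0 by simp
      qed
    qed
    ultimately show "v \<in> G ` S" by blast
  qed
  let ?f = "\<lambda>v. ennreal (R z v powr (q - ?n))"
  \<comment> \<open>The integrand without the indicator of S; it is set to 0 at the origin and on
    the ray of z, and it vanishes by itself where the height factor does.\<close>
  define H where "H = (\<lambda>y. if y \<noteq> 0 \<and> sgn y \<noteq> sgn z
     then ennreal (norm (g y *\<^sub>R sgn y - z) powr (q - ?n) * (1 - gr y \<bullet> z)) else 0)"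
  have H [measurable]: "H \<in> borel_measurable borel"
  proof -
    note [measurable] = gr_measurable
    have "(\<lambda>y. if y \<noteq> 0 \<and> sgn y \<noteq> sgn z
      then ennreal (norm (g y *\<^sub>R sgn y - z) powr (q - ?n) * (1 - (if y \<in> - {0} then gr y else 0) \<bullet> z)) else 0) \<in> borel_measurable borel"
      by measurable
    moreover have "(\<lambda>y. if y \<noteq> 0 \<and> sgn y \<noteq> sgn z
      then ennreal (norm (g y *\<^sub>R sgn y - z) powr (q - ?n) * (1 - (if y \<in> - {0} then gr y else 0) \<bullet> z)) else 0) = H"
      by (auto simp: H_def)
    ultimately show ?thesis by simp
  qed
  have "Q q z = (\<integral>\<^sup>+v. ennreal (R z v powr (q - ?n)) * indicator \<Omega> (z + v) \<partial>lborel)"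
    using Q_radial[OF zO] by simp
  also have "\<dots> = (\<integral>\<^sup>+v. ennreal (R z ((z + v) - z) powr (q - ?n)) * indicator \<Omega> (z + v) \<partial>lborel)" by simp
  also have "\<dots> = (\<integral>\<^sup>+y\<in>\<Omega>. ennreal (R z (y - z) powr (q - ?n)) \<partial>lborel)"
    by (rule nn_integral_translate) measurable
  also have "\<dots> = (\<integral>\<^sup>+y\<in>interior \<Omega>. ennreal (R z (y - z) powr (q - ?n)) \<partial>lborel)"
    by (rule nn_integral_interior[OF convex closed])
  also have "\<dots> = (\<integral>\<^sup>+v. ennreal (R z ((z + v) - z) powr (q - ?n)) * indicator (interior \<Omega>) (z + v) \<partial>lborel)"
    by (rule nn_integral_translate[symmetric]) measurable
  also have "\<dots> = (\<integral>\<^sup>+v\<in>T. ?f v \<partial>lborel)" by (simp add: T_def indicator_def)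
  also have "\<dots> = (\<integral>\<^sup>+y\<in>S. (?f (y - gauge y *\<^sub>R z) * ennreal \<bar>1 - gr y \<bullet> z\<bar>) \<partial>lborel)"
  proof (rule nn_integral_rank_one)
    show "(gauge has_derivative (\<lambda>h. gr y \<bullet> h)) (at y)" if "y \<in> S" for y
      using that by (intro gauge_derivative) (simp add: S_iff)
    show "continuous_on S gr" by (rule continuous_on_subset[OF continuous_gr]) (auto simp: S_def)
    show "inj_on (\<lambda>y. y - gauge y *\<^sub>R z) S" using inj by (simp add: G_def)
    show "(\<lambda>y. y - gauge y *\<^sub>R z) ` S = T" using img by (simp add: G_def)
  qed (use \<open>open S\<close> T in auto)
  also have "\<dots> = (\<integral>\<^sup>+y\<in>interior \<Omega>. H y \<partial>lborel)"
  proof (rule nn_integral_cong)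
    fix y
    \<comment> \<open>The inequality gr y . z \<le> gauge z = 1 leaves equality as the only
      alternative.\<close>
    have "1 - gr y \<bullet> z = 0" if "y \<noteq> 0" "\<not> gr y \<bullet> z < 1" using gr_le[OF that(1), of z] gz that(2) by simp
    moreover have "?f (y - gauge y *\<^sub>R z) * ennreal \<bar>1 - gr y \<bullet> z\<bar> = H y" if "y \<in> S"
      using GR[OF that] that normalize_gauge[of y] unfolding G_def H_def S_iff by (auto simp flip: ennreal_mult)
    ultimately show "?f (y - gauge y *\<^sub>R z) * ennreal \<bar>1 - gr y \<bullet> z\<bar> * indicator S y = H y * indicator (interior \<Omega>) y"
      by (auto simp: indicator_def S_iff interior_iff H_def)
  qed
  also have "\<dots> = (\<integral>\<^sup>+y\<in>\<Omega>. H y \<partial>lborel)"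
    by (rule nn_integral_interior[OF convex closed, symmetric])
  also have "\<dots> = (\<integral>\<^sup>+w\<in>ball 0 1. (H (g w *\<^sub>R w) * ennreal (g w ^ CARD('n))) \<partial>lborel)"
    using nn_integral_body[OF H] by simp
  also have "\<dots> = (\<integral>\<^sup>+w\<in>ball 0 1 - {w. w = 0 \<or> sgn w = sgn z}.
    (ennreal (norm (g w *\<^sub>R sgn w - z) powr (q - ?n) * (1 - gr w \<bullet> z) * g w ^ CARD('n))) \<partial>lborel)"
  proof (rule nn_integral_cong)
    fix w :: "real^'n"
    show "H (g w *\<^sub>R w) * ennreal (g w ^ CARD('n)) * indicator (ball 0 1) w =
      ennreal (norm (g w *\<^sub>R sgn w - z) powr (q - ?n) * (1 - gr w \<bullet> z) * g w ^ CARD('n))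
        * indicator (ball 0 1 - {w. w = 0 \<or> sgn w = sgn z}) w"
    proof (cases "w = 0")
      case False
      have gw: "0 < g w" using g_pos[OF False] .
      have "1 - gr w \<bullet> z \<ge> 0" using gr_le[OF False, of z] gz by simp
      then show ?thesis
        using False gw by (auto simp: H_def indicator_def sgn_scaleR g_scaleR gr_scaleR ennreal_mult)
    qed (simp add: H_def)
  qed
  finally show ?thesis .
qed

end

section \<open>Integrability of the weights\<close>

text \<open>Translating by e puts the unit ball inside the ball of radius 2 around the origin, which
  gives one constant for all e; in polar coordinates the condition is n + b > 0.\<close>

lemma nn_integral_norm_powr_finite:
  assumes "- real DIM('a) < b"
  shows "\<exists>C\<ge>0. \<forall>e::'a::euclidean_space. norm e = 1 \<longrightarrow> (\<integral>\<^sup>+w\<in>ball 0 1. ennreal (norm (w - e) powr b) \<partial>lborel) \<le> ennreal C"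
proof -
  let ?n = "real DIM('a)"
  have [measurable]: "cball (0::'a) 2 \<in> sets borel" "ball (0::'a) 1 \<in> sets borel" by simp_all
  have "(\<integral>\<^sup>+v\<in>cball (0::'a) 2. ennreal (norm v powr b) \<partial>lborel)
    = (\<integral>\<^sup>+w\<in>ball (0::'a) 1. (\<integral>\<^sup>+t\<in>{0<..}. ennreal (?n * t ^ (DIM('a) - 1)) * (ennreal (norm (t *\<^sub>R sgn w) powr b) * indicator (cball 0 2) (t *\<^sub>R sgn w)) \<partial>lborel) \<partial>lborel)"
    by (rule nn_integral_polar) measurable
  also have "\<dots> = (\<integral>\<^sup>+w\<in>ball (0::'a) 1. ennreal (?n * (2 powr (?n + b) / (?n + b))) \<partial>lborel)"
  proof (rule nn_integral_cong_AE, rule AE_mp[OF AE_lborel_singleton[of 0]], rule AE_I2, rule impI)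
    fix w :: 'a assume w: "w \<noteq> 0"
    have "(\<integral>\<^sup>+t\<in>{0<..}. ennreal (?n * t ^ (DIM('a) - 1)) * (ennreal (norm (t *\<^sub>R sgn w) powr b) * indicator (cball 0 2) (t *\<^sub>R sgn w)) \<partial>lborel)
      = (\<integral>\<^sup>+t. ennreal ?n * (ennreal (t powr (?n + b - 1)) * indicator {0<..2} t) \<partial>lborel)"
    proof (rule nn_integral_cong)
      fix t :: real
      show "ennreal (?n * t ^ (DIM('a) - 1)) * (ennreal (norm (t *\<^sub>R sgn w) powr b) * indicator (cball 0 2) (t *\<^sub>R sgn w)) * indicator {0<..} t
        = ennreal ?n * (ennreal (t powr (?n + b - 1)) * indicator {0<..2} t)"
      proof (cases "t > 0")
        case True
        have "t ^ (DIM('a) - 1) = t powr (?n - 1)" using True by (simp add: of_nat_diff flip: powr_realpow)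
        then have "?n * t ^ (DIM('a) - 1) * t powr b = ?n * t powr (?n + b - 1)"
          by (simp add: mult.assoc algebra_simps flip: powr_add)
        then show ?thesis using True w
          by (auto simp: indicator_def norm_sgn simp flip: ennreal_mult mult.assoc)
      qed simp
    qed
    also have "\<dots> = ennreal (?n * (2 powr (?n + b) / (?n + b)))"
      using assms by (subst nn_integral_cmult) (auto simp: nn_integral_powr_from_0 simp flip: ennreal_mult)
    finally show "(\<integral>\<^sup>+t\<in>{0<..}. ennreal (?n * t ^ (DIM('a) - 1)) * (ennreal (norm (t *\<^sub>R sgn w) powr b) * indicator (cball 0 2) (t *\<^sub>R sgn w)) \<partial>lborel) * indicator (ball 0 1) w
      = ennreal (?n * (2 powr (?n + b) / (?n + b))) * indicator (ball 0 1) w" by simp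
  qed
  also have "\<dots> = ennreal (?n * (2 powr (?n + b) / (?n + b))) * emeasure lborel (ball (0::'a) 1)"
    by (rule nn_integral_cmult_indicator) simp
  also have "\<dots> < \<infinity>" using emeasure_bounded_finite[OF bounded_ball, of 0 1] by (auto simp: ennreal_mult_less_top)
  finally obtain C where C: "0 \<le> C" "(\<integral>\<^sup>+v\<in>cball (0::'a) 2. ennreal (norm v powr b) \<partial>lborel) = ennreal C"
    by (cases "(\<integral>\<^sup>+v\<in>cball (0::'a) 2. ennreal (norm v powr b) \<partial>lborel)") auto
  show ?thesis
  proof (intro exI[of _ C] conjI allI impI)
    show "0 \<le> C" by fact
    fix e :: 'a assume e: "norm e = 1"
    have "(\<integral>\<^sup>+w\<in>ball 0 1. ennreal (norm (w - e) powr b) \<partial>lborel)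
      \<le> (\<integral>\<^sup>+w. ennreal (norm (- e + w) powr b) * indicator (cball 0 2) (- e + w) \<partial>lborel)"
    proof (rule nn_integral_mono)
      fix w :: 'a
      have "norm (w - e) \<le> 2" if "norm w < 1" using norm_triangle_ineq4[of w e] that e by simp
      then show "ennreal (norm (w - e) powr b) * indicator (ball 0 1) w \<le> ennreal (norm (- e + w) powr b) * indicator (cball 0 2) (- e + w)"
        by (auto simp: indicator_def)
    qed
    also have "\<dots> = ennreal C" unfolding C(2)[symmetric] by (rule nn_integral_translate) measurable
    finally show "(\<integral>\<^sup>+w\<in>ball 0 1. ennreal (norm (w - e) powr b) \<partial>lborel) \<le> ennreal C" .
  qed
qed

text \<open>For \<open>1 - d / 4 < t < 1\<close> with \<open>d = |sgn w - e|\<close> one has \<open>|t sgn w - e| \<le> 5 d / 4\<close>, so that the inner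
  integral of the polar representation of the previous lemma (with exponent \<open>a - 1\<close>) dominates \<open>d powr a\<close>.\<close>

lemma nn_integral_sgn_powr_finite:
  assumes a: "1 - real DIM('a) < a" "a < 1"
  shows "\<exists>C\<ge>0. \<forall>e::'a::euclidean_space. norm e = 1 \<longrightarrow> (\<integral>\<^sup>+w\<in>ball 0 1 - {0}. ennreal (norm (sgn w - e) powr a) \<partial>lborel) \<le> ennreal C"
proof -
  let ?n = "real DIM('a)"
  have [measurable]: "ball (0::'a) 1 \<in> sets borel" by simp
  have "- ?n < a - 1" using a by simp
  then obtain C where C: "0 \<le> C" "\<And>e::'a. norm e = 1 \<Longrightarrow> (\<integral>\<^sup>+w\<in>ball 0 1. ennreal (norm (w - e) powr (a - 1)) \<partial>lborel) \<le> ennreal C"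
    using nn_integral_norm_powr_finite by blast
  \<comment> \<open>Product of the lower bounds on the interval: t > 1/2 gives (1/2)^(n - 1), the
    distance bound 5 d / 4 with a - 1 < 0 gives the power of 5/4, and the length d / 4 supplies the
    last factor.\<close>
  define c where "c = ?n * (1/2) ^ (DIM('a) - 1) * (5/4) powr (a - 1) / 4"
  have c: "c > 0" by (simp add: c_def)
  show ?thesis
  proof (intro exI[of _ "C / c"] conjI allI impI)
    show "0 \<le> C / c" using C(1) c by simp
    fix e :: 'a assume e: "norm e = 1"
    have inner: "ennreal (c * norm (sgn w - e) powr a) \<le> (\<integral>\<^sup>+t\<in>{0<..}. ennreal (?n * t ^ (DIM('a) - 1)) *
        (ennreal (norm (t *\<^sub>R sgn w - e) powr (a - 1)) * indicator (ball 0 1) (t *\<^sub>R sgn w)) \<partial>lborel)" if w: "w \<noteq> 0" for w :: 'a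
    proof (cases "sgn w = e")
      case False
      define d where "d = norm (sgn w - e)"
      have d: "0 < d" "d \<le> 2"
        using False norm_triangle_ineq4[of "sgn w" e] w e by (auto simp: d_def norm_sgn)
      let ?m = "?n * (1/2) ^ (DIM('a) - 1) * (5/4 * d) powr (a - 1)"
      have e: "c * d powr a = ?m * (d / 4)"
      proof -
        have "d powr a = d powr (a - 1) * d" using d by (simp add: powr_diff)
        then show ?thesis using d powr_mult[of "5/4" d "a - 1"] by (simp add: c_def)
      qed
      have "ennreal (c * d powr a) = ennreal ?m * emeasure lborel {1 - d/4<..<1}"
        unfolding e using d by (simp flip: ennreal_mult)
      also have "\<dots> = (\<integral>\<^sup>+t. ennreal ?m * indicator {1 - d/4<..<1} t \<partial>lborel)"
        by (rule nn_integral_cmult_indicator[symmetric]) simp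
      also have "\<dots> \<le> (\<integral>\<^sup>+t\<in>{0<..}. ennreal (?n * t ^ (DIM('a) - 1)) *
        (ennreal (norm (t *\<^sub>R sgn w - e) powr (a - 1)) * indicator (ball 0 1) (t *\<^sub>R sgn w)) \<partial>lborel)"
      proof (rule nn_integral_mono_AE)
        \<comment> \<open>Parameters with t sgn w = e must be excluded, since
          \<open>0 powr (a - 1)\<close> is 0 and would break the lower bound; there are at most two
          of them.\<close>
        have "sgn w \<noteq> 0" using w by (simp add: sgn_zero_iff)
        have "{t. t *\<^sub>R sgn w = e} \<subseteq> {norm e, - norm e}"
        proof
          fix t assume "t \<in> {t. t *\<^sub>R sgn w = e}"
          then have "\<bar>t\<bar> = norm e" using w by (auto simp: norm_sgn)
          then show "t \<in> {norm e, - norm e}" by auto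
        qed
        then have "finite {t. t *\<^sub>R sgn w = e}" by (rule finite_subset) simp
        then have "AE t in lborel. t \<notin> {t. t *\<^sub>R sgn w = e}"
          by (intro AE_not_in finite_imp_null_set_lborel)
        then show "AE t in lborel. ennreal ?m * indicator {1 - d/4<..<1} t \<le> ennreal (?n * t ^ (DIM('a) - 1)) *
          (ennreal (norm (t *\<^sub>R sgn w - e) powr (a - 1)) * indicator (ball 0 1) (t *\<^sub>R sgn w)) * indicator {0<..} t"
        proof (rule eventually_mono)
          fix t assume ne: "t \<notin> {t. t *\<^sub>R sgn w = e}"
          show "ennreal ?m * indicator {1 - d/4<..<1} t \<le> ennreal (?n * t ^ (DIM('a) - 1)) *
            (ennreal (norm (t *\<^sub>R sgn w - e) powr (a - 1)) * indicator (ball 0 1) (t *\<^sub>R sgn w)) * indicator {0<..} t"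
          proof (cases "t \<in> {1 - d/4<..<1}")
            case True
            then have t: "1/2 < t" "t < 1" "1 - t \<le> d / 4" using d by auto
            have te: "t *\<^sub>R sgn w - e = (sgn w - e) - (1 - t) *\<^sub>R sgn w" by (simp add: algebra_simps)
            have "norm (t *\<^sub>R sgn w - e) \<le> d + (1 - t)"
              unfolding te using norm_triangle_ineq4[of "sgn w - e" "(1 - t) *\<^sub>R sgn w"] w t by (simp add: d_def norm_sgn)
            then have "norm (t *\<^sub>R sgn w - e) \<le> 5/4 * d" using t by simp
            then have "(5/4 * d) powr (a - 1) \<le> norm (t *\<^sub>R sgn w - e) powr (a - 1)"
              using ne a by (intro powr_mono2') auto
            moreover have "(1/2) ^ (DIM('a) - 1) \<le> t ^ (DIM('a) - 1)" using t by (intro power_mono) auto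
            ultimately have "?m \<le> ?n * t ^ (DIM('a) - 1) * norm (t *\<^sub>R sgn w - e) powr (a - 1)"
              using t by (intro mult_mono mult_left_mono) auto
            then have "ennreal ?m \<le> ennreal (?n * t ^ (DIM('a) - 1)) * ennreal (norm (t *\<^sub>R sgn w - e) powr (a - 1))"
              using t by (simp flip: ennreal_mult)
            then show ?thesis using True t w by (simp add: norm_sgn mult.assoc)
          qed simp
        qed
      qed
      finally show ?thesis by (simp add: d_def)
    qed simp
    have "ennreal c * (\<integral>\<^sup>+w\<in>ball 0 1 - {0}. ennreal (norm (sgn w - e) powr a) \<partial>lborel)
      = (\<integral>\<^sup>+w. ennreal c * (ennreal (norm (sgn w - e) powr a) * indicator (ball 0 1 - {0}) w) \<partial>lborel)"
      by (intro nn_integral_cmult[symmetric]) measurable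
    also have "\<dots> \<le> (\<integral>\<^sup>+w\<in>ball 0 1. (\<integral>\<^sup>+t\<in>{0<..}. ennreal (?n * t ^ (DIM('a) - 1)) *
        (ennreal (norm (t *\<^sub>R sgn w - e) powr (a - 1)) * indicator (ball 0 1) (t *\<^sub>R sgn w)) \<partial>lborel) \<partial>lborel)"
    proof (rule nn_integral_mono)
      fix w :: 'a
      show "ennreal c * (ennreal (norm (sgn w - e) powr a) * indicator (ball 0 1 - {0}) w) \<le> (\<integral>\<^sup>+t\<in>{0<..}. ennreal (?n * t ^ (DIM('a) - 1)) *
        (ennreal (norm (t *\<^sub>R sgn w - e) powr (a - 1)) * indicator (ball 0 1) (t *\<^sub>R sgn w)) \<partial>lborel) * indicator (ball 0 1) w"
        using inner[of w] c by (auto simp: indicator_def ennreal_mult)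
    qed
    also have "\<dots> = (\<integral>\<^sup>+w\<in>ball 0 1. ennreal (norm (w - e) powr (a - 1)) \<partial>lborel)"
      by (rule nn_integral_polar[symmetric]) measurable
    also have "\<dots> \<le> ennreal C" by (rule C(2)[OF e])
    finally have "ennreal (1 / c) * (ennreal c * (\<integral>\<^sup>+w\<in>ball 0 1 - {0}. ennreal (norm (sgn w - e) powr a) \<partial>lborel)) \<le> ennreal (1 / c) * ennreal C"
      by (rule mult_left_mono) simp
    then show "(\<integral>\<^sup>+w\<in>ball 0 1 - {0}. ennreal (norm (sgn w - e) powr a) \<partial>lborel) \<le> ennreal (C / c)"
      using c C(1) by (simp flip: ennreal_mult mult.assoc)
  qed
qed

section \<open>Hoelder functions on the sphere and their homogeneous extensions\<close>

text \<open>Derivatives of order j of a function constant on rays are homogeneous of degree - j.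
  Differentiability everywhere off the origin is proved in the same induction: homogeneity at one
  order uses differentiability at the order below, and in turn transports differentiability away
  from the sphere.\<close>

lemma iter_deriv_scaleR:
  fixes f :: "'a::euclidean_space \<Rightarrow> real"
  assumes diff: "\<And>j vs x. j < k \<Longrightarrow> vs \<in> multi_indices j \<Longrightarrow> norm x = 1 \<Longrightarrow> iter_deriv vs (hom_ext f) differentiable (at x)"
  assumes "vs \<in> multi_indices j" "j \<le> k"
  shows "x \<noteq> 0 \<Longrightarrow> 0 < c \<Longrightarrow> iter_deriv vs (hom_ext f) (c *\<^sub>R x) = (1 / c) ^ j * iter_deriv vs (hom_ext f) x"
    and "x \<noteq> 0 \<Longrightarrow> j < k \<Longrightarrow> iter_deriv vs (hom_ext f) differentiable (at x)"
proof -
  have "(\<forall>x c. x \<noteq> 0 \<longrightarrow> 0 < c \<longrightarrow> iter_deriv vs (hom_ext f) (c *\<^sub>R x) = (1 / c) ^ j * iter_deriv vs (hom_ext f) x)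
    \<and> (j < k \<longrightarrow> (\<forall>x. x \<noteq> 0 \<longrightarrow> iter_deriv vs (hom_ext f) differentiable (at x)))"
    using assms(2,3)
  proof (induction vs arbitrary: j)
    case Nil
    then have "j = 0" by simp
    have D: "iter_deriv [] (hom_ext f) differentiable (at x)" if "0 < k" "x \<noteq> 0" for x
    proof -
      have s: "norm (sgn x) = 1" using that by (simp add: norm_sgn)
      have "(\<lambda>y. hom_ext f (y /\<^sub>R norm x)) differentiable (at x)"
        using diff[of 0 "[]", OF that(1) _ s]
        by (intro differentiable_compose[of "hom_ext f" "\<lambda>y. y /\<^sub>R norm x"]) (auto simp: sgn_div_norm)
      then show ?thesis using that by (simp add: hom_ext_scaleR)
    qed
    show ?case using D \<open>j = 0\<close> by (simp add: hom_ext_scaleR)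
  next
    case (Cons v vs)
    then obtain i where i: "j = Suc i" "vs \<in> multi_indices i" "v \<in> Basis" by (auto simp: multi_indices_def)
    let ?F = "iter_deriv vs (hom_ext f)"
    let ?G = "iter_deriv (v # vs) (hom_ext f)"
    have IH: "\<And>x c. x \<noteq> 0 \<Longrightarrow> 0 < c \<Longrightarrow> ?F (c *\<^sub>R x) = (1 / c) ^ i * ?F x"
      "\<And>x. x \<noteq> 0 \<Longrightarrow> ?F differentiable (at x)"
      using Cons.IH[OF i(2)] Cons.prems i(1) by auto
    have hom: "?G (c *\<^sub>R x) = (1 / c) ^ j * ?G x" if x: "x \<noteq> 0" and c: "0 < c" for x c
    proof -
      have d1: "(?F has_derivative frechet_derivative ?F (at x)) (at x)"
        using IH(2)[OF x] by (simp add: frechet_derivative_works)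
      have "((\<lambda>y. ?F (y /\<^sub>R c)) has_derivative (\<lambda>h. frechet_derivative ?F (at x) (h /\<^sub>R c))) (at (c *\<^sub>R x))"
        by (rule has_derivative_compose[of "\<lambda>y. y /\<^sub>R c"]) (use d1 c in \<open>auto intro!: derivative_eq_intros\<close>)
      then have "((\<lambda>y. (1 / c) ^ i * ?F (y /\<^sub>R c)) has_derivative (\<lambda>h. (1 / c) ^ i * frechet_derivative ?F (at x) (h /\<^sub>R c))) (at (c *\<^sub>R x))"
        by (rule has_derivative_mult_right)
      then have "(?F has_derivative (\<lambda>h. (1 / c) ^ i * frechet_derivative ?F (at x) (h /\<^sub>R c))) (at (c *\<^sub>R x))"
      proof (rule has_derivative_transform_within_open[of _ _ _ _ "- {0}"])
        show "(1 / c) ^ i * ?F (y /\<^sub>R c) = ?F y" if "y \<in> - {0}" for y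
          using IH(1)[of "y /\<^sub>R c" c] that c by simp
      qed (use x c in auto)
      from partial_eqI[OF this, of v] have "?G (c *\<^sub>R x) = (1 / c) ^ i * frechet_derivative ?F (at x) (v /\<^sub>R c)" by simp
      also have "frechet_derivative ?F (at x) (v /\<^sub>R c) = (1 / c) * ?G x"
        using linear_scale[OF has_derivative_linear[OF d1]] by (simp add: divide_inverse)
      finally show ?thesis by (simp add: i(1))
    qed
    have "?G differentiable (at x)" if "j < k" "x \<noteq> 0" for x
    proof -
      have s: "norm (sgn x) = 1" using that by (simp add: norm_sgn)
      have "(\<lambda>y. ?G (y /\<^sub>R norm x)) differentiable (at x)"
        using diff[OF that(1) Cons.prems(1) s]
        by (intro differentiable_compose[of ?G "\<lambda>y. y /\<^sub>R norm x"]) (auto simp: sgn_div_norm)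
      then have D: "(\<lambda>y. (1 / norm x) ^ j * ?G (y /\<^sub>R norm x)) differentiable (at x)" by (intro differentiable_mult) auto
      show ?thesis
      proof (rule differentiable_cong_open[OF _ _ _ D])
        show "(1 / norm x) ^ j * ?G (y /\<^sub>R norm x) = ?G y" if "y \<in> - {0}" for y
          using hom[of "y /\<^sub>R norm x" "norm x"] that \<open>x \<noteq> 0\<close> by simp
      qed (use that in auto)
    qed
    with hom show ?case by blast
  qed
  then show "x \<noteq> 0 \<Longrightarrow> 0 < c \<Longrightarrow> iter_deriv vs (hom_ext f) (c *\<^sub>R x) = (1 / c) ^ j * iter_deriv vs (hom_ext f) x"
    and "x \<noteq> 0 \<Longrightarrow> j < k \<Longrightarrow> iter_deriv vs (hom_ext f) differentiable (at x)" by auto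
qed

lemma finite_multi_indices: "finite (multi_indices j :: 'a::euclidean_space list set)"
  unfolding multi_indices_def by (rule finite_lists_length_eq[OF finite_Basis])

lemma multi_indices_nonempty: "(multi_indices j :: 'a::euclidean_space list set) \<noteq> {}"
proof -
  have "replicate j (SOME b. b \<in> (Basis :: 'a set)) \<in> multi_indices j"
    using some_in_eq[of "Basis :: 'a set"] by (auto simp: multi_indices_def)
  then show ?thesis by blast
qed

text \<open>The suprema defining the norm control their members only if the sets are bounded above;
  this comes from compactness of the sphere and from the Hoelder hypothesis. An antipodal pair shows
  that the seminorm is nonnegative. The factor 2 accounts for \<alpha> = 0, where a difference is
  bounded by twice the supremum.\<close>

lemma iter_deriv_sphere_bound:
  fixes f :: "'a::euclidean_space \<Rightarrow> real"
  assumes f: "Holder_sphere k \<alpha> f"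
  shows "j \<le> k \<Longrightarrow> vs \<in> multi_indices j \<Longrightarrow> norm x = 1 \<Longrightarrow> \<bar>iter_deriv vs (hom_ext f) x\<bar> \<le> Holder_norm_sphere k \<alpha> f"
    and "vs \<in> multi_indices k \<Longrightarrow> norm x = 1 \<Longrightarrow> norm y = 1 \<Longrightarrow>
      \<bar>iter_deriv vs (hom_ext f) x - iter_deriv vs (hom_ext f) y\<bar> \<le> 2 * Holder_norm_sphere k \<alpha> f * dist x y powr \<alpha>"
proof -
  let ?D = "\<lambda>vs. iter_deriv vs (hom_ext f)"
  have cont: "continuous_on (sphere 0 1) (?D vs)" if "j \<le> k" "vs \<in> multi_indices j" for j vs
  proof (rule continuous_on_subset)
    show "continuous_on (- {0}) (?D vs)" using f that unfolding Holder_sphere_def Ck_on_def by blast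
  qed auto
  have bdd: "bdd_above ((\<lambda>(vs, x). \<bar>?D vs x\<bar>) ` (multi_indices j \<times> sphere 0 1))" if "j \<le> k" for j
  proof -
    have "bdd_above ((\<lambda>x. \<bar>?D vs x\<bar>) ` sphere 0 1)" if "vs \<in> multi_indices j" for vs
      using cont[OF \<open>j \<le> k\<close> that]
      by (intro bounded_imp_bdd_above compact_imp_bounded compact_continuous_image continuous_on_rabs) auto
    then have "\<forall>vs\<in>multi_indices j. \<exists>M. \<forall>x\<in>sphere 0 1. \<bar>?D vs x\<bar> \<le> M"
      unfolding bdd_above_def by auto
    from bchoice[OF this] obtain B where "\<And>vs x. vs \<in> multi_indices j \<Longrightarrow> x \<in> sphere 0 1 \<Longrightarrow> \<bar>?D vs x\<bar> \<le> B vs"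
      by blast
    moreover have "B vs \<le> Max (B ` multi_indices j)" if "vs \<in> multi_indices j" for vs
      using that finite_multi_indices[of j, where 'a='a] by simp
    ultimately have "\<bar>?D vs x\<bar> \<le> Max (B ` multi_indices j)" if "vs \<in> multi_indices j" "x \<in> sphere 0 1" for vs x
      using that order_trans by blast
    then show ?thesis by (intro bdd_aboveI2[of _ _ "Max (B ` multi_indices j)"]) auto
  qed
  let ?S = "\<lambda>j. SUP (vs, x)\<in>multi_indices j \<times> sphere 0 1. \<bar>?D vs x\<bar>"
  have le: "\<bar>?D vs x\<bar> \<le> ?S j" if "j \<le> k" "vs \<in> multi_indices j" "norm x = 1" for j vs x
    using cSUP_upper[OF _ bdd[OF that(1)], of "(vs, x)"] that by auto
  have S0: "0 \<le> ?S j" if "j \<le> k" for j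
  proof -
    obtain vs :: "'a list" where vs: "vs \<in> multi_indices j" using multi_indices_nonempty by blast
    obtain x :: 'a where "norm x = 1" using vector_choose_size[of 1] by auto
    then show ?thesis using le[OF that vs, of x] by simp
  qed
  have Ck: "?S j \<le> Ck_norm_sphere k f" if "j \<le> k" for j
    unfolding Ck_norm_sphere_def using that S0 by (intro member_le_sum) auto
  let ?T = "{(vs, x, y). vs \<in> multi_indices k \<and> x \<in> sphere 0 1 \<and> y \<in> sphere 0 1 \<and> x \<noteq> y}"
  have hol: "\<bar>?D vs x - ?D vs y\<bar> / dist x y powr \<alpha> \<le> Holder_seminorm_sphere k \<alpha> f"
    if "\<alpha> \<noteq> 0" "vs \<in> multi_indices k" "norm x = 1" "norm y = 1" "x \<noteq> y" for vs x y
  proof -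
    obtain L where L: "\<forall>vs\<in>multi_indices k. \<forall>x\<in>sphere 0 1. \<forall>y\<in>sphere 0 1. \<bar>?D vs x - ?D vs y\<bar> \<le> L * dist x y powr \<alpha>"
      using f \<open>\<alpha> \<noteq> 0\<close> unfolding Holder_sphere_def by blast
    have "bdd_above ((\<lambda>(vs, x, y). \<bar>?D vs x - ?D vs y\<bar> / dist x y powr \<alpha>) ` ?T)"
      using L by (intro bdd_aboveI2[of _ _ L]) (auto simp: divide_le_eq)
    then have "(\<lambda>(vs, x, y). \<bar>?D vs x - ?D vs y\<bar> / dist x y powr \<alpha>) (vs, x, y) \<le> Holder_seminorm_sphere k \<alpha> f"
      unfolding Holder_seminorm_sphere_def by (intro cSUP_upper) (use that in auto)
    then show ?thesis by simp
  qed
  have semi0: "0 \<le> Holder_seminorm_sphere k \<alpha> f" if "\<alpha> \<noteq> 0"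
  proof -
    obtain vs :: "'a list" where vs: "vs \<in> multi_indices k" using multi_indices_nonempty by blast
    obtain x :: 'a where x: "norm x = 1" using vector_choose_size[of 1] by auto
    then have "x \<noteq> - x" by (metis add.inverse_unique norm_zero pth_1 scaleR_2 scaleR_eq_0_iff zero_neq_numeral zero_neq_one eq_neg_iff_add_eq_0)
    then show ?thesis using hol[OF that vs x, of "- x"] x
      by (smt (verit) divide_nonneg_nonneg norm_minus_cancel powr_ge_zero)
  qed
  have N: "Ck_norm_sphere k f \<le> Holder_norm_sphere k \<alpha> f"
    using semi0 by (simp add: Holder_norm_sphere_def)
  show b: "\<bar>?D vs x\<bar> \<le> Holder_norm_sphere k \<alpha> f" if "j \<le> k" "vs \<in> multi_indices j" "norm x = 1" for j vs x
    using le[OF that] Ck[OF that(1)] N by linarith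
  show "\<bar>?D vs x - ?D vs y\<bar> \<le> 2 * Holder_norm_sphere k \<alpha> f * dist x y powr \<alpha>"
    if "vs \<in> multi_indices k" "norm x = 1" "norm y = 1" for vs x y
  proof (cases "x = y")
    case False
    show ?thesis
    proof (cases "\<alpha> = 0")
      case True
      then show ?thesis using b[of k vs x] b[of k vs y] that False by simp
    next
      case \<alpha>: False
      have Ck0: "0 \<le> Ck_norm_sphere k f" using Ck[of k] S0[of k] by simp
      have "\<bar>?D vs x - ?D vs y\<bar> \<le> Holder_seminorm_sphere k \<alpha> f * dist x y powr \<alpha>"
        using hol[OF \<alpha> that False] False by (simp add: divide_le_eq)
      also have "\<dots> \<le> 2 * Holder_norm_sphere k \<alpha> f * dist x y powr \<alpha>"
        using Ck0 semi0[OF \<alpha>] \<alpha> by (intro mult_right_mono) (auto simp: Holder_norm_sphere_def)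
      finally show ?thesis .
    qed
  qed simp
qed

text \<open>Dividing by 4 brings both reciprocals into the unit interval, where k-th powers have
  Lipschitz constant k.\<close>

lemma power_inverse_diff_le:
  fixes a b :: real
  assumes "1/4 \<le> a" "1/4 \<le> b"
  shows "\<bar>(1 / a) ^ k - (1 / b) ^ k\<bar> \<le> 4 ^ k * real k * 4 * \<bar>a - b\<bar>"
proof -
  let ?x = "1 / (4 * a)" and ?y = "1 / (4 * b)"
  have xy: "\<bar>?x\<bar> \<le> 1" "\<bar>?y\<bar> \<le> 1" using assms by (auto simp: field_simps)
  have e: "?x - ?y = ?x * (4 * (b - a)) * ?y" using assms by (simp add: field_simps)
  have "\<bar>?x - ?y\<bar> = \<bar>?x\<bar> * (4 * \<bar>a - b\<bar>) * \<bar>?y\<bar>"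
    unfolding e abs_mult by (simp add: abs_minus_commute)
  also have "\<dots> \<le> 1 * (4 * \<bar>a - b\<bar>) * 1" using xy by (intro mult_mono) auto
  finally have "real k * \<bar>?x - ?y\<bar> \<le> real k * (4 * \<bar>a - b\<bar>)" by (intro mult_left_mono) auto
  then have "\<bar>?x ^ k - ?y ^ k\<bar> \<le> real k * (4 * \<bar>a - b\<bar>)"
    using norm_power_diff[of ?x ?y k] xy by simp
  then have "4 ^ k * \<bar>?x ^ k - ?y ^ k\<bar> \<le> 4 ^ k * (real k * (4 * \<bar>a - b\<bar>))" by (intro mult_left_mono) auto
  moreover have "4 ^ k * \<bar>?x ^ k - ?y ^ k\<bar> = \<bar>(1 / a) ^ k - (1 / b) ^ k\<bar>"
  proof -
    have "4 ^ k * (?x ^ k - ?y ^ k) = (1 / a) ^ k - (1 / b) ^ k"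
      by (simp add: right_diff_distrib power_mult_distrib power_divide)
    moreover have "4 ^ k * \<bar>?x ^ k - ?y ^ k\<bar> = \<bar>4 ^ k * (?x ^ k - ?y ^ k)\<bar>" by (simp add: abs_mult)
    ultimately show ?thesis by simp
  qed
  ultimately show ?thesis by (simp add: mult.assoc)
qed

text \<open>By homogeneity every bound on the shell follows from one on the sphere, with constants
  depending on s but not on the function.\<close>

lemma smooth_family_hom_ext:
  fixes f :: "'i \<Rightarrow> 'a::euclidean_space \<Rightarrow> real"
  assumes f: "\<And>i. i \<in> I \<Longrightarrow> Holder_sphere k \<alpha> (f i)" "\<And>i. i \<in> I \<Longrightarrow> Holder_norm_sphere k \<alpha> (f i) \<le> s"
    and \<alpha>: "0 \<le> \<alpha>" "\<alpha> \<le> 1"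
  shows "smooth_family I k \<alpha> (\<lambda>i. hom_ext (f i))"
proof -
  \<comment> \<open>The absolute value keeps the constant nonnegative when the family is
    empty.\<close>
  define s' where "s' = \<bar>s\<bar>"
  have s': "0 \<le> s'" by (simp add: s'_def)
  have sph: "norm (sgn x) = 1" if "x \<noteq> 0" for x :: 'a using that by (simp add: norm_sgn)
  have diff: "iter_deriv vs (hom_ext (f i)) differentiable (at x)"
    if "i \<in> I" "j < k" "vs \<in> multi_indices j" "norm x = 1" for i j vs x
  proof -
    have "x \<in> - {0}" using that by auto
    then show ?thesis using f(1)[OF that(1)] that unfolding Holder_sphere_def Ck_on_def by blast
  qed
  have scale: "iter_deriv vs (hom_ext (f i)) x = (1 / norm x) ^ j * iter_deriv vs (hom_ext (f i)) (sgn x)"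
    if "i \<in> I" "j \<le> k" "vs \<in> multi_indices j" "x \<noteq> 0" for i j vs x
  proof -
    have "iter_deriv vs (hom_ext (f i)) (norm x *\<^sub>R sgn x) = (1 / norm x) ^ j * iter_deriv vs (hom_ext (f i)) (sgn x)"
      by (rule iter_deriv_scaleR(1)[of k, OF _ that(3,2)]) (use diff[OF that(1)] that in \<open>auto simp: sgn_zero_iff\<close>)
    then show ?thesis by (simp add: norm_sgn_self)
  qed
  have bd: "\<bar>iter_deriv vs (hom_ext (f i)) x\<bar> \<le> s'" if "i \<in> I" "j \<le> k" "vs \<in> multi_indices j" "norm x = 1" for i j vs x
    using iter_deriv_sphere_bound(1)[OF f(1)[OF that(1)] that(2-4)] f(2)[OF that(1)] by (simp add: s'_def)
  have hol: "\<bar>iter_deriv vs (hom_ext (f i)) x - iter_deriv vs (hom_ext (f i)) y\<bar> \<le> 2 * s' * dist x y powr \<alpha>"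
    if "i \<in> I" "vs \<in> multi_indices k" "norm x = 1" "norm y = 1" for i vs x y
  proof -
    have "\<bar>iter_deriv vs (hom_ext (f i)) x - iter_deriv vs (hom_ext (f i)) y\<bar> \<le> 2 * Holder_norm_sphere k \<alpha> (f i) * dist x y powr \<alpha>"
      using iter_deriv_sphere_bound(2)[OF f(1)[OF that(1)] that(2-4)] .
    also have "\<dots> \<le> 2 * s' * dist x y powr \<alpha>" using f(2)[OF that(1)] by (intro mult_right_mono) (auto simp: s'_def)
    finally show ?thesis .
  qed
  let ?A = "cball (0::'a) 1 - ball 0 (1/4)"
  have A: "x \<noteq> 0" "1/4 \<le> norm x" "norm x \<le> 1" if "x \<in> ?A" for x using that by auto
  have inv: "(1 / norm x) ^ j \<le> 4 ^ k" if "x \<in> ?A" "j \<le> k" for x j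
  proof -
    have "(1 / norm x) ^ j \<le> 4 ^ j" using A[OF that(1)] by (intro power_mono) (auto simp: divide_le_eq)
    also have "\<dots> \<le> 4 ^ k" using that by (intro power_increasing) auto
    finally show ?thesis .
  qed
  \<comment> \<open>On the shell 4^k bounds (1 / |x|)^k, 8 is the Lipschitz constant of x \<mapsto>
    sgn x, and 4^k k 4 is that of the power of 1 / |x|. The final 2 turns a distance of at most 2
    into its power \<alpha>.\<close>
  let ?C = "4 ^ k * s' + 4 ^ k * (2 * s') * 8 powr \<alpha> + 4 ^ k * real k * 4 * s' * 2"
  have b1: "\<bar>iter_deriv vs (hom_ext (f i)) x\<bar> \<le> 4 ^ k * s'" if "i \<in> I" "j \<le> k" "vs \<in> multi_indices j" "x \<in> ?A" for i j vs x
    unfolding scale[OF that(1-3) A(1)[OF that(4)]] abs_mult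
    using bd[OF that(1-3) sph[OF A(1)[OF that(4)]]] inv[OF that(4,2)] s' by (intro mult_mono) auto
  have b2: "\<bar>iter_deriv vs (hom_ext (f i)) x - iter_deriv vs (hom_ext (f i)) y\<bar> \<le> ?C * dist x y powr \<alpha>"
    if i: "i \<in> I" and vs: "vs \<in> multi_indices k" and x: "x \<in> ?A" and y: "y \<in> ?A" for i vs x y
  proof (cases "x = y")
    case False
    let ?D = "iter_deriv vs (hom_ext (f i))"
    have dp: "0 < dist x y" using False by simp
    have d2: "dist x y \<le> 2"
      using A(3)[OF x] A(3)[OF y] norm_triangle_ineq4[of x y] by (simp add: dist_norm)
    have lin: "dist x y \<le> 2 * dist x y powr \<alpha>"
    proof -
      have "dist x y = dist x y powr (1 - \<alpha>) * dist x y powr \<alpha>" using dp by (simp flip: powr_add)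
      also have "\<dots> \<le> 2 powr 1 * dist x y powr \<alpha>"
      proof (intro mult_right_mono)
        have "dist x y powr (1 - \<alpha>) \<le> 2 powr (1 - \<alpha>)" using d2 \<alpha> by (intro powr_mono2) auto
        also have "\<dots> \<le> 2 powr 1" using \<alpha> by (intro powr_mono) auto
        finally show "dist x y powr (1 - \<alpha>) \<le> 2 powr 1" .
      qed simp
      finally show ?thesis by simp
    qed
    have sd: "dist (sgn x) (sgn y) \<le> 8 * dist x y"
    proof -
      have "dist (sgn x) (sgn y) \<le> 2 * dist x y / norm y" using dist_sgn_le[OF A(1)[OF y], of x] by (simp add: dist_norm)
      also have "\<dots> \<le> 2 * dist x y / (1/4)" using A[OF y] by (intro divide_left_mono) auto
      finally show ?thesis by simp
    qed
    have "?D x - ?D y = (1 / norm x) ^ k * (?D (sgn x) - ?D (sgn y)) + ((1 / norm x) ^ k - (1 / norm y) ^ k) * ?D (sgn y)"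
      unfolding scale[OF i order_refl vs A(1)[OF x]] scale[OF i order_refl vs A(1)[OF y]] by (simp add: algebra_simps)
    then have "\<bar>?D x - ?D y\<bar> \<le> (1 / norm x) ^ k * \<bar>?D (sgn x) - ?D (sgn y)\<bar> + \<bar>(1 / norm x) ^ k - (1 / norm y) ^ k\<bar> * \<bar>?D (sgn y)\<bar>"
      using abs_triangle_ineq[of "(1 / norm x) ^ k * (?D (sgn x) - ?D (sgn y))" "((1 / norm x) ^ k - (1 / norm y) ^ k) * ?D (sgn y)"]
      by (simp add: abs_mult)
    also have "\<dots> \<le> 4 ^ k * (2 * s' * (8 * dist x y) powr \<alpha>) + (4 ^ k * real k * 4 * dist x y) * s'"
    proof (intro add_mono mult_mono)
      show "(1 / norm x) ^ k \<le> 4 ^ k" by (rule inv[OF x order_refl])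
      have "\<bar>?D (sgn x) - ?D (sgn y)\<bar> \<le> 2 * s' * dist (sgn x) (sgn y) powr \<alpha>"
        by (rule hol[OF i vs sph[OF A(1)[OF x]] sph[OF A(1)[OF y]]])
      also have "\<dots> \<le> 2 * s' * (8 * dist x y) powr \<alpha>" using sd s' \<alpha> by (intro mult_left_mono powr_mono2) auto
      finally show "\<bar>?D (sgn x) - ?D (sgn y)\<bar> \<le> 2 * s' * (8 * dist x y) powr \<alpha>" .
      have "\<bar>(1 / norm x) ^ k - (1 / norm y) ^ k\<bar> \<le> 4 ^ k * real k * 4 * \<bar>norm x - norm y\<bar>"
        using A[OF x] A[OF y] by (intro power_inverse_diff_le)
      also have "\<dots> \<le> 4 ^ k * real k * 4 * dist x y"
        using norm_triangle_ineq3[of x y] by (intro mult_left_mono) (auto simp: dist_norm)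
      finally show "\<bar>(1 / norm x) ^ k - (1 / norm y) ^ k\<bar> \<le> 4 ^ k * real k * 4 * dist x y" .
      show "\<bar>?D (sgn y)\<bar> \<le> s'" by (rule bd[OF i order_refl vs sph[OF A(1)[OF y]]])
    qed auto
    also have "\<dots> \<le> 4 ^ k * (2 * s' * (8 powr \<alpha> * dist x y powr \<alpha>)) + (4 ^ k * real k * 4 * (2 * dist x y powr \<alpha>)) * s'"
      using lin s' by (intro add_mono mult_left_mono mult_right_mono) (auto simp: powr_mult)
    also have "\<dots> = (4 ^ k * (2 * s') * 8 powr \<alpha> + 4 ^ k * real k * 4 * s' * 2) * dist x y powr \<alpha>"
      by (simp add: algebra_simps)
    also have "\<dots> \<le> ?C * dist x y powr \<alpha>" using s' by (intro mult_right_mono) auto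
    finally show ?thesis .
  qed simp
  show ?thesis
    unfolding smooth_family_def
  proof (intro exI[of _ ?C] conjI ballI allI impI)
    show "0 \<le> ?C" using s' by simp
    show "Ck_on k (- {0}) (hom_ext (f i))" if "i \<in> I" for i using f(1)[OF that] by (simp add: Holder_sphere_def)
    show "\<bar>iter_deriv vs (hom_ext (f i)) x\<bar> \<le> ?C" if "i \<in> I" "j \<le> k" "vs \<in> multi_indices j" "x \<in> ?A" for i j vs x
    proof -
      have "4 ^ k * s' \<le> ?C" using s' by simp
      with b1[OF that] show ?thesis by linarith
    qed
    show "\<bar>iter_deriv vs (hom_ext (f i)) x - iter_deriv vs (hom_ext (f i)) y\<bar> \<le> ?C * dist x y powr \<alpha>"
      if "i \<in> I" "vs \<in> multi_indices k" "x \<in> ?A" "y \<in> ?A" for i vs x y by (rule b2[OF that])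
  qed
qed

text \<open>Each unit vector x is the centre of the ball belonging to e = - x, so bounds uniform in
  e control every point of the sphere and all pairs at distance less than 1/2. Homogeneity extends
  continuity and differentiability to the complement of the origin.\<close>

lemma Holder_sphere_local:
  fixes f :: "'b \<Rightarrow> 'a::euclidean_space \<Rightarrow> real"
  assumes wf: "weighted_family (X \<times> sphere (0::'a) 1) (\<lambda>(\<Omega>, e). ball (- e) (1/2)) (\<lambda>_. 1) D \<beta>"
    and W: "Holder_class (X \<times> sphere 0 1) (\<lambda>(\<Omega>, e). ball (- e) (1/2)) (\<lambda>_. 1) \<beta> k \<gamma> \<tau> (\<lambda>(\<Omega>, e). hom_ext (f \<Omega>))"
  shows "\<exists>C. \<forall>\<Omega>\<in>X. Holder_sphere k \<beta> (f \<Omega>) \<and> Holder_norm_sphere k \<beta> (f \<Omega>) \<le> C"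
proof -
  interpret weighted_family "X \<times> sphere (0::'a) 1" "\<lambda>(\<Omega>, e). ball (- e) (1/2)" "\<lambda>_. 1" D \<beta> by fact
  let ?D = "\<lambda>vs \<Omega>. iter_deriv vs (hom_ext (f \<Omega>))"
  have P: "\<exists>C\<ge>0. \<forall>\<Omega>\<in>X. \<forall>x. norm x = 1 \<longrightarrow> (j < k \<longrightarrow> ?D vs \<Omega> differentiable (at x)) \<and> isCont (?D vs \<Omega>) x \<and> \<bar>?D vs \<Omega> x\<bar> \<le> C
     \<and> (j = k \<longrightarrow> (\<forall>y\<in>ball x (1/2). \<bar>?D vs \<Omega> x - ?D vs \<Omega> y\<bar> \<le> C * dist x y powr \<beta>))"
    if vs: "vs \<in> multi_indices j" and j: "j \<le> k" for j vs
  proof -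
    have Wj: "W (k - j) \<gamma> \<tau> (\<lambda>i. iter_deriv vs (case i of (\<Omega>, e) \<Rightarrow> hom_ext (f \<Omega>)))"
      using W_iter_deriv[OF W vs j] .
    have mem: "(\<Omega>, - x) \<in> X \<times> sphere 0 1" "x \<in> ball (- (- x)) (1/2)" if "\<Omega> \<in> X" "norm x = 1" for \<Omega> and x :: 'a
      using that by auto
    show ?thesis
    proof (cases "k - j")
      case 0
      then obtain C where "C \<ge> 0" and C: "\<forall>i\<in>X \<times> sphere 0 1. continuous_on (case i of (\<Omega>, e) \<Rightarrow> ball (- e) (1/2)) (iter_deriv vs (case i of (\<Omega>, e) \<Rightarrow> hom_ext (f \<Omega>))) \<and>
        (\<forall>x\<in>(case i of (\<Omega>, e) \<Rightarrow> ball (- e) (1/2)). \<bar>iter_deriv vs (case i of (\<Omega>, e) \<Rightarrow> hom_ext (f \<Omega>)) x\<bar> \<le> C) \<and>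
        (\<forall>x\<in>(case i of (\<Omega>, e) \<Rightarrow> ball (- e) (1/2)). \<forall>y\<in>(case i of (\<Omega>, e) \<Rightarrow> ball (- e) (1/2)).
          \<bar>iter_deriv vs (case i of (\<Omega>, e) \<Rightarrow> hom_ext (f \<Omega>)) x - iter_deriv vs (case i of (\<Omega>, e) \<Rightarrow> hom_ext (f \<Omega>)) y\<bar> \<le> C * dist x y powr \<beta>)"
        using Wj by auto
      show ?thesis
      proof (intro exI[of _ C] conjI ballI allI impI)
        show "0 \<le> C" by fact
        fix \<Omega> and x :: 'a assume \<Omega>: "\<Omega> \<in> X" and x: "norm x = 1"
        note Cx = C[rule_format, OF mem(1)[OF \<Omega> x], simplified]
        show "?D vs \<Omega> differentiable (at x)" if "j < k" using that 0 by simp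
        show "isCont (?D vs \<Omega>) x" using Cx continuous_on_eq_continuous_at[OF open_ball, of x "1/2" "?D vs \<Omega>"] by simp
        show "\<bar>?D vs \<Omega> x\<bar> \<le> C" using Cx by simp
        show "\<bar>?D vs \<Omega> x - ?D vs \<Omega> y\<bar> \<le> C * dist x y powr \<beta>" if "y \<in> ball x (1/2)" for y
          using Cx that by (simp add: dist_commute)
      qed
    next
      case (Suc m)
      then obtain C where "C \<ge> 0" and C: "\<forall>i\<in>X \<times> sphere 0 1. \<forall>x\<in>(case i of (\<Omega>, e) \<Rightarrow> ball (- e) (1/2)).
        iter_deriv vs (case i of (\<Omega>, e) \<Rightarrow> hom_ext (f \<Omega>)) differentiable (at x) \<and> \<bar>iter_deriv vs (case i of (\<Omega>, e) \<Rightarrow> hom_ext (f \<Omega>)) x\<bar> \<le> C"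
        using Wj by auto
      show ?thesis
      proof (intro exI[of _ C] conjI ballI allI impI)
        show "0 \<le> C" by fact
        fix \<Omega> and x :: 'a assume \<Omega>: "\<Omega> \<in> X" and x: "norm x = 1"
        note Cx = C[rule_format, OF mem(1)[OF \<Omega> x], simplified]
        show "?D vs \<Omega> differentiable (at x)" using Cx[of x] by simp
        then show "isCont (?D vs \<Omega>) x" by (rule differentiable_imp_continuous_within)
        show "\<bar>?D vs \<Omega> x\<bar> \<le> C" using Cx[of x] by simp
        show "\<bar>?D vs \<Omega> x - ?D vs \<Omega> y\<bar> \<le> C * dist x y powr \<beta>" if "j = k" for y using Suc that by simp
      qed
    qed
  qed
  have "\<exists>C\<ge>0. \<forall>vs\<in>multi_indices j. \<forall>\<Omega>\<in>X. \<forall>x. norm x = 1 \<longrightarrow> (j < k \<longrightarrow> ?D vs \<Omega> differentiable (at x)) \<and> isCont (?D vs \<Omega>) x \<and> \<bar>?D vs \<Omega> x\<bar> \<le> C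
     \<and> (j = k \<longrightarrow> (\<forall>y\<in>ball x (1/2). \<bar>?D vs \<Omega> x - ?D vs \<Omega> y\<bar> \<le> C * dist x y powr \<beta>))"
    (is "\<exists>C\<ge>0. \<forall>vs\<in>_. ?P vs C") if j: "j \<le> k" for j
  proof -
    have "\<forall>vs\<in>multi_indices j. \<exists>C. C \<ge> 0 \<and> ?P vs C" using P[OF _ j] by blast
    from bchoice[OF this] obtain c where c: "\<And>vs. vs \<in> multi_indices j \<Longrightarrow> c vs \<ge> 0 \<and> ?P vs (c vs)" by blast
    have mono: "?P vs C'" if P: "?P vs C" and le: "C \<le> C'" for vs C C'
    proof (intro ballI allI impI conjI)
      fix \<Omega> and x :: 'a assume \<Omega>: "\<Omega> \<in> X" and x: "norm x = 1"
      show "?D vs \<Omega> differentiable (at x)" if "j < k" using P \<Omega> x that by blast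
      show "isCont (?D vs \<Omega>) x" using P \<Omega> x by blast
      have "\<bar>?D vs \<Omega> x\<bar> \<le> C" using P \<Omega> x by blast
      then show "\<bar>?D vs \<Omega> x\<bar> \<le> C'" using le by linarith
      show "\<bar>?D vs \<Omega> x - ?D vs \<Omega> y\<bar> \<le> C' * dist x y powr \<beta>" if "j = k" "y \<in> ball x (1/2)" for y
      proof -
        have "\<bar>?D vs \<Omega> x - ?D vs \<Omega> y\<bar> \<le> C * dist x y powr \<beta>" using P \<Omega> x that by blast
        also have "\<dots> \<le> C' * dist x y powr \<beta>" using le by (intro mult_right_mono) auto
        finally show ?thesis .
      qed
    qed
    show ?thesis
    proof (rule exI[of _ "\<Sum>vs\<in>multi_indices j. c vs"], rule conjI, rule_tac [2] ballI)
      show "0 \<le> (\<Sum>vs\<in>multi_indices j. c vs)" using c by (intro sum_nonneg) auto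
      fix vs :: "'a list" assume vs: "vs \<in> multi_indices j"
      have "c vs \<le> (\<Sum>vs\<in>multi_indices j. c vs)"
        using c vs finite_multi_indices[of j, where 'a='a] by (intro member_le_sum) auto
      then show "?P vs (\<Sum>vs\<in>multi_indices j. c vs)" using mono c[OF vs] by blast
    qed
  qed
  then have "\<forall>j\<in>{..k}. \<exists>C. C \<ge> 0 \<and> (\<forall>vs\<in>multi_indices j. \<forall>\<Omega>\<in>X. \<forall>x. norm x = 1 \<longrightarrow>
      (j < k \<longrightarrow> ?D vs \<Omega> differentiable (at x)) \<and> isCont (?D vs \<Omega>) x \<and> \<bar>?D vs \<Omega> x\<bar> \<le> C
      \<and> (j = k \<longrightarrow> (\<forall>y\<in>ball x (1/2). \<bar>?D vs \<Omega> x - ?D vs \<Omega> y\<bar> \<le> C * dist x y powr \<beta>)))"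
    by auto
  from bchoice[OF this] obtain C where C': "\<forall>j\<in>{..k}. C j \<ge> 0 \<and> (\<forall>vs\<in>multi_indices j. \<forall>\<Omega>\<in>X. \<forall>x. norm x = 1 \<longrightarrow>
      (j < k \<longrightarrow> ?D vs \<Omega> differentiable (at x)) \<and> isCont (?D vs \<Omega>) x \<and> \<bar>?D vs \<Omega> x\<bar> \<le> C j
      \<and> (j = k \<longrightarrow> (\<forall>y\<in>ball x (1/2). \<bar>?D vs \<Omega> x - ?D vs \<Omega> y\<bar> \<le> C j * dist x y powr \<beta>)))"
    by blast
  note C = bspec[OF C', unfolded atMost_iff]
  have C0: "C j \<ge> 0" if "j \<le> k" for j using C[OF that] by blast
  have CD: "?D vs \<Omega> differentiable (at x)" if "j < k" "vs \<in> multi_indices j" "\<Omega> \<in> X" "norm x = 1" for j vs \<Omega> x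
    using C[of j] that by (metis less_imp_le)
  have CC: "isCont (?D vs \<Omega>) x" and CB: "\<bar>?D vs \<Omega> x\<bar> \<le> C j"
    if "j \<le> k" "vs \<in> multi_indices j" "\<Omega> \<in> X" "norm x = 1" for j vs \<Omega> x
    using C[OF that(1)] that by blast+
  have CH: "\<bar>?D vs \<Omega> x - ?D vs \<Omega> y\<bar> \<le> C k * dist x y powr \<beta>"
    if "vs \<in> multi_indices k" "\<Omega> \<in> X" "norm x = 1" "y \<in> ball x (1/2)" for vs \<Omega> x y
    using C[OF order_refl] that by blast
  \<comment> \<open>Pairs at distance at least 1/2 use the bound 2 C k for the values; since \<beta>
    \<le> 1, the power of the distance is at least 1/2 there.\<close>
  let ?H = "4 * C k"
  have hol: "\<bar>?D vs \<Omega> x - ?D vs \<Omega> y\<bar> \<le> ?H * dist x y powr \<beta>"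
    if vs: "vs \<in> multi_indices k" and \<Omega>: "\<Omega> \<in> X" and x: "norm x = 1" and y: "norm y = 1" for vs \<Omega> x y
  proof (cases "y \<in> ball x (1/2)")
    case True
    then have "\<bar>?D vs \<Omega> x - ?D vs \<Omega> y\<bar> \<le> C k * dist x y powr \<beta>" by (rule CH[OF vs \<Omega> x])
    also have "\<dots> \<le> ?H * dist x y powr \<beta>" using C0[of k] by (intro mult_right_mono) auto
    finally show ?thesis .
  next
    case False
    have "1/2 \<le> (1/2::real) powr \<beta>" using powr_mono'[of \<beta> 1 "1/2::real"] \<beta>_le by simp
    also have "\<dots> \<le> dist x y powr \<beta>" using False \<beta>_nonneg by (intro powr_mono2) auto
    finally have "?H * (1/2) \<le> ?H * dist x y powr \<beta>" using C0[of k] by (intro mult_left_mono) auto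
    moreover have "\<bar>?D vs \<Omega> x - ?D vs \<Omega> y\<bar> \<le> C k + C k"
      using CB[OF order_refl vs \<Omega> x] CB[OF order_refl vs \<Omega> y] by linarith
    ultimately show ?thesis by simp
  qed
  have "Holder_sphere k \<beta> (f \<Omega>) \<and> Holder_norm_sphere k \<beta> (f \<Omega>) \<le> (\<Sum>j\<le>k. C j) + ?H" if \<Omega>: "\<Omega> \<in> X" for \<Omega>
  proof
    have sph: "norm (sgn x) = 1" if "x \<noteq> 0" for x :: 'a using that by (simp add: norm_sgn)
    have Ck: "Ck_on k (- {0}) (hom_ext (f \<Omega>))"
      unfolding Ck_on_def
    proof (intro conjI allI impI ballI)
      show "?D vs \<Omega> differentiable (at x)" if "j < k" "vs \<in> multi_indices j" "x \<in> - {0}" for j vs x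
        by (rule iter_deriv_scaleR(2)[of k, OF _ that(2)]) (use CD[OF _ _ \<Omega>] that in auto)
      fix j and vs :: "'a list" assume j: "j \<le> k" and vs: "vs \<in> multi_indices j"
      have c: "continuous_on (sphere 0 1) (?D vs \<Omega>)"
        using CC[OF j vs \<Omega>] by (auto intro!: continuous_at_imp_continuous_on)
      have "continuous_on (- {0}) (\<lambda>x. (1 / norm x) ^ j * ?D vs \<Omega> (sgn x))"
        unfolding sgn_div_norm
        by (intro continuous_intros continuous_on_compose2[OF c]) (auto, metis left_inverse norm_eq_zero)
      then show "continuous_on (- {0}) (?D vs \<Omega>)"
      proof (rule continuous_on_eq)
        show "(1 / norm x) ^ j * ?D vs \<Omega> (sgn x) = ?D vs \<Omega> x" if "x \<in> - {0}" for x
        proof -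
          have "?D vs \<Omega> (norm x *\<^sub>R sgn x) = (1 / norm x) ^ j * ?D vs \<Omega> (sgn x)"
            by (rule iter_deriv_scaleR(1)[of k, OF _ vs j]) (use CD[OF _ _ \<Omega>] that in \<open>auto simp: sgn_zero_iff\<close>)
          then show ?thesis by (simp add: norm_sgn_self)
        qed
      qed
    qed
    then show "Holder_sphere k \<beta> (f \<Omega>)"
      unfolding Holder_sphere_def using hol[OF _ \<Omega>] by (auto intro!: exI[of _ ?H])
    obtain x :: 'a where x: "norm x = 1" using vector_choose_size[of 1] by auto
    then have xx: "x \<noteq> - x" by (metis add.inverse_unique norm_zero pth_1 scaleR_2 scaleR_eq_0_iff zero_neq_numeral zero_neq_one eq_neg_iff_add_eq_0)
    have "Ck_norm_sphere k (f \<Omega>) \<le> (\<Sum>j\<le>k. C j)"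
      unfolding Ck_norm_sphere_def
    proof (rule sum_mono)
      fix j assume "j \<in> {..k}"
      then show "(SUP (vs, x)\<in>multi_indices j \<times> sphere 0 1. \<bar>?D vs \<Omega> x\<bar>) \<le> C j"
        using x multi_indices_nonempty[of j, where 'a='a] CB[OF _ _ \<Omega>] by (intro cSUP_least) auto
    qed
    moreover have "Holder_seminorm_sphere k \<beta> (f \<Omega>) \<le> ?H"
    proof -
      define T where "T = {(vs :: 'a list, x, y). vs \<in> multi_indices k \<and> x \<in> sphere (0::'a) 1 \<and> y \<in> sphere 0 1 \<and> x \<noteq> y}"
      obtain vs :: "'a list" where "vs \<in> multi_indices k" using multi_indices_nonempty by blast
      then have "(vs, x, - x) \<in> T" using x xx by (simp add: T_def)
      then have "T \<noteq> {}" by blast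
      moreover have "(\<lambda>(vs, x, y). \<bar>?D vs \<Omega> x - ?D vs \<Omega> y\<bar> / dist x y powr \<beta>) p \<le> ?H" if "p \<in> T" for p
        using that hol[OF _ \<Omega>] unfolding T_def by (auto simp: divide_le_eq)
      ultimately show ?thesis
        unfolding Holder_seminorm_sphere_def T_def[symmetric] by (rule cSUP_least)
    qed
    ultimately show "Holder_norm_sphere k \<beta> (f \<Omega>) \<le> (\<Sum>j\<le>k. C j) + ?H"
      using C0[of k] by (simp add: Holder_norm_sphere_def)
  qed
  then show ?thesis by blast
qed

section \<open>Regularity for positive exponents\<close>

lemma integral_le_if_nn_integral_le:
  assumes f: "f \<in> borel_measurable M" "\<And>x. 0 \<le> f x" and C: "0 \<le> C" "(\<integral>\<^sup>+x. ennreal (f x) \<partial>M) \<le> ennreal C"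
  shows "integrable M f" "(\<integral>x. f x \<partial>M) \<le> C"
proof -
  show "integrable M f"
    using f C le_less_trans[OF C(2)] by (intro integrableI_nonneg) auto
  have "(\<integral>x. f x \<partial>M) = enn2real (\<integral>\<^sup>+x. ennreal (f x) \<partial>M)"
    using f by (intro integral_eq_nn_integral) auto
  also have "\<dots> \<le> C" using C by (intro enn2real_leI)
  finally show "(\<integral>x. f x \<partial>M) \<le> C" .
qed

lemma borel_measurable_swap [measurable]: "(\<lambda>w. swap e x w) \<in> borel_measurable borel"
  unfolding swap_def by measurable

section \<open>Weighted bounds for the kernel\<close>

locale body_family = reflected_family I e d D \<beta>
  for I :: "'i set" and e :: "'i \<Rightarrow> 'a::euclidean_space" and d :: "'i \<Rightarrow> real" and D \<beta> :: real +
  fixes \<Omega> :: "'i \<Rightarrow> 'a set" and k :: nat and \<alpha> r :: real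
  assumes body_\<Omega>: "i \<in> I \<Longrightarrow> body (\<Omega> i)"
    and smooth: "smooth_family I (Suc k) \<alpha> (\<lambda>i. body.g (\<Omega> i))"
    and r: "0 < r" "i \<in> I \<Longrightarrow> r \<le> radial_min (\<Omega> i)"
    and \<alpha>: "\<beta> \<le> \<alpha>" "\<alpha> \<le> 1"
begin

abbreviation "G i \<equiv> body.g (\<Omega> i)"

lemma \<alpha>_nonneg: "0 \<le> \<alpha>" using \<alpha> \<beta>_nonneg by simp

lemma G_lower: "i \<in> I \<Longrightarrow> p \<noteq> 0 \<Longrightarrow> r * d i powr 0 \<le> G i p"
  using body.radial_min_le[OF body_\<Omega>, of i p] r(2)[of i] d_pos[of i] by simp

lemma swap_nonzero: "p \<noteq> 0 \<Longrightarrow> swap u x p \<noteq> 0"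
  using norm_swap[of u x p] by (metis norm_eq_zero)

lemma W_G:
  assumes "\<And>i. i \<in> I \<Longrightarrow> p i \<in> cball 0 1 - ball 0 (1/2)"
  shows "W (Suc k) 0 0 (\<lambda>i x. G i (swap (e i) x (p i)))"
    and "W (Suc k) 0 0 (\<lambda>i x. G i (swap (e i) x (p i)) powr s)"
proof -
  show W: "W (Suc k) 0 0 (\<lambda>i x. G i (swap (e i) x (p i)))"
    by (rule W_comp_swap(1)[OF smooth \<alpha>]) (rule assms)
  have "W (Suc k) (s * 0) 0 (\<lambda>i x. G i (swap (e i) x (p i)) powr s)"
  proof (rule W_powr[OF r(1) _ W])
    fix i x assume i: "i \<in> I"
    then have "p i \<noteq> 0" using assms[OF i] by auto
    then show "r * d i powr 0 \<le> G i (swap (e i) x (p i))" by (intro G_lower i swap_nonzero)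
  qed
  then show "W (Suc k) 0 0 (\<lambda>i x. G i (swap (e i) x (p i)) powr s)" by simp
qed

lemma e_shell: "i \<in> I \<Longrightarrow> e i \<in> cball 0 1 - ball 0 (1/2)"
  using norm_e by simp

text \<open>With a = g(R sgn w) and b = g(Re) one has a w - b e = a (w - e) + (a - b) e, and the
  squared length expands into terms of weight 2 with loss 1 - \<alpha> coming from a - b. Being
  comparable to d^2 from below as well, it may be raised to the power s / 2.\<close>

lemma W_norm_diff_powr:
  assumes w: "\<And>i. i \<in> I \<Longrightarrow> w i \<noteq> 0 \<and> norm (w i) \<le> 1" and d: "\<And>i. i \<in> I \<Longrightarrow> d i = norm (w i - e i)"
  shows "W (Suc k) s (1 - \<alpha>) (\<lambda>i x. norm (G i (swap (e i) x (sgn (w i))) *\<^sub>R w i - G i (swap (e i) x (e i)) *\<^sub>R e i) powr s)"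
proof -
  have \<tau>: "0 \<le> 1 - \<alpha>" "1 - \<alpha> \<le> 1" using \<alpha> \<alpha>_nonneg by auto
  let ?a = "\<lambda>i x. G i (swap (e i) x (sgn (w i)))" and ?b = "\<lambda>i x. G i (swap (e i) x (e i))"
  have sw: "sgn (w i) \<in> cball 0 1 - ball 0 (1/2)" if "i \<in> I" for i
    using w[OF that] by (simp add: norm_sgn)
  have Wa: "W (Suc k) 0 0 ?a" by (rule W_G(1)) (rule sw)
  have Wab: "W (Suc k) 1 (1 - \<alpha>) (\<lambda>i x. ?a i x - ?b i x)"
  proof (rule W_comp_swap(2)[OF smooth \<alpha>, where C=2])
    show "dist (sgn (w i)) (e i) \<le> 2 * d i" if i: "i \<in> I" for i
    proof -
      have "sgn (e i) = e i" using norm_e[OF i] by (simp add: sgn_div_norm)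
      moreover have "e i \<noteq> 0" using norm_e[OF i] by auto
      ultimately show ?thesis using dist_sgn_le[of "e i" "w i"] norm_e[OF i] d[OF i] by (simp add: dist_norm)
    qed
  qed (use sw e_shell in auto)
  have W1: "W (Suc k) 1 0 (\<lambda>i x. 2 * ((w i - e i) \<bullet> e i))"
  proof (rule W_const[of 2])
    show "\<bar>2 * ((w i - e i) \<bullet> e i)\<bar> \<le> 2 * d i powr 1" if i: "i \<in> I" for i
      using Cauchy_Schwarz_ineq2[of "w i - e i" "e i"] norm_e[OF i] d[OF i] by (simp add: abs_mult)
  qed simp
  have W2: "W (Suc k) 2 0 (\<lambda>i x. (norm (w i - e i))\<^sup>2)"
    by (rule W_const[of 1]) (use d d_pos in auto)
  have "W (Suc k) (0 + 0) 0 (\<lambda>i x. ?a i x * ?a i x)" by (rule W_mult[OF _ _ Wa Wa]) auto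
  then have "W (Suc k) 0 0 (\<lambda>i x. ?a i x * ?a i x)" by simp
  from W_mult[OF _ _ this W2] have "W (Suc k) 2 0 (\<lambda>i x. ?a i x * ?a i x * (norm (w i - e i))\<^sup>2)" by simp
  then have T1: "W (Suc k) 2 (1 - \<alpha>) (\<lambda>i x. ?a i x * ?a i x * (norm (w i - e i))\<^sup>2)"
    by (rule W_mono) (use \<tau> in auto)
  from W_mult[OF _ _ Wa W1] have "W (Suc k) 1 0 (\<lambda>i x. ?a i x * (2 * ((w i - e i) \<bullet> e i)))" by simp
  from W_mult[OF \<tau> this Wab] have T2: "W (Suc k) 2 (1 - \<alpha>) (\<lambda>i x. ?a i x * (2 * ((w i - e i) \<bullet> e i)) * (?a i x - ?b i x))" by simp
  \<comment> \<open>Both factors carry the loss here, which is allowed because at least one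
    derivative is available.\<close>
  from W_mult_Suc[OF \<tau> Wab Wab] have T3: "W (Suc k) 2 (1 - \<alpha>) (\<lambda>i x. (?a i x - ?b i x) * (?a i x - ?b i x))" by simp
  let ?F = "\<lambda>i x. (norm (?a i x *\<^sub>R w i - ?b i x *\<^sub>R e i))\<^sup>2"
  have "W (Suc k) 2 (1 - \<alpha>) (\<lambda>i x. ?a i x * ?a i x * (norm (w i - e i))\<^sup>2 + ?a i x * (2 * ((w i - e i) \<bullet> e i)) * (?a i x - ?b i x)
      + (?a i x - ?b i x) * (?a i x - ?b i x))"
    by (intro W_add T1 T2 T3)
  then have WF: "W (Suc k) 2 (1 - \<alpha>) ?F"
  proof (rule W_cong[rotated])
    fix i x assume i: "i \<in> I"
    have ee: "e i \<bullet> e i = 1" using norm_e[OF i] by (simp add: dot_square_norm)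
    define v c where "v = w i - e i" and "c = ?a i x - ?b i x"
    have "(norm (a *\<^sub>R v + c *\<^sub>R e i))\<^sup>2 = a * a * (norm v)\<^sup>2 + a * (2 * (v \<bullet> e i)) * c + c * c" for a
      unfolding power2_norm_eq_inner by (simp add: inner_add_left inner_add_right ee inner_commute[of "e i" v] algebra_simps)
    moreover have "?a i x *\<^sub>R w i - ?b i x *\<^sub>R e i = ?a i x *\<^sub>R v + c *\<^sub>R e i" by (simp add: v_def c_def algebra_simps)
    ultimately show "?a i x * ?a i x * (norm (w i - e i))\<^sup>2 + ?a i x * (2 * ((w i - e i) \<bullet> e i)) * (?a i x - ?b i x)
      + (?a i x - ?b i x) * (?a i x - ?b i x) = ?F i x"
      by (simp only: v_def c_def)
  qed
  \<comment> \<open>The reflection is isometric and fixes the length of w - e, so the bilipschitz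
    estimate applies to the reflected points.\<close>
  have lower: "r / 3 * d i \<le> norm (?a i x *\<^sub>R w i - ?b i x *\<^sub>R e i)" if i: "i \<in> I" for i x
  proof -
    interpret body "\<Omega> i" by (rule body_\<Omega>[OF i])
    have nz: "w i \<noteq> 0" "e i \<noteq> 0" using w[OF i] norm_e[OF i] by auto
    have ga: "g (swap (e i) x (w i)) = ?a i x" by (metis g_sgn sgn_swap)
    have "r / 3 * d i \<le> radial_min (\<Omega> i) / 3 * norm (swap (e i) x (w i) - swap (e i) x (e i))"
      using r(2)[OF i] d[OF i] d_pos[OF i] by (simp add: swap_diff)
    also have "\<dots> \<le> norm (?a i x *\<^sub>R swap (e i) x (w i) - ?b i x *\<^sub>R swap (e i) x (e i))"
      using bilipschitz[OF swap_nonzero[OF nz(1), of "e i" x] swap_nonzero[OF nz(2), of "e i" x]] by (simp add: ga)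
    also have "\<dots> = norm (?a i x *\<^sub>R w i - ?b i x *\<^sub>R e i)"
      by (simp only: swap_scaleR[symmetric] swap_diff norm_swap)
    finally show ?thesis .
  qed
  have "W (Suc k) (s / 2 * 2) (1 - \<alpha>) (\<lambda>i x. ?F i x powr (s / 2))"
  proof (rule W_powr_Suc[OF \<tau> _ _ WF])
    show "0 < (r / 3)\<^sup>2" using r by simp
    show "(r / 3)\<^sup>2 * d i powr 2 \<le> ?F i x" if i: "i \<in> I" for i x
    proof -
      have "(r / 3)\<^sup>2 * d i powr 2 = (r / 3 * d i)\<^sup>2" using d_pos[OF i] by (simp add: power_mult_distrib power_divide)
      also have "\<dots> \<le> ?F i x" by (rule power_mono[OF lower[OF i]]) (use r(1) d_pos[OF i] in simp)
      finally show ?thesis .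
    qed
  qed
  then have "W (Suc k) s (1 - \<alpha>) (\<lambda>i x. ?F i x powr (s / 2))" by simp
  then show ?thesis
  proof (rule W_cong[rotated])
    fix i x assume i: "i \<in> I"
    have "y\<^sup>2 powr (s / 2) = y powr s" if "0 \<le> y" for y :: real
      using that powr_powr[of y 2 "s / 2"] by simp
    then show "?F i x powr (s / 2) = norm (?a i x *\<^sub>R w i - ?b i x *\<^sub>R e i) powr s"
      by simp
  qed
qed

end

context body
begin

lemma hom_ext_on_sphere:
  assumes "x \<noteq> 0" "norm e = 1" "sgn x \<noteq> e"
  shows "hom_ext (on_sphere \<Omega> V) x = V (g (swap e x e) *\<^sub>R swap e x e)"
  using swap_base[OF assms(2,1,3)] assms(1) by (simp add: hom_ext_sgn on_sphere_def g_sgn) (simp add: g_def hom_ext_sgn)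

lemma g_swap_sgn: "g (swap e x w) = g (swap e x (sgn w))"
  by (metis g_sgn sgn_swap)

end

text \<open>After the reflection the singularity is at e for every x. Removing the null set {0, e}
  makes the weight |w - e| positive on the domain, and the reflection drops out of the distance
  because it is linear and isometric.\<close>

lemma Q_ball_swap:
  fixes \<Omega> :: "(real^'n) set"
  assumes b: "body \<Omega>" and q: "0 < q" and z: "body.g \<Omega> (swap e x e) *\<^sub>R swap e x e \<in> \<Omega>"
  shows "body.Q \<Omega> q (body.g \<Omega> (swap e x e) *\<^sub>R swap e x e) = (\<integral>\<^sup>+w. ennreal (q / CARD('n) *
      (norm (body.g \<Omega> (swap e x (sgn w)) *\<^sub>R w - body.g \<Omega> (swap e x e) *\<^sub>R e) powr (q - real CARD('n))
        * body.g \<Omega> (swap e x (sgn w)) powr real CARD('n))) \<partial>restrict_space lborel (ball 0 1 - {0, e}))"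
proof -
  interpret body \<Omega> by fact
  let ?n = "real CARD('n)" and ?b = "g (swap e x e)"
  let ?h = "\<lambda>w. ennreal (norm (g w *\<^sub>R w - ?b *\<^sub>R swap e x e) powr (q - ?n) * g w ^ CARD('n)) * indicator (ball 0 1) w"
  have [measurable]: "ball (0::real^'n) 1 \<in> sets borel" by simp
  have "Q q (?b *\<^sub>R swap e x e) = ennreal (q / ?n) * (\<integral>\<^sup>+w. ?h w \<partial>lborel)"
    using Q_ball[OF z q] by simp
  also have "(\<integral>\<^sup>+w. ?h w \<partial>lborel) = (\<integral>\<^sup>+w. ?h (swap e x w) \<partial>lborel)"
    by (rule nn_integral_swap[symmetric]) measurable
  also have "ennreal (q / ?n) * \<dots> = (\<integral>\<^sup>+w. ennreal (q / ?n) * ?h (swap e x w) \<partial>lborel)"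
    by (intro nn_integral_cmult[symmetric]) measurable
  also have "\<dots> = (\<integral>\<^sup>+w. ennreal (q / ?n * (norm (g (swap e x (sgn w)) *\<^sub>R w - ?b *\<^sub>R e) powr (q - ?n)
        * g (swap e x (sgn w)) powr ?n)) * indicator (ball 0 1 - {0, e}) w \<partial>lborel)"
  proof (rule nn_integral_cong_AE, rule AE_mp[OF AE_lborel_singleton[of 0]], rule AE_mp[OF AE_lborel_singleton[of e]],
      rule AE_I2, intro impI)
    fix w :: "real^'n" assume w: "w \<noteq> e" "w \<noteq> 0"
    have "swap e x w \<noteq> 0" using w(2) norm_swap[of e x w] by (metis norm_eq_zero)
    then have gp: "0 < g (swap e x (sgn w))" using g_pos[of "swap e x w"] g_swap_sgn by simp
    have "norm (g (swap e x w) *\<^sub>R swap e x w - ?b *\<^sub>R swap e x e) = norm (g (swap e x (sgn w)) *\<^sub>R w - ?b *\<^sub>R e)"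
      by (simp add: swap_scaleR[symmetric] swap_diff g_swap_sgn[symmetric])
    then show "ennreal (q / ?n) * ?h (swap e x w) = ennreal (q / ?n * (norm (g (swap e x (sgn w)) *\<^sub>R w - ?b *\<^sub>R e) powr (q - ?n)
        * g (swap e x (sgn w)) powr ?n)) * indicator (ball 0 1 - {0, e}) w"
      using w q gp by (simp add: indicator_def g_swap_sgn[of e x w] powr_realpow flip: ennreal_mult)
  qed
  also have "\<dots> = (\<integral>\<^sup>+w. ennreal (q / ?n * (norm (g (swap e x (sgn w)) *\<^sub>R w - ?b *\<^sub>R e) powr (q - ?n)
        * g (swap e x (sgn w)) powr ?n)) \<partial>restrict_space lborel (ball 0 1 - {0, e}))"
    by (subst nn_integral_restrict_space) auto
  finally show ?thesis .
qed

text \<open>All bodies sharing the prescribed values of the norm and of 1/\<rho>_min: a constant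
  uniform over this set is a constant depending only on these values. The order is
  \<open>Suc k\<close> because the order in the theorem is positive.\<close>

definition admissible :: "nat \<Rightarrow> real \<Rightarrow> real \<Rightarrow> real \<Rightarrow> (real^'n) set set" where
  "admissible k \<alpha> s t = {\<Omega>. convex_body \<Omega> \<and> 0 \<in> interior \<Omega> \<and> Holder_sphere (Suc k) \<alpha> (radial \<Omega>) \<and>
     Holder_norm_sphere (Suc k) \<alpha> (radial \<Omega>) = s \<and> 1 / radial_min \<Omega> = t}"

lemma admissible_body: "\<Omega> \<in> admissible k \<alpha> s t \<Longrightarrow> body \<Omega>"
  by (simp add: admissible_def body_def)

lemma admissible_min:
  assumes "\<Omega> \<in> admissible k \<alpha> s t"
  shows "0 < 1 / t" "1 / t \<le> radial_min \<Omega>"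
  using assms body.radial_min_pos[OF admissible_body[OF assms]] by (auto simp: admissible_def)

text \<open>Uniform smoothness comes from the common norm s, and the common lower bound for the
  radial functions is 1 / t. Some admissible body must exist, since otherwise t could be arbitrary
  and 1 / t not positive.\<close>

lemma body_family_admissible:
  assumes \<alpha>: "0 \<le> \<beta>" "\<beta> \<le> \<alpha>" "\<alpha> \<le> 1"
    and I: "I \<subseteq> {i. fst (fst i) \<in> admissible k \<alpha> s t \<and> norm (snd (fst i)) = 1}" "\<exists>\<Omega> :: (real^'n) set. \<Omega> \<in> admissible k \<alpha> s t"
    and d: "\<And>i. i \<in> I \<Longrightarrow> 0 < d i \<and> d i \<le> 2"
  shows "body_family I (\<lambda>i. snd (fst i)) d 2 \<beta> (\<lambda>i. fst (fst i)) k \<alpha> (1 / t)"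
proof unfold_locales
  show "smooth_family I (Suc k) \<alpha> (\<lambda>i. body.g (fst (fst i)))"
  proof -
    have "smooth_family I (Suc k) \<alpha> (\<lambda>i. hom_ext (radial (fst (fst i))))"
      by (rule smooth_family_hom_ext[where s=s]) (use I \<alpha> in \<open>auto simp: admissible_def\<close>)
    moreover have "hom_ext (radial (fst (fst i))) = body.g (fst (fst i))" if "i \<in> I" for i
      using body.g_def[OF admissible_body[of "fst (fst i)" k \<alpha> s t]] I(1) that by auto
    ultimately show ?thesis unfolding smooth_family_def by (metis (no_types, lifting))
  qed
  show "convex_body (fst (fst i))" "0 \<in> interior (fst (fst i))" if "i \<in> I" for i
    using I(1) that by (auto simp: admissible_def)
  show "0 < 1 / t" using I(2) admissible_min by blast
  show "1 / t \<le> radial_min (fst (fst i))" if "i \<in> I" for i using I(1) that admissible_min by blast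
qed (use \<alpha> d I(1) in auto)

text \<open>The final argument shared by both signs of q. After integration the weights become a
  constant depending on no body and no base point, so the result lies in the class with weight 1, to
  which \<open>Holder_sphere_local\<close> applies. The set \<open>S i\<close> leaves out the
  singular set, where the weight would vanish.\<close>

lemma Holder_boundary_integral:
  fixes X :: "(real^'n) set set" and f :: "((real^'n) set \<times> (real^'n)) \<times> (real^'n) \<Rightarrow> real^'n \<Rightarrow> real"
    and S :: "(real^'n) set \<times> (real^'n) \<Rightarrow> (real^'n) set"
  defines "P \<equiv> X \<times> sphere 0 1" and "M \<equiv> \<lambda>i. restrict_space lborel (S i)"
  assumes X: "\<And>\<Omega>. \<Omega> \<in> X \<Longrightarrow> body \<Omega>"
    and wf: "weighted_family (Sigma P S) (\<lambda>j. ball (- snd (fst j)) (1/2)) d D \<beta>"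
    and f: "Holder_class (Sigma P S) (\<lambda>j. ball (- snd (fst j)) (1/2)) d \<beta> m \<gamma> \<tau> f" "\<And>j x. j \<in> Sigma P S \<Longrightarrow> 0 \<le> f j x"
    and S: "\<And>i. S i \<in> sets borel"
    and meas: "\<And>i x. i \<in> P \<Longrightarrow> x \<in> ball (- snd i) (1/2) \<Longrightarrow> (\<lambda>w. f (i, w) x) \<in> borel_measurable borel"
      "\<And>i. i \<in> P \<Longrightarrow> (\<lambda>w. d (i, w)) \<in> borel_measurable borel"
    and K: "\<And>p. p \<in> {\<gamma>, \<gamma> - \<tau>, \<gamma> - \<tau> - \<beta>} \<Longrightarrow>
        \<exists>C\<ge>0. \<forall>i\<in>P. (\<integral>\<^sup>+w\<in>S i. ennreal (d (i, w) powr p) \<partial>lborel) \<le> ennreal C"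
    and Q: "\<And>i x. i \<in> P \<Longrightarrow> x \<noteq> 0 \<Longrightarrow> sgn x \<noteq> snd i \<Longrightarrow> body.g (fst i) x *\<^sub>R sgn x \<in> frontier (fst i) \<Longrightarrow>
        body.g (fst i) x *\<^sub>R sgn x = body.g (fst i) (swap (snd i) x (snd i)) *\<^sub>R swap (snd i) x (snd i) \<Longrightarrow>
        body.Q (fst i) q (body.g (fst i) x *\<^sub>R sgn x) = (\<integral>\<^sup>+w. ennreal (f (i, w) x) \<partial>M i)"
  shows "\<exists>C. \<forall>\<Omega>\<in>X. (\<forall>z\<in>frontier \<Omega>. dual_quermass_finite q \<Omega> z) \<and>
     Holder_boundary m \<beta> \<Omega> (dual_quermass q \<Omega>) \<and> Holder_norm_boundary m \<beta> \<Omega> (dual_quermass q \<Omega>) \<le> C"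
proof -
  have sp: "space (M i) = S i" for i by (simp add: M_def space_restrict_space)
  have Uf: "(\<lambda>(i, s). ball (- snd i) (1/2)) = (\<lambda>j::((real^'n) set \<times> (real^'n)) \<times> (real^'n). ball (- snd (fst j)) (1/2))"
    by (simp add: split_beta')
  interpret B: weighted_family "Sigma P S" "\<lambda>j. ball (- snd (fst j)) (1/2)" d D \<beta> by (rule wf)
  have wfP: "weighted_family P (\<lambda>i. ball (- snd i) (1/2)) (\<lambda>_. 1) 1 \<beta>"
    by unfold_locales (use B.\<beta>_nonneg B.\<beta>_le in auto)
  \<comment> \<open>The three exponents that \<open>Holder_class_integral\<close> asks for; the sum
    of their constants serves as a common one.\<close>
  define ps where "ps = {\<gamma>, \<gamma> - \<tau>, \<gamma> - \<tau> - \<beta>}"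
  have "\<forall>p\<in>ps. \<exists>C\<ge>0. \<forall>i\<in>P. (\<integral>\<^sup>+w\<in>S i. ennreal (d (i, w) powr p) \<partial>lborel) \<le> ennreal C"
    using K by (auto simp: ps_def)
  from bchoice[OF this] obtain c where c: "\<forall>p\<in>ps. c p \<ge> 0 \<and> (\<forall>i\<in>P. (\<integral>\<^sup>+w\<in>S i. ennreal (d (i, w) powr p) \<partial>lborel) \<le> ennreal (c p))"
    by blast
  have K: "integrable (M i) (\<lambda>w. d (i, w) powr p) \<and> (\<integral>w. d (i, w) powr p \<partial>M i) \<le> (\<Sum>p\<in>ps. c p) * 1 powr p"
    if "i \<in> P" "p \<in> ps" for i p
  proof -
    have "(\<integral>\<^sup>+w. ennreal (d (i, w) powr p) \<partial>M i) = (\<integral>\<^sup>+w\<in>S i. ennreal (d (i, w) powr p) \<partial>lborel)"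
      unfolding M_def using S by (subst nn_integral_restrict_space) auto
    also have "\<dots> \<le> ennreal (c p)" using c that by auto
    finally have le: "(\<integral>\<^sup>+w. ennreal (d (i, w) powr p) \<partial>M i) \<le> ennreal (c p)" .
    note [measurable] = meas(2)[OF that(1)]
    have m: "(\<lambda>w. d (i, w) powr p) \<in> borel_measurable (M i)"
      unfolding M_def by (intro measurable_restrict_space1) simp
    have "c p \<le> (\<Sum>p\<in>ps. c p)" using c that(2) by (intro member_le_sum) (auto simp: ps_def)
    then show ?thesis
      using integral_le_if_nn_integral_le[OF m _ _ le] c that(2) by auto
  qed
  have meas': "(\<lambda>w. f (i, w) x) \<in> borel_measurable (M i)" if "i \<in> P" "x \<in> ball (- snd i) (1/2)" for i x
    unfolding M_def using meas(1)[OF that] by (intro measurable_restrict_space1) simp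
  have int: "Holder_class P (\<lambda>i. ball (- snd i) (1/2)) (\<lambda>_. 1) \<beta> m \<gamma> \<tau> (\<lambda>i x. \<integral>w. f (i, w) x \<partial>M i)"
    "\<And>i x. i \<in> P \<Longrightarrow> x \<in> ball (- snd i) (1/2) \<Longrightarrow> integrable (M i) (\<lambda>w. f (i, w) x)"
  proof -
    have c0: "0 \<le> (\<Sum>p\<in>ps. c p)" using c by (simp add: sum_nonneg)
    note H = Holder_class_integral[of P M "\<lambda>i. ball (- snd i) (1/2)" d D \<beta> "\<lambda>_. 1" 1 m \<gamma> \<tau> f "\<Sum>p\<in>ps. c p",
        folded ps_def, unfolded Uf sp, OF wf wfP f(1)]
    show "Holder_class P (\<lambda>i. ball (- snd i) (1/2)) (\<lambda>_. 1) \<beta> m \<gamma> \<tau> (\<lambda>i x. \<integral>w. f (i, w) x \<partial>M i)"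
      by (rule H(1)) (use meas' c0 K in blast)+
    show "integrable (M i) (\<lambda>w. f (i, w) x)" if "i \<in> P" "x \<in> ball (- snd i) (1/2)" for i x
      by (rule H(2)[OF _ _ _ that]) (use meas' c0 K in blast)+
  qed
  have id: "body.Q (fst i) q (body.g (fst i) x *\<^sub>R sgn x) = ennreal (\<integral>w. f (i, w) x \<partial>M i)"
    "hom_ext (on_sphere (fst i) (dual_quermass q (fst i))) x = (\<integral>w. f (i, w) x \<partial>M i)"
    if i: "i \<in> P" and x: "x \<in> ball (- snd i) (1/2)" for i x
  proof -
    have bi: "body (fst i)" and ei: "norm (snd i) = 1" using i X by (auto simp: P_def)
    interpret body "fst i" by fact
    have "norm (x + snd i) < 1/2" using x by (simp add: dist_norm norm_minus_commute add.commute)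
    then have x0: "x \<noteq> 0" using ei by auto
    have "sgn x \<noteq> snd i"
    proof
      assume "sgn x = snd i"
      then have "x = norm x *\<^sub>R snd i" using norm_sgn_self[of x] by simp
      then have "x + snd i = (norm x + 1) *\<^sub>R snd i" by (simp add: scaleR_add_left)
      then have "norm (x + snd i) = norm x + 1" using ei by simp
      then show False using \<open>norm (x + snd i) < 1/2\<close> norm_ge_zero[of x] by linarith
    qed
    note sx = this
    note sb = swap_base[OF ei x0 sx] and he = hom_ext_on_sphere[OF x0 ei sx]
    have zeq: "g (swap (snd i) x (snd i)) *\<^sub>R swap (snd i) x (snd i) = g x *\<^sub>R sgn x"
      unfolding sb by (simp add: g_sgn)
    have zf: "g x *\<^sub>R sgn x \<in> frontier (fst i)"
      using boundary_point[of "sgn x"] x0 by (simp add: norm_sgn g_sgn)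
    then have zO: "g x *\<^sub>R sgn x \<in> fst i" using frontier_subset_closed[OF closed] by blast
    have f0: "0 \<le> f (i, w) x" if "w \<in> space (M i)" for w using f(2) i that by (auto simp: sp)
    have "Q q (g x *\<^sub>R sgn x) = (\<integral>\<^sup>+w. ennreal (f (i, w) x) \<partial>M i)"
      by (rule Q[OF i x0 sx zf zeq[symmetric]])
    also have "\<dots> = ennreal (\<integral>w. f (i, w) x \<partial>M i)"
      using int(2)[OF i x] f0 by (intro nn_integral_eq_integral) (auto intro: AE_I2)
    finally show *: "Q q (g x *\<^sub>R sgn x) = ennreal (\<integral>w. f (i, w) x \<partial>M i)" .
    show "hom_ext (on_sphere (fst i) (dual_quermass q (fst i))) x = (\<integral>w. f (i, w) x \<partial>M i)"
      unfolding he zeq dual_quermass_Q(1)[OF zO] * using f0 by (simp add: integral_nonneg_AE AE_I2)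
  qed
  interpret PF: weighted_family P "\<lambda>i. ball (- snd i) (1/2)" "\<lambda>_. 1" 1 \<beta> by (rule wfP)
  have "PF.W m \<gamma> \<tau> (\<lambda>i. hom_ext (on_sphere (fst i) (dual_quermass q (fst i))))"
    by (rule PF.W_cong[OF _ int(1)]) (simp add: id(2))
  then obtain C where C: "\<forall>\<Omega>\<in>X. Holder_sphere m \<beta> (on_sphere \<Omega> (dual_quermass q \<Omega>)) \<and>
      Holder_norm_sphere m \<beta> (on_sphere \<Omega> (dual_quermass q \<Omega>)) \<le> C"
    using Holder_sphere_local[of X 1 \<beta> m \<gamma> \<tau> "\<lambda>\<Omega>. on_sphere \<Omega> (dual_quermass q \<Omega>)"] wfP
    by (auto simp: P_def split_beta')
  have fin: "dual_quermass_finite q \<Omega> z" if \<Omega>: "\<Omega> \<in> X" and z: "z \<in> frontier \<Omega>" for \<Omega> z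
  proof -
    interpret body \<Omega> using \<Omega> by (rule X)
    have z0: "z \<noteq> 0" using z frontier_iff by auto
    have zO: "z \<in> \<Omega>" using z frontier_subset_closed[OF closed] by blast
    \<comment> \<open>With e = - sgn z the direction of z is the centre of the ball on which the
      integral formula holds.\<close>
    have iP: "(\<Omega>, - sgn z) \<in> P" using \<Omega> z0 by (simp add: P_def norm_sgn)
    have "Q q (g (sgn z) *\<^sub>R sgn (sgn z)) < \<infinity>" using id(1)[OF iP, of "sgn z"] by simp
    moreover have "g (sgn z) *\<^sub>R sgn (sgn z) = z" using frontier_eq[OF z, symmetric] z0 by (simp add: g_sgn sgn_div_norm[of "sgn z"] norm_sgn)
    ultimately show ?thesis using dual_quermass_Q(2)[OF zO] by simp
  qed
  show ?thesis
    using C fin unfolding Holder_boundary_def Holder_norm_boundary_def by blast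
qed

text \<open>The kernel has \<gamma> = q - n and \<tau> = 1 - \<alpha>. The smallest exponent q - n -
  (1 - \<alpha>) - \<beta> exceeds - n exactly if 0 < q - 1 + \<alpha> - \<beta>. For q > 1 this
  permits \<beta> = \<alpha>; for q \<le> 1 it is the restriction \<beta> < \<alpha> + q -
  1.\<close>

theorem Holder_dual_quermass_pos:
  assumes q: "0 < q" and \<alpha>: "0 \<le> \<beta>" "\<beta> \<le> \<alpha>" "\<alpha> \<le> 1" "0 < q - 1 + \<alpha> - \<beta>"
  shows "\<exists>C. \<forall>\<Omega>\<in>(admissible k \<alpha> s t :: (real^'n) set set). (\<forall>z\<in>frontier \<Omega>. dual_quermass_finite q \<Omega> z) \<and>
     Holder_boundary (Suc k) \<beta> \<Omega> (dual_quermass q \<Omega>) \<and> Holder_norm_boundary (Suc k) \<beta> \<Omega> (dual_quermass q \<Omega>) \<le> C"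
proof (cases "(admissible k \<alpha> s t :: (real^'n) set set) = {}")
  case False
  define X where "X = (admissible k \<alpha> s t :: (real^'n) set set)"
  let ?n = "real CARD('n)"
  define P where "P = X \<times> sphere (0::real^'n) 1"
  define S where "S = (\<lambda>i::(real^'n) set \<times> (real^'n). ball (0::real^'n) 1 - {0, snd i})"
  define I where "I = Sigma P S"
  define d where "d = (\<lambda>j::((real^'n) set \<times> (real^'n)) \<times> (real^'n). norm (snd j - snd (fst j)))"
  define f where "f = (\<lambda>j::((real^'n) set \<times> (real^'n)) \<times> (real^'n). \<lambda>x. q / ?n *
     (norm (body.g (fst (fst j)) (swap (snd (fst j)) x (sgn (snd j))) *\<^sub>R snd j - body.g (fst (fst j)) (swap (snd (fst j)) x (snd (fst j))) *\<^sub>R snd (fst j)) powr (q - ?n)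
       * body.g (fst (fst j)) (swap (snd (fst j)) x (sgn (snd j))) powr ?n))"
  have I: "j \<in> I \<longleftrightarrow> fst (fst j) \<in> X \<and> norm (snd (fst j)) = 1 \<and> norm (snd j) < 1 \<and> snd j \<noteq> 0 \<and> snd j \<noteq> snd (fst j)" for j
    by (cases j) (auto simp: I_def P_def S_def)
  interpret B: body_family I "\<lambda>i. snd (fst i)" d 2 \<beta> "\<lambda>i. fst (fst i)" k \<alpha> "1 / t"
  proof (rule body_family_admissible[OF \<alpha>(1-3)])
    show "I \<subseteq> {i. fst (fst i) \<in> admissible k \<alpha> s t \<and> norm (snd (fst i)) = 1}" using I by (auto simp: X_def)
    show "\<exists>\<Omega>::(real^'n) set. \<Omega> \<in> admissible k \<alpha> s t" using False by blast
    show "0 < d j \<and> d j \<le> 2" if "j \<in> I" for j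
      using that norm_triangle_ineq4[of "snd j" "snd (fst j)"] by (auto simp: d_def I)
  qed
  have \<tau>: "0 \<le> 1 - \<alpha>" "1 - \<alpha> \<le> 1" using \<alpha> by auto
  have Wf: "B.W (Suc k) (q - ?n) (1 - \<alpha>) f"
  proof -
    have "B.W (Suc k) (0 + (q - ?n)) (1 - \<alpha>) (\<lambda>j x. body.g (fst (fst j)) (swap (snd (fst j)) x (sgn (snd j))) powr ?n *
      norm (body.g (fst (fst j)) (swap (snd (fst j)) x (sgn (snd j))) *\<^sub>R snd j - body.g (fst (fst j)) (swap (snd (fst j)) x (snd (fst j))) *\<^sub>R snd (fst j)) powr (q - ?n))"
    proof (rule B.W_mult[OF \<tau>])
      show "B.W (Suc k) 0 0 (\<lambda>j x. body.g (fst (fst j)) (swap (snd (fst j)) x (sgn (snd j))) powr ?n)"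
        by (rule B.W_G(2)) (simp add: I norm_sgn)
      show "B.W (Suc k) (q - ?n) (1 - \<alpha>) (\<lambda>j x. norm (body.g (fst (fst j)) (swap (snd (fst j)) x (sgn (snd j))) *\<^sub>R snd j - body.g (fst (fst j)) (swap (snd (fst j)) x (snd (fst j))) *\<^sub>R snd (fst j)) powr (q - ?n))"
        by (rule B.W_norm_diff_powr) (auto simp: I d_def)
    qed
    from B.W_cmult[OF this \<tau>, of "q / ?n"] show ?thesis by (simp add: f_def mult_ac)
  qed
  show ?thesis unfolding X_def[symmetric]
  proof (rule Holder_boundary_integral[where X=X and S=S and f=f and d=d, folded P_def, folded I_def, OF _ B.weighted_family_axioms Wf])
    show "body \<Omega>" if "\<Omega> \<in> X" for \<Omega> using that admissible_body by (simp add: X_def)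
    show "0 \<le> f j x" for j x using q by (simp add: f_def)
    show "S i \<in> sets borel" for i by (simp add: S_def)
    show "(\<lambda>w. d (i, w)) \<in> borel_measurable borel" for i by (simp add: d_def)
    show "(\<lambda>w. f (i, w) x) \<in> borel_measurable borel" if "i \<in> P" for i x
    proof -
      have "body (fst i)" using that admissible_body by (auto simp: P_def X_def)
      note [measurable] = body.g_measurable[OF this]
      show ?thesis unfolding f_def fst_conv snd_conv by measurable
    qed
    show "\<exists>C\<ge>0. \<forall>i\<in>P. (\<integral>\<^sup>+w\<in>S i. ennreal (d (i, w) powr p) \<partial>lborel) \<le> ennreal C"
      if "p \<in> {q - ?n, q - ?n - (1 - \<alpha>), q - ?n - (1 - \<alpha>) - \<beta>}" for p
    proof -
      have "- real DIM(real^'n) < p" using that \<alpha> by auto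
      from nn_integral_norm_powr_finite[OF this]
      obtain C where C: "C \<ge> 0" "\<And>e::real^'n. norm e = 1 \<Longrightarrow> (\<integral>\<^sup>+w\<in>ball 0 1. ennreal (norm (w - e) powr p) \<partial>lborel) \<le> ennreal C"
        by blast
      have "(\<integral>\<^sup>+w\<in>S i. ennreal (d (i, w) powr p) \<partial>lborel) \<le> (\<integral>\<^sup>+w\<in>ball 0 1. ennreal (norm (w - snd i) powr p) \<partial>lborel)" for i
        by (intro nn_integral_mono) (auto simp: S_def d_def indicator_def)
      moreover have "(\<integral>\<^sup>+w\<in>ball 0 1. ennreal (norm (w - snd i) powr p) \<partial>lborel) \<le> ennreal C" if "i \<in> P" for i
        using C(2)[of "snd i"] that by (auto simp: P_def)
      ultimately show ?thesis using C(1) by (meson order_trans)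
    qed
    show "body.Q (fst i) q (body.g (fst i) x *\<^sub>R sgn x) = (\<integral>\<^sup>+w. ennreal (f (i, w) x) \<partial>restrict_space lborel (S i))"
      if i: "i \<in> P" and zf: "body.g (fst i) x *\<^sub>R sgn x \<in> frontier (fst i)"
        and zeq: "body.g (fst i) x *\<^sub>R sgn x = body.g (fst i) (swap (snd i) x (snd i)) *\<^sub>R swap (snd i) x (snd i)" for i x
    proof -
      have b: "body (fst i)" using i admissible_body by (auto simp: P_def X_def)
      then have "body.g (fst i) x *\<^sub>R sgn x \<in> fst i" using zf frontier_subset_closed[OF body.closed[OF b]] by blast
      then show ?thesis using Q_ball_swap[OF b q, of "snd i" x] unfolding zeq by (simp add: f_def S_def)
    qed
  qed
qed simp

section \<open>Regularity for negative exponents\<close>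

context body
begin

text \<open>The partial derivative of |y| / g(y) by the quotient rule, written with products and
  \<open>powr - 1\<close> so that it is assembled from operations under which the weighted classes
  are closed.\<close>

definition gauge_partial :: "'a \<Rightarrow> 'a \<Rightarrow> real" where
  "gauge_partial b y = (y \<bullet> b) * (1 / norm y) * g y powr - 1 - norm y * partial b g y * (g y powr - 1 * g y powr - 1)"

lemma gauge_has_derivative:
  assumes y: "y \<noteq> 0" and g: "g differentiable (at y)"
  shows "(gauge has_derivative (\<lambda>h. \<Sum>b\<in>Basis. gauge_partial b y * (h \<bullet> b))) (at y)"
proof -
  have gp: "0 < g y" by (rule g_pos[OF y])
  have dg: "(g has_derivative (\<lambda>h. \<Sum>b\<in>Basis. (h \<bullet> b) * partial b g y)) (at y)"
    by (rule has_derivative_eq_rhs[OF frechet_derivative_works[THEN iffD1, OF g]])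
      (rule ext, rule frechet_derivative_expand[OF g])
  have inv: "g y powr - 1 = 1 / g y" using gp by (simp add: powr_minus_divide)
  have "((\<lambda>x. norm x / g x) has_derivative (\<lambda>h. (h \<bullet> sgn y * g y - norm y * (\<Sum>b\<in>Basis. (h \<bullet> b) * partial b g y)) / (g y * g y))) (at y)"
    by (rule has_derivative_divide'[OF has_derivative_norm[OF y] dg]) (use gp in simp)
  moreover have "(h \<bullet> sgn y * g y - norm y * (\<Sum>b\<in>Basis. (h \<bullet> b) * partial b g y)) / (g y * g y) = (\<Sum>b\<in>Basis. gauge_partial b y * (h \<bullet> b))" for h
  proof -
    have "h \<bullet> sgn y = (\<Sum>b\<in>Basis. (h \<bullet> b) * (y \<bullet> b) / norm y)"
      by (subst euclidean_inner) (simp add: sgn_div_norm divide_inverse mult_ac)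
    then have "(h \<bullet> sgn y * g y - norm y * (\<Sum>b\<in>Basis. (h \<bullet> b) * partial b g y)) / (g y * g y) =
       (\<Sum>b\<in>Basis. ((h \<bullet> b) * (y \<bullet> b) / norm y * g y - norm y * ((h \<bullet> b) * partial b g y)) / (g y * g y))"
      by (simp add: sum_distrib_left sum_distrib_right sum_subtractf sum_divide_distrib diff_divide_distrib)
    also have "\<dots> = (\<Sum>b\<in>Basis. gauge_partial b y * (h \<bullet> b))"
      using gp y by (intro sum.cong refl) (simp add: gauge_partial_def inv field_simps)
    finally show ?thesis .
  qed
  ultimately show ?thesis by (simp add: gauge_def[abs_def])
qed

lemma continuous_gauge_partial:
  assumes "continuous_on (- {0}) (partial b g)"
  shows "continuous_on (- {0}) (gauge_partial b)"
proof -
  have gi: "continuous_on (- {0}) (\<lambda>y. g y powr - 1)"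
    using continuous_g g_pos by (intro continuous_on_powr continuous_intros) (auto simp: less_imp_neq[symmetric])
  show ?thesis unfolding gauge_partial_def[abs_def]
    by (rule continuous_on_diff continuous_on_mult continuous_on_divide continuous_on_inner continuous_on_norm
        continuous_on_const continuous_on_id gi assms ballI | simp)+
qed

text \<open>Euler's identity again, needed below to convert the linear term at the base point into a
  value of the gauge.\<close>

lemma gauge_partial_self:
  assumes y: "y \<noteq> 0" and g: "g differentiable (at y)"
  shows "(\<Sum>b\<in>Basis. gauge_partial b y * (y \<bullet> b)) = gauge y"
proof -
  have "((\<lambda>t::real. gauge (t *\<^sub>R y)) has_derivative (\<lambda>t. \<Sum>b\<in>Basis. gauge_partial b y * ((t *\<^sub>R y) \<bullet> b))) (at 1)"
    by (rule has_derivative_compose[where f="\<lambda>t. t *\<^sub>R y" and g=gauge])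
      (auto intro!: derivative_eq_intros gauge_has_derivative[OF y g])
  moreover have "((\<lambda>t::real. gauge (t *\<^sub>R y)) has_derivative (\<lambda>t. t * gauge y)) (at 1)"
  proof (rule has_derivative_transform_within_open[where s="{0<..}"])
    show "((\<lambda>t. t * gauge y) has_derivative (\<lambda>t. t * gauge y)) (at 1)"
      by (auto intro!: derivative_eq_intros)
  qed (auto simp: gauge_scaleR)
  ultimately have "(\<lambda>t::real. \<Sum>b\<in>Basis. gauge_partial b y * ((t *\<^sub>R y) \<bullet> b)) = (\<lambda>t. t * gauge y)"
    by (rule has_derivative_unique)
  from fun_cong[OF this, of 1] show ?thesis by simp
qed

end

lemma smooth_body_gauge_partial:
  fixes \<Omega> :: "(real^'n) set"
  assumes b: "body \<Omega>" and C: "Ck_on (Suc k) (- {0}) (body.g \<Omega>)"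
  shows "smooth_body \<Omega> (\<lambda>y. \<Sum>b\<in>Basis. body.gauge_partial \<Omega> b y *\<^sub>R b)"
proof -
  interpret body \<Omega> by fact
  have dif: "g differentiable (at y)" if "y \<noteq> 0" for y
    using C that unfolding Ck_on_def by (auto simp: multi_indices_def dest!: spec[of _ 0])
  have cont: "continuous_on (- {0}) (partial b g)" if "b \<in> Basis" for b
  proof -
    have "[b] \<in> multi_indices 1" using that by (auto simp: multi_indices_def)
    then have "continuous_on (- {0}) (iter_deriv [b] g)" using C unfolding Ck_on_def by force
    then show ?thesis by simp
  qed
  show ?thesis
  proof
    show "(gauge has_derivative (\<lambda>h. (\<Sum>b\<in>Basis. gauge_partial b y *\<^sub>R b) \<bullet> h)) (at y)" if "y \<noteq> 0" for y
    proof (rule has_derivative_eq_rhs[OF gauge_has_derivative[OF that dif[OF that]]], rule ext)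
      show "(\<Sum>b\<in>Basis. gauge_partial b y * (h \<bullet> b)) = (\<Sum>b\<in>Basis. gauge_partial b y *\<^sub>R b) \<bullet> h" for h
        by (subst inner_sum_left) (simp add: inner_commute)
    qed
    show "continuous_on (- {0}) (\<lambda>y. \<Sum>b\<in>Basis. gauge_partial b y *\<^sub>R b)"
      by (intro continuous_intros continuous_gauge_partial cont)
  qed
qed

lemma smooth_family_reindex:
  "smooth_family I k \<alpha> h \<Longrightarrow> (\<And>j. j \<in> J \<Longrightarrow> \<phi> j \<in> I) \<Longrightarrow> smooth_family J k \<alpha> (\<lambda>j. h (\<phi> j))"
  unfolding smooth_family_def by blast

text \<open>With the first projection it adds an integration parameter to the index; with the
  identity it restricts the family to a subset.\<close>

lemma body_family_reindex:
  assumes "body_family I e d D \<beta> \<Omega> k \<alpha> r" "\<And>j. j \<in> J \<Longrightarrow> \<phi> j \<in> I"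
  shows "body_family J (\<lambda>j. e (\<phi> j)) (\<lambda>j. d (\<phi> j)) D \<beta> (\<lambda>j. \<Omega> (\<phi> j)) k \<alpha> r"
proof -
  interpret body_family I e d D \<beta> \<Omega> k \<alpha> r by fact
  show ?thesis
    apply unfold_locales
    using assms(2) d_pos d_le D_pos \<beta>_nonneg \<beta>_le norm_e body_\<Omega> r \<alpha> smooth_family_reindex[OF smooth, of J \<phi>] by (auto simp: body_def)
qed

context body_family
begin

abbreviation "dG i \<equiv> body.gauge_partial (\<Omega> i)"

lemma G_differentiable: "i \<in> I \<Longrightarrow> y \<noteq> 0 \<Longrightarrow> G i differentiable (at y)"
  by (rule smooth_family_Suc(2)[OF smooth])

lemma W_weaken: "W (Suc k) \<gamma> \<tau> f \<Longrightarrow> 0 \<le> \<tau> \<Longrightarrow> \<tau> \<le> 1 \<Longrightarrow> \<gamma>' \<le> \<gamma> \<Longrightarrow> W k \<gamma>' 0 f"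
  by (rule W_mono[OF W_Suc_imp_W]) auto

lemma W_gauge_partial:
  assumes p: "\<And>i. i \<in> I \<Longrightarrow> p i \<in> cball 0 1 - ball 0 (1/2)" and b: "b \<in> Basis"
  shows "W k 0 0 (\<lambda>i x. dG i b (swap (e i) x (p i)))" (is ?A)
    and "\<lbrakk>\<And>i. i \<in> I \<Longrightarrow> p' i \<in> cball 0 1 - ball 0 (1/2); 0 \<le> C; \<And>i. i \<in> I \<Longrightarrow> dist (p i) (p' i) \<le> C * d i\<rbrakk>
      \<Longrightarrow> W k \<alpha> 0 (\<lambda>i x. dG i b (swap (e i) x (p i)) - dG i b (swap (e i) x (p' i)))" (is "\<lbrakk>PROP ?P1; ?P2; PROP ?P3\<rbrakk> \<Longrightarrow> ?B")
proof -
  \<comment> \<open>Both functions are of weight 0 and their difference of weight \<alpha>. The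
    relation is stable under products and differences, so it passes from the ingredients of
    \<open>gauge_partial\<close> to the whole expression. The exponent is \<alpha> because the
    partial derivatives of g are only \<alpha>-Hoelder at the top order k.\<close>
  define close where "close = (\<lambda>f f'. W k 0 0 f \<and> W k 0 0 f' \<and> W k \<alpha> 0 (\<lambda>i x. f i x - f' i x))"
  have close_mult: "close (\<lambda>i x. f i x * h i x) (\<lambda>i x. f' i x * h' i x)" if "close f f'" "close h h'" for f f' h h'
  proof -
    have "W k (\<alpha> + 0) 0 (\<lambda>i x. (f i x - f' i x) * h i x)" "W k (0 + \<alpha>) 0 (\<lambda>i x. f' i x * (h i x - h' i x))"
      "W k (0 + 0) 0 (\<lambda>i x. f i x * h i x)" "W k (0 + 0) 0 (\<lambda>i x. f' i x * h' i x)"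
      using that unfolding close_def by (intro W_mult; simp)+
    moreover from this(1,2) have "W k \<alpha> 0 (\<lambda>i x. (f i x - f' i x) * h i x + f' i x * (h i x - h' i x))"
      by (intro W_add) simp_all
    ultimately show ?thesis unfolding close_def by (simp add: algebra_simps)
  qed
  have close_cong: "close F F'" if c: "close f f'" and eq: "\<And>i x. i \<in> I \<Longrightarrow> f i x = F i x" "\<And>i x. i \<in> I \<Longrightarrow> f' i x = F' i x" for f f' F F'
    unfolding close_def
  proof (intro conjI)
    show "W k 0 0 F" by (rule W_cong[where f=f]) (use c eq in \<open>auto simp: close_def\<close>)
    show "W k 0 0 F'" by (rule W_cong[where f=f']) (use c eq in \<open>auto simp: close_def\<close>)
    show "W k \<alpha> 0 (\<lambda>i x. F i x - F' i x)" by (rule W_cong[where f="\<lambda>i x. f i x - f' i x"]) (use c eq in \<open>auto simp: close_def\<close>)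
  qed
  have close_diff: "close (\<lambda>i x. f i x - h i x) (\<lambda>i x. f' i x - h' i x)" if "close f f'" "close h h'" for f f' h h'
  proof -
    have "W k \<alpha> 0 (\<lambda>i x. (f i x - f' i x) - (h i x - h' i x))"
      using that unfolding close_def by (intro W_diff[where f="\<lambda>i x. f i x - f' i x"]) simp_all
    then have "W k \<alpha> 0 (\<lambda>i x. f i x - h i x - (f' i x - h' i x))" by (simp add: algebra_simps)
    then show ?thesis using that unfolding close_def by (simp add: W_diff)
  qed
  have *: "close (\<lambda>i x. dG i b (swap (e i) x (p i))) (\<lambda>i x. dG i b (swap (e i) x (p' i)))"
    if p': "\<And>i. i \<in> I \<Longrightarrow> p' i \<in> cball 0 1 - ball 0 (1/2)" and C: "0 \<le> C" "\<And>i. i \<in> I \<Longrightarrow> dist (p i) (p' i) \<le> C * d i" for p' C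
  proof -
    have \<tau>: "0 \<le> 1 - \<alpha>" "1 - \<alpha> \<le> 1" using \<alpha> \<alpha>_nonneg by auto
    note sf = smooth_family_Suc(1)[OF smooth b]
    have c1: "close (\<lambda>i x. swap (e i) x (p i) \<bullet> b) (\<lambda>i x. swap (e i) x (p' i) \<bullet> b)"
      unfolding close_def
    proof (intro conjI)
      show "W k 0 0 (\<lambda>i x. swap (e i) x (p i) \<bullet> b)" by (rule W_swap[of 1]) (use p d_pos b in force)+
      show "W k 0 0 (\<lambda>i x. swap (e i) x (p' i) \<bullet> b)" by (rule W_swap[of 1]) (use p' d_pos b in force)+
      have "W k 1 0 (\<lambda>i x. swap (e i) x (p i - p' i) \<bullet> b)"
        by (rule W_swap[OF C(1)]) (use C(2) d_pos b in \<open>auto simp: dist_norm less_imp_le\<close>)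
      then show "W k \<alpha> 0 (\<lambda>i x. swap (e i) x (p i) \<bullet> b - swap (e i) x (p' i) \<bullet> b)"
        unfolding inner_diff_left[symmetric] swap_diff by (rule W_mono) (use \<alpha> in auto)
    qed
    \<comment> \<open>Covers the norm and its reciprocal. On the shell of radii between 1/2 and 1
      the reciprocal is at most 2 with Lipschitz constant 4, whence the numerical bounds.\<close>
    have cst: "close (\<lambda>i x. c i) (\<lambda>i x. c' i)"
      if "\<And>i. i \<in> I \<Longrightarrow> \<bar>c i\<bar> \<le> 2" "\<And>i. i \<in> I \<Longrightarrow> \<bar>c' i\<bar> \<le> 2" "\<And>i. i \<in> I \<Longrightarrow> \<bar>c i - c' i\<bar> \<le> 4 * C * d i" for c c' :: "'i \<Rightarrow> real"
    proof -
      have "W k 1 0 (\<lambda>i x. c i - c' i)" by (rule W_const[of "4 * C"]) (use C that d_pos in \<open>force+\<close>)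
      then have "W k \<alpha> 0 (\<lambda>i x. c i - c' i)" by (rule W_mono) (use \<alpha> in auto)
      moreover have "W k 0 0 (\<lambda>i x. c i)" "W k 0 0 (\<lambda>i x. c' i)"
        by (rule W_const[of 2]; use that d_pos in force)+
      ultimately show ?thesis by (simp add: close_def)
    qed
    have nd: "\<bar>norm (p i) - norm (p' i)\<bar> \<le> C * d i" if "i \<in> I" for i
      using norm_triangle_ineq3[of "p i" "p' i"] C(2)[OF that] by (simp add: dist_norm)
    have np: "1/2 \<le> norm (p i)" "norm (p i) \<le> 1" "1/2 \<le> norm (p' i)" "norm (p' i) \<le> 1" if "i \<in> I" for i
      using p[OF that] p'[OF that] by auto
    have c2: "close (\<lambda>i x. norm (p i)) (\<lambda>i x. norm (p' i))"
    proof (rule cst)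
      show "\<bar>norm (p i) - norm (p' i)\<bar> \<le> 4 * C * d i" if "i \<in> I" for i
        using nd[OF that] mult_nonneg_nonneg[OF C(1), of "d i"] d_pos[OF that] by linarith
    qed (use np in force)+
    have recip: "\<bar>1 / a\<bar> \<le> 2 \<and> \<bar>1 / a - 1 / b\<bar> \<le> 4 * \<bar>a - b\<bar>" if "1/2 \<le> a" "1/2 \<le> b" for a b :: real
    proof -
      have ab: "\<bar>1 / a\<bar> \<le> 2" "\<bar>1 / b\<bar> \<le> 2" using that by (auto simp: field_simps)
      have "1 / a - 1 / b = (1 / a * (1 / b)) * (b - a)" using that by (simp add: field_simps)
      then have "\<bar>1 / a - 1 / b\<bar> = \<bar>1 / a\<bar> * \<bar>1 / b\<bar> * \<bar>a - b\<bar>" by (simp only: abs_mult abs_minus_commute)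
      also have "\<dots> \<le> 2 * 2 * \<bar>a - b\<bar>" by (intro mult_mono ab) auto
      finally show ?thesis using ab by simp
    qed
    have c3: "close (\<lambda>i x. 1 / norm (p i)) (\<lambda>i x. 1 / norm (p' i))"
    proof (rule cst)
      fix i assume i: "i \<in> I"
      show "\<bar>1 / norm (p i)\<bar> \<le> 2" "\<bar>1 / norm (p' i)\<bar> \<le> 2" using recip np[OF i] by blast+
      have "\<bar>1 / norm (p i) - 1 / norm (p' i)\<bar> \<le> 4 * \<bar>norm (p i) - norm (p' i)\<bar>" using recip np[OF i] by blast
      then show "\<bar>1 / norm (p i) - 1 / norm (p' i)\<bar> \<le> 4 * C * d i" using nd[OF i] by simp
    qed
    have c4: "close (\<lambda>i x. G i (swap (e i) x (p i)) powr - 1) (\<lambda>i x. G i (swap (e i) x (p' i)) powr - 1)"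
      unfolding close_def
    proof (intro conjI)
      have 1: "W k 0 0 (\<lambda>i x. G i (swap (e i) x (q i)) powr - 1)" if "\<And>i. i \<in> I \<Longrightarrow> q i \<in> cball 0 1 - ball 0 (1/2)" for q
        by (rule W_weaken, rule W_G(2), rule that) simp_all
      show "W k 0 0 (\<lambda>i x. G i (swap (e i) x (p i)) powr - 1)" by (rule 1) (rule p)
      show p'1: "W k 0 0 (\<lambda>i x. G i (swap (e i) x (p' i)) powr - 1)" by (rule 1) (rule p')
      \<comment> \<open>The order is reversed in view of 1/a - 1/b = (1/b) (1/a) (b - a).\<close>
      have "W (Suc k) 1 (1 - \<alpha>) (\<lambda>i x. G i (swap (e i) x (p' i)) - G i (swap (e i) x (p i)))"
        by (rule W_comp_swap(2)[OF smooth \<alpha> p' p C(1)]) (use C(2) in \<open>auto simp: dist_commute\<close>)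
      then have "W k \<alpha> 0 (\<lambda>i x. G i (swap (e i) x (p' i)) - G i (swap (e i) x (p i)))"
        by (rule W_weaken) (use \<tau> \<alpha> in auto)
      then have "W k (0 + \<alpha>) 0 (\<lambda>i x. G i (swap (e i) x (p i)) powr - 1 * (G i (swap (e i) x (p' i)) - G i (swap (e i) x (p i))))"
        by (intro W_mult 1 p) auto
      from W_mult[OF _ _ p'1 this] have "W k \<alpha> 0 (\<lambda>i x. G i (swap (e i) x (p' i)) powr - 1 *
          (G i (swap (e i) x (p i)) powr - 1 * (G i (swap (e i) x (p' i)) - G i (swap (e i) x (p i)))))" by simp
      then show "W k \<alpha> 0 (\<lambda>i x. G i (swap (e i) x (p i)) powr - 1 - G i (swap (e i) x (p' i)) powr - 1)"
      proof (rule W_cong[rotated])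
        fix i x assume i: "i \<in> I"
        have "p i \<noteq> 0" "p' i \<noteq> 0" using np[OF i] by auto
        then have "0 < G i (swap (e i) x (p i))" "0 < G i (swap (e i) x (p' i))"
          using body.g_pos[OF body_\<Omega>[OF i]] swap_nonzero by blast+
        then show "G i (swap (e i) x (p' i)) powr - 1 *
          (G i (swap (e i) x (p i)) powr - 1 * (G i (swap (e i) x (p' i)) - G i (swap (e i) x (p i)))) =
          G i (swap (e i) x (p i)) powr - 1 - G i (swap (e i) x (p' i)) powr - 1"
          by (simp add: powr_minus_divide field_simps)
      qed
    qed
    have c5: "close (\<lambda>i x. partial b (G i) (swap (e i) x (p i))) (\<lambda>i x. partial b (G i) (swap (e i) x (p' i)))"
      unfolding close_def
    proof (intro conjI)
      show "W k 0 0 (\<lambda>i x. partial b (G i) (swap (e i) x (p i)))" by (rule W_comp_swap(1)[OF sf \<alpha> p])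
      show "W k 0 0 (\<lambda>i x. partial b (G i) (swap (e i) x (p' i)))" by (rule W_comp_swap(1)[OF sf \<alpha> p'])
      have "W k 1 (1 - \<alpha>) (\<lambda>i x. partial b (G i) (swap (e i) x (p i)) - partial b (G i) (swap (e i) x (p' i)))"
        by (rule W_comp_swap(2)[OF sf \<alpha> p p' C])
      then show "W k \<alpha> 0 (\<lambda>i x. partial b (G i) (swap (e i) x (p i)) - partial b (G i) (swap (e i) x (p' i)))"
        by (rule W_mono) (use \<alpha> in auto)
    qed
    have cl: "close (\<lambda>i x. (swap (e i) x (p i) \<bullet> b) * (1 / norm (p i)) * G i (swap (e i) x (p i)) powr - 1 -
        norm (p i) * partial b (G i) (swap (e i) x (p i)) * (G i (swap (e i) x (p i)) powr - 1 * G i (swap (e i) x (p i)) powr - 1))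
      (\<lambda>i x. (swap (e i) x (p' i) \<bullet> b) * (1 / norm (p' i)) * G i (swap (e i) x (p' i)) powr - 1 -
        norm (p' i) * partial b (G i) (swap (e i) x (p' i)) * (G i (swap (e i) x (p' i)) powr - 1 * G i (swap (e i) x (p' i)) powr - 1))"
      by (rule close_diff[OF close_mult[OF close_mult[OF c1 c3] c4] close_mult[OF close_mult[OF c2 c5] close_mult[OF c4 c4]]])
    have eq: "(swap (e i) x q \<bullet> b) * (1 / norm q) * G i (swap (e i) x q) powr - 1 -
        norm q * partial b (G i) (swap (e i) x q) * (G i (swap (e i) x q) powr - 1 * G i (swap (e i) x q) powr - 1) = dG i b (swap (e i) x q)"
      if "i \<in> I" for i x q
      unfolding body.gauge_partial_def[OF body_\<Omega>[OF that]] norm_swap ..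
    show ?thesis by (rule close_cong[OF cl eq eq])
  qed
  \<comment> \<open>The choice p' = p and C = 0 satisfies the hypotheses of the comparison, which
    includes the bound of the first function.\<close>
  show ?A using *[OF p order_refl] unfolding close_def by simp
  show "\<lbrakk>PROP ?P1; ?P2; PROP ?P3\<rbrakk> \<Longrightarrow> ?B" using *[of p' C] unfolding close_def by blast
qed

text \<open>Where the weight is at least 1, its nonnegative powers are at least 1 and the constant
  function 1 belongs to the class of any such exponent.\<close>

lemma W_const_far:
  assumes "\<And>i. i \<in> I \<Longrightarrow> 1 \<le> d i" "0 \<le> \<gamma>" "W k 0 0 f"
  shows "W k \<gamma> 0 f"
proof -
  have "W k \<gamma> 0 (\<lambda>i x. 1)"
    by (rule W_const[of 1]) (use assms in \<open>auto simp: ge_one_powr_ge_zero\<close>)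
  from W_mult[OF _ _ this assms(3)] show ?thesis by simp
qed

text \<open>The factor 1 - gr w . z of \<open>Q_shadow\<close> after reflection, with z = g(Re) Re
  and \<omega> in the place of the direction of w.\<close>

definition shadow_factor :: "('i \<Rightarrow> 'a) \<Rightarrow> 'i \<Rightarrow> 'a \<Rightarrow> real" where
  "shadow_factor \<omega> i x = 1 - G i (swap (e i) x (e i)) * (\<Sum>b\<in>Basis. dG i b (swap (e i) x (\<omega> i)) * (swap (e i) x (e i) \<bullet> b))"

lemma W_shadow_factor_0:
  assumes "\<And>i. i \<in> I \<Longrightarrow> norm (\<omega> i) = 1"
  shows "W k 0 0 (shadow_factor \<omega>)"
proof -
  have Ge: "W k 0 0 (\<lambda>i x. G i (swap (e i) x (e i)))"
    by (rule W_weaken, rule W_G(1), rule e_shell) simp_all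
  have "W k (0 + 0) 0 (\<lambda>i x. dG i b (swap (e i) x (\<omega> i)) * (swap (e i) x (e i) \<bullet> b))" if "b \<in> Basis" for b
  proof (rule W_mult)
    show "W k 0 0 (\<lambda>i x. dG i b (swap (e i) x (\<omega> i)))" by (rule W_gauge_partial(1)[OF _ that]) (use assms in simp)
    show "W k 0 0 (\<lambda>i x. swap (e i) x (e i) \<bullet> b)" by (rule W_swap[of 1]) (use norm_e d_pos that in force)+
  qed simp_all
  then have "W k 0 0 (\<lambda>i x. \<Sum>b\<in>Basis. dG i b (swap (e i) x (\<omega> i)) * (swap (e i) x (e i) \<bullet> b))"
    by (intro W_sum) auto
  from W_mult[OF _ _ Ge this] have "W k 0 0 (\<lambda>i x. G i (swap (e i) x (e i)) * (\<Sum>b\<in>Basis. dG i b (swap (e i) x (\<omega> i)) * (swap (e i) x (e i) \<bullet> b)))"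
    by simp
  from W_diff[OF W_real_const this, of 1] show ?thesis by (simp add: shadow_factor_def[abs_def])
qed

text \<open>A Taylor remainder. By Euler's identity the factor divided by g(Re) equals gauge(Re) -
  gauge(R\<omega>) minus the derivative at R\<omega> in the direction R(e - \<omega>). This is the
  integral over t in [0, 1] of the increment of the gradient from \<omega> to a point of the
  segment, of size d^\<alpha>, times R(e - \<omega>), of size d. The condition d < 1 keeps the
  segment away from the origin.\<close>

lemma W_shadow_factor_near:
  assumes \<omega>: "\<And>i. i \<in> I \<Longrightarrow> norm (\<omega> i) = 1" "\<And>i. i \<in> I \<Longrightarrow> d i = norm (\<omega> i - e i)" "\<And>i. i \<in> I \<Longrightarrow> d i < 1"
  shows "W k (1 + \<alpha>) 0 (shadow_factor \<omega>)"
proof -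
  define M where "M = restrict_space lborel {0..1::real}"
  have sp: "space M = {0..1}" by (simp add: M_def space_restrict_space)
  define J where "J = Sigma I (\<lambda>_. {0..1::real})"
  define p where "p = (\<lambda>j::'i \<times> real. \<omega> (fst j) + snd j *\<^sub>R (e (fst j) - \<omega> (fst j)))"
  have fJ: "fst j \<in> I" if "j \<in> J" for j using that by (auto simp: J_def)
  interpret J: body_family J "\<lambda>j. e (fst j)" "\<lambda>j. d (fst j)" D \<beta> "\<lambda>j. \<Omega> (fst j)" k \<alpha> r
    by (rule body_family_reindex[OF body_family_axioms]) (rule fJ)
  have pn: "p j \<in> cball 0 1 - ball 0 (1/2)" if "j \<in> J" for j
  proof -
    obtain i t where jt: "j = (i, t)" by (cases j)
    then have j: "j = (i, t)" "i \<in> I" "0 \<le> t" "t \<le> 1" using that by (auto simp: J_def)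
    have p1: "p j = (1 - t) *\<^sub>R \<omega> i + t *\<^sub>R e i" and p2: "p j = e i - (1 - t) *\<^sub>R (e i - \<omega> i)"
      by (simp_all add: p_def j algebra_simps)
    have "norm (p j) \<le> (1 - t) * norm (\<omega> i) + t * norm (e i)"
      unfolding p1 using j by (intro norm_triangle_le) simp
    then have up: "norm (p j) \<le> 1" using \<omega>(1)[OF j(2)] norm_e[OF j(2)] by simp
    have n: "norm (e i - \<omega> i) < 1" using \<omega>(2,3)[OF j(2)] by (simp add: norm_minus_commute)
    have "1/2 \<le> norm (p j)"
    \<comment> \<open>Compare with the nearer end point: the distance to it is at most 1/2 and both
      end points are unit vectors.\<close>
    proof (cases "t \<le> 1/2")
      case True
      have "t * norm (e i - \<omega> i) \<le> 1/2 * 1" using True n j by (intro mult_mono) auto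
      moreover have "norm (\<omega> i) \<le> norm (p j) + norm (t *\<^sub>R (e i - \<omega> i))"
        using norm_triangle_ineq4[of "p j" "t *\<^sub>R (e i - \<omega> i)"] by (simp add: p_def j)
      ultimately show ?thesis using \<omega>(1)[OF j(2)] j by simp
    next
      case False
      have "(1 - t) * norm (e i - \<omega> i) \<le> 1/2 * 1" using False n j by (intro mult_mono) auto
      moreover have "norm (e i) \<le> norm (p j) + norm ((1 - t) *\<^sub>R (e i - \<omega> i))"
        using norm_triangle_ineq[of "p j" "(1 - t) *\<^sub>R (e i - \<omega> i)"] by (simp add: p2)
      ultimately show ?thesis using norm_e[OF j(2)] j by simp
    qed
    then show ?thesis using up by simp
  qed
  define f where "f = (\<lambda>j x. \<Sum>b\<in>Basis. (dG (fst j) b (swap (e (fst j)) x (p j)) - dG (fst j) b (swap (e (fst j)) x (\<omega> (fst j))))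
      * (swap (e (fst j)) x (e (fst j) - \<omega> (fst j)) \<bullet> b))"
  have Wf: "J.W k (1 + \<alpha>) 0 f"
  proof -
    have "J.W k (\<alpha> + 1) 0 (\<lambda>j x. (dG (fst j) b (swap (e (fst j)) x (p j)) - dG (fst j) b (swap (e (fst j)) x (\<omega> (fst j))))
      * (swap (e (fst j)) x (e (fst j) - \<omega> (fst j)) \<bullet> b))" if b: "b \<in> Basis" for b
    proof (rule J.W_mult)
      show "J.W k \<alpha> 0 (\<lambda>j x. dG (fst j) b (swap (e (fst j)) x (p j)) - dG (fst j) b (swap (e (fst j)) x (\<omega> (fst j))))"
      proof (rule J.W_gauge_partial(2)[OF pn b, where C=1])
        show "\<omega> (fst j) \<in> cball 0 1 - ball 0 (1/2)" if "j \<in> J" for j using \<omega>(1)[OF fJ[OF that]] by simp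
        show "dist (p j) (\<omega> (fst j)) \<le> 1 * d (fst j)" if j: "j \<in> J" for j
        proof -
          have "\<bar>snd j\<bar> * norm (e (fst j) - \<omega> (fst j)) \<le> 1 * norm (e (fst j) - \<omega> (fst j))"
            using j by (intro mult_right_mono) (auto simp: J_def)
          then show ?thesis using \<omega>(2)[OF fJ[OF j]] by (simp add: dist_norm p_def norm_minus_commute)
        qed
      qed simp_all
      show "J.W k 1 0 (\<lambda>j x. swap (e (fst j)) x (e (fst j) - \<omega> (fst j)) \<bullet> b)"
      proof (rule J.W_swap[of 1])
        show "norm (e (fst j) - \<omega> (fst j)) \<le> 1 * d (fst j) powr 1" if "j \<in> J" for j
          using \<omega>(2)[OF fJ[OF that]] d_pos[OF fJ[OF that]] by (simp add: norm_minus_commute)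
      qed (use b in simp_all)
    qed simp_all
    then have "J.W k (\<alpha> + 1) 0 f" unfolding f_def by (intro J.W_sum) auto
    then show ?thesis by (simp add: add.commute)
  qed
  have nz: "swap (e i) x (p (i, t)) \<noteq> 0" if "i \<in> I" "t \<in> {0..1}" for i t x
    using pn[of "(i, t)"] that by (intro swap_nonzero) (auto simp: J_def)
  have pc: "continuous_on {0..1} (\<lambda>t. swap (e i) x (p (i, t)))" for i x
    unfolding p_def fst_conv snd_conv swap_add[symmetric] by (simp add: swap_add swap_scaleR) (intro continuous_intros)
  have cont: "continuous_on {0..1} (\<lambda>t. f (i, t) x)" if i: "i \<in> I" for i x
  proof -
    have "continuous_on {0..1} (\<lambda>t. dG i b (swap (e i) x (p (i, t))))" if b: "b \<in> Basis" for b
    proof (rule continuous_on_compose2[OF body.continuous_gauge_partial[OF body_\<Omega>[OF i]] pc])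
      have "[b] \<in> multi_indices 1" using b by (auto simp: multi_indices_def)
      moreover have "Ck_on (Suc k) (- {0}) (G i)" using smooth i by (auto simp: smooth_family_def)
      ultimately have "continuous_on (- {0}) (iter_deriv [b] (G i))" unfolding Ck_on_def by force
      then show "continuous_on (- {0}) (partial b (G i))" by simp
    qed (use nz[OF i] in auto)
    then show ?thesis unfolding f_def fst_conv by (intro continuous_intros)
  qed
  have val: "shadow_factor \<omega> i x = G i (swap (e i) x (e i)) * (\<integral>t. f (i, t) x \<partial>M)" if i: "i \<in> I" for i x
  proof -
    interpret b: body "\<Omega> i" by (rule body_\<Omega>[OF i])
    let ?s = "\<lambda>y. swap (e i) x y"
    have \<omega>0: "?s (\<omega> i) \<noteq> 0" and e0: "?s (e i) \<noteq> 0" using \<omega>(1)[OF i] norm_e[OF i] by (intro swap_nonzero; force)+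
    define c where "c = (\<Sum>b\<in>Basis. dG i b (?s (\<omega> i)) * (?s (e i - \<omega> i) \<bullet> b))"
    \<comment> \<open>The gauge along the segment minus its linear part at \<omega>; its derivative
      in t is the integrand f.\<close>
    define F where "F = (\<lambda>t. b.gauge (?s (p (i, t))) - t * c)"
    have fe: "f (i, t) x = (\<Sum>b\<in>Basis. dG i b (?s (p (i, t))) * (?s (e i - \<omega> i) \<bullet> b)) - c" for t
      by (simp add: f_def c_def left_diff_distrib sum_subtractf)
    have "(\<integral>t. f (i, t) x \<partial>M) = (\<integral>t. indicator {0..1} t *\<^sub>R f (i, t) x \<partial>lborel)"
      unfolding M_def by (rule integral_restrict_space) simp
    also have "\<dots> = F 1 - F 0"
    proof (rule integral_FTC_Icc)
      fix t :: real assume t: "0 \<le> t" "t \<le> 1"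
      have "(b.gauge has_derivative (\<lambda>h. \<Sum>b\<in>Basis. dG i b (?s (p (i, t))) * (h \<bullet> b))) (at (?s (p (i, t))))"
        using t by (intro b.gauge_has_derivative nz[OF i] G_differentiable[OF i]) auto
      moreover have "((\<lambda>t. ?s (p (i, t))) has_derivative (\<lambda>h. h *\<^sub>R ?s (e i - \<omega> i))) (at t within {0..1})"
        unfolding p_def fst_conv snd_conv swap_add swap_scaleR by (auto intro!: derivative_eq_intros)
      ultimately have "((\<lambda>t. b.gauge (?s (p (i, t)))) has_derivative (\<lambda>h. \<Sum>b\<in>Basis. dG i b (?s (p (i, t))) * ((h *\<^sub>R ?s (e i - \<omega> i)) \<bullet> b))) (at t within {0..1})"
        by (rule has_derivative_compose[rotated])
      then show "(F has_vector_derivative f (i, t) x) (at t within {0..1})"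
        unfolding F_def has_vector_derivative_def
        by (auto intro!: derivative_eq_intros simp: fe sum_distrib_left algebra_simps)
    qed (use cont[OF i] in auto)
    also have "\<dots> = b.gauge (?s (e i)) - b.gauge (?s (\<omega> i)) - c" by (simp add: F_def p_def)
    \<comment> \<open>Splitting e - \<omega> and using Euler's identity at R\<omega> makes the
      values of the gauge at R\<omega> cancel.\<close>
    also have "c = (\<Sum>b\<in>Basis. dG i b (?s (\<omega> i)) * (?s (e i) \<bullet> b)) - b.gauge (?s (\<omega> i))"
      unfolding b.gauge_partial_self[OF \<omega>0 G_differentiable[OF i \<omega>0], symmetric] c_def swap_diff[symmetric]
      by (simp add: inner_diff_left right_diff_distrib sum_subtractf)
    finally have "(\<integral>t. f (i, t) x \<partial>M) = b.gauge (?s (e i)) - (\<Sum>b\<in>Basis. dG i b (?s (\<omega> i)) * (?s (e i) \<bullet> b))" by simp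
    moreover have "b.gauge (?s (e i)) = 1 / G i (?s (e i))" using norm_e[OF i] by (simp add: b.gauge_def)
    ultimately show ?thesis using b.g_pos[OF e0] by (simp add: shadow_factor_def right_diff_distrib)
  qed
  have "W k (1 + \<alpha>) 0 (\<lambda>i x. \<integral>t. f (i, t) x \<partial>M)"
  \<comment> \<open>The weight does not depend on t and the interval has measure 1, so the weight is
    kept and K = 1.\<close>
  proof (rule Holder_class_integral(1)[where I=I and M="\<lambda>_. M" and D=D and D'=D and K=1 and d="\<lambda>j. d (fst j)", unfolded sp, folded J_def])
    show "weighted_family J (\<lambda>(i, s). ball (- e i) (1/2)) (\<lambda>j. d (fst j)) D \<beta>"
      using J.weighted_family_axioms by (simp add: split_beta')
    show "Holder_class J (\<lambda>(i, s). ball (- e i) (1/2)) (\<lambda>j. d (fst j)) \<beta> k (1 + \<alpha>) 0 f"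
      using Wf by (simp add: split_beta')
    show "weighted_family I (\<lambda>i. ball (- e i) (1/2)) d D \<beta>" by (rule weighted_family_axioms)
    show "(\<lambda>s. f (i, s) x) \<in> borel_measurable M" if "i \<in> I" for i x
      using borel_measurable_continuous_on_restrict[OF cont[OF that]]
      by (simp add: M_def cong: measurable_cong_sets sets_restrict_space_cong)
    show "integrable M (\<lambda>s. d (fst (i, s)) powr p) \<and> (\<integral>s. d (fst (i, s)) powr p \<partial>M) \<le> 1 * d i powr p" for i p
    proof -
      have "emeasure M (space M) = 1" by (simp add: M_def space_restrict_space emeasure_restrict_space)
      then interpret M: finite_measure M by (intro finite_measureI) simp
      have "measure M (space M) = 1" using \<open>emeasure M (space M) = 1\<close> by (simp add: measure_def)
      then show ?thesis by simp
    qed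
  qed simp
  moreover have "W k 0 0 (\<lambda>i x. G i (swap (e i) x (e i)))"
    by (rule W_weaken, rule W_G(1), rule e_shell) simp_all
  ultimately have "W k (0 + (1 + \<alpha>)) 0 (\<lambda>i x. G i (swap (e i) x (e i)) * (\<integral>t. f (i, t) x \<partial>M))"
    by (intro W_mult) simp_all
  then have "W k (1 + \<alpha>) 0 (\<lambda>i x. G i (swap (e i) x (e i)) * (\<integral>t. f (i, t) x \<partial>M))" by simp
  then show ?thesis by (rule W_cong[rotated]) (simp add: val)
qed

text \<open>For d < 1 the Taylor argument applies; for d \<ge> 1 the factor is merely bounded, which
  suffices because a positive power of the weight is then at least 1.\<close>

lemma W_shadow_factor:
  assumes \<omega>: "\<And>i. i \<in> I \<Longrightarrow> norm (\<omega> i) = 1" "\<And>i. i \<in> I \<Longrightarrow> d i = norm (\<omega> i - e i)"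
  shows "W k (1 + \<alpha>) 0 (shadow_factor \<omega>)"
proof -
  define N where "N = {i \<in> I. d i < 1}"
  define F where "F = {i \<in> I. 1 \<le> d i}"
  interpret N: body_family N e d D \<beta> \<Omega> k \<alpha> r
    by (rule body_family_reindex[OF body_family_axioms, of N "\<lambda>i. i"]) (simp add: N_def)
  interpret F: body_family F e d D \<beta> \<Omega> k \<alpha> r
    by (rule body_family_reindex[OF body_family_axioms, of F "\<lambda>i. i"]) (simp add: F_def)
  have "N.W k (1 + \<alpha>) 0 (N.shadow_factor \<omega>)"
    by (rule N.W_shadow_factor_near) (use \<omega> in \<open>auto simp: N_def\<close>)
  moreover have "F.W k (1 + \<alpha>) 0 (F.shadow_factor \<omega>)"
    by (rule F.W_const_far[OF _ _ F.W_shadow_factor_0]) (use \<omega> \<alpha>_nonneg in \<open>auto simp: F_def\<close>)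
  moreover have "N.shadow_factor = shadow_factor" "F.shadow_factor = shadow_factor"
    by (intro ext; simp add: N.shadow_factor_def F.shadow_factor_def shadow_factor_def)+
  ultimately have "Holder_class (N \<union> F) (\<lambda>i. ball (- e i) (1/2)) d \<beta> k (1 + \<alpha>) 0 (shadow_factor \<omega>)"
    by (intro Holder_class_Un) simp_all
  moreover have "N \<union> F = I" by (auto simp: N_def F_def)
  ultimately show ?thesis by simp
qed

end

definition gauge_gradient :: "(real^'n) set \<Rightarrow> real^'n \<Rightarrow> real^'n" where
  "gauge_gradient \<Omega> y = (\<Sum>b\<in>Basis. body.gauge_partial \<Omega> b y *\<^sub>R b)"

text \<open>The reflection moves the excluded ray of z to the ray through e. Both g and gr are
  constant on rays, so only the direction of w enters, apart from the domain.\<close>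

lemma (in smooth_body) Q_shadow_swap:
  assumes z: "g (swap e x e) *\<^sub>R swap e x e \<in> frontier \<Omega>" and e: "norm e = 1"
  shows "Q q (g (swap e x e) *\<^sub>R swap e x e) = (\<integral>\<^sup>+w. ennreal (norm (g (swap e x (sgn w)) *\<^sub>R sgn w - g (swap e x e) *\<^sub>R e) powr (q - real CARD('n))
      * (1 - g (swap e x e) * (gr (swap e x (sgn w)) \<bullet> swap e x e)) * g (swap e x (sgn w)) powr real CARD('n))
      \<partial>restrict_space lborel (ball 0 1 - {w. w = 0 \<or> sgn w = e}))"
proof -
  let ?n = "real CARD('n)" and ?b = "g (swap e x e)"
  define z where "z = ?b *\<^sub>R swap e x e"
  have e0: "swap e x e \<noteq> 0" using e by (metis norm_swap norm_zero zero_neq_one)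
  have sz: "sgn z = swap e x e" using g_pos[OF e0] e by (simp add: z_def sgn_div_norm)
  define gr' where "gr' = (\<lambda>y. if y \<in> - {0} then gr y else 0)"
  have [measurable]: "gr' \<in> borel_measurable borel" using gr_measurable by (simp add: gr'_def)
  have [measurable]: "ball (0::real^'n) 1 \<in> sets borel" by simp
  have S [measurable]: "{w::real^'n. w = 0 \<or> sgn w = u} \<in> sets borel" for u by measurable
  let ?h = "\<lambda>w. ennreal (norm (g w *\<^sub>R sgn w - z) powr (q - ?n) * (1 - gr' w \<bullet> z) * g w ^ CARD('n)) * indicator (ball 0 1 - {w. w = 0 \<or> sgn w = sgn z}) w"
  have "Q q z = (\<integral>\<^sup>+w. ?h w \<partial>lborel)"
    unfolding Q_shadow[OF z[folded z_def]] by (intro nn_integral_cong) (auto simp: gr'_def indicator_def)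
  also have "\<dots> = (\<integral>\<^sup>+w. ?h (swap e x w) \<partial>lborel)"
    by (rule nn_integral_swap[symmetric]) measurable
  also have "\<dots> = (\<integral>\<^sup>+w. ennreal (norm (g (swap e x (sgn w)) *\<^sub>R sgn w - ?b *\<^sub>R e) powr (q - ?n)
      * (1 - ?b * (gr (swap e x (sgn w)) \<bullet> swap e x e)) * g (swap e x (sgn w)) powr ?n) * indicator (ball 0 1 - {w. w = 0 \<or> sgn w = e}) w \<partial>lborel)"
  proof (rule nn_integral_cong)
    fix w :: "real^'n"
    show "?h (swap e x w) = ennreal (norm (g (swap e x (sgn w)) *\<^sub>R sgn w - ?b *\<^sub>R e) powr (q - ?n)
      * (1 - ?b * (gr (swap e x (sgn w)) \<bullet> swap e x e)) * g (swap e x (sgn w)) powr ?n) * indicator (ball 0 1 - {w. w = 0 \<or> sgn w = e}) w"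
    proof (cases "w = 0")
      case False
      have w0: "swap e x w \<noteq> 0" using False by (metis norm_swap norm_eq_zero)
      have "sgn (swap e x w) = sgn z \<longleftrightarrow> sgn w = e"
        unfolding sz sgn_swap by (metis swap_swap)
      moreover have "norm (g (swap e x w) *\<^sub>R sgn (swap e x w) - z) = norm (g (swap e x (sgn w)) *\<^sub>R sgn w - ?b *\<^sub>R e)"
        unfolding sgn_swap z_def g_swap_sgn[of e x w] by (simp only: swap_scaleR[symmetric] swap_diff norm_swap)
      moreover have "gr' (swap e x w) = gr (swap e x (sgn w))"
        using w0 gr_scaleR[OF w0, of "1 / norm w"] False by (simp add: gr'_def sgn_div_norm swap_scaleR divide_inverse)
      moreover have "g (swap e x w) ^ CARD('n) = g (swap e x (sgn w)) powr ?n"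
        using g_pos[OF w0] by (simp add: powr_realpow flip: g_swap_sgn)
      ultimately show ?thesis using False w0 by (simp add: indicator_def z_def)
    qed (auto simp: indicator_def swap_def)
  qed
  also have "\<dots> = (\<integral>\<^sup>+w. ennreal (norm (g (swap e x (sgn w)) *\<^sub>R sgn w - ?b *\<^sub>R e) powr (q - ?n)
      * (1 - ?b * (gr (swap e x (sgn w)) \<bullet> swap e x e)) * g (swap e x (sgn w)) powr ?n) \<partial>restrict_space lborel (ball 0 1 - {w. w = 0 \<or> sgn w = e}))"
    by (subst nn_integral_restrict_space) auto
  finally show ?thesis by (simp add: z_def)
qed

lemma admissible_smooth_body:
  assumes "\<Omega> \<in> admissible k \<alpha> s t"
  shows "smooth_body \<Omega> (gauge_gradient \<Omega>)"
proof -
  interpret body \<Omega> by (rule admissible_body[OF assms])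
  show ?thesis unfolding gauge_gradient_def[abs_def]
    by (rule smooth_body_gauge_partial[OF body_axioms, of k]) (use assms in \<open>simp add: admissible_def Holder_sphere_def g_def[abs_def]\<close>)
qed

text \<open>The kernel contributes q - n and the height factor 1 + \<alpha>, with no loss at order
  k. The integrand depends on the direction only, so the critical exponent is 1 - n, and q - n + 1 +
  \<alpha> - \<beta> > 1 - n is the condition \<beta> < \<alpha> + q.\<close>

theorem Holder_dual_quermass_neg:
  assumes q: "q < 0" and \<alpha>: "0 \<le> \<beta>" "\<beta> \<le> \<alpha>" "\<alpha> < 1" "\<beta> < \<alpha> + q"
  shows "\<exists>C. \<forall>\<Omega>\<in>(admissible k \<alpha> s t :: (real^'n) set set). (\<forall>z\<in>frontier \<Omega>. dual_quermass_finite q \<Omega> z) \<and>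
     Holder_boundary k \<beta> \<Omega> (dual_quermass q \<Omega>) \<and> Holder_norm_boundary k \<beta> \<Omega> (dual_quermass q \<Omega>) \<le> C"
proof (cases "(admissible k \<alpha> s t :: (real^'n) set set) = {}")
  case False
  define X where "X = (admissible k \<alpha> s t :: (real^'n) set set)"
  let ?n = "real CARD('n)"
  define P where "P = X \<times> sphere (0::real^'n) 1"
  define S where "S = (\<lambda>i::(real^'n) set \<times> (real^'n). ball (0::real^'n) 1 - {w. w = 0 \<or> sgn w = snd i})"
  define I where "I = Sigma P S"
  define d where "d = (\<lambda>j::((real^'n) set \<times> (real^'n)) \<times> (real^'n). norm (sgn (snd j) - snd (fst j)))"
  define f where "f = (\<lambda>j::((real^'n) set \<times> (real^'n)) \<times> (real^'n). \<lambda>x.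
     norm (body.g (fst (fst j)) (swap (snd (fst j)) x (sgn (snd j))) *\<^sub>R sgn (snd j) - body.g (fst (fst j)) (swap (snd (fst j)) x (snd (fst j))) *\<^sub>R snd (fst j)) powr (q - ?n)
       * (1 - body.g (fst (fst j)) (swap (snd (fst j)) x (snd (fst j))) *
           (gauge_gradient (fst (fst j)) (swap (snd (fst j)) x (sgn (snd j))) \<bullet> swap (snd (fst j)) x (snd (fst j))))
       * body.g (fst (fst j)) (swap (snd (fst j)) x (sgn (snd j))) powr ?n)"
  have I: "j \<in> I \<longleftrightarrow> fst (fst j) \<in> X \<and> norm (snd (fst j)) = 1 \<and> norm (snd j) < 1 \<and> snd j \<noteq> 0 \<and> sgn (snd j) \<noteq> snd (fst j)" for j
    by (cases j) (auto simp: I_def P_def S_def)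
  interpret B: body_family I "\<lambda>i. snd (fst i)" d 2 \<beta> "\<lambda>i. fst (fst i)" k \<alpha> "1 / t"
  proof (rule body_family_admissible)
    show "I \<subseteq> {i. fst (fst i) \<in> admissible k \<alpha> s t \<and> norm (snd (fst i)) = 1}" using I by (auto simp: X_def)
    show "\<exists>\<Omega>::(real^'n) set. \<Omega> \<in> admissible k \<alpha> s t" using False by blast
    show "0 < d j \<and> d j \<le> 2" if "j \<in> I" for j
      using that norm_triangle_ineq4[of "sgn (snd j)" "snd (fst j)"] by (auto simp: d_def I norm_sgn)
  qed (use \<alpha> in auto)
  have bd: "body (fst i)" "smooth_body (fst i) (gauge_gradient (fst i))" if "i \<in> P" for i
    using that admissible_body admissible_smooth_body by (auto simp: P_def X_def)
  have ss: "sgn (sgn w) = sgn w" for w :: "real^'n" by (cases "w = 0") (simp_all add: sgn_div_norm)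
  have Wf: "B.W k (q - ?n + (1 + \<alpha>)) 0 f"
  proof -
    have "B.W (Suc k) (q - ?n) (1 - \<alpha>) (\<lambda>j x. norm (body.g (fst (fst j)) (swap (snd (fst j)) x (sgn (sgn (snd j)))) *\<^sub>R sgn (snd j) - body.g (fst (fst j)) (swap (snd (fst j)) x (snd (fst j))) *\<^sub>R snd (fst j)) powr (q - ?n))"
      by (rule B.W_norm_diff_powr) (auto simp: I d_def norm_sgn, metis norm_sgn norm_zero zero_neq_one)
    \<comment> \<open>Only k derivatives are taken because of the gradient in the other factor, so
      the loss at order k + 1 does not occur.\<close>
    from B.W_weaken[OF this, of "q - ?n"] have 1: "B.W k (q - ?n) 0 (\<lambda>j x. norm (body.g (fst (fst j)) (swap (snd (fst j)) x (sgn (snd j))) *\<^sub>R sgn (snd j) - body.g (fst (fst j)) (swap (snd (fst j)) x (snd (fst j))) *\<^sub>R snd (fst j)) powr (q - ?n))"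
      using \<alpha> by (simp add: ss)
    have 2: "B.W k (1 + \<alpha>) 0 (B.shadow_factor (\<lambda>j. sgn (snd j)))"
      by (rule B.W_shadow_factor) (auto simp: I d_def norm_sgn)
    have "B.W (Suc k) 0 0 (\<lambda>j x. body.g (fst (fst j)) (swap (snd (fst j)) x (sgn (snd j))) powr ?n)"
      by (rule B.W_G(2)) (simp add: I norm_sgn)
    then have 3: "B.W k 0 0 (\<lambda>j x. body.g (fst (fst j)) (swap (snd (fst j)) x (sgn (snd j))) powr ?n)"
      by (rule B.W_weaken) simp_all
    have "B.W k (q - ?n + (1 + \<alpha>) + 0) 0 (\<lambda>j x. norm (body.g (fst (fst j)) (swap (snd (fst j)) x (sgn (snd j))) *\<^sub>R sgn (snd j) - body.g (fst (fst j)) (swap (snd (fst j)) x (snd (fst j))) *\<^sub>R snd (fst j)) powr (q - ?n)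
      * B.shadow_factor (\<lambda>j. sgn (snd j)) j x * body.g (fst (fst j)) (swap (snd (fst j)) x (sgn (snd j))) powr ?n)"
      by (rule B.W_mult[OF _ _ B.W_mult[OF _ _ 1 2] 3]) simp_all
    moreover have "(\<Sum>b\<in>Basis. body.gauge_partial \<Omega> b y * (v \<bullet> b)) = gauge_gradient \<Omega> y \<bullet> v" for \<Omega> and y v :: "real^'n"
      unfolding gauge_gradient_def by (subst inner_sum_left) (simp add: inner_commute)
    ultimately show ?thesis by (simp add: f_def[abs_def] B.shadow_factor_def)
  qed
  show ?thesis unfolding X_def[symmetric]
  proof (rule Holder_boundary_integral[where X=X and S=S and f=f and d=d, folded P_def, folded I_def, OF _ B.weighted_family_axioms Wf])
    show "body \<Omega>" if "\<Omega> \<in> X" for \<Omega> using that admissible_body by (simp add: X_def)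
    show "0 \<le> f j x" if j: "j \<in> I" for j x
    proof -
      interpret smooth_body "fst (fst j)" "gauge_gradient (fst (fst j))" using j bd(2)[of "fst j"] by (auto simp: I_def)
      let ?y = "swap (snd (fst j)) x (sgn (snd j))" and ?u = "swap (snd (fst j)) x (snd (fst j))"
      have u: "norm ?u = 1" "norm ?y = 1" using j by (auto simp: I norm_sgn)
      then have u0: "?u \<noteq> 0" "?y \<noteq> 0" by (metis norm_zero zero_neq_one)+
      have gu: "0 < g ?u" "0 < g ?y" by (rule g_pos; fact u0)+
      have "gauge_gradient (fst (fst j)) ?y \<bullet> ?u \<le> gauge ?u" by (rule gr_le[OF u0(2)])
      then have "g ?u * (gauge_gradient (fst (fst j)) ?y \<bullet> ?u) \<le> 1" using gu u by (simp add: gauge_def field_simps)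
      then show ?thesis by (simp add: f_def)
    qed
    show "S i \<in> sets borel" for i unfolding S_def by measurable
    show "(\<lambda>w. d (i, w)) \<in> borel_measurable borel" for i unfolding d_def fst_conv snd_conv by measurable
    show "(\<lambda>w. f (i, w) x) \<in> borel_measurable borel" if "i \<in> P" for i x
    proof -
      interpret smooth_body "fst i" "gauge_gradient (fst i)" by (rule bd(2)[OF that])
      have "(\<lambda>y. if y \<in> - {0} then gauge_gradient (fst i) y else gauge_gradient (fst i) 0) \<in> borel_measurable borel"
        by (intro borel_measurable_continuous_on_if continuous_gr) auto
      moreover have "(\<lambda>y. if y \<in> - {0} then gauge_gradient (fst i) y else gauge_gradient (fst i) 0) = gauge_gradient (fst i)"
        by auto
      ultimately have [measurable]: "gauge_gradient (fst i) \<in> borel_measurable borel" by simp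
      show ?thesis unfolding f_def fst_conv snd_conv by measurable
    qed
    show "\<exists>C\<ge>0. \<forall>i\<in>P. (\<integral>\<^sup>+w\<in>S i. ennreal (d (i, w) powr p) \<partial>lborel) \<le> ennreal C"
      if "p \<in> {q - ?n + (1 + \<alpha>), q - ?n + (1 + \<alpha>) - 0, q - ?n + (1 + \<alpha>) - 0 - \<beta>}" for p
    proof -
      have n: "1 \<le> ?n" by (simp add: Suc_leI)
      have p: "q - ?n + (1 + \<alpha>) - \<beta> \<le> p" "p \<le> q - ?n + (1 + \<alpha>)" using that \<alpha> by auto
      \<comment> \<open>The upper bound p < 1 is what the comparison with a solid integral of
        exponent p - 1 asks for; it follows from q < 0, \<alpha> < 1 and n \<ge> 1.\<close>
      have "1 - real DIM(real^'n) < p" "p < 1" using p q \<alpha> n by (simp, linarith)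
      from nn_integral_sgn_powr_finite[OF this]
      obtain C where C: "C \<ge> 0" "\<And>e::real^'n. norm e = 1 \<Longrightarrow> (\<integral>\<^sup>+w\<in>ball 0 1 - {0}. ennreal (norm (sgn w - e) powr p) \<partial>lborel) \<le> ennreal C"
        by blast
      have "(\<integral>\<^sup>+w\<in>S i. ennreal (d (i, w) powr p) \<partial>lborel) \<le> (\<integral>\<^sup>+w\<in>ball 0 1 - {0}. ennreal (norm (sgn w - snd i) powr p) \<partial>lborel)" for i
        by (intro nn_integral_mono) (auto simp: S_def d_def indicator_def)
      moreover have "(\<integral>\<^sup>+w\<in>ball 0 1 - {0}. ennreal (norm (sgn w - snd i) powr p) \<partial>lborel) \<le> ennreal C" if "i \<in> P" for i
        using C(2)[of "snd i"] that by (auto simp: P_def)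
      ultimately show ?thesis using C(1) by (meson order_trans)
    qed
    show "body.Q (fst i) q (body.g (fst i) x *\<^sub>R sgn x) = (\<integral>\<^sup>+w. ennreal (f (i, w) x) \<partial>restrict_space lborel (S i))"
      if i: "i \<in> P" and zf: "body.g (fst i) x *\<^sub>R sgn x \<in> frontier (fst i)"
        and zeq: "body.g (fst i) x *\<^sub>R sgn x = body.g (fst i) (swap (snd i) x (snd i)) *\<^sub>R swap (snd i) x (snd i)" for i x
    proof -
      interpret smooth_body "fst i" "gauge_gradient (fst i)" by (rule bd(2)[OF i])
      have "norm (snd i) = 1" using i by (simp add: P_def mem_Times_iff)
      from Q_shadow_swap[OF zf[unfolded zeq] this, of q] show ?thesis unfolding zeq by (simp add: f_def S_def)
    qed
  qed
qed simp

text \<open>The constants have to form a total positive function of the parameters, chosen before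
  any body: the value is 1 outside the admissible parameters, and a given bound is raised to at
  least 1 inside.\<close>

lemma positive_bound_function:
  assumes "\<And>p. P p \<Longrightarrow> \<exists>C::real. Q p C" and mono: "\<And>p C C'. Q p C \<Longrightarrow> C \<le> C' \<Longrightarrow> Q p C'"
  obtains C where "\<And>p. 0 < C p" "\<And>p. P p \<Longrightarrow> Q p (C p)"
proof -
  have "\<exists>C>0. P p \<longrightarrow> Q p C" for p
  proof (cases "P p")
    case True
    then obtain C where "Q p C" using assms(1) by blast
    then have "Q p (max C 1)" using mono by (meson max.cobounded1)
    then show ?thesis by (intro exI[of _ "max C 1"]) simp
  qed (auto intro: exI[of _ 1])
  then show ?thesis using that by metis
qed

theorem theorem1p4:
  shows
    "(\<exists>C :: real \<Rightarrow> real \<Rightarrow> nat \<Rightarrow> real \<Rightarrow> real \<Rightarrow> real.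
        (\<forall>q \<alpha> k s t. 0 < C q \<alpha> k s t) \<and>
        (\<forall>(\<Omega> :: (real ^ 'n) set) k q \<alpha>.
           convex_body \<Omega> \<and> 0 \<in> interior \<Omega> \<and> 1 \<le> k \<and>
           1 < q \<and> q \<noteq> real CARD('n) \<and> 0 \<le> \<alpha> \<and> \<alpha> \<le> 1 \<and>
           Holder_sphere k \<alpha> (radial \<Omega>) \<longrightarrow>
             (\<forall>z\<in>frontier \<Omega>. dual_quermass_finite q \<Omega> z) \<and>
             Holder_boundary k \<alpha> \<Omega> (dual_quermass q \<Omega>) \<and>
             Holder_norm_boundary k \<alpha> \<Omega> (dual_quermass q \<Omega>)
               \<le> C q \<alpha> k (Holder_norm_sphere k \<alpha> (radial \<Omega>)) (1 / radial_min \<Omega>)))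
     \<and>
     (\<exists>C :: real \<Rightarrow> real \<Rightarrow> real \<Rightarrow> nat \<Rightarrow> real \<Rightarrow> real \<Rightarrow> real.
        (\<forall>q \<alpha> \<alpha>' k s t. 0 < C q \<alpha> \<alpha>' k s t) \<and>
        (\<forall>(\<Omega> :: (real ^ 'n) set) k q \<alpha> \<alpha>'.
           convex_body \<Omega> \<and> 0 \<in> interior \<Omega> \<and> 1 \<le> k \<and>
           0 < q \<and> q \<le> 1 \<and> 1 - q < \<alpha> \<and> \<alpha> \<le> 1 \<and>
           Holder_sphere k \<alpha> (radial \<Omega>) \<and>
           0 < \<alpha>' \<and> \<alpha>' < \<alpha> + q - 1 \<longrightarrow>
             (\<forall>z\<in>frontier \<Omega>. dual_quermass_finite q \<Omega> z) \<and>
             Holder_boundary k \<alpha>' \<Omega> (dual_quermass q \<Omega>) \<and>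
             Holder_norm_boundary k \<alpha>' \<Omega> (dual_quermass q \<Omega>)
               \<le> C q \<alpha> \<alpha>' k (Holder_norm_sphere k \<alpha> (radial \<Omega>)) (1 / radial_min \<Omega>)))
     \<and>
     (\<exists>C :: real \<Rightarrow> real \<Rightarrow> real \<Rightarrow> nat \<Rightarrow> real \<Rightarrow> real \<Rightarrow> real.
        (\<forall>q \<alpha> \<beta> k s t. 0 < C q \<alpha> \<beta> k s t) \<and>
        (\<forall>(\<Omega> :: (real ^ 'n) set) k q \<alpha> \<beta>.
           convex_body \<Omega> \<and> 0 \<in> interior \<Omega> \<and> 1 \<le> k \<and>
           - 1 < q \<and> q < 0 \<and> - q < \<alpha> \<and> \<alpha> < 1 \<and>
           Holder_sphere k \<alpha> (radial \<Omega>) \<and>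
           0 < \<beta> \<and> \<beta> < \<alpha> + q \<longrightarrow>
             (\<forall>z\<in>frontier \<Omega>. dual_quermass_finite q \<Omega> z) \<and>
             Holder_boundary (k - 1) \<beta> \<Omega> (dual_quermass q \<Omega>) \<and>
             Holder_norm_boundary (k - 1) \<beta> \<Omega> (dual_quermass q \<Omega>)
               \<le> C q \<alpha> \<beta> k (Holder_norm_sphere k \<alpha> (radial \<Omega>)) (1 / radial_min \<Omega>)))"
  (is "?i \<and> ?ii \<and> ?iii")
proof (intro conjI)
  define bounded_by where "bounded_by = (\<lambda>q m \<beta> k \<alpha> s t C. \<forall>\<Omega>\<in>(admissible k \<alpha> s t :: (real^'n) set set).
     (\<forall>z\<in>frontier \<Omega>. dual_quermass_finite q \<Omega> z) \<and>
     Holder_boundary m \<beta> \<Omega> (dual_quermass q \<Omega>) \<and> Holder_norm_boundary m \<beta> \<Omega> (dual_quermass q \<Omega>) \<le> C)"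
  have mono: "bounded_by q m \<beta> k \<alpha> s t C \<Longrightarrow> C \<le> C' \<Longrightarrow> bounded_by q m \<beta> k \<alpha> s t C'" for q m \<beta> k \<alpha> s t C C'
    unfolding bounded_by_def by fastforce
  \<comment> \<open>Since k \<ge> 1, the order \<open>Suc (k - 1)\<close> in
    \<open>admissible\<close> is k itself.\<close>
  have adm: "\<Omega> \<in> admissible (k - 1) \<alpha> (Holder_norm_sphere k \<alpha> (radial \<Omega>)) (1 / radial_min \<Omega>)"
    if "convex_body \<Omega>" "0 \<in> interior \<Omega>" "1 \<le> k" "Holder_sphere k \<alpha> (radial \<Omega>)" for \<Omega> :: "(real^'n) set" and k \<alpha>
    using that by (cases k) (simp_all add: admissible_def)
  define P1 where "P1 = (\<lambda>(q :: real, \<beta> :: real, k :: nat, \<alpha> :: real, s :: real, t :: real). 0 < q \<and> 0 \<le> \<beta> \<and> \<beta> \<le> \<alpha> \<and> \<alpha> \<le> 1 \<and> 0 < q - 1 + \<alpha> - \<beta>)"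
  define Q1 where "Q1 = (\<lambda>(q, \<beta>, k, \<alpha>, s, t). bounded_by q (Suc k) \<beta> k \<alpha> s t)"
  obtain C1 where C1: "\<And>p. 0 < C1 p" "\<And>p. P1 p \<Longrightarrow> Q1 p (C1 p)"
  proof (rule positive_bound_function[of P1 Q1])
    show "\<exists>C. Q1 p C" if "P1 p" for p
    proof -
      obtain q \<beta> k \<alpha> s t where p: "p = (q, \<beta>, k, \<alpha>, s, t)" by (cases p)
      show ?thesis unfolding p Q1_def prod.case bounded_by_def
        by (rule Holder_dual_quermass_pos) (use that in \<open>auto simp: p P1_def\<close>)
    qed
    show "Q1 p C'" if "Q1 p C" "C \<le> C'" for p C C'
      using that mono by (cases p) (simp add: Q1_def)
  qed blast
  define P3 where "P3 = (\<lambda>(q :: real, \<beta> :: real, k :: nat, \<alpha> :: real, s :: real, t :: real). q < 0 \<and> 0 \<le> \<beta> \<and> \<beta> \<le> \<alpha> \<and> \<alpha> < 1 \<and> \<beta> < \<alpha> + q)"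
  define Q3 where "Q3 = (\<lambda>(q, \<beta>, k, \<alpha>, s, t). bounded_by q k \<beta> k \<alpha> s t)"
  obtain C3 where C3: "\<And>p. 0 < C3 p" "\<And>p. P3 p \<Longrightarrow> Q3 p (C3 p)"
  proof (rule positive_bound_function[of P3 Q3])
    show "\<exists>C. Q3 p C" if "P3 p" for p
    proof -
      obtain q \<beta> k \<alpha> s t where p: "p = (q, \<beta>, k, \<alpha>, s, t)" by (cases p)
      show ?thesis unfolding p Q3_def prod.case bounded_by_def
        by (rule Holder_dual_quermass_neg) (use that in \<open>auto simp: p P3_def\<close>)
    qed
    show "Q3 p C'" if "Q3 p C" "C \<le> C'" for p C C'
      using that mono by (cases p) (simp add: Q3_def)
  qed blast
  show ?i
  \<comment> \<open>For q > 1 the full exponent \<beta> = \<alpha> is admissible, as q - 1 >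
    0.\<close>
  proof (intro exI[of _ "\<lambda>q \<alpha> k s t. C1 (q, \<alpha>, k - 1, \<alpha>, s, t)"] conjI allI ballI impI; (elim conjE)?)
    fix \<Omega> :: "(real^'n) set" and k and q \<alpha> :: real
    assume a: "convex_body \<Omega>" "0 \<in> interior \<Omega>" "1 \<le> k" "1 < q" "0 \<le> \<alpha>" "\<alpha> \<le> 1" "Holder_sphere k \<alpha> (radial \<Omega>)"
    let ?p = "(q, \<alpha>, k - 1, \<alpha>, Holder_norm_sphere k \<alpha> (radial \<Omega>), 1 / radial_min \<Omega>)"
    have b: "bounded_by q k \<alpha> (k - 1) \<alpha> (Holder_norm_sphere k \<alpha> (radial \<Omega>)) (1 / radial_min \<Omega>) (C1 ?p)"
      using C1(2)[of ?p] a by (simp add: P1_def Q1_def)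
    show "dual_quermass_finite q \<Omega> z" if "z \<in> frontier \<Omega>" for z
      using b[unfolded bounded_by_def] adm[OF a(1-3,7)] that by blast
    show "Holder_boundary k \<alpha> \<Omega> (dual_quermass q \<Omega>)" "Holder_norm_boundary k \<alpha> \<Omega> (dual_quermass q \<Omega>) \<le> C1 ?p"
      using b[unfolded bounded_by_def] adm[OF a(1-3,7)] by blast+
  qed (rule C1)
  show ?ii
  proof (intro exI[of _ "\<lambda>q \<alpha> \<beta> k s t. C1 (q, \<beta>, k - 1, \<alpha>, s, t)"] conjI allI ballI impI; (elim conjE)?)
    fix \<Omega> :: "(real^'n) set" and k and q \<alpha> \<beta> :: real
    assume a: "convex_body \<Omega>" "0 \<in> interior \<Omega>" "1 \<le> k" "0 < q" "q \<le> 1" "\<alpha> \<le> 1" "Holder_sphere k \<alpha> (radial \<Omega>)"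
      "0 < \<beta>" "\<beta> < \<alpha> + q - 1"
    let ?p = "(q, \<beta>, k - 1, \<alpha>, Holder_norm_sphere k \<alpha> (radial \<Omega>), 1 / radial_min \<Omega>)"
    have b: "bounded_by q k \<beta> (k - 1) \<alpha> (Holder_norm_sphere k \<alpha> (radial \<Omega>)) (1 / radial_min \<Omega>) (C1 ?p)"
      using C1(2)[of ?p] a by (simp add: P1_def Q1_def)
    show "dual_quermass_finite q \<Omega> z" if "z \<in> frontier \<Omega>" for z
      using b[unfolded bounded_by_def] adm[OF a(1-3,7)] that by blast
    show "Holder_boundary k \<beta> \<Omega> (dual_quermass q \<Omega>)" "Holder_norm_boundary k \<beta> \<Omega> (dual_quermass q \<Omega>) \<le> C1 ?p"
      using b[unfolded bounded_by_def] adm[OF a(1-3,7)] by blast+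
  qed (rule C1)
  show ?iii
  \<comment> \<open>The bodies have order k, and the bound for negative exponents returns order k -
    1.\<close>
  proof (intro exI[of _ "\<lambda>q \<alpha> \<beta> k s t. C3 (q, \<beta>, k - 1, \<alpha>, s, t)"] conjI allI ballI impI; (elim conjE)?)
    fix \<Omega> :: "(real^'n) set" and k and q \<alpha> \<beta> :: real
    assume a: "convex_body \<Omega>" "0 \<in> interior \<Omega>" "1 \<le> k" "q < 0" "- q < \<alpha>" "\<alpha> < 1" "Holder_sphere k \<alpha> (radial \<Omega>)"
      "0 < \<beta>" "\<beta> < \<alpha> + q"
    let ?p = "(q, \<beta>, k - 1, \<alpha>, Holder_norm_sphere k \<alpha> (radial \<Omega>), 1 / radial_min \<Omega>)"
    have b: "bounded_by q (k - 1) \<beta> (k - 1) \<alpha> (Holder_norm_sphere k \<alpha> (radial \<Omega>)) (1 / radial_min \<Omega>) (C3 ?p)"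
      using C3(2)[of ?p] a by (simp add: P3_def Q3_def)
    show "dual_quermass_finite q \<Omega> z" if "z \<in> frontier \<Omega>" for z
      using b[unfolded bounded_by_def] adm[OF a(1-3,7)] that by blast
    show "Holder_boundary (k - 1) \<beta> \<Omega> (dual_quermass q \<Omega>)" "Holder_norm_boundary (k - 1) \<beta> \<Omega> (dual_quermass q \<Omega>) \<le> C3 ?p"
      using b[unfolded bounded_by_def] adm[OF a(1-3,7)] by blast+
  qed (rule C3)
qed

end
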